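(* Let $\mathcal X$ be a smooth Deligne–Mumford stack with projective coarse moduli space, take a real structure on the A-model semi-infinite variation of Hodge structures of $\mathcal X$, and let $\omega$ be a Kähler class on $\mathcal X$. (i) If the real structure satisfies $$\kappa_{\mathcal H}\big(H^*(\mathcal X_v)\otimes\mathbb C\{z,z^{-1}\}\big)=H^*(\mathcal X_{\mathrm{inv}(v)})\otimes\mathbb C\{z,z^{-1}\},\qquad \kappa_{\mathcal V}(H^*(\mathcal X_v))=H^*(\mathcal X_{\mathrm{inv}(v)})\qquad (v\in\mathsf T),$$ then the A-model semi-infinite variation of Hodge structures is pure at $\tau=-x\omega$ for all $x$ with $\Re(x)>0$ sufficiently big. (ii) If moreover the real structure satisfies $$\kappa_{\mathcal V}(\alpha)\in(-1)^k\,\mathbb R_{>0}\,\mathrm{inv}^*(\overline{\alpha})+H^{>2k}(\mathcal X_{\mathrm{inv}(v)})\qquad\text{for all } \alpha\in H^{2k}(\mathcal X_v)\subset H^*_{\rm orb}(\mathcal X)$$ (equivalently $\kappa_{\mathcal H}(\alpha)=(-1)^k\mathbb R_{>0}\,\mathrm{inv}^*(\overline\alpha)\,z^{-2k+n_v}+O(z^{-2k+n_v-1})$), then the Hermitian metric $h$ on $K_\tau\cong H^*_{\rm orb}(\mathcal X)$ satisfies $$(-1)^{\frac{p-q}{2}}\,h(u,u)>0,\qquad u\in H^{p,q}(\mathcal X_v)\subset K_{-x\omega},\ u\ne0,$$ for $\Re(x)>0$ sufficiently big. In particular, if $H^*_{\rm orb}(\mathcal X)$ consists only of the $(p,p)$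 part, i.e. $H^{2p}(\mathcal X_v)=H^{p,p}(\mathcal X_v)$ for all $v\in\mathsf T$ and $p\ge0$, then the A-model semi-infinite variation of Hodge structures is polarized at $\tau=-x\omega$ for $\Re(x)>0$ sufficiently big.
   Context: Orbifold notation. $\mathcal X$ is a proper smooth Deligne–Mumford stack over $\mathbb C$ with projective coarse moduli space, $n=\dim_{\mathbb C}\mathcal X$. Its inertia stack is $I\mathcal X=\bigsqcup_{v\in\mathsf T}\mathcal X_v$ (points $(x,g)$ with $g\in\mathrm{Aut}(x)$), $\mathcal X_0=\mathcal X$ is the component with trivial stabilizer, $\mathsf T'=\mathsf T\setminus\{0\}$, $n_v=\dim_{\mathbb C}\mathcal X_v$, $\iota_v$ is the age of $\mathcal X_v$, $\mathrm{pr}:I\mathcal X\to\mathcal X$ is the projection and $\mathrm{inv}$ is the involution $(x,g)\mapsto(x,g^{-1})$ on $I\mathcal X$ and on $\mathsf T$. Cohomology has complex coefficients and only the even part is considered ($H^*$ means $\bigoplus_kH^{2k}$). $H^*_{\rm orb}(\mathcal X)=\bigoplus_{v}H^*(\mathcal X_v)$, where $H^{2k}(\mathcal X_v)$ is given degree $2k+2\iota_v$; $(\alpha,\beta)_{\rm orb}=\int_{I\mathcal X}\alpha\cup\mathrm{inv}^*\beta$; $H^*(\mathcal X)$ acts on $H^*_{\rm orb}(\mathcal X)$ by $\tau\cdot\alpha=\mathrm{pr}^*\tau\cup\alpha$. $\{\phi_i\}_{i=1}^N$ is a homogeneous basis of $H^*_{\rm orb}(\mathcal X)$, $\{\phi^i\}$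 the dual basis for $(\cdot,\cdot)_{\rm orb}$; $\mu(\phi_i)=\frac12(\deg\phi_i-n)\phi_i$; $\rho=c_1(T\mathcal X)$. For $\xi\in H^2(\mathcal X,\mathbb Z)$ (cohomology of the topological stack = isomorphism classes of topological orbifold line bundles $L_\xi$), $f_v(\xi)\in[0,1)$ is the number such that the stabilizer along $\mathcal X_v$ acts on $L_\xi|_{\mathcal X_v}$ by $e^{2\pi\sqrt{-1}f_v(\xi)}$, and $\xi_0$ is the image of $\xi$ in $H^2(\mathcal X,\mathbb Q)$. $\mathbb C\{z\}$, $\mathbb C\{z,z^{-1}\}$ are the rings of holomorphic functions on $\mathbb C$, $\mathbb C^*$. Quantum cohomology. $\langle\alpha_1\psi^{k_1},\dots,\alpha_l\psi^{k_l}\rangle_{0,l,d}$ are the genus-zero orbifold Gromov–Witten invariants (with descendants) and $\mathrm{Eff}_{\mathcal X}\subset H_2(\mathcal X,\mathbb Q)$ is the semigroup of classes of effective stable maps. Write $\tau=\tau_{0,2}+\tau'$ with $\tau_{0,2}\in H^2(\mathcal X)$, $\tau'\in\bigoplus_{k\ne1}H^{2k}(\mathcal X)\oplus\bigoplus_{v\in\mathsf T'}H^*(\mathcal X_v)$. It is assumed throughout that the quantum product $\phi_i\circ_\tau\phi_j=\sum_{d,l,k}\frac1{l!}\langle\phi_i,\phi_j,\tau',\dots,\tau',\phi_k\rangle_{0,l+3,d}\,e^{\langle\tau_{0,2},d\rangle}\phi^k$ converges on a domain $U\subset H^*_{\rm orb}(\mathcal X)$ containing the large radius limit direction $\Re\langle\tau_{0,2},d\rangle\to-\infty$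 ($d\in\mathrm{Eff}_{\mathcal X}\setminus\{0\}$), $\tau'\to0$. The A-model semi-infinite variation of Hodge structures is $H^*_{\rm orb}(\mathcal X)\otimes\mathcal O_U\{z\}$ with the Dubrovin connection $\nabla_i=\partial/\partial t^i+\frac1z\phi_i\circ_\tau$, modulo the Galois action of $H^2(\mathcal X,\mathbb Z)$. It is realized by the subspaces $\mathbb F_\tau=\mathcal J_\tau(H^*_{\rm orb}(\mathcal X)\otimes\mathbb C\{z\})\subset\mathcal H^{\mathcal X}:=H^*_{\rm orb}(\mathcal X)\otimes\mathbb C\{z,z^{-1}\}$, $\tau\in U$, where $\mathcal J_\tau$ is the $\mathbb C\{z\}$-linear map $$\mathcal J_\tau(\alpha)=e^{\tau_{0,2}/z}\Big(\alpha+\sum_{(d,l)\ne(0,0),\,d\in\mathrm{Eff}_{\mathcal X}}\ \sum_{i=1}^N\frac1{l!}\Big\langle\alpha,\tau',\dots,\tau',\frac{\phi_i}{z-\psi}\Big\rangle_{0,l+2,d}e^{\langle\tau_{0,2},d\rangle}\phi^i\Big).$$ The pairing on $\mathcal H^{\mathcal X}$ is $(\alpha,\beta)_{\mathcal H}=(\alpha(-z),\beta(z))_{\rm orb}$. Real structure. Let $\mathcal V^{\mathcal X}=H^*_{\rm orb}(\mathcal X)$ (identified with multi-valued flat sections for the $z$-direction via $\phi\mapsto z^{-\mu}z^{\rho}\phi=e^{-\mu\log z}e^{\rho\log z}\phi$). A real structure on the A-model semi-infinite variation of Hodge structures is a real subspace $\mathcal V_{\mathbb R}\subset\mathcal V^{\mathcal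 X}$ with $\mathcal V^{\mathcal X}=\mathcal V_{\mathbb R}\otimes_{\mathbb R}\mathbb C$, invariant under the Galois action $G^{\mathcal V}(\xi)=\bigoplus_{v\in\mathsf T}e^{-2\pi\sqrt{-1}\xi_0}e^{2\pi\sqrt{-1}f_v(\xi)}$ for all $\xi\in H^2(\mathcal X,\mathbb Z)$, and on which the pairing $(\alpha,\beta)_{\mathcal V}=(e^{\pi\sqrt{-1}\rho}\alpha,e^{\pi\sqrt{-1}\mu}\beta)_{\rm orb}$ is real-valued. $\kappa_{\mathcal V}$ is the complex-antilinear involution of $\mathcal V^{\mathcal X}$ fixing $\mathcal V_{\mathbb R}$, and $\kappa_{\mathcal H}:\mathcal H^{\mathcal X}\to\mathcal H^{\mathcal X}$ is the antilinear involution determined by $(\kappa_{\mathcal H}s)(z)=z^{-\mu}z^{\rho}\kappa_{\mathcal V}(z^{-\rho}z^{\mu}s(z))$ for $|z|=1$. Purity and polarization. The structure is pure at $\tau$ if $\mathbb F_\tau\oplus z^{-1}\kappa_{\mathcal H}(\mathbb F_\tau)=\mathcal H^{\mathcal X}$; equivalently, $\mathbb F_\tau\cap\kappa_{\mathcal H}(\mathbb F_\tau)\to\mathbb F_\tau/z\mathbb F_\tau$ is an isomorphism. It is polarized at $\tau$ if the Hermitian form $h(s_1,s_2)=(\kappa_{\mathcal H}(s_1),s_2)_{\mathcal H}$ on $\mathbb F_\tau\cap\kappa_{\mathcal H}(\mathbb F_\tau)$ (which is $\mathbb C$-valued) is positive definite. When pure, $h$ is transported to $K_\tau:=\mathbb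 F_\tau/z\mathbb F_\tau\cong\mathbb F_\tau\cap\kappa_{\mathcal H}(\mathbb F_\tau)$, and $K_\tau$ is identified with $H^*_{\rm orb}(\mathcal X)$ by $\alpha\mapsto[\mathcal J_\tau(\alpha)]$. *)

theory Defs
  imports "HOL-Complex_Analysis.Complex_Analysis" "HOL-Library.Multiset"
begin

text \<open>
  Deligne-Mumford stacks and their moduli of stable maps are not available. What is formalised is the
  package of cohomological and enumerative data of such a stack \<open>\<X>\<close>: the record \<open>orbifold\<close> lists
  the data, the locales below list the standard facts about them (Hodge theory of the compact Kaehler
  orbifolds \<open>\<X>\<^sub>v\<close>, and the genus-zero Gromov-Witten axioms). All notions built from these data
  (\<open>\<J>\<^sub>\<tau>\<close>, \<open>\<F>\<^sub>\<tau>\<close>, real structures, purity, polarization) are then defined explicitly.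

  The even cohomology \<open>H\<^sup>*(I\<X>)\<close> is coordinatised by a homogeneous basis \<open>\<phi>\<^sub>i\<close>, indexed by the
  type \<open>'n\<close>: it is \<open>complex ^ 'n\<close>, with \<open>\<phi>\<^sub>i = axis i 1\<close>. The type \<open>'t\<close> is the index set of the
  components of the inertia stack, \<open>'d\<close> is (the additive group of) \<open>H\<^sub>2(\<X>, \<rat>)\<close>, and \<open>'x\<close> is
  \<open>H\<^sup>2(\<X>, \<int>)\<close>.
\<close>

record ('n, 't, 'd, 'x) orbifold =
  cdim :: nat                                  \<comment> \<open>\<open>n\<close>, the complex dimension of \<open>\<X>\<close>\<close>
  sdim :: "'t \<Rightarrow> nat"                          \<comment> \<open>\<open>n\<^sub>v\<close>\<close>
  age :: "'t \<Rightarrow> real"                          \<comment> \<open>\<open>\<iota>\<^sub>v\<close>\<close>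
  untw :: 't                                   \<comment> \<open>the index \<open>0\<close> of the untwisted sector \<open>\<X>\<^sub>0 = \<X>\<close>\<close>
  sinv :: "'t \<Rightarrow> 't"                           \<comment> \<open>the involution of the index set\<close>
  sector :: "'n \<Rightarrow> 't"                         \<comment> \<open>\<open>\<phi>\<^sub>i\<close> lies in \<open>H\<^sup>2\<^sup>k(\<X>\<^sub>v)\<close> for \<open>v = sector i\<close>, \<open>k = hdeg i\<close>\<close>
  hdeg :: "'n \<Rightarrow> nat"
  cup :: "complex^'n \<Rightarrow> complex^'n \<Rightarrow> complex^'n"      \<comment> \<open>cup product of \<open>H\<^sup>*(I\<X>)\<close>, not the orbifold product\<close>
  unitIX :: "complex^'n"                          \<comment> \<open>the unit of \<open>H\<^sup>*(I\<X>)\<close>\<close>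
  integ :: "complex^'n \<Rightarrow> complex"             \<comment> \<open>integration over \<open>I\<X>\<close>\<close>
  prs :: "complex^'n \<Rightarrow> complex^'n"            \<comment> \<open>\<open>pr\<^sup>*\<close>, meaningful on the summand \<open>H\<^sup>*(\<X>)\<close> only\<close>
  invs :: "complex^'n \<Rightarrow> complex^'n"           \<comment> \<open>\<open>inv\<^sup>*\<close>\<close>
  conjH :: "complex^'n \<Rightarrow> complex^'n"          \<comment> \<open>complex conjugation with respect to \<open>H\<^sup>*(I\<X>, \<real>)\<close>\<close>
  hodge :: "'t \<Rightarrow> nat \<Rightarrow> nat \<Rightarrow> (complex^'n) set"      \<comment> \<open>\<open>H\<^sup>p\<^sup>,\<^sup>q(\<X>\<^sub>v)\<close>, for \<open>p + q\<close> even\<close>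
  kahler :: "(complex^'n) set"                 \<comment> \<open>the Kaehler classes of \<open>\<X>\<close>\<close>
  c1 :: "complex^'n"                           \<comment> \<open>\<open>\<rho> = c\<^sub>1(T\<X>)\<close>\<close>
  ratcl :: "'x \<Rightarrow> complex^'n"                  \<comment> \<open>\<open>\<xi> \<mapsto> \<xi>\<^sub>0\<close>\<close>
  fage :: "'x \<Rightarrow> 't \<Rightarrow> real"                    \<comment> \<open>\<open>f\<^sub>v(\<xi>)\<close>\<close>
  h2pair :: "complex^'n \<Rightarrow> 'd \<Rightarrow> complex"       \<comment> \<open>the pairing of \<open>H\<^sup>2(\<X>)\<close> and \<open>H\<^sub>2(\<X>, \<rat>)\<close>\<close>
  eff :: "'d set"                              \<comment> \<open>\<open>Eff\<close>\<close>
  gw :: "((complex^'n) \<times> nat) list \<Rightarrow> 'd \<Rightarrow> complex"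
    \<comment> \<open>\<open>gw [(\<alpha>\<^sub>1,k\<^sub>1),\<dots>,(\<alpha>\<^sub>l,k\<^sub>l)] d\<close> is \<open>\<langle>\<alpha>\<^sub>1\<psi>^k\<^sub>1, \<dots>, \<alpha>\<^sub>l\<psi>^k\<^sub>l\<rangle>\<close> in genus \<open>0\<close> and class \<open>d\<close>\<close>


subsection \<open>Orbifold cohomology\<close>

definition pos_real :: "complex \<Rightarrow> bool" where
  "pos_real c \<longleftrightarrow> c \<in> \<real> \<and> Re c > 0"

definition Hsec :: "('n::finite, 't, 'd, 'x) orbifold \<Rightarrow> 't \<Rightarrow> (complex^'n) set" where
  "Hsec X v = {\<alpha>. \<forall>i. \<alpha> $ i \<noteq> 0 \<longrightarrow> sector X i = v}"

definition Hgr :: "('n::finite, 't, 'd, 'x) orbifold \<Rightarrow> 't \<Rightarrow> nat \<Rightarrow> (complex^'n) set" where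
  \<comment> \<open>\<open>H\<^sup>2\<^sup>k(\<X>\<^sub>v)\<close>\<close>
  "Hgr X v k = {\<alpha>. \<forall>i. \<alpha> $ i \<noteq> 0 \<longrightarrow> sector X i = v \<and> hdeg X i = k}"

definition Hgt :: "('n::finite, 't, 'd, 'x) orbifold \<Rightarrow> 't \<Rightarrow> nat \<Rightarrow> (complex^'n) set" where
  \<comment> \<open>\<open>H\<close> of degree \<open>> 2k\<close> of \<open>\<X>\<^sub>v\<close>\<close>
  "Hgt X v k = {\<alpha>. \<forall>i. \<alpha> $ i \<noteq> 0 \<longrightarrow> sector X i = v \<and> hdeg X i > k}"

definition hcomp :: "('n::finite, 't, 'd, 'x) orbifold \<Rightarrow> 't \<Rightarrow> nat \<Rightarrow> complex^'n \<Rightarrow> complex^'n" where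
  \<comment> \<open>the component of a class in \<open>H\<^sup>2\<^sup>k(\<X>\<^sub>v)\<close>\<close>
  "hcomp X v k \<alpha> = (\<chi> i. if sector X i = v \<and> hdeg X i = k then \<alpha> $ i else 0)"

definition unitX :: "('n::finite, 't, 'd, 'x) orbifold \<Rightarrow> complex^'n" where
  "unitX X = hcomp X (untw X) 0 (unitIX X)"

definition act :: "('n::finite, 't, 'd, 'x) orbifold \<Rightarrow> complex^'n \<Rightarrow> complex^'n \<Rightarrow> complex^'n" where
  "act X \<tau> \<alpha> = cup X (prs X \<tau>) \<alpha>"

definition orb_pair :: "('n::finite, 't, 'd, 'x) orbifold \<Rightarrow> complex^'n \<Rightarrow> complex^'n \<Rightarrow> complex" where
  "orb_pair X \<alpha> \<beta> = integ X (cup X \<alpha> (invs X \<beta>))"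

definition \<phi> :: "'n::finite \<Rightarrow> complex^'n" where
  "\<phi> i = axis i 1"

definition dual_basis :: "('n::finite, 't, 'd, 'x) orbifold \<Rightarrow> 'n \<Rightarrow> complex^'n" where
  "dual_basis X j = (THE \<beta>. \<forall>i. orb_pair X (\<phi> i) \<beta> = (if i = j then 1 else 0))"

definition mu :: "('n::finite, 't, 'd, 'x) orbifold \<Rightarrow> complex^'n \<Rightarrow> complex^'n" where
  \<comment> \<open>\<open>deg \<phi>\<^sub>i = 2 k + 2 \<iota>\<^sub>v\<close> is the real degree and \<open>n\<close> the complex dimension\<close>
  "mu X \<alpha> = (\<chi> i. of_real (real (hdeg X i) + age X (sector X i) - real (cdim X) / 2) * \<alpha> $ i)"

definition expop :: "complex \<Rightarrow> (complex^'n \<Rightarrow> complex^'n) \<Rightarrow> complex^'n \<Rightarrow> complex^'n::finite" where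
  \<comment> \<open>the operator exponential \<open>e\<^sup>c\<^sup>A\<close>\<close>
  "expop c A \<alpha> = (\<Sum>k. (c ^ k / fact k) *s (A ^^ k) \<alpha>)"

locale orbifold_cohomology =
  fixes X :: "('n::finite, 't::finite, 'd::ab_group_add, 'x::ab_group_add) orbifold"
  \<comment> \<open>sectors\<close>
  assumes sinv_sinv: "sinv X (sinv X v) = v"
    and sinv_untw: "sinv X (untw X) = untw X"
    and sdim_untw: "sdim X (untw X) = cdim X"
    and sdim_sinv: "sdim X (sinv X v) = sdim X v"
    and age_rat: "age X v \<in> \<rat>"
    and age_nonneg: "age X v \<ge> 0"
    and age_untw: "age X (untw X) = 0"
    and age_sinv: "age X v + age X (sinv X v) = real (cdim X) - real (sdim X v)"
    and hdeg_le: "hdeg X i \<le> sdim X (sector X i)"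
    and sector_connected: "card {i. sector X i = v \<and> hdeg X i = 0} = 1"
  \<comment> \<open>the ring \<open>H\<^sup>*(I\<X>) = \<Prod>\<^sub>v H\<^sup>*(\<X>\<^sub>v)\<close>\<close>
    and cup_linear: "Vector_Spaces.linear (*s) (*s) (cup X \<alpha>)"
    and cup_commute: "cup X \<alpha> \<beta> = cup X \<beta> \<alpha>"
    and cup_assoc: "cup X (cup X \<alpha> \<beta>) \<gamma> = cup X \<alpha> (cup X \<beta> \<gamma>)"
    and cup_one: "cup X (unitIX X) \<alpha> = \<alpha>"
    and one_deg: "unitIX X $ i \<noteq> 0 \<Longrightarrow> hdeg X i = 0"
    and cup_sectors: "\<lbrakk>\<alpha> \<in> Hsec X v; \<beta> \<in> Hsec X w; v \<noteq> w\<rbrakk> \<Longrightarrow> cup X \<alpha> \<beta> = 0"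
    and cup_Hgr: "\<lbrakk>\<alpha> \<in> Hgr X v j; \<beta> \<in> Hgr X v k\<rbrakk> \<Longrightarrow> cup X \<alpha> \<beta> \<in> Hgr X v (j + k)"
  \<comment> \<open>integration and Poincare duality\<close>
    and integ_linear: "Vector_Spaces.linear (*s) (*) (integ X)"
    and integ_top: "\<lbrakk>\<alpha> \<in> Hgr X v k; k \<noteq> sdim X v\<rbrakk> \<Longrightarrow> integ X \<alpha> = 0"
    and poincare: "(\<And>\<beta>. integ X (cup X \<alpha> \<beta>) = 0) \<Longrightarrow> \<alpha> = 0"
  \<comment> \<open>the maps \<open>pr\<^sup>*\<close> and \<open>inv\<^sup>*\<close>\<close>
    and prs_linear: "Vector_Spaces.linear (*s) (*s) (prs X)"
    and prs_cup: "\<lbrakk>\<alpha> \<in> Hsec X (untw X); \<beta> \<in> Hsec X (untw X)\<rbrakk>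
                    \<Longrightarrow> prs X (cup X \<alpha> \<beta>) = cup X (prs X \<alpha>) (prs X \<beta>)"
    and prs_unit: "prs X (unitX X) = unitIX X"
    and prs_untw: "\<lbrakk>\<alpha> \<in> Hsec X (untw X); sector X i = untw X\<rbrakk> \<Longrightarrow> prs X \<alpha> $ i = \<alpha> $ i"
    and prs_deg: "\<lbrakk>\<alpha> \<in> Hgr X (untw X) k; prs X \<alpha> $ i \<noteq> 0\<rbrakk> \<Longrightarrow> hdeg X i = k"
    and invs_linear: "Vector_Spaces.linear (*s) (*s) (invs X)"
    and invs_invs: "invs X (invs X \<alpha>) = \<alpha>"
    and invs_cup: "invs X (cup X \<alpha> \<beta>) = cup X (invs X \<alpha>) (invs X \<beta>)"
    and invs_Hgr: "\<alpha> \<in> Hgr X v k \<Longrightarrow> invs X \<alpha> \<in> Hgr X (sinv X v) k"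
    and invs_untw: "\<alpha> \<in> Hsec X (untw X) \<Longrightarrow> invs X \<alpha> = \<alpha>"
    and invs_prs: "\<alpha> \<in> Hsec X (untw X) \<Longrightarrow> invs X (prs X \<alpha>) = prs X \<alpha>"
    and integ_invs: "integ X (invs X \<alpha>) = integ X \<alpha>"
  \<comment> \<open>complex conjugation\<close>
    and conjH_add: "conjH X (\<alpha> + \<beta>) = conjH X \<alpha> + conjH X \<beta>"
    and conjH_scale: "conjH X (c *s \<alpha>) = cnj c *s conjH X \<alpha>"
    and conjH_conjH: "conjH X (conjH X \<alpha>) = \<alpha>"
    and conjH_Hgr: "\<alpha> \<in> Hgr X v k \<Longrightarrow> conjH X \<alpha> \<in> Hgr X v k"
    and conjH_cup: "conjH X (cup X \<alpha> \<beta>) = cup X (conjH X \<alpha>) (conjH X \<beta>)"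
    and conjH_prs: "\<alpha> \<in> Hsec X (untw X) \<Longrightarrow> conjH X (prs X \<alpha>) = prs X (conjH X \<alpha>)"
    and conjH_invs: "conjH X (invs X \<alpha>) = invs X (conjH X \<alpha>)"
    and integ_conjH: "integ X (conjH X \<alpha>) = cnj (integ X \<alpha>)"
  \<comment> \<open>Hodge decomposition\<close>
    and hodge_subspace: "even (p + q) \<Longrightarrow> vec.subspace (hodge X v p q)"
    and hodge_Hgr: "p + q = 2 * k \<Longrightarrow> hodge X v p q \<subseteq> Hgr X v k"
    and hodge_decomp: "\<alpha> \<in> Hgr X v k \<Longrightarrow>
          \<exists>!a. (\<forall>p\<le>2*k. a p \<in> hodge X v p (2*k - p)) \<and> (\<forall>p>2*k. a p = 0) \<and> \<alpha> = (\<Sum>p\<le>2*k. a p)"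
    and hodge_conjH: "\<lbrakk>even (p + q); \<alpha> \<in> hodge X v p q\<rbrakk> \<Longrightarrow> conjH X \<alpha> \<in> hodge X v q p"
    and hodge_invs: "\<lbrakk>even (p + q); \<alpha> \<in> hodge X v p q\<rbrakk> \<Longrightarrow> invs X \<alpha> \<in> hodge X (sinv X v) p q"
    and hodge_cup: "\<lbrakk>even (p + q); even (p' + q'); \<alpha> \<in> hodge X v p q; \<beta> \<in> hodge X v p' q'\<rbrakk>
          \<Longrightarrow> cup X \<alpha> \<beta> \<in> hodge X v (p + p') (q + q')"
    and hodge_act: "\<lbrakk>even (p + q); even (p' + q'); \<alpha> \<in> hodge X (untw X) p q; \<beta> \<in> hodge X v p' q'\<rbrakk>
          \<Longrightarrow> act X \<alpha> \<beta> \<in> hodge X v (p + p') (q + q')"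
  \<comment> \<open>integral classes and topological orbifold line bundles; the image of \<open>H\<^sup>2(\<X>, \<int>)\<close> is a lattice in
      \<open>H\<^sup>2(\<X>, \<real>)\<close>, and \<open>c\<^sub>1(T\<X>)\<close> is the class of the determinant of \<open>T\<X>\<close>\<close>
    and ratcl_add: "ratcl X (\<xi> + \<eta>) = ratcl X \<xi> + ratcl X \<eta>"
    and ratcl_lattice: "\<exists>B. independent B \<and> range (ratcl X) = {\<Sum>b\<in>B. of_int (m b) *\<^sub>R b | m. True}
          \<and> span B = {\<alpha> \<in> Hgr X (untw X) 1. conjH X \<alpha> = \<alpha>}"
    and fage_range: "0 \<le> fage X \<xi> v \<and> fage X \<xi> v < 1"
    and fage_rat: "fage X \<xi> v \<in> \<rat>"
    and fage_add: "fage X (\<xi> + \<eta>) v - fage X \<xi> v - fage X \<eta> v \<in> \<int>"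
    and fage_untw: "fage X \<xi> (untw X) = 0"
    and fage_sinv: "fage X \<xi> v + fage X \<xi> (sinv X v) \<in> \<int>"
    and c1_integral: "\<exists>\<xi>. ratcl X \<xi> = c1 X \<and> (\<forall>v. age X v - fage X \<xi> v \<in> \<int>)"
    and c1_hodge: "c1 X \<in> hodge X (untw X) 1 1"
  \<comment> \<open>the Kaehler cone\<close>
    and kahler_nonempty: "kahler X \<noteq> {}"
    and kahler_add: "\<lbrakk>\<omega> \<in> kahler X; \<omega>' \<in> kahler X\<rbrakk> \<Longrightarrow> \<omega> + \<omega>' \<in> kahler X"
    and kahler_scale: "\<lbrakk>\<omega> \<in> kahler X; r > 0\<rbrakk> \<Longrightarrow> r *\<^sub>R \<omega> \<in> kahler X"
    and kahler_hodge: "\<omega> \<in> kahler X \<Longrightarrow> \<omega> \<in> hodge X (untw X) 1 1"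
    and kahler_real: "\<omega> \<in> kahler X \<Longrightarrow> conjH X \<omega> = \<omega>"
  \<comment> \<open>hard Lefschetz and the Hodge-Riemann bilinear relations for the restriction of a Kaehler class to
      \<open>\<X>\<^sub>v\<close>; for \<open>p + q = 2k\<close> the usual sign \<open>\<i>\<^sup>p\<^sup>-\<^sup>q (-1)^((p+q)(p+q-1)/2)\<close> is \<open>(-1)^((p-q)/2 + k)\<close>\<close>
    and hard_lefschetz: "\<lbrakk>\<omega> \<in> kahler X; 2 * k \<le> sdim X v\<rbrakk> \<Longrightarrow>
          bij_betw (act X \<omega> ^^ (sdim X v - 2 * k)) (Hgr X v k) (Hgr X v (sdim X v - k))"
    and hodge_riemann: "\<lbrakk>\<omega> \<in> kahler X; p + q = 2 * k; 2 * k \<le> sdim X v; \<alpha> \<in> hodge X v p q;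
          (act X \<omega> ^^ (sdim X v - 2 * k + 1)) \<alpha> = 0; \<alpha> \<noteq> 0\<rbrakk> \<Longrightarrow>
          pos_real ((-1) powi ((int p - int q) div 2 + int k) *
            integ X (cup X ((act X \<omega> ^^ (sdim X v - 2 * k)) \<alpha>) (conjH X \<alpha>)))"
  \<comment> \<open>the pairing of \<open>H\<^sup>2\<close> and \<open>H\<^sub>2\<close>, and effective classes\<close>
    and h2pair_linear: "Vector_Spaces.linear (*s) (*) (\<lambda>\<tau>. h2pair X \<tau> d)"
    and h2pair_add: "h2pair X \<tau> (d + d') = h2pair X \<tau> d + h2pair X \<tau> d'"
    and h2pair_rat: "h2pair X (ratcl X \<xi>) d \<in> \<rat>"
    and h2pair_nondeg_right: "(\<And>\<tau>. \<tau> \<in> Hgr X (untw X) 1 \<Longrightarrow> h2pair X \<tau> d = 0) \<Longrightarrow> d = 0"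
    and h2pair_nondeg_left: "\<lbrakk>\<tau> \<in> Hgr X (untw X) 1; \<And>d. h2pair X \<tau> d = 0\<rbrakk> \<Longrightarrow> \<tau> = 0"
    and eff_zero: "0 \<in> eff X"
    and eff_add: "\<lbrakk>d \<in> eff X; d' \<in> eff X\<rbrakk> \<Longrightarrow> d + d' \<in> eff X"
    and kahler_eff: "\<lbrakk>\<omega> \<in> kahler X; d \<in> eff X; d \<noteq> 0\<rbrakk> \<Longrightarrow> pos_real (h2pair X \<omega> d)"
    and kahler_bounded: "\<omega> \<in> kahler X \<Longrightarrow> finite {d \<in> eff X. Re (h2pair X \<omega> d) \<le> C}"


subsection \<open>Genus-zero Gromov-Witten theory\<close>

definition basis_ins :: "('n::finite \<times> nat) list \<Rightarrow> ((complex^'n) \<times> nat) list" where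
  "basis_ins is = map (\<lambda>(i, k). (\<phi> i, k)) is"

definition stable :: "'a list \<Rightarrow> 'd::zero \<Rightarrow> bool" where
  "stable xs d \<longleftrightarrow> length xs \<ge> 3 \<or> d \<noteq> 0"

definition lower :: "('n::finite, 't, 'd, 'x) orbifold \<Rightarrow> (complex^'n \<Rightarrow> complex^'n) \<Rightarrow> ((complex^'n) \<times> nat) list \<Rightarrow> 'd \<Rightarrow> complex" where
  \<comment> \<open>the sum over \<open>j\<close> of the correlators in which \<open>\<alpha>\<^sub>j\<psi>^k\<^sub>j\<close> is replaced by \<open>A(\<alpha>\<^sub>j)\<psi>^(k\<^sub>j-1)\<close>, where negative
      powers of \<open>\<psi>\<close> count as \<open>0\<close>\<close>
  "lower X A xs d = (\<Sum>j \<in> {j. j < length xs \<and> snd (xs ! j) > 0}.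
       gw X (xs[j := (A (fst (xs ! j)), snd (xs ! j) - 1)]) d)"

text \<open>
  Unstable correlators are set to \<open>0\<close>. The degree and monodromy axioms hold because the moduli space of
  twisted stable maps with markings in \<open>\<X>\<^sub>v\<^sub>1, \<dots>, \<X>\<^sub>v\<^sub>l\<close> has virtual dimension
  \<open>n - 3 + l + \<langle>\<rho>, d\<rangle> - \<iota>\<^sub>v\<^sub>1 - \<dots> - \<iota>\<^sub>v\<^sub>l\<close>, and a line bundle on an orbicurve has integral degree minus
  ages. The sums over \<open>(d\<^sub>1, d\<^sub>2)\<close> in the recursion are finite by \<open>kahler_bounded\<close>.
\<close>

locale orbifold_GW = orbifold_cohomology X
  for X :: "('n::finite, 't::finite, 'd::ab_group_add, 'x::ab_group_add) orbifold" +
  assumes gw_sym: "mset xs = mset ys \<Longrightarrow> gw X xs d = gw X ys d"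
    and gw_linear: "Vector_Spaces.linear (*s) (*) (\<lambda>\<alpha>. gw X ((\<alpha>, k) # xs) d)"
    and gw_eff: "d \<notin> eff X \<Longrightarrow> gw X xs d = 0"
    and gw_unstable: "\<not> stable xs d \<Longrightarrow> gw X xs d = 0"
    and gw_real: "gw X (map (\<lambda>(\<alpha>, k). (conjH X \<alpha>, k)) xs) d = cnj (gw X xs d)"
    and gw_degree: "gw X (basis_ins is) d \<noteq> 0 \<Longrightarrow>
          complex_of_real (\<Sum>(i, k)\<leftarrow>is. real (hdeg X i) + age X (sector X i) + real k)
            = of_nat (cdim X) - 3 + of_nat (length is) + h2pair X (c1 X) d"
    and gw_monodromy: "gw X (basis_ins is) d \<noteq> 0 \<Longrightarrow>
          h2pair X (ratcl X \<xi>) d - complex_of_real (\<Sum>(i, k)\<leftarrow>is. fage X \<xi> (sector X i)) \<in> \<int>"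
    and gw_degree_zero: "\<gamma> \<in> Hsec X (untw X) \<Longrightarrow>
          gw X [(\<gamma>, 0), (\<alpha>, 0), (\<beta>, 0)] 0 = orb_pair X (act X \<gamma> \<alpha>) \<beta>"
    and gw_string: "stable xs d \<Longrightarrow> gw X ((unitX X, 0) # xs) d = lower X id xs d"
    and gw_dilaton: "stable xs d \<Longrightarrow> gw X ((unitX X, 1) # xs) d = (of_nat (length xs) - 2) * gw X xs d"
    and gw_divisor: "\<lbrakk>stable xs d; \<gamma> \<in> Hgr X (untw X) 1\<rbrakk> \<Longrightarrow>
          gw X ((\<gamma>, 0) # xs) d = h2pair X \<gamma> d * gw X xs d + lower X (act X \<gamma>) xs d"
    and gw_recursion: "gw X ((\<alpha>, Suc k) # (\<beta>, l) # (\<gamma>, m) # ys) d =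
          (\<Sum>(d1, d2) \<in> {(d1, d2). d1 \<in> eff X \<and> d2 \<in> eff X \<and> d1 + d2 = d}.
             \<Sum>S \<in> Pow {..<length ys}. \<Sum>i\<in>UNIV.
               gw X ((\<alpha>, k) # (\<phi> i, 0) # nths ys S) d1 *
               gw X ((dual_basis X i, 0) # (\<beta>, l) # (\<gamma>, m) # nths ys (- S)) d2)"


subsection \<open>Quantum cohomology and the A-model semi-infinite variation of Hodge structures\<close>

definition tau02 :: "('n::finite, 't, 'd, 'x) orbifold \<Rightarrow> complex^'n \<Rightarrow> complex^'n" where
  "tau02 X \<tau> = hcomp X (untw X) 1 \<tau>"

definition tau' :: "('n::finite, 't, 'd, 'x) orbifold \<Rightarrow> complex^'n \<Rightarrow> complex^'n" where
  "tau' X \<tau> = \<tau> - tau02 X \<tau>"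

definition qprod_term :: "('n::finite, 't, 'd, 'x) orbifold \<Rightarrow> complex^'n \<Rightarrow> complex^'n \<Rightarrow> complex^'n \<Rightarrow> 'd \<times> nat \<Rightarrow> complex^'n" where
  \<comment> \<open>the summand of \<open>\<alpha> \<circ>\<^sub>\<tau> \<beta>\<close> indexed by \<open>(d, l)\<close>\<close>
  "qprod_term X \<tau> \<alpha> \<beta> = (\<lambda>(d, l). \<Sum>k\<in>UNIV.
     (gw X ([(\<alpha>, 0), (\<beta>, 0)] @ replicate l (tau' X \<tau>, 0) @ [(\<phi> k, 0)]) d / fact l
        * exp (h2pair X (tau02 X \<tau>) d)) *s dual_basis X k)"

definition qprod_converges_on :: "('n::finite, 't, 'd::zero, 'x) orbifold \<Rightarrow> (complex^'n) set \<Rightarrow> bool" where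
  "qprod_converges_on X U \<longleftrightarrow> open U \<and> connected U \<and>
     (\<exists>M>0. \<exists>\<epsilon>>0. {\<tau>. (\<forall>d \<in> eff X - {0}. Re (h2pair X (tau02 X \<tau>) d) < - M) \<and> norm (tau' X \<tau>) < \<epsilon>} \<subseteq> U) \<and>
     (\<forall>\<tau>\<in>U. \<forall>i j. qprod_term X \<tau> (\<phi> i) (\<phi> j) summable_on (eff X \<times> UNIV))"

definition Jop :: "('n::finite, 't, 'd::zero, 'x) orbifold \<Rightarrow> complex^'n \<Rightarrow> complex \<Rightarrow> complex^'n \<Rightarrow> complex^'n" where
  \<comment> \<open>\<open>\<J>\<^sub>\<tau>\<close> at the point \<open>z\<close>, with \<open>1/(z - \<psi>) = \<Sum>\<^sub>k \<psi>\<^sup>k z^(-k-1)\<close>; only finitely many \<open>k\<close> contribute for given \<open>(d, l)\<close>\<close>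
  "Jop X \<tau> z \<alpha> = expop (1 / z) (act X (tau02 X \<tau>))
     (\<alpha> + (\<Sum>\<^sub>\<infinity>(d, l) \<in> eff X \<times> UNIV - {(0, 0)}. \<Sum>i\<in>UNIV.
        ((\<Sum>k. gw X ((\<alpha>, 0) # replicate l (tau' X \<tau>, 0) @ [(\<phi> i, k)]) d / z ^ Suc k)
           / fact l * exp (h2pair X (tau02 X \<tau>) d)) *s dual_basis X i))"

text \<open>
  Elements of \<open>H\<^sup>*\<^sub>o\<^sub>r\<^sub>b \<otimes> \<complex>{z, z\<^sup>-\<^sup>1}\<close> are functions on \<open>\<complex>\<close> that are holomorphic on \<open>\<complex>\<^sup>*\<close>, normalised to
  vanish at \<open>0\<close> so that equality on \<open>\<complex>\<^sup>*\<close> is equality of functions.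
\<close>

definition HH :: "(complex \<Rightarrow> complex^'n::finite) set" where
  "HH = {s. s 0 = 0 \<and> (\<forall>i. (\<lambda>z. s z $ i) holomorphic_on (- {0}))}"

definition HHsec :: "('n::finite, 't, 'd, 'x) orbifold \<Rightarrow> 't \<Rightarrow> (complex \<Rightarrow> complex^'n) set" where
  "HHsec X v = {s \<in> HH. \<forall>z. s z \<in> Hsec X v}"

definition Fspace :: "('n::finite, 't, 'd::zero, 'x) orbifold \<Rightarrow> complex^'n \<Rightarrow> (complex \<Rightarrow> complex^'n) set" where
  \<comment> \<open>\<open>\<F>\<^sub>\<tau> = \<J>\<^sub>\<tau>(H\<^sup>*\<^sub>o\<^sub>r\<^sub>b \<otimes> \<complex>{z})\<close>\<close>
  "Fspace X \<tau> = {s. s 0 = 0 \<and> (\<exists>a. (\<forall>i. (\<lambda>z. a z $ i) holomorphic_on UNIV) \<and>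
                                  (\<forall>z. z \<noteq> 0 \<longrightarrow> s z = Jop X \<tau> z (a z)))}"


subsection \<open>Real structures\<close>

definition galois :: "('n::finite, 't, 'd, 'x) orbifold \<Rightarrow> 'x \<Rightarrow> complex^'n \<Rightarrow> complex^'n" where
  "galois X \<xi> \<alpha> = expop (- 2 * pi * \<i>) (act X (ratcl X \<xi>))
     (\<chi> i. exp (2 * pi * \<i> * fage X \<xi> (sector X i)) * \<alpha> $ i)"

definition V_pair :: "('n::finite, 't, 'd, 'x) orbifold \<Rightarrow> complex^'n \<Rightarrow> complex^'n \<Rightarrow> complex" where
  "V_pair X \<alpha> \<beta> = orb_pair X (expop (pi * \<i>) (act X (c1 X)) \<alpha>) (expop (pi * \<i>) (mu X) \<beta>)"

definition real_structure :: "('n::finite, 't, 'd, 'x) orbifold \<Rightarrow> (complex^'n) set \<Rightarrow> bool" where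
  "real_structure X VR \<longleftrightarrow> subspace VR \<and>
     (\<forall>\<alpha>. \<exists>!(a, b). a \<in> VR \<and> b \<in> VR \<and> \<alpha> = a + \<i> *s b) \<and>
     (\<forall>\<xi>. galois X \<xi> ` VR = VR) \<and>
     (\<forall>\<alpha>\<in>VR. \<forall>\<beta>\<in>VR. V_pair X \<alpha> \<beta> \<in> \<real>)"

definition kappaV :: "(complex^'n) set \<Rightarrow> complex^'n \<Rightarrow> complex^'n::finite" where
  "kappaV VR \<alpha> = (THE \<beta>. \<exists>a\<in>VR. \<exists>b\<in>VR. \<alpha> = a + \<i> *s b \<and> \<beta> = a - \<i> *s b)"

definition kappaH :: "('n::finite, 't, 'd, 'x) orbifold \<Rightarrow> (complex^'n) set \<Rightarrow> (complex \<Rightarrow> complex^'n) \<Rightarrow> complex \<Rightarrow> complex^'n" where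
  \<comment> \<open>\<open>z = e\<^sup>i\<^sup>\<theta>\<close> and \<open>log z = \<i>\<theta>\<close>; quantifying over all \<open>\<theta>\<close> imposes the equation for every branch of \<open>log z\<close>\<close>
  "kappaH X VR s = (THE t. t \<in> HH \<and> (\<forall>\<theta>::real.
     t (cis \<theta>) = expop (- \<i> * \<theta>) (mu X) (expop (\<i> * \<theta>) (act X (c1 X))
       (kappaV VR (expop (- \<i> * \<theta>) (act X (c1 X)) (expop (\<i> * \<theta>) (mu X) (s (cis \<theta>))))))))"

definition h_form :: "('n::finite, 't, 'd, 'x) orbifold \<Rightarrow> (complex^'n) set \<Rightarrow>
    (complex \<Rightarrow> complex^'n) \<Rightarrow> (complex \<Rightarrow> complex^'n) \<Rightarrow> complex" where
  \<comment> \<open>the constant value of \<open>(\<kappa>\<^sub>\<H> s\<^sub>1, s\<^sub>2)\<^sub>\<H>\<close>, a function of \<open>z\<close>\<close>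
  "h_form X VR s1 s2 = (THE c. \<forall>z. z \<noteq> 0 \<longrightarrow> orb_pair X (kappaH X VR s1 (- z)) (s2 z) = c)"


subsection \<open>Purity and polarization\<close>

text \<open>
  The variation of Hodge structures lives over \<open>U\<close>, so that both notions include \<open>\<tau> \<in> U\<close>.
\<close>

definition pure_at :: "('n::finite, 't, 'd::zero, 'x) orbifold \<Rightarrow> (complex^'n) set \<Rightarrow> (complex^'n) set \<Rightarrow> complex^'n \<Rightarrow> bool" where
  "pure_at X U VR \<tau> \<longleftrightarrow> \<tau> \<in> U \<and>
     (let F = Fspace X \<tau>; G = (\<lambda>s z. (1 / z) *s s z) ` (kappaH X VR ` F)
      in F \<inter> G = {\<lambda>z. 0} \<and> {\<lambda>z. f z + g z | f g. f \<in> F \<and> g \<in> G} = HH)"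

definition polarized_at :: "('n::finite, 't, 'd::zero, 'x) orbifold \<Rightarrow> (complex^'n) set \<Rightarrow> (complex^'n) set \<Rightarrow> complex^'n \<Rightarrow> bool" where
  "polarized_at X U VR \<tau> \<longleftrightarrow> \<tau> \<in> U \<and>
     (\<forall>s \<in> Fspace X \<tau> \<inter> kappaH X VR ` Fspace X \<tau>. s \<noteq> (\<lambda>z. 0) \<longrightarrow> pos_real (h_form X VR s s))"

definition K_lift :: "('n::finite, 't, 'd::zero, 'x) orbifold \<Rightarrow> (complex^'n) set \<Rightarrow> complex^'n \<Rightarrow> complex^'n \<Rightarrow> complex \<Rightarrow> complex^'n" where
  \<comment> \<open>the element of \<open>\<F>\<^sub>\<tau> \<inter> \<kappa>\<^sub>\<H>(\<F>\<^sub>\<tau>)\<close> representing the class \<open>[\<J>\<^sub>\<tau>(u)]\<close> in \<open>K\<^sub>\<tau> = \<F>\<^sub>\<tau>/z\<F>\<^sub>\<tau>\<close>\<close>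
  "K_lift X VR \<tau> u = (THE s. s \<in> Fspace X \<tau> \<inter> kappaH X VR ` Fspace X \<tau> \<and>
     (\<exists>f \<in> Fspace X \<tau>. \<forall>z. z \<noteq> 0 \<longrightarrow> s z = Jop X \<tau> z u + z *s f z))"

definition h_K :: "('n::finite, 't, 'd::zero, 'x) orbifold \<Rightarrow> (complex^'n) set \<Rightarrow> complex^'n \<Rightarrow> complex^'n \<Rightarrow> complex^'n \<Rightarrow> complex" where
  "h_K X VR \<tau> u u' = h_form X VR (K_lift X VR \<tau> u) (K_lift X VR \<tau> u')"


subsection \<open>The conditions on the real structure\<close>

definition respects_sectors :: "('n::finite, 't, 'd, 'x) orbifold \<Rightarrow> (complex^'n) set \<Rightarrow> bool" where
  "respects_sectors X VR \<longleftrightarrow>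
     (\<forall>v. kappaH X VR ` HHsec X v = HHsec X (sinv X v) \<and> kappaV VR ` Hsec X v = Hsec X (sinv X v))"

definition leading_term_condition :: "('n::finite, 't, 'd, 'x) orbifold \<Rightarrow> (complex^'n) set \<Rightarrow> bool" where
  "leading_term_condition X VR \<longleftrightarrow>
     (\<forall>v k. \<forall>\<alpha> \<in> Hgr X v k. \<exists>r::real. r > 0 \<and>
        kappaV VR \<alpha> - ((-1) ^ k * of_real r) *s invs X (conjH X \<alpha>) \<in> Hgt X (sinv X v) k)"

end

theory Submission
  imports Defs "HOL-Real_Asymp.Real_Asymp"
begin

no_notation fps_nth (infixl \<open>$\<close> 75)
no_notation Infinite_Set_Sum.abs_summable_on (infix \<open>abs'_summable'_on\<close> 50)

text \<open>
  Near the large radius limit the quantum corrections are exponentially small, so the fundamental solution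
  is \<open>exp (- x N / z) \<Phi>\<close> with \<open>N = \<omega> \<cup>\<close> and \<open>\<Phi>\<close> close to \<open>1\<close>. By hard Lefschetz \<open>N\<close> belongs to an
  \<open>sl\<^sub>2\<close>-triple \<open>(e, h, N)\<close>. With \<open>Re x = exp (2 r)\<close>, the rescaling \<open>exp (- r h)\<close> turns \<open>Re x \<cdot> N\<close> into \<open>N\<close> and
  leaves of \<open>\<kappa>\<^sub>\<V>\<close> only its weight-preserving part \<open>C\<close>, because \<open>\<kappa>\<^sub>\<V>\<close> never raises the weight. The
  factorisation \<open>exp (2 N / z) z\<^sup>h = exp (z e / 2) w exp (e / (2 z))\<close>, with \<open>w\<close> a Weyl element, then writes
  the intersection of \<open>\<F>\<^sub>\<tau>\<close> and its conjugate as the solutions \<open>a\<close>, \<open>c\<close>, holomorphic on the whole plane,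
  of the gluing equation \<open>G1 z a(z) = G2 z c(1/z)\<close> with \<open>G1\<close>, \<open>G2\<close> close to \<open>1\<close> on an annulus.
  A contraction argument shows that every \<open>a(0)\<close> belongs to exactly one solution, which is purity, and that
  \<open>c(0)\<close> is close to \<open>a(0)\<close>. Hence the polarisation form tends to the pairing of \<open>C w\<^sup>-\<^sup>1 u\<close> with \<open>u\<close>, whose sign on
  \<open>H\<^sup>p\<^sup>,\<^sup>q\<close> follows from the Hodge-Riemann relations on the Lefschetz strings.
\<close>

text \<open>Convergence is assumed for the quantum product only, so the summability of
  \<open>Phi\<close> has to be extracted from the quantum differential equation by a majorant
  argument. That \<open>kappaV\<close> never raises the weight comes from Galois invariance: a
  multiple of an integral class acts by a unipotent exponential with purely imaginary exponent, and
  for an antilinear map commuting with it amounts to anticommuting with the class. Integral classes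
  span the real ones, so \<open>N\<close> is covered, and hard Lefschetz turns anticommutation into
  a bound on weights. The power z^h enters because the weight-preserving part of the conjugation is
  z^h followed by \<open>C\<close>. The rescaling does not spoil the smallness of the corrections:
  it costs a power of Re x, while they decay exponentially in Re x. In the gluing equation
  \<open>a\<close> is controlled near 0 and \<open>c\<close> near infinity, so their errors are
  measured on different circles, and the splitting estimate is built for exactly this. The
  polarisation form is accessible through values at z = 0 because unitarity exhibits it as an entire
  function, which a reflection symmetry then forces to be constant.\<close>

text \<open>A copy of the bounded linear operators on which multiplication is composition, so that the
  exponential of a Banach algebra applies to operators.\<close>

typedef (overloaded) ('a::real_normed_vector) endo = "UNIV :: ('a \<Rightarrow>\<^sub>L 'a) set"
  morphisms blinfun_of Endo by simp

setup_lifting type_definition_endo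

instantiation endo :: (real_normed_vector) real_normed_vector
begin
lift_definition norm_endo :: "'a endo \<Rightarrow> real" is norm .
lift_definition minus_endo :: "'a endo \<Rightarrow> 'a endo \<Rightarrow> 'a endo" is minus .
lift_definition uminus_endo :: "'a endo \<Rightarrow> 'a endo" is uminus .
lift_definition zero_endo :: "'a endo" is 0 .
lift_definition plus_endo :: "'a endo \<Rightarrow> 'a endo \<Rightarrow> 'a endo" is plus .
lift_definition scaleR_endo :: "real \<Rightarrow> 'a endo \<Rightarrow> 'a endo" is scaleR .
definition dist_endo :: "'a endo \<Rightarrow> 'a endo \<Rightarrow> real" where "dist_endo a b = norm (a - b)"
definition sgn_endo :: "'a endo \<Rightarrow> 'a endo" where "sgn_endo a = inverse (norm a) *\<^sub>R a"
definition uniformity_endo :: "('a endo \<times> 'a endo) filter"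
  where "uniformity_endo = (INF e\<in>{0 <..}. principal {(x, y). dist x y < e})"
definition open_endo :: "'a endo set \<Rightarrow> bool"
  where "open_endo S = (\<forall>x\<in>S. \<forall>\<^sub>F (x', y) in uniformity. x' = x \<longrightarrow> y \<in> S)"
instance
  apply standard
  unfolding dist_endo_def open_endo_def sgn_endo_def uniformity_endo_def
  by (transfer, force simp: norm_triangle_ineq scaleR_add_left scaleR_add_right)+
end

instantiation endo :: (real_normed_vector) real_normed_algebra
begin
lift_definition times_endo :: "'a endo \<Rightarrow> 'a endo \<Rightarrow> 'a endo" is blinfun_compose .
instance
  by standard (transfer, force intro: blinfun_eqI simp: blinfun.bilinear_simps norm_blinfun_compose)+
end

instantiation endo :: ("{real_normed_vector, perfect_space}") real_normed_algebra_1
begin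
lift_definition one_endo :: "'a endo" is id_blinfun .
instance
proof
  show "norm (1 :: 'a endo) = 1" by transfer (rule norm_blinfun_id)
  show "(0 :: 'a endo) \<noteq> 1"
  proof transfer
    have "norm (id_blinfun :: 'a \<Rightarrow>\<^sub>L 'a) \<noteq> norm (0 :: 'a \<Rightarrow>\<^sub>L 'a)" by (simp only: norm_blinfun_id norm_zero)
    then show "(0 :: 'a \<Rightarrow>\<^sub>L 'a) \<noteq> id_blinfun" by force
  qed
  show "1 * A = A" "A * 1 = A" for A :: "'a endo"
    by (transfer, simp add: blinfun_eqI)+
qed
end

lift_definition ap :: "'a::real_normed_vector endo \<Rightarrow> 'a \<Rightarrow> 'a" (infixr \<open>\<rhd>\<close> 75) is blinfun_apply .

instance endo :: (banach) banach
proof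
  fix X :: "nat \<Rightarrow> 'a endo" assume "Cauchy X"
  have d: "dist (blinfun_of a) (blinfun_of b) = dist a b" for a b :: "'a endo"
    unfolding dist_endo_def dist_norm by transfer simp
  then have "Cauchy (\<lambda>n. blinfun_of (X n))"
    using \<open>Cauchy X\<close> unfolding Cauchy_def by simp
  then obtain L where "(\<lambda>n. blinfun_of (X n)) \<longlonglongrightarrow> L"
    by (auto simp: Cauchy_convergent_iff convergent_def)
  then have "X \<longlonglongrightarrow> Endo L"
    unfolding lim_sequentially by (simp add: d[symmetric] Endo_inverse)
  then show "convergent X" by (auto simp: convergent_def)
qed

lemma endo_eqI: "(\<And>v. A \<rhd> v = B \<rhd> v) \<Longrightarrow> A = B"
  by transfer (rule blinfun_eqI)

lemma bounded_bilinear_ap: "bounded_bilinear (\<rhd>)"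
  unfolding bounded_bilinear_def
  by (transfer, use blinfun.bounded_bilinear_axioms in \<open>simp add: bounded_bilinear_def\<close>)

interpretation ap: bounded_bilinear "(\<rhd>)" by (rule bounded_bilinear_ap)

lemma ap_times [simp]: "(A * B) \<rhd> v = A \<rhd> B \<rhd> v"
  by transfer simp

lemma ap_one [simp]: "1 \<rhd> v = v"
  by transfer simp

lemma ap_add [simp]: "(A + B) \<rhd> v = A \<rhd> v + B \<rhd> v" by (rule ap.add_left)
lemma ap_diff [simp]: "(A - B) \<rhd> v = A \<rhd> v - B \<rhd> v" by (rule ap.diff_left)
lemma ap_minus [simp]: "(- A) \<rhd> v = - (A \<rhd> v)" by (rule ap.minus_left)
lemma ap_zero [simp]: "0 \<rhd> v = 0" by (rule ap.zero_left)
lemma ap_scaleR [simp]: "(r *\<^sub>R A) \<rhd> v = r *\<^sub>R (A \<rhd> v)" by (rule ap.scaleR_left)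
lemma ap_sum: "(\<Sum>i\<in>I. A i) \<rhd> v = (\<Sum>i\<in>I. A i \<rhd> v)" by (rule ap.sum_left)

lemma norm_ap: "norm (A \<rhd> v) \<le> norm A * norm v"
  by transfer (rule norm_blinfun)

lemma ap_power: "(A ^ k) \<rhd> v = ((\<rhd>) A ^^ k) v"
  by (induction k arbitrary: v) (auto simp: funpow_swap1)

definition Op :: "('a \<Rightarrow> 'a) \<Rightarrow> 'a::euclidean_space endo" where
  "Op f = Endo (Blinfun f)"

lemma ap_Op [simp]: "linear f \<Longrightarrow> Op f \<rhd> v = f v"
  unfolding Op_def ap_def map_fun_def comp_def
  by (simp add: Endo_inverse bounded_linear_Blinfun_apply linear_conv_bounded_linear)

lemma norm_endo_le: "0 \<le> b \<Longrightarrow> (\<And>v. norm (A \<rhd> v) \<le> b * norm v) \<Longrightarrow> norm A \<le> b"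
  by transfer (rule norm_blinfun_bound)

section \<open>Operators on complex coordinate space\<close>

lemma norm_cvec_scale: "norm (c *s v) = norm c * norm (v :: complex^'n::finite)"
  by (simp add: norm_vec_def norm_mult L2_set_right_distrib)

lemma linear_vec_scale: "linear (\<lambda>v::complex^'n::finite. c *s v)"
  by (rule linearI) (simp_all add: vec_eq_iff algebra_simps)

lemma linear_of_clinear:
  "Vector_Spaces.linear (*s) (*s) f \<Longrightarrow> linear (f :: complex^'n::finite \<Rightarrow> complex^'n)"
proof (rule linearI)
  assume f: "Vector_Spaces.linear (*s) (*s) f"
  interpret f: Vector_Spaces.linear "(*s)" "(*s)" f by fact
  show "f (x + y) = f x + f y" for x y by (rule f.add)
  show "f (r *\<^sub>R x) = r *\<^sub>R f x" for r x
    using f.scale[of "of_real r" x] by (simp add: scaleR_vec_def vector_scalar_mult_def scaleR_conv_of_real)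
qed

text \<open>The algebra \<open>endo\<close> is taken over the reals because the antilinear
  involution must live in it as well. Complex scalars therefore enter as operators, and linearity or
  antilinearity becomes a commutation rule with them.\<close>

definition cop :: "complex \<Rightarrow> (complex^'n::finite) endo" where
  "cop c = Op (\<lambda>v. c *s v)"

lemma ap_cop [simp]: "cop c \<rhd> v = c *s v"
  by (simp add: cop_def linear_vec_scale)

lemma cop_0 [simp]: "cop 0 = 0" and cop_1 [simp]: "cop 1 = 1"
  and cop_add: "cop (a + b) = cop a + cop b"
  and cop_diff: "cop (a - b) = cop a - cop b"
  and cop_mult: "cop (a * b) = cop a * cop b"
  and cop_minus: "cop (- a) = - cop a"
  by (rule endo_eqI, simp add: vec_eq_iff ring_distribs mult.assoc)+

lemma cop_of_real: "cop (of_real r) = r *\<^sub>R 1"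
  by (rule endo_eqI, simp add: vec_eq_iff, simp add: scaleR_conv_of_real)

lemma norm_cop: "norm (cop c :: (complex^'n::finite) endo) = norm c"
proof (rule antisym)
  show "norm (cop c :: (complex^'n) endo) \<le> norm c"
    by (rule norm_endo_le) (simp_all add: norm_cvec_scale)
  show "norm c \<le> norm (cop c :: (complex^'n) endo)"
    using norm_ap[of "cop c" "axis undefined 1 :: complex^'n"] by (simp add: norm_cvec_scale)
qed

definition clin :: "(complex^'n::finite) endo \<Rightarrow> bool" where
  "clin A \<longleftrightarrow> (\<forall>c. A * cop c = cop c * A)"

definition alin :: "(complex^'n::finite) endo \<Rightarrow> bool" where
  "alin A \<longleftrightarrow> (\<forall>c. A * cop c = cop (cnj c) * A)"

definition dg :: "('n \<Rightarrow> complex) \<Rightarrow> (complex^'n::finite) endo" where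
  "dg f = Op (\<lambda>v. \<chi> i. f i * v $ i)"

definition cj :: "(complex^'n::finite) endo" where
  "cj = Op (\<lambda>v. \<chi> i. cnj (v $ i))"

lemma clinD: "clin A \<Longrightarrow> A * cop c = cop c * A" by (simp add: clin_def)
lemma alinD: "alin A \<Longrightarrow> A * cop c = cop (cnj c) * A" by (simp add: alin_def)

lemma clin_ap: "clin A \<Longrightarrow> A \<rhd> (c *s v) = c *s (A \<rhd> v)"
  by (metis ap_cop ap_times clinD)
lemma alin_ap: "alin A \<Longrightarrow> A \<rhd> (c *s v) = cnj c *s (A \<rhd> v)"
  by (metis ap_cop ap_times alinD)

lemma ap_dg [simp]: "dg f \<rhd> v = (\<chi> i. f i * v $ i)"
proof -
  have "linear (\<lambda>v::complex^'a. \<chi> i. f i * v $ i)"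
    by (rule linearI) (simp_all add: vec_eq_iff algebra_simps)
  then show ?thesis by (simp add: dg_def)
qed

lemma ap_cj [simp]: "cj \<rhd> v = (\<chi> i. cnj (v $ i))"
proof -
  have "linear (\<lambda>v::complex^'a. \<chi> i. cnj (v $ i))"
    by (rule linearI) (simp_all add: vec_eq_iff)
  then show ?thesis by (simp add: cj_def)
qed

lemma dg_mult: "dg f * dg g = dg (\<lambda>i. f i * g i)"
  by (rule endo_eqI) (simp add: vec_eq_iff)

lemma dg_one [simp]: "dg (\<lambda>i. 1) = 1"
  by (rule endo_eqI) (simp add: vec_eq_iff)

lemma cop_eq_dg: "cop c = dg (\<lambda>_. c)"
  by (rule endo_eqI) (simp add: vec_eq_iff)

lemma cj_cj [simp]: "cj * cj = 1"
  by (rule endo_eqI) (simp add: vec_eq_iff)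

lemma clin_intros [intro!, simp]:
  "clin (cop c)" "clin (dg f)" "clin 0" "clin 1"
  by (auto simp: clin_def cop_mult[symmetric] mult.commute cop_eq_dg dg_mult)

lemma clin_mult [intro]: "clin A \<Longrightarrow> clin B \<Longrightarrow> clin (A * B)"
  unfolding clin_def by (metis mult.assoc)
lemma clin_add [intro]: "clin A \<Longrightarrow> clin B \<Longrightarrow> clin (A + B)"
  unfolding clin_def by (simp add: algebra_simps)
lemma clin_diff [intro]: "clin A \<Longrightarrow> clin B \<Longrightarrow> clin (A - B)"
  unfolding clin_def by (simp add: algebra_simps)
lemma clin_power [intro]: "clin A \<Longrightarrow> clin (A ^ k)"
  by (induction k) auto
lemma clin_scaleR [intro]: "clin A \<Longrightarrow> clin (r *\<^sub>R A)"
  unfolding clin_def by simp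
lemma clin_sum [intro]: "(\<And>i. i \<in> I \<Longrightarrow> clin (A i)) \<Longrightarrow> clin (sum A I)"
  by (induction I rule: infinite_finite_induct) auto

lemma alin_cj [intro!, simp]: "alin cj"
  by (auto simp: alin_def vec_eq_iff intro!: endo_eqI)

lemma alin_clin_mult [intro]: "alin A \<Longrightarrow> clin B \<Longrightarrow> alin (A * B)"
  unfolding clin_def alin_def by (metis mult.assoc)
lemma clin_alin_mult [intro]: "clin A \<Longrightarrow> alin B \<Longrightarrow> alin (A * B)"
  unfolding clin_def alin_def by (metis mult.assoc)
lemma alin_mult [intro]: "alin A \<Longrightarrow> alin B \<Longrightarrow> clin (A * B)"
  unfolding clin_def alin_def by (metis mult.assoc complex_cnj_cnj)

lemma clin_limit:
  assumes "F \<noteq> bot" "\<And>x. clin (A x)" "(A \<longlongrightarrow> L) F"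
  shows "clin L"
  unfolding clin_def
proof
  fix c
  have "((\<lambda>x. A x * cop c) \<longlongrightarrow> L * cop c) F" "((\<lambda>x. cop c * A x) \<longlongrightarrow> cop c * L) F"
    by (intro tendsto_intros assms)+
  moreover have "(\<lambda>x. A x * cop c) = (\<lambda>x. cop c * A x)"
    using assms(2) by (auto simp: clin_def)
  ultimately show "L * cop c = cop c * L"
    using assms(1) tendsto_unique by metis
qed

lemma vec_expand: "(v :: complex^'n::finite) = (\<Sum>j\<in>UNIV. v $ j *s axis j 1)"
proof -
  have "(\<Sum>j\<in>UNIV. (v $ j *s axis j 1)) $ i = v $ i" for i
  proof -
    have "(\<Sum>j\<in>UNIV. (v $ j *s axis j 1)) $ i = (\<Sum>j\<in>UNIV. if j = i then v $ i else 0)"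
      unfolding sum_component by (intro sum.cong) (auto simp: axis_def)
    then show ?thesis by simp
  qed
  then show ?thesis by (simp add: vec_eq_iff)
qed

lemma clin_expand: "clin A \<Longrightarrow> A \<rhd> v = (\<Sum>j\<in>UNIV. v $ j *s (A \<rhd> axis j 1))"
  by (subst vec_expand[of v]) (simp add: ap.sum_right clin_ap)

lemma alin_expand: "alin A \<Longrightarrow> A \<rhd> v = (\<Sum>j\<in>UNIV. cnj (v $ j) *s (A \<rhd> axis j 1))"
  by (subst vec_expand[of v]) (simp add: ap.sum_right alin_ap)

lemma clin_eqI:
  assumes "clin A" "clin B" "\<And>j. A \<rhd> axis j 1 = B \<rhd> axis j 1"
  shows "A = B"
proof (rule endo_eqI)
  fix v
  have "A \<rhd> v = (\<Sum>j\<in>UNIV. v $ j *s (B \<rhd> axis j 1))"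
    unfolding clin_expand[OF assms(1), of v] assms(3) ..
  also have "\<dots> = B \<rhd> v" by (rule clin_expand[OF assms(2), symmetric])
  finally show "A \<rhd> v = B \<rhd> v" .
qed

lemma norm_clin_le:
  assumes "clin A" shows "norm A \<le> (\<Sum>j\<in>UNIV. norm (A \<rhd> axis j 1))"
proof (rule norm_endo_le)
  fix v
  have "norm (A \<rhd> v) \<le> (\<Sum>j\<in>UNIV. norm (v $ j *s (A \<rhd> axis j 1)))"
    unfolding clin_expand[OF assms, of v] by (rule norm_sum)
  also have "\<dots> \<le> (\<Sum>j\<in>UNIV. norm v * norm (A \<rhd> axis j 1))"
    unfolding norm_cvec_scale by (intro sum_mono mult_right_mono) (auto simp: Finite_Cartesian_Product.norm_nth_le)
  finally show "norm (A \<rhd> v) \<le> (\<Sum>j\<in>UNIV. norm (A \<rhd> axis j 1)) * norm v"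
    by (simp add: sum_distrib_left mult.commute)
qed (simp add: sum_nonneg)

lemma norm_dg_le: "(\<And>i. norm (f i) \<le> b) \<Longrightarrow> norm (dg f) \<le> b"
proof (rule norm_endo_le)
  assume f: "\<And>i. norm (f i) \<le> b"
  show b: "0 \<le> b" using f norm_ge_zero order_trans by blast
  fix v :: "complex^'a"
  show "norm (dg f \<rhd> v) \<le> b * norm v"
    unfolding norm_vec_def L2_set_right_distrib[OF b]
    by (rule L2_set_mono) (auto simp: norm_mult intro!: mult_right_mono f)
qed

subsection \<open>Exponentials\<close>

lemma clin_exp [intro]: assumes "clin A" shows "clin (exp A)"
proof -
  have "(\<lambda>n. \<Sum>k<n. A ^ k /\<^sub>R fact k) \<longlonglongrightarrow> exp A"
    using exp_converges[of A] by (simp add: sums_def)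
  moreover have "clin (\<Sum>k<n. A ^ k /\<^sub>R fact k)" for n
    using assms by auto
  ultimately show ?thesis
    using clin_limit[of sequentially "\<lambda>n. \<Sum>k<n. A ^ k /\<^sub>R fact k" "exp A"] by simp
qed

lemma exp_intertwine:
  fixes X Y A :: "'a::{real_normed_algebra_1,banach}"
  assumes "A * X = Y * A"
  shows "A * exp X = exp Y * A"
proof -
  have p: "A * X ^ k = Y ^ k * A" for k
    by (induction k) (simp_all add: power_commutes flip: mult.assoc power_Suc,
        metis assms mult.assoc power_Suc power_commutes)
  have "(\<lambda>k. A * (X ^ k /\<^sub>R fact k)) sums (A * exp X)"
    by (intro sums_mult exp_converges)
  moreover have "(\<lambda>k. (Y ^ k /\<^sub>R fact k) * A) sums (exp Y * A)"
    by (intro sums_mult2 exp_converges)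
  ultimately show ?thesis using p by (simp add: sums_iff)
qed

text \<open>Hadamard's formula for conjugation by \<open>exp X\<close>, cut off because the third
  iterated commutator vanishes: \<open>Z\<close> is [X, Y] and \<open>W\<close> is [X, Z]. It is
  proved coefficient by coefficient; \<open>g\<close> and \<open>h\<close> are the exponential
  series shifted by one and by two places.\<close>

lemma exp_ad2:
  fixes X Y Z W :: "'a::{real_normed_algebra_1,banach}"
  assumes "X * Y = Y * X + Z" "X * Z = Z * X + W" "X * W = W * X"
  shows "exp X * Y = (Y + Z + (1/2) *\<^sub>R W) * exp X"
proof -
  define f where "f k = X ^ k /\<^sub>R fact k" for k
  define g where "g k = (case k of 0 \<Rightarrow> 0 | Suc j \<Rightarrow> f j)" for k
  define h where "h k = (case k of 0 \<Rightarrow> 0 | Suc j \<Rightarrow> g j)" for k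
  have g0: "g 0 = 0" "\<And>k. g (Suc k) = f k" and h0: "h 0 = 0" "\<And>k. h (Suc k) = g k"
    by (simp_all add: g_def h_def)
  have f: "f sums exp X" unfolding f_def by (rule exp_converges)
  have g: "g sums exp X"
    using sums_Suc_iff[of g "exp X"] f by (simp add: g0)
  have h: "h sums exp X"
    using sums_Suc_iff[of h "exp X"] g by (simp add: h0)
  have Wk: "X ^ k * W = W * X ^ k" for k
    by (induction k) (simp_all add: mult.assoc, metis assms(3) mult.assoc)
  have Xf: "X * f k = real (Suc k) *\<^sub>R f (Suc k)" for k
    by (simp add: f_def del: of_nat_Suc)
  have Xg: "X * g k = real k *\<^sub>R f k" for k
    by (cases k) (simp_all add: g0 Xf del: of_nat_Suc)
  have Xh: "X * h k = real (k - 1) *\<^sub>R g k" for k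
    by (cases k) (simp_all add: h0 Xg g0)
  have main: "f k * Y = Y * f k + Z * g k + (1/2) *\<^sub>R (W * h k)" for k
  proof (induction k)
    case 0 then show ?case by (simp add: f_def g0 h0)
  next
    case (Suc k)
    have "real (Suc k) *\<^sub>R (f (Suc k) * Y) = X * (f k * Y)"
      by (simp add: Xf mult.assoc[symmetric] del: of_nat_Suc)
    also have "\<dots> = X * Y * f k + X * Z * g k + (1/2) *\<^sub>R (X * W * h k)"
      unfolding Suc by (simp add: algebra_simps)
    also have "\<dots> = Y * (X * f k) + Z * f k + Z * (X * g k) + W * g k + (1/2) *\<^sub>R (W * (X * h k))"
      unfolding assms by (simp add: algebra_simps)
    also have "\<dots> = real (Suc k) *\<^sub>R (Y * f (Suc k) + Z * g (Suc k) + (1/2) *\<^sub>R (W * h (Suc k)))"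
      unfolding Xf Xg Xh
      by (cases k) (simp_all add: g0 h0 algebra_simps scaleR_2)
    finally show ?case by (simp del: of_nat_Suc)
  qed
  have "(\<lambda>k. f k * Y) sums (exp X * Y)" by (rule sums_mult2[OF f])
  moreover have "(\<lambda>k. Y * f k + Z * g k + (1/2) *\<^sub>R (W * h k)) sums
      (Y * exp X + Z * exp X + (1/2) *\<^sub>R (W * exp X))"
    by (intro sums_add sums_mult sums_scaleR_right f g h)
  ultimately have "exp X * Y = Y * exp X + Z * exp X + (1/2) *\<^sub>R (W * exp X)"
    by (simp add: main sums_iff)
  then show ?thesis by (simp add: algebra_simps)
qed

lemma exp_nilpotent:
  fixes X :: "'a::{real_normed_algebra_1,banach}"
  assumes "X ^ m = 0"
  shows "exp X = (\<Sum>k<m. X ^ k /\<^sub>R fact k)"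
proof -
  have "X ^ k = 0" if "k \<ge> m" for k
    using assms that by (metis le_add_diff_inverse mult_zero_left power_add)
  then have "(\<lambda>k. X ^ k /\<^sub>R fact k) sums (\<Sum>k<m. X ^ k /\<^sub>R fact k)"
    by (intro sums_finite) auto
  then show ?thesis by (rule sums_unique2[OF exp_converges])
qed

lemma cop_mult_power: "clin A \<Longrightarrow> (cop c * A) ^ k = cop (c ^ k) * A ^ k"
proof (induction k)
  case (Suc k)
  assume A: "clin A"
  have "(cop c * A) ^ Suc k = cop c * (A * cop (c ^ k)) * A ^ k"
    using Suc A by (simp add: mult.assoc)
  then show ?case by (simp add: clinD[OF A] cop_mult mult.assoc)
qed simp

lemma expop_eq_exp:
  assumes "clin A"
  shows "expop c ((\<rhd>) A) v = exp (cop c * A) \<rhd> v"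
proof -
  have "(\<lambda>k. ((cop c * A) ^ k /\<^sub>R fact k) \<rhd> v) sums (exp (cop c * A) \<rhd> v)"
    by (intro bounded_linear.sums[OF ap.bounded_linear_left] exp_converges)
  moreover have "((cop c * A) ^ k /\<^sub>R fact k) \<rhd> v = (c ^ k / fact k) *s (((\<rhd>) A ^^ k) v)" for k
    unfolding cop_mult_power[OF assms] ap_scaleR ap_times ap_cop ap_power vec_eq_iff
    by (simp, simp add: scaleR_conv_of_real field_simps)
  ultimately show ?thesis by (simp add: expop_def sums_iff)
qed

subsection \<open>Holomorphic families\<close>

definition hvec :: "complex set \<Rightarrow> (complex \<Rightarrow> complex^'n::finite) \<Rightarrow> bool" where
  "hvec S v \<longleftrightarrow> (\<forall>i. (\<lambda>z. v z $ i) holomorphic_on S)"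

text \<open>Holomorphy is tested on columns. Linearity is demanded at every point, also outside
  \<open>S\<close>, so that it can be used without a side condition; families on the punctured plane
  must therefore be linear at 0 too.\<close>

definition holop :: "complex set \<Rightarrow> (complex \<Rightarrow> (complex^'n::finite) endo) \<Rightarrow> bool" where
  "holop S G \<longleftrightarrow> (\<forall>z. clin (G z)) \<and> (\<forall>j. hvec S (\<lambda>z. G z \<rhd> axis j 1))"

lemma hvec_const [intro!, simp]: "hvec S (\<lambda>_. v)" by (simp add: hvec_def)
lemma hvec_add: "hvec S v \<Longrightarrow> hvec S w \<Longrightarrow> hvec S (\<lambda>z. v z + w z)"
  by (simp add: hvec_def holomorphic_intros)
lemma hvec_diff: "hvec S v \<Longrightarrow> hvec S w \<Longrightarrow> hvec S (\<lambda>z. v z - w z)"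
  by (simp add: hvec_def holomorphic_intros)
lemma hvec_minus: "hvec S v \<Longrightarrow> hvec S (\<lambda>z. - v z)"
  by (simp add: hvec_def holomorphic_intros)
lemma hvec_scale: "f holomorphic_on S \<Longrightarrow> hvec S w \<Longrightarrow> hvec S (\<lambda>z. f z *s w z)"
  by (simp add: hvec_def holomorphic_intros)
lemma hvec_sum: "(\<And>i. i \<in> I \<Longrightarrow> hvec S (v i)) \<Longrightarrow> hvec S (\<lambda>z. \<Sum>i\<in>I. v i z)"
  by (simp add: hvec_def holomorphic_intros)
lemma hvec_subset: "hvec S v \<Longrightarrow> T \<subseteq> S \<Longrightarrow> hvec T v"
  unfolding hvec_def using holomorphic_on_subset by blast
lemma hvec_compose: "hvec S v \<Longrightarrow> f holomorphic_on T \<Longrightarrow> f ` T \<subseteq> S \<Longrightarrow> hvec T (\<lambda>z. v (f z))"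
  unfolding hvec_def using holomorphic_on_compose_gen[of f T _ S] by (auto simp: comp_def)
lemma hvec_cong: "(\<And>z. z \<in> S \<Longrightarrow> v z = w z) \<Longrightarrow> hvec S v \<longleftrightarrow> hvec S w"
  unfolding hvec_def by (auto cong: holomorphic_cong)

lemma holopI: "(\<And>z. clin (G z)) \<Longrightarrow> (\<And>v. hvec S (\<lambda>z. G z \<rhd> v)) \<Longrightarrow> holop S G"
  by (simp add: holop_def)
lemma holop_clin: "holop S G \<Longrightarrow> clin (G z)" by (simp add: holop_def)

lemma hvec_ap: assumes "holop S G" "hvec S v" shows "hvec S (\<lambda>z. G z \<rhd> v z)"
proof -
  have "hvec S (\<lambda>z. \<Sum>j\<in>UNIV. v z $ j *s (G z \<rhd> axis j 1))"
    using assms by (intro hvec_sum hvec_scale) (auto simp: holop_def hvec_def)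
  then show ?thesis by (simp only: clin_expand[OF holop_clin[OF assms(1)], symmetric])
qed

lemma holop_const [intro]: "clin A \<Longrightarrow> holop S (\<lambda>_. A)"
  by (simp add: holop_def)
lemma holop_mult: assumes "holop S G" "holop S H" shows "holop S (\<lambda>z. G z * H z)"
proof (rule holopI)
  show "clin (G z * H z)" for z by (intro clin_mult assms[THEN holop_clin])
  show "hvec S (\<lambda>z. (G z * H z) \<rhd> v)" for v
    unfolding ap_times by (intro hvec_ap[OF assms(1)] hvec_ap[OF assms(2)] hvec_const)
qed
lemma holop_diff: assumes "holop S G" "holop S H" shows "holop S (\<lambda>z. G z - H z)"
proof (rule holopI)
  show "clin (G z - H z)" for z by (intro clin_diff assms[THEN holop_clin])
  show "hvec S (\<lambda>z. (G z - H z) \<rhd> v)" for v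
    unfolding ap_diff by (intro hvec_diff hvec_ap[OF assms(1)] hvec_ap[OF assms(2)] hvec_const)
qed
lemma holop_scaleR: assumes "holop S G" shows "holop S (\<lambda>z. r *\<^sub>R G z)"
  using assms by (auto simp: holop_def hvec_def intro!: holomorphic_intros)
lemma holop_sum:
  assumes "\<And>i. i \<in> I \<Longrightarrow> holop S (G i)" shows "holop S (\<lambda>z. \<Sum>i\<in>I. G i z)"
proof (rule holopI)
  show "clin (\<Sum>i\<in>I. G i z)" for z by (intro clin_sum assms[THEN holop_clin])
  show "hvec S (\<lambda>z. (\<Sum>i\<in>I. G i z) \<rhd> v)" for v
    unfolding ap_sum by (intro hvec_sum hvec_ap[OF assms] hvec_const)
qed
lemma holop_cop: "f holomorphic_on S \<Longrightarrow> holop S (\<lambda>z. cop (f z))"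
  by (rule holopI) (simp_all add: hvec_scale)
lemma holop_subset: "holop S G \<Longrightarrow> T \<subseteq> S \<Longrightarrow> holop T G"
  unfolding holop_def using hvec_subset by blast
lemma holop_compose: "holop S G \<Longrightarrow> f holomorphic_on T \<Longrightarrow> f ` T \<subseteq> S \<Longrightarrow> holop T (\<lambda>z. G (f z))"
  unfolding holop_def using hvec_compose[of S "\<lambda>z. G z \<rhd> axis j 1" f T for j] by simp
lemma holop_power: "holop S G \<Longrightarrow> holop S (\<lambda>z. G z ^ k)"
  by (induction k) (simp_all add: holop_mult holop_const)
text \<open>Nilpotency makes the exponential a polynomial in \<open>f z\<close>.\<close>

lemma holop_exp_nilpotent:
  assumes "clin A" "A ^ m = 0" "f holomorphic_on S"
  shows "holop S (\<lambda>z. exp (cop (f z) * A))"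
proof -
  have "exp (cop (f z) * A) = (\<Sum>k<m. (cop (f z) * A) ^ k /\<^sub>R fact k)" for z
    by (rule exp_nilpotent) (simp add: cop_mult_power assms)
  moreover have "holop S (\<lambda>z. (cop (f z) * A) ^ k /\<^sub>R fact k)" for k
    by (rule holop_scaleR, rule holop_power, rule holop_mult, rule holop_cop[OF assms(3)], rule holop_const[OF assms(1)])
  then have "holop S (\<lambda>z. \<Sum>k<m. (cop (f z) * A) ^ k /\<^sub>R fact k)"
    by (rule holop_sum)
  ultimately show ?thesis by (simp only:)
qed

lemma holomorphic_cnj_cnj:
  assumes "f holomorphic_on S" "open T" "cnj ` T \<subseteq> S"
  shows "(\<lambda>z. cnj (f (cnj z))) holomorphic_on T"
  using holomorphic_on_compose_cnj_cnj[OF holomorphic_on_subset[OF assms(1,3)] assms(2)]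
  by (simp add: comp_def)

section \<open>Additive splitting on the punctured plane\<close>

lemma contour_integral_circles_eq:
  assumes f: "f holomorphic_on S" and "open S" "0 < r" "r \<le> R"
    and S: "\<And>w. r \<le> norm w \<Longrightarrow> norm w \<le> R \<Longrightarrow> w \<in> S"
  shows "contour_integral (circlepath 0 R) f = contour_integral (circlepath 0 r) f"
proof (rule Cauchy_theorem_homotopic_loops[OF _ \<open>open S\<close> f])
  show "homotopic_loops S (circlepath 0 R) (circlepath 0 r)"
  proof (rule homotopic_loops_linear)
    fix t :: real
    define e where "e = exp (2 * of_real pi * \<i> * of_real t)"
    have e: "norm e = 1" by (simp add: e_def norm_exp_eq_Re)
    show "closed_segment (circlepath 0 R t) (circlepath 0 r t) \<subseteq> S"
    proof
      fix w assume "w \<in> closed_segment (circlepath 0 R t) (circlepath 0 r t)"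
      then obtain u where u: "0 \<le> u" "u \<le> 1"
        "w = (1 - u) *\<^sub>R circlepath 0 R t + u *\<^sub>R circlepath 0 r t"
        by (auto simp: in_segment)
      have w: "w = of_real ((1 - u) * R + u * r) * e"
        by (simp add: u(3) circlepath e_def scaleR_conv_of_real algebra_simps)
      have "(1 - u) * r \<le> (1 - u) * R" "u * r \<le> u * R" using u assms by (auto intro: mult_left_mono)
      then have "r \<le> (1 - u) * R + u * r" "(1 - u) * R + u * r \<le> R" by (simp_all add: algebra_simps)
      moreover have "norm w = \<bar>(1 - u) * R + u * r\<bar>"
        unfolding w norm_mult e norm_of_real by simp
      ultimately have "r \<le> norm w" "norm w \<le> R" using assms(3) by simp_all
      then show "w \<in> S" by (rule S)
    qed
  qed auto
qed auto

text \<open>The difference quotient \<open>h\<close> of \<open>u\<close> at \<open>z\<close> has a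
  removable singularity, so its integrals over the two circles agree. They differ from those of u w
  / (w - z) by the integral of the constant numerator \<open>u z\<close>, which is 2 pi i
  \<open>u z\<close> on the outer circle and 0 on the inner one.\<close>

lemma annulus_formula:
  assumes u: "u holomorphic_on -{0}" and r: "0 < r" "r < norm z" "norm z < R"
  shows "contour_integral (circlepath 0 R) (\<lambda>w. u w / (w - z))
       - contour_integral (circlepath 0 r) (\<lambda>w. u w / (w - z)) = 2 * of_real pi * \<i> * u z"
proof -
  define h where "h w = (if w = z then deriv u z else u w / (w - z) - u z / (w - z))" for w
  have z: "z \<noteq> 0" using r by auto
  have h: "h holomorphic_on -{0}"
    unfolding h_def
    by (rule pole_theorem[OF u]) (use z in \<open>auto simp: interior_open[OF open_Compl]\<close>)
  have intu: "(\<lambda>w. u w / (w - z)) contour_integrable_on circlepath 0 \<rho>" if "\<rho> > 0" "\<rho> \<noteq> norm z" for \<rho>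
    by (intro contour_integrable_continuous_circlepath continuous_intros
        continuous_on_subset[OF holomorphic_on_imp_continuous_on[OF u]]) (use that in auto)
  have R1: "((\<lambda>w. u z / (w - z)) has_contour_integral (2 * of_real pi * \<i> * u z)) (circlepath 0 R)"
    by (rule Cauchy_integral_circlepath_simple) (use r in auto)
  have "(\<lambda>w. u z / (w - z)) holomorphic_on ball 0 (norm z)"
    by (intro holomorphic_intros) auto
  then have r1: "((\<lambda>w. u z / (w - z)) has_contour_integral 0) (circlepath 0 r)"
    by (rule Cauchy_theorem_disc_simple) (use r in auto)
  have hint: "contour_integral (circlepath 0 \<rho>) h
        = contour_integral (circlepath 0 \<rho>) (\<lambda>w. u w / (w - z)) - y"
    if "\<rho> > 0" "\<rho> \<noteq> norm z" "((\<lambda>w. u z / (w - z)) has_contour_integral y) (circlepath 0 \<rho>)" for \<rho> y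
  proof -
    have "((\<lambda>w. u w / (w - z) - u z / (w - z)) has_contour_integral
        (contour_integral (circlepath 0 \<rho>) (\<lambda>w. u w / (w - z)) - y)) (circlepath 0 \<rho>)"
      by (intro has_contour_integral_diff has_contour_integral_integral intu that)
    then have "(h has_contour_integral
        (contour_integral (circlepath 0 \<rho>) (\<lambda>w. u w / (w - z)) - y)) (circlepath 0 \<rho>)"
      by (rule has_contour_integral_eq) (use that in \<open>auto simp: h_def\<close>)
    then show ?thesis by (rule contour_integral_unique)
  qed
  have "contour_integral (circlepath 0 R) h = contour_integral (circlepath 0 r) h"
    by (rule contour_integral_circles_eq[OF h]) (use r in auto)
  then show ?thesis
    using hint[OF _ _ R1] hint[OF _ _ r1] r by (simp add: algebra_simps)
qed

text \<open>The equation shows that the entire function \<open>a\<close> tends to 0 at infinity, so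
  Liouville's theorem applies. This leaves \<open>c 0\<close>, which follows by continuity.\<close>

lemma split_uniqueness:
  assumes a: "a holomorphic_on UNIV" and c: "c holomorphic_on UNIV"
    and eq: "\<And>z. z \<noteq> 0 \<Longrightarrow> a z + c (1 / z) / z = (0::complex)"
  shows "a z = 0" "c z = 0"
proof -
  have "((\<lambda>z. c (1 / z)) \<longlongrightarrow> c 0) at_infinity"
  proof -
    have "isCont c 0" using holomorphic_on_imp_continuous_on[OF c] by (simp add: continuous_on_eq_continuous_at)
    moreover have "((\<lambda>z::complex. 1 / z) \<longlongrightarrow> 0) at_infinity"
      using tendsto_inverse_0 by (simp add: inverse_eq_divide[symmetric])
    ultimately show ?thesis by (rule isCont_tendsto_compose)
  qed
  moreover have "((\<lambda>z::complex. 1 / z) \<longlongrightarrow> 0) at_infinity"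
    using tendsto_inverse_0 by (simp add: inverse_eq_divide[symmetric])
  ultimately have "((\<lambda>z. - (c (1 / z) * (1 / z))) \<longlongrightarrow> - (c 0 * 0)) at_infinity"
    by (intro tendsto_intros)
  moreover have "\<forall>\<^sub>F z in at_infinity. - (c (1 / z) * (1 / z)) = a z"
    using eventually_not_equal_at_infinity[of 0]
    by eventually_elim (use eq in \<open>force simp: add_eq_0_iff2\<close>)
  ultimately have "(a \<longlongrightarrow> 0) at_infinity"
    by (simp add: filterlim_cong)
  then have a0: "a w = 0" for w by (rule Liouville_weak_0[OF a])
  then show "a z = 0" .
  have cz: "c w = 0" if "w \<noteq> 0" for w using eq[of "1 / w"] that a0 by simp
  show "c z = 0"
  proof (cases "z = 0")
    case True
    have "isCont c 0" using holomorphic_on_imp_continuous_on[OF c] by (simp add: continuous_on_eq_continuous_at)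
    then have "(c \<longlongrightarrow> c 0) (at 0)" by (simp add: isCont_def)
    moreover have "(c \<longlongrightarrow> 0) (at 0)"
      by (rule tendsto_eventually) (auto simp: eventually_at cz intro!: exI[of _ 1])
    ultimately show ?thesis using True tendsto_unique[OF at_neq_bot] by metis
  qed (rule cz)
qed

text \<open>The Laurent splitting: \<open>a\<close> is the Cauchy integral over a large circle and
  \<open>c\<close> carries the principal part. The last clause bounds the principal part by the
  values of \<open>u\<close> on one small circle: for norm z at least 2 r the inner Cauchy integral
  is at most m r / (norm z - r), hence at most 2 r m / norm z.\<close>

lemma split_exists:
  assumes u: "u holomorphic_on -{0::complex}"
  obtains a c where "a holomorphic_on UNIV" "c holomorphic_on UNIV"
    "\<And>z. z \<noteq> 0 \<Longrightarrow> u z = a z + c (1 / z) / z"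
    "\<And>m z r. \<lbrakk>0 < r; 2 * r \<le> norm z; \<And>w. norm w = r \<Longrightarrow> norm (u w) \<le> m\<rbrakk> \<Longrightarrow> norm (c (1 / z)) \<le> 2 * r * m"
proof -
  define I where "I R z = contour_integral (circlepath 0 R) (\<lambda>w. u w / (w - z)) / (2 * of_real pi * \<i>)" for R z
  \<comment> \<open>The radius varies with \<open>z\<close>, but by \<open>I_eq\<close> any radius
    beyond norm z gives the same value; on a fixed ball one radius can be used, which is what
    holomorphy needs.\<close>
  define a where "a z = I (norm z + 1) z" for z
  have pi: "2 * of_real pi * \<i> \<noteq> (0::complex)" by simp
  have u_cont: "continuous_on (-{0}) u" using u by (rule holomorphic_on_imp_continuous_on)
  have intu: "(\<lambda>w. u w / (w - z)) contour_integrable_on circlepath 0 \<rho>" if "\<rho> > 0" "\<rho> \<noteq> norm z" for \<rho> z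
    by (intro contour_integrable_continuous_circlepath continuous_intros
        continuous_on_subset[OF u_cont]) (use that in auto)
  have I_eq: "I R z = I R' z" if "norm z < R" "R \<le> R'" for z R R'
  proof -
    have "contour_integral (circlepath 0 R') (\<lambda>w. u w / (w - z)) = contour_integral (circlepath 0 R) (\<lambda>w. u w / (w - z))"
    proof (rule contour_integral_circles_eq)
      show "(\<lambda>w. u w / (w - z)) holomorphic_on (-{0} - {z})"
        by (intro holomorphic_intros holomorphic_on_subset[OF u]) auto
      show "0 < R" using that norm_ge_zero[of z] by linarith
      then show "w \<in> - {0} - {z}" if "R \<le> norm w" "norm w \<le> R'" for w
        using that \<open>norm z < R\<close> by auto
    qed (use that in auto)
    then show ?thesis by (simp add: I_def)
  qed
  have I_hol: "I R holomorphic_on ball 0 R" if "R > 0" for R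
  proof -
    have D: "((\<lambda>z. contour_integral (circlepath 0 R) (\<lambda>w. u w / (w - z))) has_field_derivative
        (of_nat 1 * contour_integral (circlepath 0 R) (\<lambda>w. u w / (w - z) ^ Suc 1))) (at z)" if "z \<in> ball 0 R" for z
    proof (rule Cauchy_next_derivative_circlepath(2))
      show "continuous_on (path_image (circlepath 0 R)) u"
        by (rule continuous_on_subset[OF u_cont]) (use \<open>R > 0\<close> in auto)
      show "((\<lambda>w. u w / (w - x) ^ 1) has_contour_integral
        contour_integral (circlepath 0 R) (\<lambda>w. u w / (w - x))) (circlepath 0 R)" if "x \<in> ball 0 R" for x
        using has_contour_integral_integral[OF intu[of R x]] that \<open>R > 0\<close> by simp
    qed (use that in auto)
    have "(\<lambda>z. contour_integral (circlepath 0 R) (\<lambda>w. u w / (w - z))) holomorphic_on ball 0 R"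
      unfolding holomorphic_on_open[OF open_ball] by (intro ballI exI, rule D)
    then show ?thesis
      unfolding I_def by (intro holomorphic_intros) auto
  qed
  have a_eq: "a z = I R z" if "norm z < R" for z R
  proof (cases "R \<le> norm z + 1")
    case True
    from I_eq[OF that True] show ?thesis by (simp add: a_def)
  next
    case False
    then show ?thesis using I_eq[of z "norm z + 1" R] by (simp add: a_def)
  qed
  have a: "a holomorphic_on UNIV"
  proof -
    have "a field_differentiable (at z)" for z
    proof -
      have "a holomorphic_on ball 0 (norm z + 1)"
        using I_hol[of "norm z + 1"]
        by (subst holomorphic_cong[OF refl, of _ _ "I (norm z + 1)"])
          (simp_all add: add_nonneg_pos a_eq[of _ "norm z + 1"])
      then show ?thesis
        by (rule holomorphic_on_imp_differentiable_at) auto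
    qed
    then show ?thesis by (simp add: holomorphic_on_def)
  qed
  have p_eq: "u z - a z = - I r z" if "0 < r" "r < norm z" for r z
    using annulus_formula[OF u that, of "norm z + 1"] pi
    by (simp add: a_def I_def field_simps)
  have p_bound: "norm (u z - a z) * norm z \<le> 2 * r * m"
    if "0 < r" "2 * r \<le> norm z" "\<And>w. norm w = r \<Longrightarrow> norm (u w) \<le> m" for m z r
  proof -
    have r: "r < norm z" using that(1,2) by simp
    have m: "0 \<le> m" using that(3)[of "of_real r"] that(1) norm_ge_zero order_trans by (metis norm_of_real abs_of_pos)
    have "norm (contour_integral (circlepath 0 r) (\<lambda>w. u w / (w - z))) \<le> m / (norm z - r) * (2 * pi * r)"
    proof (rule has_contour_integral_bound_circlepath)
      show "((\<lambda>w. u w / (w - z)) has_contour_integral contour_integral (circlepath 0 r) (\<lambda>w. u w / (w - z))) (circlepath 0 r)"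
        by (rule has_contour_integral_integral, rule intu) (use that(1) r in auto)
      show "norm (u w / (w - z)) \<le> m / (norm z - r)" if "norm (w - 0) = r" for w
        using that norm_triangle_ineq2[of z w] r \<open>\<And>w. norm w = r \<Longrightarrow> norm (u w) \<le> m\<close>[of w] m
        by (auto simp: norm_divide norm_minus_commute intro!: frac_le)
    qed (use m r that(1) in auto)
    then have "norm (u z - a z) \<le> m * r / (norm z - r)"
      unfolding p_eq[OF that(1) r] using r by (simp add: I_def norm_divide norm_mult field_simps)
    then have "norm (u z - a z) * norm z \<le> m * r * (norm z / (norm z - r))"
      by (metis mult_right_mono norm_ge_zero times_divide_eq_left times_divide_eq_right)
    also have "\<dots> \<le> m * r * 2"
      using that(1,2) m r by (intro mult_left_mono) (auto simp: field_simps)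
    finally show ?thesis by (simp add: mult_ac)
  qed
  \<comment> \<open>The principal part in the coordinate w = 1 / z. The bound on a small circle
    makes its singularity at 0 removable.\<close>
  define c0 where "c0 w = (u (1 / w) - a (1 / w)) / w" for w
  have "c0 holomorphic_on UNIV - {0}"
  proof -
    have inv: "(\<lambda>w::complex. 1 / w) holomorphic_on -{0}" by (intro holomorphic_intros) auto
    have "(\<lambda>w. u (1 / w)) holomorphic_on -{0}"
      using holomorphic_on_compose_gen[OF inv u] by (force simp: comp_def)
    moreover have "(\<lambda>w. a (1 / w)) holomorphic_on -{0}"
      using holomorphic_on_compose_gen[OF inv a] by (simp add: comp_def)
    ultimately show ?thesis
      unfolding c0_def by (intro holomorphic_intros) (auto simp: Compl_eq_Diff_UNIV)
  qed
  moreover obtain M where M: "\<And>w. norm w = 1 \<Longrightarrow> norm (u w) \<le> M"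
  proof -
    have "compact (u ` sphere 0 1)"
      by (intro compact_continuous_image continuous_on_subset[OF u_cont]) auto
    then obtain a where "\<forall>x\<in>sphere 0 1. norm (u x) \<le> a"
      by (auto dest!: compact_imp_bounded simp: bounded_iff)
    then show ?thesis using that[of a] by simp
  qed
  have c0_bound: "norm (c0 (1 / z)) \<le> 2 * r * m"
    if "0 < r" "2 * r \<le> norm z" "\<And>w. norm w = r \<Longrightarrow> norm (u w) \<le> m" for m z r
    using p_bound[OF that] by (simp add: c0_def norm_mult)
  have "\<forall>\<^sub>F w in at 0. norm (c0 w) \<le> 2 * M"
  proof -
    have "norm (c0 w) \<le> 2 * M" if "w \<noteq> 0" "norm w < 1 / 2" for w
    proof -
      have "2 * 1 \<le> norm (1 / w)" using that by (simp add: norm_divide field_simps)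
      from c0_bound[OF _ this M] show ?thesis using that by simp
    qed
    then show ?thesis unfolding eventually_at by (intro exI[of _ "1/2"]) (simp add: dist_norm)
  qed
  ultimately have "\<exists>c. c holomorphic_on UNIV \<and> (\<forall>w\<in>UNIV - {0}. c w = c0 w)"
    by (subst holomorphic_on_extend_bounded) auto
  then obtain c where c: "c holomorphic_on UNIV" "\<And>w. w \<noteq> 0 \<Longrightarrow> c w = c0 w"
    by auto
  show ?thesis
  proof (rule that[OF a c(1)])
    show "u z = a z + c (1 / z) / z" if "z \<noteq> 0" for z
      using that c(2)[of "1 / z"] by (simp add: c0_def)
    show "norm (c (1 / z)) \<le> 2 * r * m"
      if "0 < r" "2 * r \<le> norm z" "\<And>w. norm w = r \<Longrightarrow> norm (u w) \<le> m" for m z r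
    proof -
      have "z \<noteq> 0" using that(1,2) by auto
      then show ?thesis using c0_bound[OF that] c(2)[of "1 / z"] by simp
    qed
  qed
qed

lemma maximum_modulus_cball:
  assumes "f holomorphic_on UNIV" "\<And>z. norm z = r \<Longrightarrow> norm (f z) \<le> B" "norm z \<le> r" "0 < r"
  shows "norm (f z) \<le> (B::real)"
proof (rule maximum_modulus_frontier[of f "cball 0 r"])
  show "continuous_on (closure (cball 0 r)) f"
    using continuous_on_subset[OF holomorphic_on_imp_continuous_on[OF assms(1)]] by blast
qed (use assms holomorphic_on_subset in \<open>auto simp: frontier_cball\<close>)

text \<open>The circle of radius 1/4 controls the principal part for norm z at least 1/2. On the
  circle of radius 2 the entire part is the difference of \<open>u\<close> and the principal part,
  so it is controlled there as well. The maximum principle carries both bounds into the disc of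
  radius 2.\<close>

lemma split_inner_bound:
  assumes u: "u holomorphic_on -{0::complex}"
    and m: "\<And>w. norm w = 1/4 \<Longrightarrow> norm (u w) \<le> m" "\<And>w. norm w = 2 \<Longrightarrow> norm (u w) \<le> m"
  obtains a c where "a holomorphic_on UNIV" "c holomorphic_on UNIV"
    "\<And>z. z \<noteq> 0 \<Longrightarrow> u z = a z + c (1 / z) / z"
    "\<And>z. norm z \<le> 2 \<Longrightarrow> norm (a z) \<le> 2 * m" "\<And>z. norm z \<le> 2 \<Longrightarrow> norm (c z) \<le> m"
proof -
  obtain a c where a: "a holomorphic_on UNIV" and c: "c holomorphic_on UNIV"
    and eq: "\<And>z. z \<noteq> 0 \<Longrightarrow> u z = a z + c (1 / z) / z"
    and b: "\<And>m z r. \<lbrakk>0 < r; 2 * r \<le> norm z; \<And>w. norm w = r \<Longrightarrow> norm (u w) \<le> m\<rbrakk> \<Longrightarrow> norm (c (1 / z)) \<le> 2 * r * m"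
    using split_exists[OF u] by blast
  have m0: "0 \<le> m" using order_trans[OF norm_ge_zero m(2)[of 2]] by simp
  have b': "norm (c (1 / z)) \<le> m / 2" if "1/2 \<le> norm z" for z
    using b[of "1/4" z m, OF _ _ m(1)] that by simp
  show ?thesis
  proof (rule that[OF a c eq])
    show "norm (c z) \<le> m" if "norm z \<le> 2" for z
    proof (rule maximum_modulus_cball[OF c _ that])
      show "norm (c w) \<le> m" if "norm w = 2" for w
        using b'[of "1 / w"] that m0 by (simp add: norm_divide)
    qed simp
    show "norm (a z) \<le> 2 * m" if "norm z \<le> 2" for z
    proof (rule maximum_modulus_cball[OF a _ that])
      fix w :: complex assume w: "norm w = 2"
      then have "w \<noteq> 0" by auto
      have "a w = u w - c (1 / w) / w" using eq[OF \<open>w \<noteq> 0\<close>] by simp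
      then have "norm (a w) \<le> norm (u w) + norm (c (1 / w) / w)"
        by (simp add: norm_triangle_ineq4)
      also have "\<dots> \<le> m + m"
        using m(2)[OF w] b'[of w] w m0 by (simp add: norm_divide)
      finally show "norm (a w) \<le> 2 * m" by simp
    qed simp
  qed
qed

text \<open>In the gluing problem one error term contains \<open>a z\<close>, known for norm z at
  most 2, and the other contains \<open>c (1 / z)\<close>, known for norm z at least 1/2; hence the
  different circles for \<open>u1\<close> and \<open>u2\<close>. The substitution z to 1 / z
  exchanges the two cases. Dividing by w with norm 1/4 costs a factor 4, and m + 2 (4 m) = 9 m is
  rounded up to 10 m.\<close>

lemma split_bound:
  assumes u1: "u1 holomorphic_on -{0::complex}" and u2: "u2 holomorphic_on -{0}"
    and m: "\<And>w. norm w = 1/4 \<Longrightarrow> norm (u1 w) \<le> m" "\<And>w. norm w = 2 \<Longrightarrow> norm (u1 w) \<le> m"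
      "\<And>w. norm w = 4 \<Longrightarrow> norm (u2 w) \<le> m" "\<And>w. norm w = 1/2 \<Longrightarrow> norm (u2 w) \<le> m"
  obtains a c where "a holomorphic_on UNIV" "c holomorphic_on UNIV"
    "\<And>z. z \<noteq> 0 \<Longrightarrow> u1 z + u2 z = a z + c (1 / z) / z"
    "\<And>z. norm z \<le> 2 \<Longrightarrow> norm (a z) \<le> 10 * m" "\<And>z. norm z \<le> 2 \<Longrightarrow> norm (c z) \<le> 10 * m"
proof -
  obtain a1 c1 where 1: "a1 holomorphic_on UNIV" "c1 holomorphic_on UNIV"
    "\<And>z. z \<noteq> 0 \<Longrightarrow> u1 z = a1 z + c1 (1 / z) / z"
    "\<And>z. norm z \<le> 2 \<Longrightarrow> norm (a1 z) \<le> 2 * m" "\<And>z. norm z \<le> 2 \<Longrightarrow> norm (c1 z) \<le> m"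
    using split_inner_bound[OF u1 m(1,2)] by blast
  have m0: "0 \<le> m" using order_trans[OF norm_ge_zero m(2)[of 2]] by simp
  have inv: "(\<lambda>w::complex. 1 / w) holomorphic_on -{0}" by (intro holomorphic_intros) auto
  have "(\<lambda>w. u2 (1 / w)) holomorphic_on -{0}"
    using holomorphic_on_compose_gen[OF inv u2] by (force simp: comp_def)
  then have v: "(\<lambda>w. u2 (1 / w) / w) holomorphic_on -{0}"
    by (intro holomorphic_intros) auto
  have "norm (u2 (1 / w) / w) \<le> 4 * m" if "norm w = 1/4" for w
    using m(3)[of "1 / w"] unfolding norm_divide that by simp
  moreover have "norm (u2 (1 / w) / w) \<le> 4 * m" if "norm w = 2" for w
    using m(4)[of "1 / w"] that m0 by (simp add: norm_divide)
  ultimately obtain a2 c2 where 2: "a2 holomorphic_on UNIV" "c2 holomorphic_on UNIV"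
    "\<And>z. z \<noteq> 0 \<Longrightarrow> u2 (1 / z) / z = a2 z + c2 (1 / z) / z"
    "\<And>z. norm z \<le> 2 \<Longrightarrow> norm (a2 z) \<le> 2 * (4 * m)" "\<And>z. norm z \<le> 2 \<Longrightarrow> norm (c2 z) \<le> 4 * m"
    using split_inner_bound[OF v] by blast
  show ?thesis
  proof (rule that[of "\<lambda>z. a1 z + c2 z" "\<lambda>z. c1 z + a2 z"])
    show "(\<lambda>z. a1 z + c2 z) holomorphic_on UNIV" "(\<lambda>z. c1 z + a2 z) holomorphic_on UNIV"
      by (intro holomorphic_intros 1 2)+
    show "u1 z + u2 z = a1 z + c2 z + (c1 (1 / z) + a2 (1 / z)) / z" if "z \<noteq> 0" for z
      using 1(3)[OF that] 2(3)[of "1 / z"] that by (simp add: field_simps)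
    show "norm (a1 z + c2 z) \<le> 10 * m" "norm (c1 z + a2 z) \<le> 10 * m" if "norm z \<le> 2" for z
      using norm_triangle_ineq[of "a1 z" "c2 z"] norm_triangle_ineq[of "c1 z" "a2 z"]
        1(4,5)[OF that] 2(4,5)[OF that] m0 by linarith+
  qed
qed

lemma norm_cvec_le: "norm (v :: complex^'n::finite) \<le> (\<Sum>i\<in>UNIV. norm (v $ i))"
  unfolding norm_vec_def by (rule L2_set_le_sum) simp

lemma hvec_split_bound:
  fixes u1 u2 :: "complex \<Rightarrow> complex^'n::finite"
  assumes u1: "hvec (-{0}) u1" and u2: "hvec (-{0}) u2"
    and m: "\<And>w. norm w = 1/4 \<Longrightarrow> norm (u1 w) \<le> m" "\<And>w. norm w = 2 \<Longrightarrow> norm (u1 w) \<le> m"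
      "\<And>w. norm w = 4 \<Longrightarrow> norm (u2 w) \<le> m" "\<And>w. norm w = 1/2 \<Longrightarrow> norm (u2 w) \<le> m"
  obtains a c where "hvec UNIV a" "hvec UNIV c"
    "\<And>z. z \<noteq> 0 \<Longrightarrow> u1 z + u2 z = a z + (1 / z) *s c (1 / z)"
    "\<And>z. norm z \<le> 2 \<Longrightarrow> norm (a z) \<le> 10 * real CARD('n) * m"
    "\<And>z. norm z \<le> 2 \<Longrightarrow> norm (c z) \<le> 10 * real CARD('n) * m"
proof -
  have "\<forall>i. \<exists>a c. a holomorphic_on UNIV \<and> c holomorphic_on UNIV \<and>
    (\<forall>z. z \<noteq> 0 \<longrightarrow> u1 z $ i + u2 z $ i = a z + c (1 / z) / z) \<and>
    (\<forall>z. norm z \<le> 2 \<longrightarrow> norm (a z) \<le> 10 * m) \<and> (\<forall>z. norm z \<le> 2 \<longrightarrow> norm (c z) \<le> 10 * m)"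
  proof
    fix i
    have h: "(\<lambda>z. u1 z $ i) holomorphic_on -{0}" "(\<lambda>z. u2 z $ i) holomorphic_on -{0}"
      using u1 u2 by (simp_all add: hvec_def)
    have le: "norm (v $ i) \<le> m" if "norm v \<le> m" for v :: "complex^'n"
      using that Finite_Cartesian_Product.norm_nth_le order_trans by blast
    show "\<exists>a c. a holomorphic_on UNIV \<and> c holomorphic_on UNIV \<and>
      (\<forall>z. z \<noteq> 0 \<longrightarrow> u1 z $ i + u2 z $ i = a z + c (1 / z) / z) \<and>
      (\<forall>z. norm z \<le> 2 \<longrightarrow> norm (a z) \<le> 10 * m) \<and> (\<forall>z. norm z \<le> 2 \<longrightarrow> norm (c z) \<le> 10 * m)"
      by (rule split_bound[OF h le[OF m(1)] le[OF m(2)] le[OF m(3)] le[OF m(4)]]) blast+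
  qed
  then obtain A C where AC: "\<And>i. A i holomorphic_on UNIV" "\<And>i. C i holomorphic_on UNIV"
    "\<And>i z. z \<noteq> 0 \<Longrightarrow> u1 z $ i + u2 z $ i = A i z + C i (1 / z) / z"
    "\<And>i z. norm z \<le> 2 \<Longrightarrow> norm (A i z) \<le> 10 * m" "\<And>i z. norm z \<le> 2 \<Longrightarrow> norm (C i z) \<le> 10 * m"
    by metis
  have nle: "norm (\<chi> i. F i :: complex^'n) \<le> 10 * real CARD('n) * m" if "\<And>i. norm (F i) \<le> 10 * m" for F
  proof -
    have "norm (\<chi> i. F i :: complex^'n) \<le> (\<Sum>i\<in>(UNIV::'n set). norm (F i))"
      using norm_cvec_le[of "\<chi> i. F i"] by simp
    also have "\<dots> \<le> (\<Sum>i\<in>(UNIV::'n set). 10 * m)" by (intro sum_mono that)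
    finally show ?thesis by simp
  qed
  show ?thesis
  proof (rule that[of "\<lambda>z. \<chi> i. A i z" "\<lambda>z. \<chi> i. C i z"])
    show "u1 z + u2 z = (\<chi> i. A i z) + (1 / z) *s (\<chi> i. C i (1 / z))" if "z \<noteq> 0" for z
      using AC(3)[OF that] by (simp add: vec_eq_iff)
  qed (use AC nle in \<open>simp_all add: hvec_def\<close>)
qed

lemma hvec_split_uniqueness:
  assumes "hvec UNIV a" "hvec UNIV c" "\<And>z. z \<noteq> 0 \<Longrightarrow> a z + (1 / z) *s c (1 / z) = 0"
  shows "a z = 0" "c z = 0"
proof -
  have "a z $ i = 0 \<and> c z $ i = 0" for i
    using split_uniqueness[of "\<lambda>z. a z $ i" "\<lambda>z. c z $ i" z] assms
    by (simp add: hvec_def vec_eq_iff)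
  then show "a z = 0" "c z = 0" by (simp_all add: vec_eq_iff)
qed

text \<open>Because the splitting is unique, its bounds hold for any splitting that is given in
  advance.\<close>

lemma hvec_split_bound_unique:
  fixes u1 u2 :: "complex \<Rightarrow> complex^'n::finite"
  assumes "hvec (-{0}) u1" "hvec (-{0}) u2"
    and "\<And>w. norm w = 1/4 \<Longrightarrow> norm (u1 w) \<le> m" "\<And>w. norm w = 2 \<Longrightarrow> norm (u1 w) \<le> m"
      "\<And>w. norm w = 4 \<Longrightarrow> norm (u2 w) \<le> m" "\<And>w. norm w = 1/2 \<Longrightarrow> norm (u2 w) \<le> m"
    and a: "hvec UNIV a" and c: "hvec UNIV c"
    and eq: "\<And>z. z \<noteq> 0 \<Longrightarrow> u1 z + u2 z = a z + (1 / z) *s c (1 / z)"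
    and z: "norm z \<le> 2"
  shows "norm (a z) \<le> 10 * real CARD('n) * m" "norm (c z) \<le> 10 * real CARD('n) * m"
proof -
  obtain a' c' where ac: "hvec UNIV a'" "hvec UNIV c'"
    "\<And>z. z \<noteq> 0 \<Longrightarrow> u1 z + u2 z = a' z + (1 / z) *s c' (1 / z)"
    "\<And>z. norm z \<le> 2 \<Longrightarrow> norm (a' z) \<le> 10 * real CARD('n) * m"
    "\<And>z. norm z \<le> 2 \<Longrightarrow> norm (c' z) \<le> 10 * real CARD('n) * m"
    using hvec_split_bound[OF assms(1-6)] by blast
  have "(a z - a' z) + (1 / z) *s (c (1 / z) - c' (1 / z)) = 0" if "z \<noteq> 0" for z
    using eq[OF that] ac(3)[OF that] by (simp add: vec_eq_iff algebra_simps)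
  from hvec_split_uniqueness[OF hvec_diff[OF a ac(1)] hvec_diff[OF c ac(2)] this, of z]
  show "norm (a z) \<le> 10 * real CARD('n) * m" "norm (c z) \<le> 10 * real CARD('n) * m"
    using ac(4,5)[OF z] by simp_all
qed

lemma hvec_continuous: "hvec S v \<Longrightarrow> continuous_on S v"
  unfolding hvec_def
  using continuous_on_vec_lambda[of S "\<lambda>i z. v z $ i"] by (simp add: holomorphic_on_imp_continuous_on)

lemma hvec_bounded:
  assumes "hvec S v" "K \<subseteq> S" "compact K"
  obtains B where "B \<ge> 0" "\<And>z. z \<in> K \<Longrightarrow> norm (v z) \<le> B"
proof -
  have "compact (v ` K)"
    by (intro compact_continuous_image continuous_on_subset[OF hvec_continuous[OF assms(1)]] assms)
  then obtain B where "\<forall>z\<in>K. norm (v z) \<le> B"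
    by (auto dest!: compact_imp_bounded simp: bounded_iff)
  then show ?thesis using that[of "max B 0"] by (auto simp: le_max_iff_disj)
qed

lemma hvec_uniform_limit:
  assumes "\<And>n. hvec UNIV (f n)" "\<And>n z. z \<in> cball 0 r \<Longrightarrow> norm (f n z) \<le> M n" "summable M"
  shows "hvec (ball 0 r) (\<lambda>z. \<Sum>n. f n z)"
  unfolding hvec_def
proof
  fix i
  have sum_i: "(\<Sum>n. f n z) $ i = (\<Sum>n. f n z $ i)" if "z \<in> cball 0 r" for z
  proof -
    have "summable (\<lambda>n. f n z)"
      by (rule summable_comparison_test'[OF assms(3)]) (use assms(2) that in auto)
    then show ?thesis
      using bounded_linear.suminf[OF bounded_linear_vec_nth] by metis
  qed
  have "uniform_limit (cball 0 r) (\<lambda>n z. \<Sum>k<n. f k z $ i) (\<lambda>z. \<Sum>n. f n z $ i) sequentially"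
    by (rule Weierstrass_m_test[OF _ assms(3)])
      (meson Finite_Cartesian_Product.norm_nth_le assms(2) order_trans)
  moreover have "\<forall>\<^sub>F n in sequentially. continuous_on (cball 0 r) (\<lambda>z. \<Sum>k<n. f k z $ i) \<and>
      (\<lambda>z. \<Sum>k<n. f k z $ i) holomorphic_on ball 0 r"
  proof (intro always_eventually allI)
    fix n
    have "(\<lambda>z. \<Sum>k<n. f k z $ i) holomorphic_on UNIV"
      using assms(1) by (auto simp: hvec_def intro!: holomorphic_intros)
    then show "continuous_on (cball 0 r) (\<lambda>z. \<Sum>k<n. f k z $ i) \<and>
      (\<lambda>z. \<Sum>k<n. f k z $ i) holomorphic_on ball 0 r"
      using holomorphic_on_imp_continuous_on holomorphic_on_subset continuous_on_subset by blast
  qed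
  ultimately have "(\<lambda>z. \<Sum>n. f n z $ i) holomorphic_on ball 0 r"
    using holomorphic_uniform_limit[where F = sequentially and f = "\<lambda>n z. \<Sum>k<n. f k z $ i"
        and g = "\<lambda>z. \<Sum>n. f n z $ i" and z = 0 and r = r] by auto
  then show "(\<lambda>z. (\<Sum>n. f n z) $ i) holomorphic_on ball 0 r"
    by (rule holomorphic_transform) (simp add: sum_i)
qed

lemma hvec_inverse_arg: "hvec UNIV c \<Longrightarrow> hvec (-{0}) (\<lambda>z. c (1 / z))"
  by (rule hvec_compose) (auto intro!: holomorphic_intros)

lemma hvec_paste:
  assumes "hvec S v" "hvec T w" "open S" "open T" "\<And>z. z \<in> S \<Longrightarrow> z \<in> T \<Longrightarrow> v z = w z"
  shows "hvec (S \<union> T) (\<lambda>z. if z \<in> S then v z else w z)"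
proof -
  have "(\<lambda>z. if z \<in> S then v z $ i else w z $ i) holomorphic_on (S \<union> T)" for i
    using assms by (intro holomorphic_on_If_Un) (auto simp: hvec_def)
  then show ?thesis by (simp add: hvec_def if_distrib[of "\<lambda>v. v $ i" for i])
qed

text \<open>The annulus contains the four circles 1/4, 1/2, 2, 4 on which the splitting is
  estimated. The inverses \<open>H1\<close> and \<open>H2\<close> serve to continue solutions beyond
  the disc of radius 2, with no bound on them. The constant 320 is dictated by
  \<open>gluing_value_at_zero\<close>, where 160 n \<epsilon> must be at most 1/2; the halving in
  \<open>gluing_unique\<close> and \<open>gluing_exists\<close> would be satisfied with
  less.\<close>

locale gluing =
  fixes G1 G2 H1 H2 :: "complex \<Rightarrow> (complex^'n::finite) endo" and \<epsilon> :: real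
  assumes holo: "holop (-{0}) G1" "holop (-{0}) G2" "holop (-{0}) H1" "holop (-{0}) H2"
    and inverses: "\<And>z. z \<noteq> 0 \<Longrightarrow> H1 z * G1 z = 1" "\<And>z. z \<noteq> 0 \<Longrightarrow> G1 z * H1 z = 1"
      "\<And>z. z \<noteq> 0 \<Longrightarrow> H2 z * G2 z = 1" "\<And>z. z \<noteq> 0 \<Longrightarrow> G2 z * H2 z = 1"
    and near: "\<And>z. 1/4 \<le> norm z \<Longrightarrow> norm z \<le> 4 \<Longrightarrow> norm (G1 z - 1) \<le> \<epsilon>"
      "\<And>z. 1/4 \<le> norm z \<Longrightarrow> norm z \<le> 4 \<Longrightarrow> norm (G2 z - 1) \<le> \<epsilon>"
    and small: "320 * real CARD('n) * \<epsilon> \<le> 1"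
begin

lemma eps_nonneg: "0 \<le> \<epsilon>"
  using order_trans[OF norm_ge_zero near(1)[of 1]] by simp

text \<open>The factor 2 is the size of 1 / w on the circle of radius 1/2; all other cases are
  better.\<close>

lemma remainder_bounds:
  assumes "\<And>z. norm z \<le> 2 \<Longrightarrow> norm (a z) \<le> B" "\<And>z. norm z \<le> 2 \<Longrightarrow> norm (c z) \<le> B"
  shows "norm w = 1/4 \<Longrightarrow> norm ((1 - G1 w) \<rhd> a w) \<le> 2 * \<epsilon> * B"
    "norm w = 2 \<Longrightarrow> norm ((1 - G1 w) \<rhd> a w) \<le> 2 * \<epsilon> * B"
    "norm w = 4 \<Longrightarrow> norm ((1 / w) *s ((1 - G2 w) \<rhd> c (1 / w))) \<le> 2 * \<epsilon> * B"
    "norm w = 1/2 \<Longrightarrow> norm ((1 / w) *s ((1 - G2 w) \<rhd> c (1 / w))) \<le> 2 * \<epsilon> * B"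
proof -
  have B: "0 \<le> B" using order_trans[OF norm_ge_zero assms(1)[of 0]] by simp
  have eB: "0 \<le> \<epsilon> * B" using B eps_nonneg by simp
  have 1: "norm ((1 - G1 w) \<rhd> a w) \<le> \<epsilon> * B" if "1/4 \<le> norm w" "norm w \<le> 2"
    using norm_ap[of "1 - G1 w" "a w"] near(1)[of w] assms(1)[of w] that eps_nonneg
      mult_mono[of "norm (1 - G1 w)" \<epsilon> "norm (a w)" B] by (simp add: norm_minus_commute)
  have 2: "norm ((1 - G2 w) \<rhd> c (1 / w)) \<le> \<epsilon> * B" if "1/2 \<le> norm w" "norm w \<le> 4"
  proof -
    have "0 < norm w" using that by linarith
    then have "norm (1 / w) \<le> 2" using that by (simp add: norm_divide field_simps)
    then show ?thesis
      using norm_ap[of "1 - G2 w" "c (1 / w)"] near(2)[of w] assms(2)[of "1 / w"] that eps_nonneg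
        mult_mono[of "norm (1 - G2 w)" \<epsilon> "norm (c (1 / w))" B] by (simp add: norm_minus_commute)
  qed
  show "norm w = 1/4 \<Longrightarrow> norm ((1 - G1 w) \<rhd> a w) \<le> 2 * \<epsilon> * B"
    "norm w = 2 \<Longrightarrow> norm ((1 - G1 w) \<rhd> a w) \<le> 2 * \<epsilon> * B"
    using 1 eB by linarith+
  show "norm ((1 / w) *s ((1 - G2 w) \<rhd> c (1 / w))) \<le> 2 * \<epsilon> * B" if w: "norm w = 4"
    unfolding norm_cvec_scale norm_divide w using 2 w eB by simp
  show "norm ((1 / w) *s ((1 - G2 w) \<rhd> c (1 / w))) \<le> 2 * \<epsilon> * B" if w: "norm w = 1/2"
    unfolding norm_cvec_scale norm_divide w using 2 w eB by simp
qed

lemma remainder_small: "20 * real CARD('n) * (2 * \<epsilon> * B) \<le> B / 2" if "0 \<le> B"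
proof -
  have "(320 * real CARD('n) * \<epsilon>) * B \<le> 1 * B" using small that by (rule mult_right_mono)
  then show ?thesis using that by simp
qed

lemma hvec_remainders:
  assumes "hvec UNIV a" "hvec UNIV c"
  shows "hvec (-{0}) (\<lambda>z. (1 - G1 z) \<rhd> a z)"
    "hvec (-{0}) (\<lambda>z. (1 / z) *s ((1 - G2 z) \<rhd> c (1 / z)))"
proof -
  have "holop (-{0}) (\<lambda>z. 1 - G1 z)" "holop (-{0}) (\<lambda>z. 1 - G2 z)"
    by (intro holop_diff holop_const holo clin_intros)+
  then show "hvec (-{0}) (\<lambda>z. (1 - G1 z) \<rhd> a z)"
    "hvec (-{0}) (\<lambda>z. (1 / z) *s ((1 - G2 z) \<rhd> c (1 / z)))"
    using hvec_subset[OF assms(1)] hvec_inverse_arg[OF assms(2)]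
    by (intro hvec_scale hvec_ap holomorphic_intros; simp)+
qed

text \<open>The equation says that \<open>a\<close> and \<open>c\<close> form the splitting of their
  own error terms, so any common bound on the disc of radius 2 can be halved, and both vanish there.
  For larger \<open>z\<close> the point 1 / z lies in the disc, and invertibility of
  \<open>G1\<close> or \<open>G2\<close> kills the remaining term.\<close>

lemma gluing_unique:
  assumes a: "hvec UNIV a" and c: "hvec UNIV c"
    and eq: "\<And>z. z \<noteq> 0 \<Longrightarrow> G1 z \<rhd> a z + (1 / z) *s (G2 z \<rhd> c (1 / z)) = 0"
  shows "a z = 0" "c z = 0"
proof -
  obtain A C where A: "\<And>z. z \<in> cball 0 2 \<Longrightarrow> norm (a z) \<le> A" and C: "\<And>z. z \<in> cball 0 2 \<Longrightarrow> norm (c z) \<le> C"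
    using hvec_bounded[OF a, of "cball 0 2"] hvec_bounded[OF c, of "cball 0 2"] by (metis compact_cball subset_UNIV)
  have bound: "norm (a z) \<le> max A C / 2 ^ k \<and> norm (c z) \<le> max A C / 2 ^ k" if "norm z \<le> 2" for k z
    using that
  proof (induction k arbitrary: z)
    case 0
    then show ?case using A C by (auto simp: le_max_iff_disj)
  next
    case (Suc k)
    define B where "B = max A C / 2 ^ k"
    have B: "norm (a z) \<le> B" "norm (c z) \<le> B" if "norm z \<le> 2" for z
      using Suc.IH[OF that] by (simp_all add: B_def)
    have B0: "0 \<le> B" using order_trans[OF norm_ge_zero B(1)[of 0]] by simp
    have eq': "(1 - G1 z) \<rhd> a z + (1 / z) *s ((1 - G2 z) \<rhd> c (1 / z)) = a z + (1 / z) *s c (1 / z)"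
      if "z \<noteq> 0" for z
      using eq[OF that] by (simp add: vec_eq_iff algebra_simps)
    note split = hvec_split_bound_unique[OF hvec_remainders[OF a c]
        remainder_bounds[of a B c, OF B] a c eq' Suc.prems]
    have "norm (a z) \<le> B / 2" "norm (c z) \<le> B / 2"
      using split remainder_small[OF B0] B0 by linarith+
    then show ?case by (simp add: B_def mult.commute)
  qed
  have zero: "v = 0" if "\<And>k. norm v \<le> max A C / 2 ^ k" for v :: "complex^'n"
  proof -
    have "(\<lambda>k. max A C * (1/2) ^ k) \<longlonglongrightarrow> max A C * 0"
      by (intro tendsto_intros LIMSEQ_power_zero) auto
    then have "(\<lambda>k. max A C / 2 ^ k) \<longlonglongrightarrow> 0" by (simp add: power_divide)
    then have "norm v \<le> 0" by (rule LIMSEQ_le_const) (use that in auto)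
    then show ?thesis by simp
  qed
  have a0: "a z = 0" and c0: "c z = 0" if "norm z \<le> 2" for z
    using zero bound[OF that] by blast+
  show "a z = 0"
  proof (cases "norm z \<le> 2")
    case False
    then have "z \<noteq> 0" by auto
    have "1 / norm z \<le> 1 / 1" using False by (intro divide_left_mono) auto
    then have "norm (1 / z) \<le> 2" by (simp add: norm_divide)
    then have "G1 z \<rhd> a z = 0" using eq[of z] c0[of "1 / z"] \<open>z \<noteq> 0\<close> by (simp add: ap.zero_right)
    then have "(H1 z * G1 z) \<rhd> a z = 0" by (simp add: ap.zero_right)
    then show ?thesis using inverses(1)[OF \<open>z \<noteq> 0\<close>] by simp
  qed (rule a0)
  show "c z = 0"
  proof (cases "norm z \<le> 2")
    case False
    then have "z \<noteq> 0" by auto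
    have "1 / norm z \<le> 1 / 1" using False by (intro divide_left_mono) auto
    then have "norm (1 / z) \<le> 2" by (simp add: norm_divide)
    with \<open>z \<noteq> 0\<close> have z: "z \<noteq> 0" "norm (1 / z) \<le> 2" by auto
    then have "G2 (1 / z) \<rhd> c z = 0" using eq[of "1 / z"] a0[of "1 / z"] by (simp add: ap.zero_right)
    then have "(H2 (1 / z) * G2 (1 / z)) \<rhd> c z = 0" by (simp add: ap.zero_right)
    then show ?thesis using inverses(3)[of "1 / z"] z by simp
  qed (rule c0)
qed

text \<open>Splitting \<open>g\<close> additively solves the equation with \<open>1\<close> in place of \<open>G1\<close> and \<open>G2\<close>. The error is split
  again, and its bounds halve in each round; the solution is the sum of the resulting series.\<close>

lemma gluing_exists:
  assumes g: "hvec (-{0}) g"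
  obtains a c where "hvec UNIV a" "hvec UNIV c"
    "\<And>z. z \<noteq> 0 \<Longrightarrow> G1 z \<rhd> a z + (1 / z) *s (G2 z \<rhd> c (1 / z)) = g z"
proof -
  have zero: "hvec (-{0}) (\<lambda>_. 0 :: complex^'n)" by simp
  obtain M where M: "\<And>w. w \<in> cball 0 4 - ball 0 (1/4) \<Longrightarrow> norm (g w) \<le> M"
  proof (rule hvec_bounded[OF g])
    show "cball 0 4 - ball 0 (1/4) \<subseteq> - {0::complex}" by auto
    show "compact (cball 0 4 - ball (0::complex) (1/4))" by (intro compact_diff) auto
  qed blast
  have M0: "0 \<le> M" using order_trans[OF norm_ge_zero M[of 1]] by (simp add: dist_norm)
  define K where "K = 10 * real CARD('n) * M"
  have "norm (g w) \<le> M" if "norm w = 1/4 \<or> norm w = 2" for w using M[of w] that by auto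
  then obtain a0 c0 where 0: "hvec UNIV a0" "hvec UNIV c0"
    "\<And>z. z \<noteq> 0 \<Longrightarrow> g z + 0 = a0 z + (1 / z) *s c0 (1 / z)"
    "\<And>z. norm z \<le> 2 \<Longrightarrow> norm (a0 z) \<le> K" "\<And>z. norm z \<le> 2 \<Longrightarrow> norm (c0 z) \<le> K"
    using hvec_split_bound[OF g zero, of M] M0 unfolding K_def by auto
  \<comment> \<open>The clause for \<open>n = 0\<close> pins down the first member of the sequence,
    which dependent choice would otherwise leave free among all pairs with the right bounds.\<close>
  define P where "P n p \<longleftrightarrow> hvec UNIV (fst p) \<and> hvec UNIV (snd p) \<and>
      (\<forall>z. norm z \<le> 2 \<longrightarrow> norm (fst p z) \<le> K / 2 ^ n \<and> norm (snd p z) \<le> K / 2 ^ n) \<and>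
      (n = 0 \<longrightarrow> p = (a0, c0))"
    for n :: nat and p :: "(complex \<Rightarrow> complex^'n) \<times> (complex \<Rightarrow> complex^'n)"
  define Q where "Q p q \<longleftrightarrow> (\<forall>z. z \<noteq> 0 \<longrightarrow>
      (1 - G1 z) \<rhd> fst p z + (1 / z) *s ((1 - G2 z) \<rhd> snd p (1 / z)) = fst q z + (1 / z) *s snd q (1 / z))"
    for p q :: "(complex \<Rightarrow> complex^'n) \<times> (complex \<Rightarrow> complex^'n)"
  have "\<exists>f. \<forall>n. P n (f n) \<and> Q (f n) (f (Suc n))"
  proof (rule dependent_nat_choice)
    show "\<exists>p. P 0 p" using 0 by (auto simp: P_def)
    fix p n assume p: "P n p"
    define B where "B = K / 2 ^ n"
    have B: "norm (fst p z) \<le> B" "norm (snd p z) \<le> B" if "norm z \<le> 2" for z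
      using p that by (simp_all add: P_def B_def)
    have B0: "0 \<le> B" using order_trans[OF norm_ge_zero B(1)[of 0]] by simp
    have hp: "hvec UNIV (fst p)" "hvec UNIV (snd p)" using p by (simp_all add: P_def)
    obtain a c where ac: "hvec UNIV a" "hvec UNIV c"
      "\<And>z. z \<noteq> 0 \<Longrightarrow> (1 - G1 z) \<rhd> fst p z + (1 / z) *s ((1 - G2 z) \<rhd> snd p (1 / z)) = a z + (1 / z) *s c (1 / z)"
      "\<And>z. norm z \<le> 2 \<Longrightarrow> norm (a z) \<le> 10 * real CARD('n) * (2 * \<epsilon> * B)"
      "\<And>z. norm z \<le> 2 \<Longrightarrow> norm (c z) \<le> 10 * real CARD('n) * (2 * \<epsilon> * B)"
      by (rule hvec_split_bound[OF hvec_remainders[OF hp] remainder_bounds[of "fst p" B "snd p", OF B]]) blast+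
    have "norm (a z) \<le> B / 2" "norm (c z) \<le> B / 2" if "norm z \<le> 2" for z
      using ac(4,5)[OF that] remainder_small[OF B0] B0 by linarith+
    then have "P (Suc n) (a, c)" "Q p (a, c)"
      using ac(1-3) by (simp_all add: P_def Q_def B_def mult.commute)
    then show "\<exists>q. P (Suc n) q \<and> Q p q" by blast
  qed
  then obtain f where f: "\<And>n. P n (f n)" "\<And>n. Q (f n) (f (Suc n))" by blast
  have f0: "f 0 = (a0, c0)" using f(1)[of 0] by (simp add: P_def)
  have hf: "hvec UNIV (fst (f n))" "hvec UNIV (snd (f n))" for n using f(1)[of n] by (simp_all add: P_def)
  have bf: "norm (fst (f n) z) \<le> K / 2 ^ n" "norm (snd (f n) z) \<le> K / 2 ^ n" if "z \<in> cball 0 2" for n z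
    using f(1)[of n] that by (simp_all add: P_def)
  have "summable (\<lambda>n. K * (1/2) ^ n)" by (intro summable_mult summable_geometric) simp
  then have sK: "summable (\<lambda>n. K / 2 ^ n)" by (simp add: power_divide)
  define A where "A z = (\<Sum>n. fst (f n) z)" for z
  define C where "C z = (\<Sum>n. snd (f n) z)" for z
  have hA: "hvec (ball 0 2) A" unfolding A_def by (rule hvec_uniform_limit[OF hf(1) bf(1) sK])
  have hC: "hvec (ball 0 2) C" unfolding C_def by (rule hvec_uniform_limit[OF hf(2) bf(2) sK])
  have sA: "(\<lambda>n. fst (f n) z) sums A z" and sC: "(\<lambda>n. snd (f n) z) sums C z" if "z \<in> cball 0 2" for z
    unfolding A_def C_def using bf[OF that]
    by (auto intro!: summable_sums summable_comparison_test'[OF sK])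
  have eq: "G1 z \<rhd> A z + (1 / z) *s (G2 z \<rhd> C (1 / z)) = g z" if "1/2 < norm z" "norm z < 2" for z
  proof -
    have z: "z \<noteq> 0" "z \<in> cball 0 2" "1 / z \<in> cball 0 2"
      using that by (auto simp: norm_divide divide_simps)
    define T where "T n = fst (f n) z + cop (1 / z) \<rhd> snd (f n) (1 / z)" for n
    have ap_sums: "(\<lambda>n. E \<rhd> u n) sums (E \<rhd> v)" if "u sums v" for E :: "(complex^'n) endo" and u v
      by (rule bounded_linear.sums[OF ap.bounded_linear_right that])
    have "T sums (A z + cop (1 / z) \<rhd> C (1 / z))"
      unfolding T_def by (intro sums_add ap_sums sA sC z)
    then have S1: "(\<lambda>n. T (Suc n)) sums (A z + cop (1 / z) \<rhd> C (1 / z) - T 0)"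
      by (simp only: sums_Suc_iff diff_add_cancel)
    have Teq: "T (Suc n) = (1 - G1 z) \<rhd> fst (f n) z + cop (1 / z) \<rhd> (1 - G2 z) \<rhd> snd (f n) (1 / z)" for n
      using f(2)[of n] z unfolding T_def Q_def by simp
    have S2: "(\<lambda>n. (1 - G1 z) \<rhd> fst (f n) z + cop (1 / z) \<rhd> (1 - G2 z) \<rhd> snd (f n) (1 / z)) sums
      ((1 - G1 z) \<rhd> A z + cop (1 / z) \<rhd> (1 - G2 z) \<rhd> C (1 / z))"
      by (intro sums_add ap_sums sA sC z)
    have "A z + cop (1 / z) \<rhd> C (1 / z) - T 0 =
        (1 - G1 z) \<rhd> A z + cop (1 / z) \<rhd> (1 - G2 z) \<rhd> C (1 / z)"
      by (rule sums_unique2[OF S1[unfolded Teq] S2])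
    moreover have "T 0 = g z" using 0(3)[OF z(1)] by (simp add: T_def f0)
    ultimately have *: "A z + cop (1 / z) \<rhd> C (1 / z) - g z =
        (1 - G1 z) \<rhd> A z + cop (1 / z) \<rhd> (1 - G2 z) \<rhd> C (1 / z)" by simp
    have "G1 z \<rhd> A z + (1 / z) *s (G2 z \<rhd> C (1 / z)) = A z + cop (1 / z) \<rhd> C (1 / z) -
        ((1 - G1 z) \<rhd> A z + cop (1 / z) \<rhd> (1 - G2 z) \<rhd> C (1 / z))"
      by (simp add: ap.diff_right)
    also have "\<dots> = g z" unfolding *[symmetric] by simp
    finally show ?thesis .
  qed
  \<comment> \<open>The series converge only on the disc of radius 2. Outside it the equation itself
    dictates the value, by inverting \<open>G1\<close> or \<open>G2\<close>; on 1/2 < norm z < 2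
    both descriptions agree by \<open>eq\<close>.\<close>
  define a where "a z = (if z \<in> ball 0 2 then A z else H1 z \<rhd> (g z - (1 / z) *s (G2 z \<rhd> C (1 / z))))" for z
  define c where "c w = (if w \<in> ball 0 2 then C w
      else (1 / w) *s (H2 (1 / w) \<rhd> (g (1 / w) - G1 (1 / w) \<rhd> A (1 / w))))" for w
  define T where "T = {z::complex. 1/2 < norm z}"
  have T: "open T" "T \<subseteq> -{0}" "ball 0 2 \<union> T = UNIV"
    by (auto simp: T_def open_Collect_less continuous_intros)
  have invT1: "(\<lambda>z. 1 / z) holomorphic_on T" using T(2) by (intro holomorphic_intros) auto
  have "1 / z \<in> ball 0 2 \<and> 1 / z \<noteq> 0" if "z \<in> T" for z
  proof -
    have "1/2 < norm z" using that by (simp add: T_def)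
    then have "z \<noteq> 0" "1 < 2 * norm z" by auto
    then show ?thesis by (simp add: norm_divide divide_simps)
  qed
  then have invT: "(\<lambda>z. 1 / z) holomorphic_on T" "(\<lambda>z. 1 / z) ` T \<subseteq> ball 0 2" "(\<lambda>z. 1 / z) ` T \<subseteq> -{0}"
    using invT1 by auto
  have GA: "G1 z \<rhd> A z = g z - (1 / z) *s (G2 z \<rhd> C (1 / z))" if "1/2 < norm z" "norm z < 2" for z
    using eq[OF that] by (simp add: vec_eq_iff algebra_simps)
  have Aeq: "A z = H1 z \<rhd> (g z - (1 / z) *s (G2 z \<rhd> C (1 / z)))" if "1/2 < norm z" "norm z < 2" for z
  proof -
    have "z \<noteq> 0" using that by auto
    have "H1 z \<rhd> G1 z \<rhd> A z = A z" using inverses(1)[OF \<open>z \<noteq> 0\<close>] by (metis ap_times ap_one)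
    then show ?thesis by (simp only: GA[OF that])
  qed
  have Ceq: "C w = (1 / w) *s (H2 (1 / w) \<rhd> (g (1 / w) - G1 (1 / w) \<rhd> A (1 / w)))"
    if "1/2 < norm w" "norm w < 2" for w
  proof -
    have w: "w \<noteq> 0" "1/2 < norm (1 / w)" "norm (1 / w) < 2" using that by (auto simp: norm_divide divide_simps)
    have "g (1 / w) - G1 (1 / w) \<rhd> A (1 / w) = w *s (G2 (1 / w) \<rhd> C w)"
      using eq[OF w(2,3)] by (simp add: vec_eq_iff algebra_simps)
    also have "(1 / w) *s (H2 (1 / w) \<rhd> (w *s (G2 (1 / w) \<rhd> C w))) = H2 (1 / w) \<rhd> G2 (1 / w) \<rhd> C w"
      using w(1) by (simp add: clin_ap[OF holop_clin[OF holo(4)]])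
    finally show ?thesis using inverses(3)[of "1 / w"] w(1) by (metis ap_times ap_one divide_eq_0_iff zero_neq_one)
  qed
  have "hvec (ball 0 2 \<union> T) a"
    unfolding a_def
  proof (rule hvec_paste[OF hA])
    show "hvec T (\<lambda>z. H1 z \<rhd> (g z - (1 / z) *s (G2 z \<rhd> C (1 / z))))"
      by (intro hvec_ap[OF holop_subset[OF holo(3) T(2)]] hvec_diff hvec_subset[OF g T(2)] hvec_scale invT
          hvec_ap[OF holop_subset[OF holo(2) T(2)]] hvec_compose[OF hC])
  qed (use T Aeq in \<open>auto simp: T_def\<close>)
  then have ha: "hvec UNIV a" by (simp add: T)
  have "hvec (ball 0 2 \<union> T) c"
    unfolding c_def
  proof (rule hvec_paste[OF hC])
    show "hvec T (\<lambda>w. (1 / w) *s (H2 (1 / w) \<rhd> (g (1 / w) - G1 (1 / w) \<rhd> A (1 / w))))"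
      by (intro hvec_scale invT hvec_ap[OF holop_compose[OF holo(4)]] hvec_diff hvec_compose[OF g]
          hvec_ap[OF holop_compose[OF holo(1)]] hvec_compose[OF hA])
  qed (use T Ceq in \<open>auto simp: T_def\<close>)
  then have hc: "hvec UNIV c" by (simp add: T)
  show ?thesis
  proof (rule that[OF ha hc])
    fix z :: complex assume z: "z \<noteq> 0"
    consider "norm z \<ge> 2" | "1/2 < norm z" "norm z < 2" | "norm z \<le> 1/2" by linarith
    then show "G1 z \<rhd> a z + (1 / z) *s (G2 z \<rhd> c (1 / z)) = g z"
    proof cases
      case 1
      then have "norm (1 / z) < 2" by (simp add: norm_divide divide_simps)
      then have "c (1 / z) = C (1 / z)" by (simp add: c_def)
      moreover have "G1 z \<rhd> a z = (G1 z * H1 z) \<rhd> (g z - (1 / z) *s (G2 z \<rhd> C (1 / z)))"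
        using 1 by (simp add: a_def)
      ultimately show ?thesis by (simp only: inverses(2)[OF z] ap_one diff_add_cancel)
    next
      case 2
      moreover have "norm (1 / z) < 2" using 2 z by (simp add: norm_divide divide_simps)
      ultimately show ?thesis using eq[OF 2] by (simp add: a_def c_def)
    next
      case 3
      then have "\<not> norm (1 / z) < 2" using z by (simp add: norm_divide divide_simps)
      then have "c (1 / z) = z *s (H2 z \<rhd> (g z - G1 z \<rhd> A z))" by (simp add: c_def)
      then have "(1 / z) *s (G2 z \<rhd> c (1 / z)) = (G2 z * H2 z) \<rhd> (g z - G1 z \<rhd> A z)"
        using z by (simp add: clin_ap[OF holop_clin[OF holo(2)]])
      moreover have "a z = A z" using 3 by (simp add: a_def)
      ultimately show ?thesis by (simp only: inverses(4)[OF z] ap_one) simp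
    qed
  qed
qed

text \<open>With a(z) = a(0) + z \<open>a1\<close>(z) and \<open>c1\<close> = a(0) - c, division of
  the equation by z shows that \<open>a1\<close> and \<open>c1\<close> split the error terms divided
  by z. Those are at most 8 \<epsilon> times a bound for \<open>a\<close> and \<open>c\<close>,
  where 8 = 2 / (1/4) comes from the innermost circle. So \<open>c1 0\<close> is small compared with
  any bound for \<open>a\<close> and \<open>c\<close>, and iteration brings this bound down to 2
  norm (a 0).\<close>

lemma gluing_value_at_zero:
  assumes a: "hvec UNIV a" and c: "hvec UNIV c"
    and eq: "\<And>z. z \<noteq> 0 \<Longrightarrow> G1 z \<rhd> a z = G2 z \<rhd> c (1 / z)"
  shows "norm (c 0 - a 0) \<le> 160 * real CARD('n) * \<epsilon> * norm (a 0)"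
proof -
  define a1 where "a1 z = (\<chi> i. if z = 0 then deriv (\<lambda>z. a z $ i) 0 else (a z $ i - a 0 $ i) / (z - 0))" for z
  have ha1: "hvec UNIV a1"
    using a pole_lemma[of "\<lambda>z. a z $ i" UNIV 0 for i] by (simp add: hvec_def a1_def)
  have a1: "a z = a 0 + z *s a1 z" for z
    by (cases "z = 0") (simp_all add: a1_def vec_eq_iff)
  define c1 where "c1 w = a 0 - c w" for w
  have hc1: "hvec UNIV c1" unfolding c1_def by (intro hvec_diff hvec_const c)
  obtain A C where A: "\<And>z. z \<in> cball 0 2 \<Longrightarrow> norm (a z) \<le> A" and C: "\<And>z. z \<in> cball 0 2 \<Longrightarrow> norm (c z) \<le> C"
    using hvec_bounded[OF a, of "cball 0 2"] hvec_bounded[OF c, of "cball 0 2"] by (metis compact_cball subset_UNIV)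
  define D where "D = 160 * real CARD('n) * \<epsilon>"
  have D: "0 \<le> D" "2 * D \<le> 1" using small eps_nonneg by (simp_all add: D_def)
  have improve: "norm (a1 z) \<le> D / 2 * B \<and> norm (c1 z) \<le> D / 2 * B"
    if B: "\<And>z. norm z \<le> 2 \<Longrightarrow> norm (a z) \<le> B" "\<And>z. norm z \<le> 2 \<Longrightarrow> norm (c z) \<le> B" and z: "norm z \<le> 2" for B z
  proof -
    have B0: "0 \<le> B" using order_trans[OF norm_ge_zero B(1)[of 0]] by simp
    then have eB: "0 \<le> \<epsilon> * B" using eps_nonneg by simp
    note rem = hvec_remainders[OF a c]
    have rb: "norm w = 1/4 \<Longrightarrow> norm ((1 - G1 w) \<rhd> a w) \<le> 2 * \<epsilon> * B"
      "norm w = 2 \<Longrightarrow> norm ((1 - G1 w) \<rhd> a w) \<le> 2 * \<epsilon> * B"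
      "norm w = 4 \<Longrightarrow> norm ((1 / w) *s ((1 - G2 w) \<rhd> c (1 / w))) \<le> 2 * \<epsilon> * B"
      "norm w = 1/2 \<Longrightarrow> norm ((1 / w) *s ((1 - G2 w) \<rhd> c (1 / w))) \<le> 2 * \<epsilon> * B" for w
      using remainder_bounds[of a B c w] B by blast+
    have h1: "hvec (-{0}) (\<lambda>z. (1 / z) *s ((1 - G1 z) \<rhd> a z))"
      by (intro hvec_scale rem holomorphic_intros) auto
    have h2: "hvec (-{0}) (\<lambda>z. - ((1 / z) *s ((1 - G2 z) \<rhd> c (1 / z))))"
      by (intro hvec_minus rem)
    have q: "(1 / z) *s ((1 - G1 z) \<rhd> a z) + - ((1 / z) *s ((1 - G2 z) \<rhd> c (1 / z)))
        = a1 z + (1 / z) *s c1 (1 / z)" (is "?L = _") if "z \<noteq> 0" for z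
    proof -
      have "z *s a1 z = a z - a 0" using a1[of z] by (metis add_diff_cancel_left')
      then have "(1 / z) *s (a z - a 0) = a1 z" using that by (metis vector_smult_assoc vector_smult_lid nonzero_divide_eq_eq)
      moreover have "?L = (1 / z) *s (a z - c (1 / z))"
        unfolding ap_diff ap_one eq[OF that] by (simp add: vec_eq_iff algebra_simps)
      moreover have "(1 / z) *s (a z - c (1 / z)) = (1 / z) *s (a z - a 0) + (1 / z) *s c1 (1 / z)"
        by (simp add: c1_def vec_eq_iff algebra_simps)
      ultimately show ?thesis by metis
    qed
    have "norm ((1 / w) *s ((1 - G1 w) \<rhd> a w)) \<le> 8 * \<epsilon> * B" if "norm w = 1/4" for w
      unfolding norm_cvec_scale norm_divide that using rb(1)[OF that] by (simp add: mult.commute)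
    moreover have "norm ((1 / w) *s ((1 - G1 w) \<rhd> a w)) \<le> 8 * \<epsilon> * B" if "norm w = 2" for w
      unfolding norm_cvec_scale norm_divide that using rb(2)[OF that] eB by simp
    moreover have "norm (- ((1 / w) *s ((1 - G2 w) \<rhd> c (1 / w)))) \<le> 8 * \<epsilon> * B" if "norm w = 4" for w
      using rb(3)[OF that] eB unfolding norm_minus_cancel by linarith
    moreover have "norm (- ((1 / w) *s ((1 - G2 w) \<rhd> c (1 / w)))) \<le> 8 * \<epsilon> * B" if "norm w = 1/2" for w
      using rb(4)[OF that] eB unfolding norm_minus_cancel by linarith
    ultimately have "norm (a1 z) \<le> 10 * real CARD('n) * (8 * \<epsilon> * B) \<and> norm (c1 z) \<le> 10 * real CARD('n) * (8 * \<epsilon> * B)"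
      using hvec_split_bound_unique[OF h1 h2 _ _ _ _ ha1 hc1 q z, of "8 * \<epsilon> * B"] by blast
    then show ?thesis by (simp add: D_def algebra_simps)
  qed
  \<comment> \<open>The iterates of B to norm (a 0) + B / 2, whose fixed point is 2 norm (a
    0).\<close>
  define B where "B k = 2 * norm (a 0) + max A C / 2 ^ k" for k :: nat
  have B: "norm (a z) \<le> B k \<and> norm (c z) \<le> B k" if "norm z \<le> 2" for k z
    using that
  proof (induction k arbitrary: z)
    case 0
    then show ?case using A[of z] C[of z] norm_ge_zero[of "a 0"] unfolding B_def by (auto simp: le_max_iff_disj intro: add_increasing)
  next
    case (Suc k)
    have *: "norm (a1 z) \<le> D / 2 * B k" "norm (c1 z) \<le> D / 2 * B k"
      using improve[of "B k" z] Suc by blast+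
    have B0: "0 \<le> B k" using Suc.IH[OF Suc.prems] norm_ge_zero order_trans by blast
    then have D2: "2 * (D / 2 * B k) \<le> B k / 2" "0 \<le> D / 2 * B k"
      using mult_right_mono[OF D(2) B0] D(1) by simp_all
    have "norm (a z) \<le> norm (a 0) + norm z * norm (a1 z)"
      using a1[of z] norm_triangle_ineq[of "a 0" "z *s a1 z"] by (simp add: norm_cvec_scale)
    moreover have "norm z * norm (a1 z) \<le> 2 * (D / 2 * B k)"
      using * Suc.prems by (intro mult_mono) auto
    moreover have "norm (c z) \<le> norm (a 0) + norm (c1 z)"
      using norm_triangle_ineq4[of "a 0" "c1 z"] by (simp add: c1_def)
    moreover have "B (Suc k) = norm (a 0) + B k / 2" by (simp add: B_def)
    ultimately show ?case using * D2 by linarith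
  qed
  have "norm (c1 0) \<le> D / 2 * B k" for k
    using improve[of "B k" 0] B by auto
  moreover have "(\<lambda>k. D / 2 * B k) \<longlonglongrightarrow> D / 2 * (2 * norm (a 0) + 0)"
  proof -
    have "(\<lambda>k. max A C * (1/2) ^ k) \<longlonglongrightarrow> max A C * 0"
      by (intro tendsto_intros LIMSEQ_power_zero) auto
    then have "(\<lambda>k. max A C / 2 ^ k) \<longlonglongrightarrow> 0" by (simp add: power_divide)
    then show ?thesis unfolding B_def by (intro tendsto_intros)
  qed
  ultimately have "norm (c1 0) \<le> D / 2 * (2 * norm (a 0) + 0)"
    by (intro LIMSEQ_le_const) auto
  then show ?thesis by (simp add: c1_def D_def norm_minus_commute mult_ac)
qed

end

section \<open>Hard Lefschetz and the associated sl2-triple\<close>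

lemma scaleR_eq_scale: "r *\<^sub>R v = of_real r *s (v :: complex^'n::finite)"
  by (simp add: vec_eq_iff, simp add: scaleR_conv_of_real)

lemma cop_scaleR: "cop (of_real r * c) = r *\<^sub>R cop c"
  by (simp add: cop_mult cop_of_real)

lemma powi_plus_two: "z powi (l + 2) = z\<^sup>2 * z powi l" and powi_minus_two: "z powi (l - 2) = 1 / z\<^sup>2 * z powi l"
  if "z \<noteq> 0" for z :: complex
  using power_int_add[of z l 2] power_int_diff[of z l 2] that by (simp_all add: mult.commute)

lemma endo_eq_on_span:
  assumes "span S = UNIV" "\<And>v. v \<in> S \<Longrightarrow> A \<rhd> v = B \<rhd> v"
  shows "A = B"
proof (rule endo_eqI)
  fix v
  have "linear (\<lambda>v. A \<rhd> v)" "linear (\<lambda>v. B \<rhd> v)"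
    by (simp_all add: bounded_linear.linear[OF ap.bounded_linear_right])
  then show "A \<rhd> v = B \<rhd> v"
    by (rule linear_eq_on[where B = S]) (use assms in auto)
qed

text \<open>On classes of degree 2k in dimension n the weight will be n - 2k, so that cup product
  with a Kaehler class lowers it. \<open>N\<close> thus takes the place of the lowering operator of
  the triple, and \<open>e\<close> that of the dual Lefschetz operator.\<close>

locale lefschetz =
  fixes N :: "(complex^'n::finite) endo" and wt :: "'n \<Rightarrow> int"
  assumes clin_N: "clin N"
    and N_lower: "(N \<rhd> axis j 1) $ i \<noteq> 0 \<Longrightarrow> wt i = wt j - 2"
    and N_lefschetz: "bij_betw (\<lambda>v. N ^ k \<rhd> v) {v. \<forall>i. v $ i \<noteq> 0 \<longrightarrow> wt i = int k}
        {v. \<forall>i. v $ i \<noteq> 0 \<longrightarrow> wt i = - int k}"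
begin

definition V :: "int \<Rightarrow> (complex^'n) set" where
  "V l = {v. \<forall>i. v $ i \<noteq> 0 \<longrightarrow> wt i = l}"

definition pr :: "int \<Rightarrow> (complex^'n) endo" where
  "pr l = dg (\<lambda>i. if wt i = l then 1 else 0)"

definition h :: "(complex^'n) endo" where
  "h = dg (\<lambda>i. of_int (wt i))"

lemma V_pr: "v \<in> V l \<longleftrightarrow> pr l \<rhd> v = v"
  by (auto simp: V_def pr_def vec_eq_iff)

lemma pr_V: "v \<in> V l \<Longrightarrow> pr m \<rhd> v = (if m = l then v else 0)"
  by (auto simp: V_def pr_def vec_eq_iff)

lemma pr_in_V: "pr l \<rhd> v \<in> V l"
  by (auto simp: V_def pr_def)

lemma h_V: "v \<in> V l \<Longrightarrow> h \<rhd> v = of_int l *s v"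
  by (auto simp: V_def h_def vec_eq_iff)

lemma V_zero [simp]: "0 \<in> V l" by (simp add: V_def)
lemma V_add: "v \<in> V l \<Longrightarrow> w \<in> V l \<Longrightarrow> v + w \<in> V l"
  by (auto simp: V_pr ap.add_right)
lemma V_diff: "v \<in> V l \<Longrightarrow> w \<in> V l \<Longrightarrow> v - w \<in> V l"
  by (auto simp: V_pr ap.diff_right)
lemma V_scale: "v \<in> V l \<Longrightarrow> c *s v \<in> V l"
  by (auto simp: V_def)

lemma V_scaleR: "v \<in> V l \<Longrightarrow> r *\<^sub>R v \<in> V l"
  by (auto simp: V_def)

lemma V_disjoint: "v \<in> V l \<Longrightarrow> v \<in> V m \<Longrightarrow> l \<noteq> m \<Longrightarrow> v = 0"
  by (auto simp: V_def vec_eq_iff)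

lemma sum_pr: "finite L \<Longrightarrow> range wt \<subseteq> L \<Longrightarrow> (\<Sum>l\<in>L. pr l) = 1"
  by (rule endo_eqI) (auto simp: pr_def vec_eq_iff ap_sum if_distrib[of "\<lambda>x. x * _"] cong: if_cong)

lemma N_V: "v \<in> V l \<Longrightarrow> N \<rhd> v \<in> V (l - 2)"
  unfolding V_def
proof (clarsimp)
  fix i assume v: "\<forall>i. v $ i \<noteq> 0 \<longrightarrow> wt i = l" and i: "(N \<rhd> v) $ i \<noteq> 0"
  have "(\<Sum>j\<in>UNIV. v $ j * (N \<rhd> axis j 1) $ i) \<noteq> 0"
    using i by (subst (asm) clin_expand[OF clin_N]) simp
  then obtain j where "v $ j * (N \<rhd> axis j 1) $ i \<noteq> 0" using sum.not_neutral_contains_not_neutral by blast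
  then show "wt i = l - 2" using v N_lower[of j i] by auto
qed

lemma Npow_V: "v \<in> V l \<Longrightarrow> N ^ k \<rhd> v \<in> V (l - 2 * int k)"
proof (induction k)
  case (Suc k)
  have "N \<rhd> N ^ k \<rhd> v \<in> V (l - 2 * int k - 2)" by (rule N_V[OF Suc.IH[OF Suc.prems]])
  then show ?case by (simp add: algebra_simps)
qed simp

lemma bij_V: "bij_betw (\<lambda>v. N ^ k \<rhd> v) (V (int k)) (V (- int k))"
  using N_lefschetz[of k] by (simp add: V_def)

lemma Npow_inj: "v \<in> V (int k) \<Longrightarrow> N ^ k \<rhd> v = 0 \<Longrightarrow> v = 0"
  using bij_betw_imp_inj_on[OF bij_V[of k]] inj_onD[of "\<lambda>v. N ^ k \<rhd> v" "V (int k)" v 0]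
  by (simp add: ap.zero_right)

definition bnd :: nat where
  "bnd = nat (Max ((\<lambda>i. \<bar>wt i\<bar>) ` UNIV))"

lemma wt_bnd: "\<bar>wt i\<bar> \<le> int bnd"
proof -
  have "\<bar>wt i\<bar> \<le> Max ((\<lambda>i. \<bar>wt i\<bar>) ` UNIV)" by (intro Max_ge) auto
  moreover have "0 \<le> \<bar>wt i\<bar>" by simp
  ultimately show ?thesis unfolding bnd_def by linarith
qed

lemma V_large: "\<bar>l\<bar> > int bnd \<Longrightarrow> v \<in> V l \<Longrightarrow> v = 0"
  using wt_bnd by (auto simp: V_def vec_eq_iff) (metis linorder_not_le)

lemma axis_V: "axis j 1 \<in> V (wt j)"
  by (auto simp: V_def axis_def)

text \<open>After 2 bnd + 1 steps of size at least 1 every weight has left the interval from - bnd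
  to bnd.\<close>

lemma raise_nilpotent:
  assumes "clin A" "d \<noteq> 0" "\<And>v l. v \<in> V l \<Longrightarrow> A \<rhd> v \<in> V (l + d)"
  shows "A ^ (2 * bnd + 1) = 0"
proof (rule clin_eqI)
  show "clin (A ^ (2 * bnd + 1))" using assms(1) by auto
  fix j
  have *: "A ^ k \<rhd> axis j 1 \<in> V (wt j + d * int k)" for k
  proof (induction k)
    case (Suc k)
    have "A \<rhd> A ^ k \<rhd> axis j 1 \<in> V (wt j + d * int k + d)" by (rule assms(3)[OF Suc.IH])
    then show ?case by (simp add: algebra_simps)
  qed (simp add: axis_V)
  have "int (2 * bnd + 1) \<le> \<bar>d * int (2 * bnd + 1)\<bar>"
    using assms(2) by (simp add: abs_mult)
  then have "\<bar>wt j + d * int (2 * bnd + 1)\<bar> > int bnd"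
    using wt_bnd[of j] by linarith
  then show "A ^ (2 * bnd + 1) \<rhd> axis j 1 = 0 \<rhd> axis j 1"
    using V_large[OF _ *[of "2 * bnd + 1"]] by simp
qed simp

lemma N_nilpotent: "N ^ (2 * bnd + 1) = 0"
  by (rule raise_nilpotent[of N "-2"]) (use clin_N N_V in auto)

text \<open>The primitive vectors, which are the tops of the Lefschetz strings because
  \<open>N\<close> lowers the weight.\<close>

definition P :: "nat \<Rightarrow> (complex^'n) set" where
  "P k = {v \<in> V (int k). N ^ Suc k \<rhd> v = 0}"

definition strings :: "(complex^'n) set" where
  "strings = {N ^ j \<rhd> a | j k a. a \<in> P k \<and> j \<le> k}"

lemma P_scale: "a \<in> P k \<Longrightarrow> c *s a \<in> P k"
  using clin_ap[OF clin_power[OF clin_N, of "Suc k"], of c a]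
  by (simp add: P_def V_scale del: power_Suc)

lemma P_kill: "a \<in> P k \<Longrightarrow> j > k \<Longrightarrow> N ^ j \<rhd> a = 0"
proof -
  assume a: "a \<in> P k" and j: "j > k"
  then have "N ^ j = N ^ (j - Suc k) * N ^ Suc k"
    by (metis Suc_leI le_add_diff_inverse2 power_add)
  then show ?thesis using a by (simp add: P_def ap.zero_right del: power_Suc)
qed

lemma stringsI: "a \<in> P k \<Longrightarrow> j \<le> k \<Longrightarrow> N ^ j \<rhd> a \<in> strings"
  by (auto simp: strings_def)

lemma strings_base: "a \<in> P k \<Longrightarrow> a \<in> strings"
  using stringsI[of a k 0] by simp

lemma N_span_strings: "v \<in> span strings \<Longrightarrow> N \<rhd> v \<in> span strings"
proof (induction v rule: span_induct)
  show "subspace {v. N \<rhd> v \<in> span strings}"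
    by (rule subspaceI) (auto simp: ap.zero_right ap.add_right ap.scaleR_right span_zero span_add span_scale)
  fix v assume "v \<in> strings"
  then obtain j k a where v: "v = N ^ j \<rhd> a" "a \<in> P k" "j \<le> k" by (auto simp: strings_def)
  then have *: "N \<rhd> v = N ^ Suc j \<rhd> a" by simp
  show "N \<rhd> v \<in> span strings"
  proof (cases "j = k")
    case True
    then show ?thesis using P_kill[OF v(2), of "Suc j"] * by (simp add: span_zero)
  next
    case False
    then have "N \<rhd> v \<in> strings" unfolding * using v by (intro stringsI) auto
    then show ?thesis by (rule span_base)
  qed
qed

lemma Npow_span_strings: "v \<in> span strings \<Longrightarrow> N ^ k \<rhd> v \<in> span strings"
  by (induction k) (auto intro: N_span_strings)

text \<open>Induction downwards from the largest weight. By surjectivity of N^(k+2) from weight k +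
  2 to weight - (k + 2), the vector N^(k+1) v equals N^(k+2) y for some \<open>y\<close> of higher
  weight, and then v - N y is primitive.\<close>

lemma V_span_strings: "v \<in> V (int k) \<Longrightarrow> v \<in> span strings"
proof (induction "bnd + 1 - k" arbitrary: k v rule: less_induct)
  case less
  show ?case
  proof (cases "k > bnd")
    case True
    then show ?thesis using V_large[OF _ less.prems] by (simp add: span_zero)
  next
    case False
    have "N ^ (k + 1) \<rhd> v \<in> V (- int (k + 2))"
      using Npow_V[OF less.prems, of "k + 1"] by (simp add: algebra_simps del: power_Suc)
    then have "N ^ (k + 1) \<rhd> v \<in> (\<lambda>v. N ^ (k + 2) \<rhd> v) ` V (int (k + 2))"
      using bij_betw_imp_surj_on[OF bij_V[of "k + 2"]] by (simp only:)
    then obtain y where y: "y \<in> V (int (k + 2))" "N ^ (k + 2) \<rhd> y = N ^ (k + 1) \<rhd> v"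
      unfolding image_iff by metis
    have Ny: "N \<rhd> y \<in> V (int k)" using N_V[OF y(1)] by simp
    have "N ^ (k + 1) \<rhd> N \<rhd> y = N ^ (k + 2) \<rhd> y"
      by (simp only: ap_times[symmetric] power_Suc2[symmetric]) simp
    then have "v - N \<rhd> y \<in> P k"
      using V_diff[OF less.prems Ny] y(2) by (simp add: P_def ap.diff_right del: power_Suc)
    then have "v - N \<rhd> y \<in> span strings"
      by (intro span_base strings_base)
    moreover have "y \<in> span strings" using less.hyps[OF _ y(1)] False by simp
    ultimately show ?thesis using N_span_strings span_add by fastforce
  qed
qed

lemma span_strings: "span strings = UNIV"
proof -
  have V: "v \<in> span strings" if "v \<in> V l" for v l
  proof (cases "l \<ge> 0")
    case True
    then show ?thesis using V_span_strings[of v "nat l"] that by simp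
  next
    case False
    then obtain k where "l = - int k" by (intro that[of "nat (- l)"]) (use False in simp)
    then have "v \<in> (\<lambda>v. N ^ k \<rhd> v) ` V (int k)"
      using bij_betw_imp_surj_on[OF bij_V[of k]] that by simp
    then obtain y where "y \<in> V (int k)" "N ^ k \<rhd> y = v" by auto
    then show ?thesis using V_span_strings Npow_span_strings by blast
  qed
  have "v \<in> span strings" for v
  proof -
    have "v = (\<Sum>l\<in>range wt. pr l \<rhd> v)"
      using sum_pr[of "range wt"] by (simp flip: ap_sum)
    moreover have "(\<Sum>l\<in>range wt. pr l \<rhd> v) \<in> span strings"
      by (intro span_sum V[OF pr_in_V])
    ultimately show ?thesis by simp
  qed
  then show ?thesis by auto
qed

definition I :: "(nat \<times> nat) set" where
  "I = {(k, j). k \<le> bnd \<and> j \<le> k}"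

lemma finite_I [simp]: "finite I"
  by (rule finite_subset[of _ "{..bnd} \<times> {..bnd}"]) (auto simp: I_def)

text \<open>The Lefschetz decomposition of \<open>v\<close>; the index (k, j) stands for position
  \<open>j\<close> in strings with top weight \<open>k\<close>. Components outside \<open>I\<close>
  are set to 0 so that the decomposition is unique as a function.\<close>

definition compos :: "(nat \<times> nat \<Rightarrow> complex^'n) \<Rightarrow> complex^'n \<Rightarrow> bool" where
  "compos a v \<longleftrightarrow> (\<forall>k j. a (k, j) \<in> P k \<and> ((k, j) \<notin> I \<longrightarrow> a (k, j) = 0)) \<and>
     v = (\<Sum>(k, j)\<in>I. N ^ j \<rhd> a (k, j))"

lemma P_subspace: "subspace (P k)"
  by (rule subspaceI) (auto simp: P_def ap.zero_right ap.add_right ap.scaleR_right V_add V_scaleR simp del: power_Suc)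

lemma compos_add: "compos a v \<Longrightarrow> compos b w \<Longrightarrow> compos (\<lambda>x. a x + b x) (v + w)"
  unfolding compos_def
  by (auto simp: subspace_add[OF P_subspace] ap.add_right sum.distrib[symmetric] intro!: sum.cong)

lemma compos_scaleR: "compos a v \<Longrightarrow> compos (\<lambda>x. r *\<^sub>R a x) (r *\<^sub>R v)"
  unfolding compos_def
  by (auto simp: subspace_scale[OF P_subspace] ap.scaleR_right scaleR_sum_right intro!: sum.cong)

lemma compos_string:
  assumes "a \<in> P k" "j \<le> k"
  shows "compos (\<lambda>x. if x = (k, j) then a else 0) (N ^ j \<rhd> a)"
proof (cases "k \<le> bnd")
  case True
  then have "(k, j) \<in> I" using assms by (simp add: I_def)
  then have "(\<Sum>(k', j')\<in>I. N ^ j' \<rhd> (if (k', j') = (k, j) then a else 0)) = N ^ j \<rhd> a"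
    by (subst sum.remove[of _ "(k, j)"]) (auto simp: ap.zero_right split: if_splits intro!: sum.neutral)
  then show ?thesis
    using assms \<open>(k, j) \<in> I\<close> subspace_0[OF P_subspace] by (auto simp: compos_def)
next
  case False
  then have "a = 0" using V_large[of "int k" a] assms by (simp add: P_def)
  then show ?thesis using subspace_0[OF P_subspace] by (auto simp: compos_def ap.zero_right)
qed

lemma compos_exists: "\<exists>a. compos a v"
proof -
  have "v \<in> span strings" by (simp add: span_strings)
  then show ?thesis
  proof (induction v rule: span_induct)
    show "subspace {v. \<exists>a. compos a v}"
    proof (rule subspaceI)
      show "0 \<in> {v. \<exists>a. compos a v}"
        using subspace_0[OF P_subspace]
        by (auto simp: compos_def ap.zero_right intro!: exI[of _ "\<lambda>_. 0"])
    qed (use compos_add compos_scaleR in blast)+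
    fix v assume "v \<in> strings"
    then show "\<exists>a. compos a v" using compos_string by (auto simp: strings_def)
  qed
qed

text \<open>Induction downwards in \<open>k\<close>. Apply N^(k-j) and project to weight - k: longer
  strings are already known to be absent, shorter ones have been pushed past their end, and of those
  of length \<open>k\<close> only position \<open>j\<close> arrives there. What remains is N^k a(k,
  j), and N^k is injective on weight k.\<close>

lemma compos_zero:
  assumes "compos a 0" shows "a (k, j) = 0"
proof (cases "(k, j) \<in> I")
  case False
  then show ?thesis using assms by (simp add: compos_def)
next
  case True
  then show ?thesis
  proof (induction "bnd - k" arbitrary: k j rule: less_induct)
    case less
    have aP: "a (k', j') \<in> P k'" for k' j' using assms by (simp add: compos_def)
    have kj: "k \<le> bnd" "j \<le> k" using less.prems by (simp_all add: I_def)
    have trm: "pr (- int k) \<rhd> N ^ (k - j) \<rhd> N ^ j' \<rhd> a (k', j') =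
        (if (k', j') = (k, j) then N ^ k \<rhd> a (k, j) else 0)" if "(k', j') \<in> I" for k' j'
    proof -
      have "N ^ (k - j) \<rhd> N ^ j' \<rhd> a (k', j') = N ^ (k - j + j') \<rhd> a (k', j')"
        by (simp add: power_add)
      moreover have "N ^ (k - j + j') \<rhd> a (k', j') \<in> V (int k' - 2 * int (k - j + j'))"
        using Npow_V aP[of k' j'] unfolding P_def by blast
      ultimately have eq: "pr (- int k) \<rhd> N ^ (k - j) \<rhd> N ^ j' \<rhd> a (k', j') =
          (if - int k = int k' - 2 * int (k - j + j') then N ^ (k - j + j') \<rhd> a (k', j') else 0)"
        by (simp add: pr_V)
      show ?thesis
      proof (cases "- int k = int k' - 2 * int (k - j + j')")
        case False
        then have ne: "(k', j') \<noteq> (k, j)" using kj by auto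
        show ?thesis unfolding eq if_not_P[OF False] if_not_P[OF ne] ..
      next
        case True
        consider "k' = k" | "k' < k" | "k < k'" by linarith
        then show ?thesis
        proof cases
          case 1
          then have "j' = j" using True kj by (simp add: of_nat_diff)
          then show ?thesis unfolding eq if_P[OF True] using 1 kj by simp
        next
          case 2
          define p where "p = k - j + j'"
          have "2 * p = k + k'" using True unfolding p_def[symmetric] by linarith
          then have "k' < p" using 2 by linarith
          then have "k' < k - j + j'" unfolding p_def .
          then show ?thesis unfolding eq if_P[OF True] using 2 P_kill[OF aP] by simp
        next
          case 3
          have "a (k', j') = 0" using less.hyps[of k' j'] 3 kj that by (auto simp: I_def)
          then show ?thesis using 3 by (simp add: ap.zero_right)
        qed
      qed
    qed
    have "0 = pr (- int k) \<rhd> N ^ (k - j) \<rhd> (\<Sum>(k', j')\<in>I. N ^ j' \<rhd> a (k', j'))"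
      using assms by (simp add: compos_def ap.zero_right)
    also have "\<dots> = (\<Sum>x\<in>I. if x = (k, j) then N ^ k \<rhd> a (k, j) else 0)"
      unfolding ap.sum_right by (intro sum.cong refl) (auto simp: trm split: prod.splits)
    also have "\<dots> = N ^ k \<rhd> a (k, j)" using less.prems by simp
    finally have "N ^ k \<rhd> a (k, j) = 0" by simp
    then show ?case using Npow_inj[of "a (k, j)" k] aP[of k j] by (simp add: P_def)
  qed
qed

lemma compos_unique:
  assumes "compos a v" "compos b v" shows "a = b"
proof
  fix x :: "nat \<times> nat"
  have "compos (\<lambda>x. a x + (-1) *\<^sub>R b x) (v + (-1) *\<^sub>R v)"
    by (intro compos_add compos_scaleR assms)
  then show "a x = b x"
    using compos_zero[of "\<lambda>x. a x + (-1) *\<^sub>R b x" "fst x" "snd x"] by simp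
qed

definition dec :: "complex^'n \<Rightarrow> nat \<times> nat \<Rightarrow> complex^'n" where
  "dec v = (SOME a. compos a v)"

lemma compos_dec: "compos (dec v) v"
  unfolding dec_def using compos_exists by (rule someI_ex)

lemma dec_eqI: "compos a v \<Longrightarrow> dec v = a"
  using compos_unique compos_dec by blast

text \<open>The raising operator of the triple: a primitive \<open>a\<close> of weight \<open>k\<close> satisfies
  \<open>e N\<^sup>j a = j (k - j + 1) N\<^sup>j\<^sup>-\<^sup>1 a\<close>.\<close>

definition e :: "(complex^'n) endo" where
  "e = Op (\<lambda>v. \<Sum>(k, j)\<in>I. (real j * (real k - real j + 1)) *\<^sub>R (N ^ (j - 1) \<rhd> dec v (k, j)))"

lemma e_string:
  assumes "a \<in> P k" "j \<le> k"
  shows "e \<rhd> N ^ j \<rhd> a = (real j * (real k - real j + 1)) *\<^sub>R (N ^ (j - 1) \<rhd> a)"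
proof -
  have "linear (\<lambda>v. \<Sum>(k, j)\<in>I. (real j * (real k - real j + 1)) *\<^sub>R (N ^ (j - 1) \<rhd> dec v (k, j)))"
  proof (rule linearI)
    fix v w
    have "dec (v + w) = (\<lambda>x. dec v x + dec w x)"
      by (intro dec_eqI compos_add compos_dec)
    then show "(\<Sum>(k, j)\<in>I. (real j * (real k - real j + 1)) *\<^sub>R (N ^ (j - 1) \<rhd> dec (v + w) (k, j))) =
       (\<Sum>(k, j)\<in>I. (real j * (real k - real j + 1)) *\<^sub>R (N ^ (j - 1) \<rhd> dec v (k, j))) +
       (\<Sum>(k, j)\<in>I. (real j * (real k - real j + 1)) *\<^sub>R (N ^ (j - 1) \<rhd> dec w (k, j)))"
      by (simp add: ap.add_right scaleR_add_right sum.distrib case_prod_beta)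
  next
    fix r v
    have "dec (r *\<^sub>R v) = (\<lambda>x. r *\<^sub>R dec v x)"
      by (intro dec_eqI compos_scaleR compos_dec)
    then show "(\<Sum>(k, j)\<in>I. (real j * (real k - real j + 1)) *\<^sub>R (N ^ (j - 1) \<rhd> dec (r *\<^sub>R v) (k, j))) =
       r *\<^sub>R (\<Sum>(k, j)\<in>I. (real j * (real k - real j + 1)) *\<^sub>R (N ^ (j - 1) \<rhd> dec v (k, j)))"
      by (simp add: ap.scaleR_right scaleR_sum_right case_prod_beta mult.commute)
  qed
  then have e: "e \<rhd> N ^ j \<rhd> a =
      (\<Sum>(k', j')\<in>I. (real j' * (real k' - real j' + 1)) *\<^sub>R (N ^ (j' - 1) \<rhd> (if (k', j') = (k, j) then a else 0)))"
    using dec_eqI[OF compos_string[OF assms]] by (simp add: e_def)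
  show ?thesis
  proof (cases "k \<le> bnd")
    case True
    then have "(k, j) \<in> I" using assms by (simp add: I_def)
    then show ?thesis unfolding e
      by (subst sum.remove[of _ "(k, j)"]) (auto simp: ap.zero_right split: if_splits intro!: sum.neutral)
  next
    case False
    then have "a = 0" using V_large[of "int k" a] assms by (simp add: P_def)
    then show ?thesis unfolding e \<open>a = 0\<close> by (simp add: ap.zero_right case_prod_beta)
  qed
qed

lemma string_V: "a \<in> P k \<Longrightarrow> N ^ j \<rhd> a \<in> V (int k - 2 * int j)"
  using Npow_V[of a "int k" j] by (simp add: P_def)

lemma clin_e: "clin e"
  unfolding clin_def
proof (intro allI endo_eq_on_span[OF span_strings])
  fix c v assume "v \<in> strings"
  then obtain j k a where v: "v = N ^ j \<rhd> a" "a \<in> P k" "j \<le> k" by (auto simp: strings_def)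
  have "c *s v = N ^ j \<rhd> (c *s a)" by (simp add: v clin_ap[OF clin_power[OF clin_N]])
  then have "e \<rhd> (c *s v) = (real j * (real k - real j + 1)) *\<^sub>R (N ^ (j - 1) \<rhd> (c *s a))"
    using e_string[OF P_scale[OF v(2)] v(3)] by simp
  also have "\<dots> = c *s (e \<rhd> v)"
    unfolding v(1) e_string[OF v(2,3)] clin_ap[OF clin_power[OF clin_N]] by (simp add: vec_eq_iff)
  finally show "(e * cop c) \<rhd> v = (cop c * e) \<rhd> v" by simp
qed

lemma clin_h: "clin h" and clin_pr: "clin (pr l)"
  by (simp_all add: h_def pr_def)

lemma e_N: "e * N = N * e + h"
proof (rule endo_eq_on_span[OF span_strings])
  fix v assume "v \<in> strings"
  then obtain j k a where v: "v = N ^ j \<rhd> a" "a \<in> P k" "j \<le> k" by (auto simp: strings_def)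
  have h: "h \<rhd> v = (real k - 2 * real j) *\<^sub>R v"
    using h_V[OF string_V[OF v(2), of j]] v(1) by (simp add: scaleR_eq_scale)
  have Ne: "N \<rhd> e \<rhd> v = (real j * (real k - real j + 1)) *\<^sub>R v"
  proof (cases j)
    case (Suc j')
    then show ?thesis unfolding v(1) e_string[OF v(2,3)] by (simp add: ap.scaleR_right)
  qed (unfold v(1) e_string[OF v(2,3)], simp add: ap.zero_right)
  have eN: "e \<rhd> N \<rhd> v = ((real j + 1) * (real k - real j)) *\<^sub>R v"
  proof (cases "j = k")
    case True
    then have "N \<rhd> v = 0" using P_kill[OF v(2), of "Suc j"] v(1) by simp
    then show ?thesis using True by (simp add: ap.zero_right)
  next
    case False
    then show ?thesis using e_string[OF v(2), of "Suc j"] v by (simp add: add.commute)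
  qed
  have "(N * e + h) \<rhd> v = (real j * (real k - real j + 1) + (real k - 2 * real j)) *\<^sub>R v"
    by (simp only: ap_add ap_times Ne h scaleR_add_left)
  also have "real j * (real k - real j + 1) + (real k - 2 * real j) = (real j + 1) * (real k - real j)"
    by (simp add: algebra_simps)
  finally show "(e * N) \<rhd> v = (N * e + h) \<rhd> v" using eN by simp
qed

lemma e_P: "a \<in> P k \<Longrightarrow> e \<rhd> a = 0"
  using e_string[of a k 0] by simp

lemma e_V: "v \<in> V l \<Longrightarrow> e \<rhd> v \<in> V (l + 2)"
proof -
  assume v: "v \<in> V l"
  have "pr (m + 2) * e = e * pr m" for m
  proof (rule endo_eq_on_span[OF span_strings])
    fix v assume "v \<in> strings"
    then obtain j k a where v: "v = N ^ j \<rhd> a" "a \<in> P k" "j \<le> k" by (auto simp: strings_def)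
    have "e \<rhd> v \<in> V (int k - 2 * int j + 2)"
    proof (cases j)
      case (Suc j')
      then show ?thesis unfolding v(1) e_string[OF v(2,3)]
        using V_scaleR[OF string_V[OF v(2), of j']] by simp
    qed (use e_P v in simp)
    then show "(pr (m + 2) * e) \<rhd> v = (e * pr m) \<rhd> v"
      using pr_V[of "e \<rhd> v"] pr_V[OF string_V[OF v(2), of j]] v(1)
      by (simp add: ap.zero_right)
  qed
  then have "(pr (l + 2) * e) \<rhd> v = (e * pr l) \<rhd> v" by simp
  then show ?thesis using v by (simp add: V_pr)
qed

lemma commutator_h:
  assumes "clin A" "\<And>v l. v \<in> V l \<Longrightarrow> A \<rhd> v \<in> V (l + d)"
  shows "h * A = A * h + cop (of_int d) * A"
proof (rule clin_eqI)
  fix j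
  have "h \<rhd> A \<rhd> axis j 1 = of_int (wt j + d) *s (A \<rhd> axis j 1)"
    by (rule h_V[OF assms(2)[OF axis_V]])
  then show "(h * A) \<rhd> axis j 1 = (A * h + cop (of_int d) * A) \<rhd> axis j 1"
    unfolding ap_times ap_add h_V[OF axis_V] clin_ap[OF assms(1)]
    by (simp add: vec_eq_iff algebra_simps)
qed (use assms clin_h in auto)

lemma h_e: "h * e = e * h + 2 *\<^sub>R e"
proof -
  have "(cop 2 :: (complex^'n) endo) = 2 *\<^sub>R 1" using cop_of_real[of 2] by simp
  then show ?thesis using commutator_h[OF clin_e e_V] by simp
qed

lemma h_N: "h * N = N * h - 2 *\<^sub>R N"
proof -
  have "(cop (-2) :: (complex^'n) endo) = -2 *\<^sub>R 1" using cop_of_real[of "-2"] by simp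
  then show ?thesis using commutator_h[OF clin_N, of "-2"] N_V by simp
qed

lemma e_nilpotent: "e ^ (2 * bnd + 1) = 0"
  by (rule raise_nilpotent[OF clin_e _ e_V]) auto

text \<open>If \<open>e\<close> and \<open>N\<close> are represented by the elementary matrices E12
  and E21, this is the matrix with rows (0, -1/2) and (2, 0), a Weyl element. Its 2 is the one in 2
  Re x = x + cnj x, which appears when the conjugate of exp (- x N / z) is compared with the
  original.\<close>

definition w :: "(complex^'n) endo" where
  "w = exp (- (1/2) *\<^sub>R e) * exp (2 *\<^sub>R N) * exp (- (1/2) *\<^sub>R e)"

definition w' :: "(complex^'n) endo" where
  "w' = exp ((1/2) *\<^sub>R e) * exp (- 2 *\<^sub>R N) * exp ((1/2) *\<^sub>R e)"

lemma clin_w: "clin w" and clin_w': "clin w'"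
  unfolding w_def w'_def by (intro clin_mult clin_exp clin_scaleR clin_e clin_N)+

lemma exp_cancel: "exp (- r *\<^sub>R A) * exp (r *\<^sub>R A) = 1" "exp (r *\<^sub>R A) * exp (- r *\<^sub>R A) = 1"
  for A :: "(complex^'n) endo"
  using exp_minus_inverse[of "r *\<^sub>R A"] exp_minus_inverse[of "- r *\<^sub>R A"] by simp_all

lemma w_w': "w * w' = 1" and w'_w: "w' * w = 1"
proof -
  have "w * w' = exp (- (1/2) *\<^sub>R e) * exp (2 *\<^sub>R N) * (exp (- (1/2) *\<^sub>R e) * exp ((1/2) *\<^sub>R e)) * exp (- 2 *\<^sub>R N) * exp ((1/2) *\<^sub>R e)"
    by (simp only: w_def w'_def mult.assoc)
  also have "\<dots> = exp (- (1/2) *\<^sub>R e) * (exp (2 *\<^sub>R N) * exp (- 2 *\<^sub>R N)) * exp ((1/2) *\<^sub>R e)"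
    by (simp only: exp_cancel mult_1_right mult.assoc)
  finally show "w * w' = 1" by (simp only: exp_cancel mult_1_right)
  have "w' * w = exp ((1/2) *\<^sub>R e) * exp (- 2 *\<^sub>R N) * (exp ((1/2) *\<^sub>R e) * exp (- (1/2) *\<^sub>R e)) * exp (2 *\<^sub>R N) * exp (- (1/2) *\<^sub>R e)"
    by (simp only: w_def w'_def mult.assoc)
  also have "\<dots> = exp ((1/2) *\<^sub>R e) * (exp (- 2 *\<^sub>R N) * exp (2 *\<^sub>R N)) * exp (- (1/2) *\<^sub>R e)"
    by (simp only: exp_cancel mult_1_right mult.assoc)
  finally show "w' * w = 1" by (simp only: exp_cancel mult_1_right)
qed

text \<open>Passing through the three factors of \<open>w\<close>, the operator \<open>h\<close>
  becomes h + e, then e - h, then - h. Hence \<open>w\<close> reverses weights.\<close>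

lemma w_h: "w * h = - h * w"
proof -
  have 1: "exp (- (1/2) *\<^sub>R e) * h = (h + e) * exp (- (1/2) *\<^sub>R e)"
    using exp_ad2[of "- (1/2) *\<^sub>R e" h e 0] by (simp add: h_e algebra_simps)
  have 2: "exp (2 *\<^sub>R N) * (h + e) = (e - h) * exp (2 *\<^sub>R N)"
  proof -
    have "exp (2 *\<^sub>R N) * (h + e) = (h + e + (4 *\<^sub>R N - 2 *\<^sub>R h) + (1/2) *\<^sub>R (- 8 *\<^sub>R N)) * exp (2 *\<^sub>R N)"
      by (rule exp_ad2) (simp_all add: h_N e_N algebra_simps)
    also have "h + e + (4 *\<^sub>R N - 2 *\<^sub>R h) + (1/2) *\<^sub>R (- 8 *\<^sub>R N) = e - h"
      by (simp add: algebra_simps scaleR_2)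
    finally show ?thesis .
  qed
  have 3: "exp (- (1/2) *\<^sub>R e) * (e - h) = - h * exp (- (1/2) *\<^sub>R e)"
    using exp_ad2[of "- (1/2) *\<^sub>R e" "e - h" "- e" 0] by (simp add: h_e algebra_simps)
  have "w * h = exp (- (1/2) *\<^sub>R e) * (exp (2 *\<^sub>R N) * (exp (- (1/2) *\<^sub>R e) * h))"
    by (simp only: w_def mult.assoc)
  also have "\<dots> = exp (- (1/2) *\<^sub>R e) * (exp (2 *\<^sub>R N) * (h + e)) * exp (- (1/2) *\<^sub>R e)"
    by (simp only: 1 mult.assoc)
  also have "\<dots> = (exp (- (1/2) *\<^sub>R e) * (e - h)) * exp (2 *\<^sub>R N) * exp (- (1/2) *\<^sub>R e)"
    by (simp only: 2 mult.assoc)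
  also have "\<dots> = - h * w" by (simp only: 3 w_def mult.assoc)
  finally show ?thesis .
qed

lemma w_e: "w * e = - 4 *\<^sub>R (N * w)"
proof -
  have 1: "exp (- (1/2) *\<^sub>R e) * e = e * exp (- (1/2) *\<^sub>R e)"
    by (rule exp_intertwine[symmetric]) simp
  have 2: "exp (2 *\<^sub>R N) * e = (e - 2 *\<^sub>R h - 4 *\<^sub>R N) * exp (2 *\<^sub>R N)"
  proof -
    have "exp (2 *\<^sub>R N) * e = (e + (- 2 *\<^sub>R h) + (1/2) *\<^sub>R (- 8 *\<^sub>R N)) * exp (2 *\<^sub>R N)"
      by (rule exp_ad2) (simp_all add: h_N e_N algebra_simps)
    then show ?thesis by (simp add: algebra_simps)
  qed
  have 3: "exp (- (1/2) *\<^sub>R e) * (e - 2 *\<^sub>R h - 4 *\<^sub>R N) = - 4 *\<^sub>R N * exp (- (1/2) *\<^sub>R e)"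
  proof -
    have "exp (- (1/2) *\<^sub>R e) * (e - 2 *\<^sub>R h - 4 *\<^sub>R N) =
      (e - 2 *\<^sub>R h - 4 *\<^sub>R N + (2 *\<^sub>R h - 2 *\<^sub>R e) + (1/2) *\<^sub>R (2 *\<^sub>R e)) * exp (- (1/2) *\<^sub>R e)"
      by (rule exp_ad2) (simp_all add: h_e e_N algebra_simps)
    also have "e - 2 *\<^sub>R h - 4 *\<^sub>R N + (2 *\<^sub>R h - 2 *\<^sub>R e) + (1/2) *\<^sub>R (2 *\<^sub>R e) = - 4 *\<^sub>R N"
      by (simp add: scaleR_2)
    finally show ?thesis .
  qed
  have "w * e = exp (- (1/2) *\<^sub>R e) * (exp (2 *\<^sub>R N) * (exp (- (1/2) *\<^sub>R e) * e))"
    by (simp only: w_def mult.assoc)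
  also have "\<dots> = exp (- (1/2) *\<^sub>R e) * (exp (2 *\<^sub>R N) * e) * exp (- (1/2) *\<^sub>R e)"
    by (simp only: 1 mult.assoc)
  also have "\<dots> = (exp (- (1/2) *\<^sub>R e) * (e - 2 *\<^sub>R h - 4 *\<^sub>R N)) * exp (2 *\<^sub>R N) * exp (- (1/2) *\<^sub>R e)"
    by (simp only: 2 mult.assoc)
  also have "\<dots> = - 4 *\<^sub>R (N * w)" by (simp only: 3 w_def mult.assoc mult_scaleR_left)
  finally show ?thesis .
qed

lemma w'_N: "w' * N = - (1/4) *\<^sub>R (e * w')"
proof -
  have "w' * (w * e) * w' = - 4 *\<^sub>R (w' * N * (w * w'))"
    by (simp add: w_e mult.assoc)
  then have "e * w' = - 4 *\<^sub>R (w' * N)"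
    by (simp add: w_w' w'_w flip: mult.assoc)
  then show ?thesis by simp
qed

lemma w_V: "v \<in> V l \<Longrightarrow> w \<rhd> v \<in> V (- l)"
proof -
  assume v: "v \<in> V l"
  have "(w * h) \<rhd> v = (- h * w) \<rhd> v" by (simp only: w_h)
  then have "of_int l *s (w \<rhd> v) = - (h \<rhd> w \<rhd> v)"
    by (simp add: h_V[OF v] clin_ap[OF clin_w])
  then have "of_int l * (w \<rhd> v) $ i = - (of_int (wt i) * (w \<rhd> v) $ i)" for i
    by (simp add: h_def vec_eq_iff)
  then have "of_int (l + wt i) * (w \<rhd> v) $ i = 0" for i
    by (simp add: distrib_right)
  then have "(w \<rhd> v) $ i = 0 \<or> l + wt i = 0" for i
    using of_int_eq_0_iff mult_eq_0_iff by blast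
  then show ?thesis by (auto simp: V_def eq_neg_iff_add_eq_0 add.commute)
qed

lemma dg_weight: "v \<in> V l \<Longrightarrow> dg (\<lambda>i. f (wt i)) \<rhd> v = f l *s v"
  by (auto simp: V_def vec_eq_iff)

lemma dg_intertwine:
  assumes "clin A" "\<And>v l. v \<in> V l \<Longrightarrow> A \<rhd> v \<in> V (s l)"
    "\<And>l. g (s l) = c * f l"
  shows "dg (\<lambda>i. g (wt i)) * A = cop c * A * dg (\<lambda>i. f (wt i))"
proof (rule clin_eqI)
  fix j
  have "dg (\<lambda>i. g (wt i)) \<rhd> A \<rhd> axis j 1 = g (s (wt j)) *s (A \<rhd> axis j 1)"
    by (rule dg_weight[OF assms(2)[OF axis_V]])
  then show "(dg (\<lambda>i. g (wt i)) * A) \<rhd> axis j 1 = (cop c * A * dg (\<lambda>i. f (wt i))) \<rhd> axis j 1"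
    unfolding ap_times dg_weight[OF axis_V] clin_ap[OF assms(1)] assms(3) by simp
qed (use assms in auto)

definition Zh :: "complex \<Rightarrow> (complex^'n) endo" where
  "Zh z = dg (\<lambda>i. z powi wt i)"

lemma clin_Zh: "clin (Zh z)" by (simp add: Zh_def)

lemma Zh_mult: "z \<noteq> 0 \<Longrightarrow> Zh z * Zh z = Zh (z\<^sup>2)"
  by (simp add: Zh_def dg_mult power_int_mult_distrib power2_eq_square)

lemma Zh_inverse: "z \<noteq> 0 \<Longrightarrow> Zh z * Zh (1 / z) = 1" "z \<noteq> 0 \<Longrightarrow> Zh (1 / z) * Zh z = 1"
  by (simp_all add: Zh_def dg_mult power_int_divide_distrib)

lemma Zh_e: "z \<noteq> 0 \<Longrightarrow> Zh z * e = cop (z\<^sup>2) * e * Zh z"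
  unfolding Zh_def by (rule dg_intertwine[OF clin_e e_V], assumption, erule powi_plus_two)

lemma Zh_N: "z \<noteq> 0 \<Longrightarrow> Zh z * N = cop (1 / z\<^sup>2) * N * Zh z"
  unfolding Zh_def by (rule dg_intertwine[OF clin_N N_V], assumption, erule powi_minus_two)

lemma Zh_w: "z \<noteq> 0 \<Longrightarrow> Zh z * w = w * Zh (1 / z)"
  unfolding Zh_def using dg_intertwine[OF clin_w w_V, where g = "\<lambda>i. z powi i" and c = 1 and f = "\<lambda>i. (1 / z) powi i"]
  by (simp add: power_int_minus power_int_divide_distrib field_simps)

text \<open>By definition w exp (e / 2) = exp (- e / 2) exp (2 N). Multiply by y^h on both sides,
  where y is a square root of z: moving y^h across multiplies \<open>e\<close> by z and
  \<open>N\<close> by 1 / z, it turns into its inverse at \<open>w\<close>, and the two outer copies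
  combine to z^h, which is \<open>Zh z\<close>.\<close>

lemma birkhoff_factorization:
  assumes "z \<noteq> 0"
  shows "exp (cop (2 / z) * N) * Zh z = exp (cop (z / 2) * e) * w * exp (cop (1 / (2 * z)) * e)"
proof -
  define y where "y = csqrt z"
  have y: "y\<^sup>2 = z" "y \<noteq> 0" using assms by (auto simp: y_def)
  have cop_r: "cop (of_real r * c) = r *\<^sub>R (cop c :: (complex^'n) endo)" for r c
    by (rule cop_scaleR)
  have 1: "exp ((1/2) *\<^sub>R e) * Zh y = Zh y * exp (cop (1 / (2 * z)) * e)"
  proof (rule exp_intertwine[symmetric])
    have "Zh y * (cop (1 / (2 * z)) * e) = cop (1 / (2 * z)) * (Zh y * e)"
      using clinD[OF clin_Zh] by (metis mult.assoc)
    also have "\<dots> = cop (1 / (2 * z) * z) * e * Zh y"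
      unfolding Zh_e[OF y(2)] y(1) by (simp only: cop_mult mult.assoc)
    finally show "Zh y * (cop (1 / (2 * z)) * e) = (1/2) *\<^sub>R e * Zh y"
      using assms cop_r[of "1/2" 1] by (simp add: mult.assoc)
  qed
  have 2: "Zh y * exp (- (1/2) *\<^sub>R e) = exp (cop (- z / 2) * e) * Zh y"
  proof (rule exp_intertwine)
    show "Zh y * (- (1/2) *\<^sub>R e) = cop (- z / 2) * e * Zh y"
      using Zh_e[OF y(2)] y(1) cop_r[of "- 1/2" z] by (simp add: mult.assoc)
  qed
  have 3: "Zh y * exp (2 *\<^sub>R N) = exp (cop (2 / z) * N) * Zh y"
  proof (rule exp_intertwine)
    show "Zh y * (2 *\<^sub>R N) = cop (2 / z) * N * Zh y"
      using Zh_N[OF y(2)] y(1) cop_r[of 2 "1 / z"] by (simp add: mult.assoc)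
  qed
  have 4: "w * exp ((1/2) *\<^sub>R e) = exp (- (1/2) *\<^sub>R e) * exp (2 *\<^sub>R N)"
    unfolding w_def by (simp only: mult.assoc exp_cancel mult_1_right)
  have 5: "exp (cop (z / 2) * e) * exp (cop (- z / 2) * e) = 1"
    using exp_minus_inverse[of "cop (z / 2) * e"] by (simp add: cop_minus)
  have "w * exp (cop (1 / (2 * z)) * e) = w * (Zh (1 / y) * Zh y) * exp (cop (1 / (2 * z)) * e)"
    by (simp add: Zh_inverse y)
  also have "\<dots> = (w * Zh (1 / y)) * (Zh y * exp (cop (1 / (2 * z)) * e))"
    by (simp only: mult.assoc)
  also have "\<dots> = Zh y * (w * exp ((1/2) *\<^sub>R e)) * Zh y"
    by (simp only: Zh_w[OF y(2), symmetric] 1[symmetric] mult.assoc)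
  also have "\<dots> = exp (cop (- z / 2) * e) * (Zh y * exp (2 *\<^sub>R N)) * Zh y"
    by (simp only: 4 2 mult.assoc[symmetric])
  also have "\<dots> = exp (cop (- z / 2) * e) * exp (cop (2 / z) * N) * Zh z"
    unfolding 3 using Zh_mult[OF y(2)] y(1) by (simp add: mult.assoc)
  finally have "exp (cop (z / 2) * e) * w * exp (cop (1 / (2 * z)) * e)
      = (exp (cop (z / 2) * e) * exp (cop (- z / 2) * e)) * exp (cop (2 / z) * N) * Zh z"
    by (simp only: mult.assoc)
  then show ?thesis by (simp only: 5 mult_1_left)
qed

lemma e_power_top:
  assumes a: "a \<in> P k" "j \<le> k"
  shows "\<exists>r>0. e ^ j \<rhd> N ^ k \<rhd> a = r *\<^sub>R (N ^ (k - j) \<rhd> a)"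
  using assms(2)
proof (induction j)
  case 0
  then show ?case by (intro exI[of _ 1]) simp
next
  case (Suc j)
  then obtain r where r: "r > 0" "e ^ j \<rhd> N ^ k \<rhd> a = r *\<^sub>R (N ^ (k - j) \<rhd> a)" by auto
  have "e ^ Suc j \<rhd> N ^ k \<rhd> a = (r * (real (k - j) * (real k - real (k - j) + 1))) *\<^sub>R (N ^ (k - j - 1) \<rhd> a)"
    using r(2) e_string[OF a(1), of "k - j"] by (simp add: ap.scaleR_right)
  moreover have "0 < r * (real (k - j) * (real k - real (k - j) + 1))"
    using r(1) Suc.prems by (intro mult_pos_pos) auto
  ultimately show ?case using Suc.prems by (metis diff_Suc_eq_diff_pred diff_commute)
qed

text \<open>Since \<open>w'\<close> reverses weights, only the component of weight - k of exp (e /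
  2) exp (- 2 N) exp (e / 2) a matters. The rightmost factor fixes the primitive \<open>a\<close>.
  From N^i a with i at most k, raising can never produce weight - k except when i = k and nothing is
  raised, so only the coefficient of N^k survives.\<close>

lemma w'_primitive:
  assumes a: "a \<in> P k"
  shows "w' \<rhd> a = ((-2) ^ k / fact k) *\<^sub>R (N ^ k \<rhd> a)"
proof -
  have aV: "a \<in> V (int k)" using a by (simp add: P_def)
  have "w \<rhd> w' \<rhd> a = a" using w_w' by (metis ap_times ap_one)
  have V: "w' \<rhd> a \<in> V (- int k)"
  proof -
    have "pr l \<rhd> w' \<rhd> a = w' \<rhd> pr (- l) \<rhd> a" for l
    proof -
      have "pr l * w' = w' * pr (- l)"
      proof -
        have "w * pr l = pr (- l) * w"
          unfolding pr_def
          using dg_intertwine[OF clin_w w_V, where g = "\<lambda>i. if i = - l then 1 else 0" and c = 1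
              and f = "\<lambda>i. if i = l then 1 else 0"]
          by auto
        then have "w' * (w * pr l) * w' = w' * (pr (- l) * w) * w'" by simp
        then have "(w' * w) * pr l * w' = w' * pr (- l) * (w * w')" by (simp only: mult.assoc)
        then show ?thesis by (simp add: w_w' w'_w)
      qed
      then show ?thesis by (metis ap_times)
    qed
    then show ?thesis using pr_V[OF aV, of "int k"] by (simp add: V_pr)
  qed
  have exp_e: "exp ((1/2) *\<^sub>R e) = (\<Sum>l<2*bnd+1. ((1/2) *\<^sub>R e) ^ l /\<^sub>R fact l)"
    by (rule exp_nilpotent) (simp only: e_nilpotent scaleR_power scaleR_zero_right)
  have pe: "pr (- int k) \<rhd> exp ((1/2) *\<^sub>R e) \<rhd> N ^ i \<rhd> a = pr (- int k) \<rhd> N ^ i \<rhd> a" for i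
  proof (cases "i \<le> k")
    case False
    then show ?thesis using P_kill[OF a] by (simp add: ap.zero_right)
  next
    case True
    have "e ^ l \<rhd> N ^ i \<rhd> a \<in> V (int k - 2 * int i + 2 * int l)" for l
    proof (induction l)
      case (Suc l)
      show ?case using e_V[OF Suc.IH] by (simp add: algebra_simps)
    qed (simp add: string_V[OF a])
    from pr_V[OF this] have p: "pr (- int k) \<rhd> e ^ l \<rhd> N ^ i \<rhd> a = 0" if "l \<noteq> 0" for l
      using True that by simp
    have z: "pr (- int k) \<rhd> (((1/2) *\<^sub>R e) ^ l /\<^sub>R fact l) \<rhd> N ^ i \<rhd> a = 0" if "l \<noteq> 0" for l
      by (simp only: scaleR_power ap.scaleR_right ap_scaleR p[OF that] scaleR_zero_right)
    have "pr (- int k) \<rhd> exp ((1/2) *\<^sub>R e) \<rhd> N ^ i \<rhd> a =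
        (\<Sum>l<2*bnd+1. pr (- int k) \<rhd> (((1/2) *\<^sub>R e) ^ l /\<^sub>R fact l) \<rhd> N ^ i \<rhd> a)"
      unfolding exp_e by (simp only: ap_sum ap.sum_right)
    also have "\<dots> = (\<Sum>l<2*bnd+1. if l = 0 then pr (- int k) \<rhd> N ^ i \<rhd> a else 0)"
    proof (intro sum.cong refl)
      fix l show "pr (- int k) \<rhd> (((1/2) *\<^sub>R e) ^ l /\<^sub>R fact l) \<rhd> N ^ i \<rhd> a =
        (if l = 0 then pr (- int k) \<rhd> N ^ i \<rhd> a else 0)"
      proof (cases "l = 0")
        case False
        then show ?thesis by (simp only: z[OF False] if_False)
      qed simp
    qed
    finally show ?thesis by simp
  qed
  have expa: "exp ((1/2) *\<^sub>R e) \<rhd> a = a"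
  proof -
    have "(((1/2) *\<^sub>R e) ^ l /\<^sub>R fact l) \<rhd> a = (if l = 0 then a else 0)" for l
      using e_P[OF a] by (cases l) (simp_all add: scaleR_power power_Suc2 ap.zero_right del: power_Suc)
    then show ?thesis unfolding exp_e ap_sum by simp
  qed
  have "(-2 *\<^sub>R N) ^ (Suc k + (2 * bnd + 1)) = 0"
    by (simp only: scaleR_power power_add[of N "Suc k"] N_nilpotent mult_zero_right scaleR_zero_right)
  then have expN: "exp (-2 *\<^sub>R N) = (\<Sum>i<Suc k + (2*bnd+1). (-2 *\<^sub>R N) ^ i /\<^sub>R fact i)"
    by (rule exp_nilpotent)
  have "w' \<rhd> a = pr (- int k) \<rhd> w' \<rhd> a" using V by (simp add: V_pr)
  also have "\<dots> = pr (- int k) \<rhd> exp ((1/2) *\<^sub>R e) \<rhd> exp (-2 *\<^sub>R N) \<rhd> a"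
    by (simp add: w'_def expa)
  also have "\<dots> = (\<Sum>i<Suc k + (2*bnd+1). pr (- int k) \<rhd> exp ((1/2) *\<^sub>R e) \<rhd> ((-2 *\<^sub>R N) ^ i /\<^sub>R fact i) \<rhd> a)"
    unfolding expN by (simp only: ap_sum ap.sum_right)
  also have "\<dots> = (\<Sum>i<Suc k + (2*bnd+1). if i = k then ((-2) ^ k / fact k) *\<^sub>R (N ^ k \<rhd> a) else 0)"
  proof (intro sum.cong refl)
    fix i
    have "pr (- int k) \<rhd> exp ((1/2) *\<^sub>R e) \<rhd> ((-2 *\<^sub>R N) ^ i /\<^sub>R fact i) \<rhd> a
        = ((-2) ^ i / fact i) *\<^sub>R (pr (- int k) \<rhd> N ^ i \<rhd> a)"
      by (simp only: scaleR_power ap_scaleR ap.scaleR_right pe scaleR_scaleR) (simp add: divide_inverse mult.commute)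
    then show "pr (- int k) \<rhd> exp ((1/2) *\<^sub>R e) \<rhd> ((-2 *\<^sub>R N) ^ i /\<^sub>R fact i) \<rhd> a =
      (if i = k then ((-2) ^ k / fact k) *\<^sub>R (N ^ k \<rhd> a) else 0)"
      using pr_V[OF string_V[OF a, of i], of "- int k"] by auto
  qed
  finally show ?thesis by simp
qed

text \<open>Moving N^j through \<open>w'\<close> replaces it by e^j up to (-1/4)^j, and e^j climbs
  from the bottom N^k a of the string with positive coefficients. Only the sign is recorded: (-1)^j
  from this exchange and (-1)^k from \<open>w'_primitive\<close>.\<close>

lemma w'_string:
  assumes a: "a \<in> P k" "j \<le> k"
  shows "\<exists>r>0. w' \<rhd> N ^ j \<rhd> a = ((-1) ^ (j + k) * r) *\<^sub>R (N ^ (k - j) \<rhd> a)"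
proof -
  have "w' * N ^ i = ((-1/4) ^ i) *\<^sub>R (e ^ i * w')" for i
  proof (induction i)
    case (Suc i)
    have "w' * N ^ Suc i = (w' * N ^ i) * N" by (simp only: power_Suc2 mult.assoc)
    also have "\<dots> = ((-1/4) ^ i) *\<^sub>R (e ^ i * (w' * N))" by (simp only: Suc.IH mult_scaleR_left mult.assoc)
    also have "\<dots> = ((-1/4) ^ Suc i) *\<^sub>R (e ^ Suc i * w')"
      by (simp add: w'_N mult.assoc power_commutes flip: mult.assoc)
    finally show ?case .
  qed simp
  then have "(w' * N ^ j) \<rhd> a = ((-1/4) ^ j) *\<^sub>R (e ^ j * w') \<rhd> a" by simp
  then have 1: "w' \<rhd> N ^ j \<rhd> a = ((-1/4) ^ j * ((-2) ^ k / fact k)) *\<^sub>R (e ^ j \<rhd> N ^ k \<rhd> a)"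
    by (simp add: w'_primitive[OF a(1)] ap.scaleR_right)
  obtain r where r: "r > 0" "e ^ j \<rhd> N ^ k \<rhd> a = r *\<^sub>R (N ^ (k - j) \<rhd> a)"
    using e_power_top[OF a] by blast
  have "(-1/4::real) ^ j = (-1) ^ j * (1/4) ^ j" "(-2::real) ^ k = (-1) ^ k * 2 ^ k"
    by (simp_all flip: power_mult_distrib)
  then have "w' \<rhd> N ^ j \<rhd> a = ((-1) ^ (j + k) * ((1/4) ^ j * 2 ^ k / fact k * r)) *\<^sub>R (N ^ (k - j) \<rhd> a)"
    by (simp add: 1 r(2) power_add mult_ac)
  then show ?thesis using r(1) by (intro exI[of _ "(1/4) ^ j * 2 ^ k / fact k * r"]) simp
qed

text \<open>For a primitive \<open>a\<close> of weight \<open>k\<close> and m > k, anticommutation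
  gives N^m K a = 0 up to sign of K N^m a. As N^m is injective on weight m, the component of K a of
  weight m vanishes. The other members of the string follow by applying powers of
  \<open>N\<close>.\<close>

lemma antilinear_lowers_weight:
  assumes K: "K * N = - N * K" and nz: "(K \<rhd> axis j 1) $ i \<noteq> 0"
  shows "wt i \<le> wt j"
proof -
  have Kpow: "K * N ^ k = (-1) ^ k * N ^ k * K" for k
  proof (induction k)
    case (Suc k)
    have "K * N ^ Suc k = (K * N) * N ^ k" by (simp only: power_Suc mult.assoc)
    also have "\<dots> = - N * (K * N ^ k)" by (simp only: K mult.assoc)
    also have "\<dots> = (-1) ^ Suc k * N ^ Suc k * K"
      by (cases "even k") (simp_all add: Suc.IH mult.assoc)
    finally show ?case .
  qed simp
  have prim: "wt i \<le> int k" if a: "a \<in> P k" and i: "(K \<rhd> a) $ i \<noteq> 0" for a k i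
  proof (rule ccontr)
    assume "\<not> wt i \<le> int k"
    then obtain m where m: "wt i = int m" "m > k" by (metis linorder_not_le nonneg_int_cases of_nat_0_le_iff of_nat_less_iff order_trans less_imp_le)
    have "N ^ m \<rhd> K \<rhd> a = 0"
    proof -
      have "(K * N ^ m) \<rhd> a = 0" using P_kill[OF a m(2)] by (simp add: ap.zero_right)
      then show ?thesis unfolding Kpow by (cases "even m") simp_all
    qed
    moreover have "pr (- int m) * N ^ m = N ^ m * pr (int m)"
      unfolding pr_def
      using dg_intertwine[OF clin_power[OF clin_N, of m] Npow_V[of _ _ m],
          where g = "\<lambda>l. if l = - int m then 1 else 0" and c = 1 and f = "\<lambda>l. if l = int m then 1 else 0"] by auto
    ultimately have "N ^ m \<rhd> pr (int m) \<rhd> K \<rhd> a = 0"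
      by (metis ap_times ap.zero_right)
    then have "pr (int m) \<rhd> K \<rhd> a = 0" using Npow_inj pr_in_V by blast
    then have "(pr (int m) \<rhd> K \<rhd> a) $ i = 0" by simp
    then show False using i m(1) by (simp add: pr_def)
  qed
  \<comment> \<open>Imposing the inequality on each weight component separately makes
    \<open>T\<close> a subspace, so that span induction over the strings applies.\<close>
  define T where "T = {v. \<forall>l i. (K \<rhd> pr l \<rhd> v) $ i \<noteq> 0 \<longrightarrow> wt i \<le> l}"
  have "axis j 1 \<in> span strings" by (simp add: span_strings)
  then have "axis j 1 \<in> T"
  proof (induction rule: span_induct)
    show "subspace {v. v \<in> T}"
      by (rule subspaceI) (force simp: T_def ap.zero_right ap.add_right ap.scaleR_right)+
    fix v assume "v \<in> strings"
    then obtain q k a where v: "v = N ^ q \<rhd> a" "a \<in> P k" "q \<le> k" by (auto simp: strings_def)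
    have Kv: "K \<rhd> v = (-1) ^ q *\<^sub>R (N ^ q \<rhd> K \<rhd> a)"
    proof -
      have "K \<rhd> v = (K * N ^ q) \<rhd> a" by (simp add: v(1))
      then show ?thesis unfolding Kpow by (cases "even q") simp_all
    qed
    have "wt i \<le> int k - 2 * int q" if "(K \<rhd> v) $ i \<noteq> 0" for i
    proof -
      have "(N ^ q \<rhd> K \<rhd> a) $ i \<noteq> 0" using that by (auto simp: Kv)
      then have "(\<Sum>j\<in>UNIV. (K \<rhd> a) $ j * (N ^ q \<rhd> axis j 1) $ i) \<noteq> 0"
        by (subst (asm) clin_expand[OF clin_power[OF clin_N]]) simp
      then obtain j where "(K \<rhd> a) $ j * (N ^ q \<rhd> axis j 1) $ i \<noteq> 0"
        using sum.not_neutral_contains_not_neutral by blast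
      then have "wt j \<le> int k" "wt i = wt j - 2 * int q"
        using prim[OF v(2)] Npow_V[OF axis_V, of q j] by (auto simp: V_def)
      then show ?thesis by simp
    qed
    then show "v \<in> T"
      using pr_V[OF string_V[OF v(2), of q]] v(1) by (auto simp: T_def ap.zero_right)
  qed
  then show ?thesis using nz pr_V[OF axis_V, of "wt j" j] by (auto simp: T_def dest: spec[of _ "wt j"])
qed

end

section \<open>Operators on orbifold cohomology\<close>

lemma clin_Op: "Vector_Spaces.linear (*s) (*s) f \<Longrightarrow> clin (Op f)"
  unfolding clin_def
proof (intro allI endo_eqI)
  fix c v assume f: "Vector_Spaces.linear (*s) (*s) f"
  interpret f: Vector_Spaces.linear "(*s)" "(*s)" f by fact
  show "(Op f * cop c) \<rhd> v = (cop c * Op f) \<rhd> v"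
    using linear_of_clinear[OF f] by (simp add: f.scale)
qed

lemma sum_mult_delta:
  "(\<Sum>j\<in>UNIV. c j * (if j = i then 1 else 0)) = (c i :: 'a::semiring_1)"
  "(\<Sum>j\<in>UNIV. (if i = j then 1 else 0) * c j) = (c i :: 'a::semiring_1)" for i :: "'b::finite"
  by (simp_all add: if_distrib[of "\<lambda>x. _ * x"] if_distrib[of "\<lambda>x. x * _"] cong: if_cong)

context orbifold_cohomology
begin

sublocale cup: Vector_Spaces.linear "(*s)" "(*s)" "cup X \<alpha>" for \<alpha>
  by (rule cup_linear)
sublocale integ: Vector_Spaces.linear "(*s)" "(*)" "integ X"
  by (rule integ_linear)
sublocale prs: Vector_Spaces.linear "(*s)" "(*s)" "prs X"
  by (rule prs_linear)
sublocale invs: Vector_Spaces.linear "(*s)" "(*s)" "invs X"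
  by (rule invs_linear)

definition Act :: "complex^'n \<Rightarrow> (complex^'n) endo" where
  "Act \<tau> = Op (act X \<tau>)"

lemma act_clinear: "Vector_Spaces.linear (*s) (*s) (act X \<tau>)"
  unfolding act_def by (rule cup_linear)

lemma ap_Act [simp]: "Act \<tau> \<rhd> v = act X \<tau> v"
  by (simp add: Act_def linear_of_clinear[OF act_clinear])

lemma clin_Act [simp]: "clin (Act \<tau>)"
  by (simp add: Act_def clin_Op act_clinear)

lemma cup_add_left: "cup X (\<alpha> + \<beta>) \<gamma> = cup X \<alpha> \<gamma> + cup X \<beta> \<gamma>"
  by (simp add: cup_commute[of _ \<gamma>] cup.add)
lemma cup_scale_left: "cup X (c *s \<alpha>) \<gamma> = c *s cup X \<alpha> \<gamma>"
  by (simp add: cup_commute[of _ \<gamma>] cup.scale)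

lemma Act_scale: "Act (c *s \<tau>) = cop c * Act \<tau>"
  by (rule endo_eqI) (simp add: act_def prs.scale cup_scale_left)
lemma Act_add: "Act (\<sigma> + \<tau>) = Act \<sigma> + Act \<tau>"
  by (rule endo_eqI) (simp add: act_def prs.add cup_add_left)

lemma orb_pair_add_left: "orb_pair X (\<alpha> + \<beta>) \<gamma> = orb_pair X \<alpha> \<gamma> + orb_pair X \<beta> \<gamma>"
  by (simp add: orb_pair_def cup_add_left integ.add)
lemma orb_pair_scale_left: "orb_pair X (c *s \<alpha>) \<gamma> = c * orb_pair X \<alpha> \<gamma>"
  by (simp add: orb_pair_def cup_scale_left integ.scale)

lemma orb_pair_sym: "orb_pair X \<alpha> \<beta> = orb_pair X \<beta> \<alpha>"
proof -
  have "orb_pair X \<alpha> \<beta> = integ X (invs X (cup X \<alpha> (invs X \<beta>)))" by (simp add: orb_pair_def integ_invs)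
  also have "\<dots> = orb_pair X \<beta> \<alpha>" by (simp add: invs_cup invs_invs orb_pair_def cup_commute)
  finally show ?thesis .
qed

lemma orb_pair_add_right: "orb_pair X \<gamma> (\<alpha> + \<beta>) = orb_pair X \<gamma> \<alpha> + orb_pair X \<gamma> \<beta>"
  by (metis orb_pair_sym orb_pair_add_left)
lemma orb_pair_scale_right: "orb_pair X \<gamma> (c *s \<alpha>) = c * orb_pair X \<gamma> \<alpha>"
  by (metis orb_pair_sym orb_pair_scale_left)

lemma orb_pair_zero [simp]: "orb_pair X 0 \<alpha> = 0" "orb_pair X \<alpha> 0 = 0"
  using orb_pair_scale_left[of 0 0 \<alpha>] orb_pair_scale_right[of \<alpha> 0 0] by simp_all
lemma orb_pair_minus_left: "orb_pair X (- \<alpha>) \<beta> = - orb_pair X \<alpha> \<beta>"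
  using orb_pair_scale_left[of "-1" \<alpha> \<beta>] by simp
lemma orb_pair_diff_left: "orb_pair X (\<alpha> - \<beta>) \<gamma> = orb_pair X \<alpha> \<gamma> - orb_pair X \<beta> \<gamma>"
  using orb_pair_add_left[of \<alpha> "- \<beta>" \<gamma>] by (simp add: orb_pair_minus_left)
lemma orb_pair_diff_right: "orb_pair X \<gamma> (\<alpha> - \<beta>) = orb_pair X \<gamma> \<alpha> - orb_pair X \<gamma> \<beta>"
  by (metis orb_pair_sym orb_pair_diff_left)
lemma orb_pair_sum_left: "orb_pair X (\<Sum>i\<in>J. f i) \<beta> = (\<Sum>i\<in>J. orb_pair X (f i) \<beta>)"
  by (induction J rule: infinite_finite_induct) (simp_all add: orb_pair_add_left)
lemma orb_pair_sum_right: "orb_pair X \<beta> (\<Sum>i\<in>J. f i) = (\<Sum>i\<in>J. orb_pair X \<beta> (f i))"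
  by (induction J rule: infinite_finite_induct) (simp_all add: orb_pair_add_right)

lemma orb_pair_nondegenerate: "(\<And>\<beta>. orb_pair X \<alpha> \<beta> = 0) \<Longrightarrow> \<alpha> = 0"
  unfolding orb_pair_def by (rule poincare) (metis invs_invs)

lemma orb_pair_eqI: "(\<And>\<beta>. orb_pair X \<alpha> \<beta> = orb_pair X \<alpha>' \<beta>) \<Longrightarrow> \<alpha> = \<alpha>'"
  using orb_pair_nondegenerate[of "\<alpha> - \<alpha>'"] by (simp add: orb_pair_diff_left)

lemma Hgr_Hsec: "\<alpha> \<in> Hgr X v k \<Longrightarrow> \<alpha> \<in> Hsec X v"
  by (auto simp: Hgr_def Hsec_def)

lemma Act_selfadjoint:
  assumes "\<tau> \<in> Hsec X (untw X)"
  shows "orb_pair X (act X \<tau> \<alpha>) \<beta> = orb_pair X \<alpha> (act X \<tau> \<beta>)"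
  unfolding orb_pair_def act_def invs_cup invs_prs[OF assms]
  by (simp add: cup_commute[of "prs X \<tau>" \<alpha>] cup_assoc)

lemma orb_pair_exists:
  assumes "Vector_Spaces.linear (*s) (*) (f :: complex^'n \<Rightarrow> complex)"
  obtains \<alpha> where "\<And>\<beta>. orb_pair X \<alpha> \<beta> = f \<beta>"
proof -
  interpret f: Vector_Spaces.linear "(*s)" "(*)" f by fact
  define L where "L \<alpha> = (\<chi> i. orb_pair X \<alpha> (axis i 1))" for \<alpha>
  have lin: "Vector_Spaces.linear (*s) (*s) L"
    by unfold_locales
      (simp_all add: L_def vec_eq_iff orb_pair_add_left orb_pair_scale_left algebra_simps)
  have expand: "orb_pair X \<alpha> \<beta> = (\<Sum>i\<in>UNIV. \<beta> $ i * L \<alpha> $ i)" for \<alpha> \<beta>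
    by (subst vec_expand[of \<beta>]) (simp add: orb_pair_sum_right orb_pair_scale_right L_def)
  have "inj L"
  proof (rule injI)
    fix \<alpha> \<beta> assume "L \<alpha> = L \<beta>"
    then show "\<alpha> = \<beta>" by (intro orb_pair_eqI) (simp add: expand)
  qed
  then have "surj L" by (rule vec.linear_inj_imp_surj[OF lin])
  then obtain \<alpha> where "L \<alpha> = (\<chi> i. f (axis i 1))" by (metis surjD)
  then have "orb_pair X \<alpha> \<beta> = f \<beta>" for \<beta>
    by (subst (2) vec_expand[of \<beta>]) (simp add: expand f.sum f.scale)
  then show ?thesis using that by blast
qed

lemma dual_basis: "orb_pair X (\<phi> i) (dual_basis X j) = (if i = j then 1 else 0)"
proof -
  have "Vector_Spaces.linear (*s) (*) (\<lambda>v::complex^'n. v $ j)"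
    by unfold_locales (simp_all add: algebra_simps)
  from orb_pair_exists[OF this] obtain \<beta> where \<beta>: "\<And>v. orb_pair X \<beta> v = v $ j" by metis
  have "dual_basis X j = \<beta>"
    unfolding dual_basis_def
  proof (rule the_equality)
    show "\<forall>i. orb_pair X (\<phi> i) \<beta> = (if i = j then 1 else 0)"
      by (simp add: orb_pair_sym[of _ \<beta>] \<beta> \<phi>_def axis_def)
    fix \<gamma> assume \<gamma>: "\<forall>i. orb_pair X (\<phi> i) \<gamma> = (if i = j then 1 else 0)"
    show "\<gamma> = \<beta>"
    proof (rule orb_pair_eqI)
      fix v
      show "orb_pair X \<gamma> v = orb_pair X \<beta> v"
        using \<gamma> by (subst vec_expand[of v])
          (simp add: orb_pair_sum_right orb_pair_scale_right orb_pair_sym[of \<gamma>] \<beta> \<phi>_def sum_mult_delta)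
    qed
  qed
  then show ?thesis by (simp add: orb_pair_sym[of _ \<beta>] \<beta> \<phi>_def axis_def)
qed

lemma orb_pair_dual_basis: "orb_pair X v (dual_basis X j) = v $ j"
  by (subst vec_expand[of v])
    (simp add: orb_pair_sum_left orb_pair_scale_left dual_basis sum_mult_delta flip: \<phi>_def)

lemma expand_dual_basis: "v = (\<Sum>i\<in>UNIV. orb_pair X v (\<phi> i) *s dual_basis X i)"
proof (rule orb_pair_eqI)
  fix \<beta>
  have "orb_pair X v \<beta> = (\<Sum>i\<in>UNIV. \<beta> $ i * orb_pair X v (\<phi> i))"
    by (subst vec_expand[of \<beta>]) (simp add: orb_pair_sum_right orb_pair_scale_right \<phi>_def)
  then show "orb_pair X v \<beta> = orb_pair X (\<Sum>i\<in>UNIV. orb_pair X v (\<phi> i) *s dual_basis X i) \<beta>"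
    by (simp add: orb_pair_sum_left orb_pair_scale_left orb_pair_sym[of "dual_basis X _"] orb_pair_dual_basis mult.commute)
qed

text \<open>Centred at the middle degree of the sector itself and not at that of the whole stack:
  this is the grading for which hard Lefschetz holds on every sector at once.\<close>

definition wt :: "'n \<Rightarrow> int" where
  "wt i = int (sdim X (sector X i)) - 2 * int (hdeg X i)"

definition sp :: "'t \<Rightarrow> (complex^'n) endo" where
  "sp v = dg (\<lambda>i. if sector X i = v then 1 else 0)"

lemma sum_sp: "(\<Sum>v\<in>UNIV. sp v \<rhd> \<alpha>) = \<alpha>"
  by (simp add: sp_def vec_eq_iff flip: sum_distrib_right)

lemma sp_Hsec: "sp v \<rhd> \<alpha> \<in> Hsec X v"
  by (simp add: sp_def Hsec_def)

lemma Hsec_sp: "\<alpha> \<in> Hsec X v \<Longrightarrow> sp w \<rhd> \<alpha> = (if w = v then \<alpha> else 0)"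
  by (auto simp: sp_def Hsec_def vec_eq_iff)

text \<open>Only the component of the pullback of \<tau> in the sector \<open>v\<close> meets
  \<alpha>, and the pullback preserves degrees.\<close>

lemma Act_Hgr:
  assumes "\<tau> \<in> Hgr X (untw X) 1" "\<alpha> \<in> Hgr X v k"
  shows "act X \<tau> \<alpha> \<in> Hgr X v (Suc k)"
proof -
  have deg: "sp w \<rhd> prs X \<tau> \<in> Hgr X w 1" for w
    using prs_deg[OF assms(1)] by (auto simp: sp_def Hgr_def)
  have "cup X (prs X \<tau>) \<alpha> = (\<Sum>w\<in>UNIV. cup X (sp w \<rhd> prs X \<tau>) \<alpha>)"
    by (subst sum_sp[of "prs X \<tau>", symmetric]) (simp add: cup_commute[of _ \<alpha>] cup.sum)
  also have "\<dots> = (\<Sum>w\<in>UNIV. if w = v then cup X (sp w \<rhd> prs X \<tau>) \<alpha> else 0)"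
    using cup_sectors[OF sp_Hsec Hgr_Hsec[OF assms(2)]] by (intro sum.cong) auto
  also have "\<dots> = cup X (sp v \<rhd> prs X \<tau>) \<alpha>" by simp
  finally show ?thesis using cup_Hgr[OF deg assms(2)] by (simp add: act_def)
qed

lemma axis_Hgr: "axis j 1 \<in> Hgr X (sector X j) (hdeg X j)"
  by (auto simp: Hgr_def axis_def)

lemma Act_sp: assumes "\<tau> \<in> Hgr X (untw X) 1" shows "Act \<tau> * sp v = sp v * Act \<tau>"
proof (rule clin_eqI)
  fix j
  have "act X \<tau> (axis j 1) \<in> Hsec X (sector X j)"
    by (rule Hgr_Hsec[OF Act_Hgr[OF assms axis_Hgr]])
  then show "(Act \<tau> * sp v) \<rhd> axis j 1 = (sp v * Act \<tau>) \<rhd> axis j 1"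
    using Hsec_sp[OF Hgr_Hsec[OF axis_Hgr], of v j] by (simp add: Hsec_sp vec.linear_0[OF act_clinear])
qed (auto simp: sp_def)

lemma Act_lowers:
  assumes "\<tau> \<in> Hgr X (untw X) 1" "(Act \<tau> \<rhd> axis j 1) $ i \<noteq> 0"
  shows "sector X i = sector X j" "hdeg X i = Suc (hdeg X j)" "wt i = wt j - 2"
proof -
  have "act X \<tau> (axis j 1) \<in> Hgr X (sector X j) (Suc (hdeg X j))"
    by (rule Act_Hgr[OF assms(1) axis_Hgr])
  then show "sector X i = sector X j" "hdeg X i = Suc (hdeg X j)" using assms(2) by (auto simp: Hgr_def)
  then show "wt i = wt j - 2" by (simp add: wt_def)
qed

lemma kahler_Hgr: "\<omega> \<in> kahler X \<Longrightarrow> \<omega> \<in> Hgr X (untw X) 1"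
  using kahler_hodge hodge_Hgr[of 1 1 1] by auto

text \<open>One weight space collects different degrees from sectors of different dimension. The
  projections \<open>sp v\<close> commute with the action and reduce the claim to hard Lefschetz in
  each sector; a sector without basis classes of the given weight contributes nothing.\<close>

lemma lefschetz_Act:
  assumes \<omega>: "\<omega> \<in> kahler X"
  shows "lefschetz (Act \<omega>) wt"
proof
  note H = kahler_Hgr[OF \<omega>]
  show "clin (Act \<omega>)" by simp
  show "wt i = wt j - 2" if "(Act \<omega> \<rhd> axis j 1) $ i \<noteq> 0" for i j
    by (rule Act_lowers[OF H that])
  fix k
  let ?V = "\<lambda>l. {v :: complex^'n. \<forall>i. v $ i \<noteq> 0 \<longrightarrow> wt i = l}"
  have pow: "Act \<omega> ^ k \<rhd> v = (act X \<omega> ^^ k) v" for v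
  proof -
    have "(\<rhd>) (Act \<omega>) = act X \<omega>" by auto
    then show ?thesis by (simp add: ap_power)
  qed
  have sp_pow: "Act \<omega> ^ k * sp v = sp v * Act \<omega> ^ k" for v
    by (induction k) (simp_all add: mult.assoc Act_sp[OF H], simp add: Act_sp[OF H] flip: mult.assoc)
  have sp_pow': "Act \<omega> ^ k \<rhd> sp v \<rhd> u = sp v \<rhd> Act \<omega> ^ k \<rhd> u" for u v
    by (simp only: ap_times[symmetric] sp_pow)
  have comp: "sp v \<rhd> \<alpha> \<in> Hgr X v d" if "\<alpha> \<in> ?V l" "l = int (sdim X v) - 2 * int d" for \<alpha> l v d
    using that by (auto simp: sp_def Hgr_def wt_def)
  have V: "Hgr X v d \<subseteq> ?V (int (sdim X v) - 2 * int d)" for v d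
    by (auto simp: Hgr_def wt_def)
  have comp0: "sp v \<rhd> \<alpha> = 0" if "\<alpha> \<in> ?V l" "\<And>i. sector X i = v \<Longrightarrow> wt i \<noteq> l" for \<alpha> l v
    using that by (auto simp: sp_def vec_eq_iff)
  show "bij_betw (\<lambda>v. Act \<omega> ^ k \<rhd> v) (?V (int k)) (?V (- int k))"
    unfolding bij_betw_def
  proof
    show "inj_on (\<lambda>v. Act \<omega> ^ k \<rhd> v) (?V (int k))"
    proof (rule inj_onI)
      fix \<alpha> \<beta> assume ab: "\<alpha> \<in> ?V (int k)" "\<beta> \<in> ?V (int k)" "Act \<omega> ^ k \<rhd> \<alpha> = Act \<omega> ^ k \<rhd> \<beta>"
      have "sp v \<rhd> \<alpha> = sp v \<rhd> \<beta>" for v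
      proof (cases "\<exists>i. sector X i = v \<and> wt i = int k")
        case True
        then obtain i where i: "sector X i = v" "wt i = int k" by blast
        define d where "d = hdeg X i"
        have d: "int k = int (sdim X v) - 2 * int d" using i by (simp add: wt_def d_def)
        then have d': "2 * d \<le> sdim X v" "sdim X v - 2 * d = k" by linarith+
        have "Act \<omega> ^ k \<rhd> sp v \<rhd> \<alpha> = Act \<omega> ^ k \<rhd> sp v \<rhd> \<beta>"
          by (simp only: sp_pow' ab(3))
        moreover have "sp v \<rhd> \<alpha> \<in> Hgr X v d" "sp v \<rhd> \<beta> \<in> Hgr X v d" using comp[OF _ d] ab by blast+
        ultimately show ?thesis
          using bij_betw_imp_inj_on[OF hard_lefschetz[OF \<omega> d'(1)]] unfolding d'(2) pow
          by (metis inj_onD)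
      next
        case False
        then have "sp v \<rhd> \<gamma> = 0" if "\<gamma> \<in> ?V (int k)" for \<gamma>
          by (intro comp0[OF that]) blast
        then show ?thesis using ab(1,2) by simp
      qed
      then have "(\<Sum>v\<in>UNIV. sp v \<rhd> \<alpha>) = (\<Sum>v\<in>UNIV. sp v \<rhd> \<beta>)" by (intro sum.cong refl)
      then show "\<alpha> = \<beta>" unfolding sum_sp .
    qed
    show "(\<lambda>v. Act \<omega> ^ k \<rhd> v) ` ?V (int k) = ?V (- int k)"
    proof (intro equalityI subsetI)
      fix y assume "y \<in> (\<lambda>v. Act \<omega> ^ k \<rhd> v) ` ?V (int k)"
      then obtain v where v: "v \<in> ?V (int k)" "y = Act \<omega> ^ k \<rhd> v" by blast
      have "Act \<omega> ^ m \<rhd> v \<in> ?V (int k - 2 * int m)" for m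
      proof (induction m)
        case (Suc m)
        let ?u = "Act \<omega> ^ m \<rhd> v"
        have "wt i = int k - 2 * int (Suc m)" if "(Act \<omega> \<rhd> ?u) $ i \<noteq> 0" for i
        proof -
          have "(\<Sum>j\<in>UNIV. ?u $ j * (Act \<omega> \<rhd> axis j 1) $ i) \<noteq> 0"
            using that by (subst (asm) clin_expand[OF clin_Act]) simp
          then obtain j where "?u $ j * (Act \<omega> \<rhd> axis j 1) $ i \<noteq> 0"
            using sum.not_neutral_contains_not_neutral by blast
          then show ?thesis using Suc Act_lowers(3)[OF H, of j i] by auto
        qed
        then show ?case by simp
      qed (use v in simp)
      from this[of k] show "y \<in> ?V (- int k)" by (simp add: v)
    next
      fix y assume y: "y \<in> ?V (- int k)"
      have ex: "\<exists>x. x \<in> ?V (int k) \<and> Act \<omega> ^ k \<rhd> x = sp v \<rhd> y" for v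
      proof (cases "\<exists>i. sector X i = v \<and> wt i = - int k")
        case True
        then obtain i where i: "sector X i = v" "wt i = - int k" by blast
        define d where "d = sdim X v - hdeg X i"
        have le: "hdeg X i \<le> sdim X v" using hdeg_le[of i] i by simp
        have d: "- int k = int (sdim X v) - 2 * int (sdim X v - d)" "int k = int (sdim X v) - 2 * int d"
          using i le by (auto simp: wt_def d_def of_nat_diff)
        then have d': "2 * d \<le> sdim X v" "sdim X v - 2 * d = k" by linarith+
        have "sp v \<rhd> y \<in> Hgr X v (sdim X v - d)" by (rule comp[OF y d(1)])
        then have "sp v \<rhd> y \<in> (act X \<omega> ^^ k) ` Hgr X v d"
          using bij_betw_imp_surj_on[OF hard_lefschetz[OF \<omega> d'(1)]] unfolding d'(2) by simp
        then obtain x where x: "x \<in> Hgr X v d" "(act X \<omega> ^^ k) x = sp v \<rhd> y" by auto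
        then have "Act \<omega> ^ k \<rhd> x = sp v \<rhd> y" by (simp only: pow)
        moreover have "x \<in> ?V (int k)" unfolding d(2) by (rule subsetD[OF V x(1)])
        ultimately show ?thesis by blast
      next
        case False
        then have "sp v \<rhd> y = 0" by (intro comp0[OF y]) blast
        then show ?thesis by (intro exI[of _ 0]) (simp add: ap.zero_right)
      qed
      have "\<exists>x. \<forall>v. x v \<in> ?V (int k) \<and> Act \<omega> ^ k \<rhd> x v = sp v \<rhd> y"
        by (rule choice, rule allI, rule ex)
      then obtain x where x0: "\<forall>v. x v \<in> ?V (int k) \<and> Act \<omega> ^ k \<rhd> x v = sp v \<rhd> y" by (rule exE)
      have x: "x v \<in> ?V (int k)" "Act \<omega> ^ k \<rhd> x v = sp v \<rhd> y" for v
        by (rule conjunct1[OF spec[OF x0]], rule conjunct2[OF spec[OF x0]])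
      have "Act \<omega> ^ k \<rhd> (\<Sum>v\<in>UNIV. x v) = y"
        unfolding ap.sum_right x(2) by (rule sum_sp)
      moreover have "(\<Sum>v\<in>UNIV. x v) \<in> ?V (int k)"
      proof -
        have "wt i = int k" if nz: "(\<Sum>v\<in>UNIV. x v $ i) \<noteq> 0" for i
        proof -
          obtain v where "x v $ i \<noteq> 0" by (rule sum.not_neutral_contains_not_neutral[OF nz])
          then show ?thesis using x(1)[of v] by blast
        qed
        then show ?thesis by simp
      qed
      ultimately show "y \<in> (\<lambda>v. Act \<omega> ^ k \<rhd> v) ` ?V (int k)" by blast
    qed
  qed
qed

lemma orb_pair_Hgr:
  assumes "\<alpha> \<in> Hgr X v k" "\<beta> \<in> Hgr X v' k'" "orb_pair X \<alpha> \<beta> \<noteq> 0"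
  shows "v' = sinv X v" "k + k' = sdim X v"
proof -
  note b = invs_Hgr[OF assms(2)]
  have "sinv X v' = v"
  proof (rule ccontr)
    assume "sinv X v' \<noteq> v"
    then have "cup X \<alpha> (invs X \<beta>) = 0" using cup_sectors[OF Hgr_Hsec[OF assms(1)] Hgr_Hsec[OF b]] by metis
    then show False using assms(3) by (simp add: orb_pair_def integ.zero)
  qed
  then show "v' = sinv X v" using sinv_sinv[of v'] by simp
  show "k + k' = sdim X v"
    using integ_top[OF cup_Hgr[OF assms(1), of "invs X \<beta>" k']] b \<open>sinv X v' = v\<close> assms(3)
    by (auto simp: orb_pair_def)
qed

end

section \<open>The fundamental solution of the quantum connection\<close>

context orbifold_cohomology
begin

text \<open>The operator that represents a bilinear form through the orbifold pairing; see
  \<open>orb_pair_bil\<close>.\<close>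

definition bil :: "(complex^'n \<Rightarrow> complex^'n \<Rightarrow> complex) \<Rightarrow> (complex^'n) endo" where
  "bil f = Op (\<lambda>\<alpha>. \<Sum>i\<in>UNIV. f \<alpha> (\<phi> i) *s dual_basis X i)"

lemma bil_clinear:
  assumes "\<And>\<beta>. Vector_Spaces.linear (*s) (*) (\<lambda>\<alpha>. f \<alpha> \<beta>)"
  shows "Vector_Spaces.linear (*s) (*s) (\<lambda>\<alpha>. \<Sum>i\<in>UNIV. f \<alpha> (\<phi> i) *s dual_basis X i)"
proof -
  have l: "f (\<alpha> + \<alpha>') \<beta> = f \<alpha> \<beta> + f \<alpha>' \<beta>" "f (c *s \<alpha>) \<beta> = c * f \<alpha> \<beta>" for \<alpha> \<alpha>' \<beta> c
  proof -
    interpret g: Vector_Spaces.linear "(*s)" "(*)" "\<lambda>\<alpha>. f \<alpha> \<beta>" by (rule assms)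
    show "f (\<alpha> + \<alpha>') \<beta> = f \<alpha> \<beta> + f \<alpha>' \<beta>" "f (c *s \<alpha>) \<beta> = c * f \<alpha> \<beta>"
      by (rule g.add, rule g.scale)
  qed
  show ?thesis
    by unfold_locales
      (simp_all only: l vec_eq_iff sum_component vector_add_component vector_smult_component
        distrib_right sum.distrib sum_distrib_left mult.assoc simp_thms)
qed

lemma ap_bil:
  assumes "\<And>\<beta>. Vector_Spaces.linear (*s) (*) (\<lambda>\<alpha>. f \<alpha> \<beta>)"
  shows "bil f \<rhd> \<alpha> = (\<Sum>i\<in>UNIV. f \<alpha> (\<phi> i) *s dual_basis X i)"
  unfolding bil_def by (rule ap_Op[OF linear_of_clinear[OF bil_clinear[OF assms]]])

lemma clin_bil:
  assumes "\<And>\<beta>. Vector_Spaces.linear (*s) (*) (\<lambda>\<alpha>. f \<alpha> \<beta>)" shows "clin (bil f)"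
  unfolding bil_def by (rule clin_Op[OF bil_clinear[OF assms]])

lemma orb_pair_bil:
  assumes "\<And>\<beta>. Vector_Spaces.linear (*s) (*) (\<lambda>\<alpha>. f \<alpha> \<beta>)" "\<And>\<alpha>. Vector_Spaces.linear (*s) (*) (f \<alpha>)"
  shows "orb_pair X (bil f \<rhd> \<alpha>) \<beta> = f \<alpha> \<beta>"
proof -
  interpret f: Vector_Spaces.linear "(*s)" "(*)" "f \<alpha>" by (rule assms(2))
  have "f \<alpha> \<beta> = (\<Sum>i\<in>UNIV. \<beta> $ i * f \<alpha> (\<phi> i))"
    by (subst vec_expand[of \<beta>]) (simp add: f.sum f.scale \<phi>_def)
  then show ?thesis
    by (simp add: ap_bil[OF assms(1)] orb_pair_sum_left orb_pair_scale_left
        orb_pair_sym[of "dual_basis X _"] orb_pair_dual_basis mult.commute)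
qed

end

locale kahler_GW = orbifold_GW X
  for X :: "('n::finite, 't::finite, 'd::ab_group_add, 'x::ab_group_add) orbifold" +
  fixes \<omega> :: "complex^'n"
  assumes kahler: "\<omega> \<in> kahler X"
begin

definition N :: "(complex^'n) endo" where "N = Act \<omega>"

sublocale L: lefschetz N wt
  unfolding N_def by (rule lefschetz_Act[OF kahler])

lemma omega_Hgr: "\<omega> \<in> Hgr X (untw X) 1" by (rule kahler_Hgr[OF kahler])
lemma omega_Hsec: "\<omega> \<in> Hsec X (untw X)" by (rule Hgr_Hsec[OF omega_Hgr])

lemma clin_N: "clin N" by (simp add: N_def)

lemma N_ap: "N \<rhd> v = act X \<omega> v" by (simp add: N_def)

lemma N_selfadjoint: "orb_pair X (N \<rhd> \<alpha>) \<beta> = orb_pair X \<alpha> (N \<rhd> \<beta>)"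
  by (simp add: N_def Act_selfadjoint[OF omega_Hsec])

definition lam :: "'d \<Rightarrow> real" where "lam d = Re (h2pair X \<omega> d)"

lemma lam_add: "lam (d + d') = lam d + lam d'" by (simp add: lam_def h2pair_add)
lemma lam_0 [simp]: "lam 0 = 0" using lam_add[of 0 0] by simp
lemma lam_pos: "d \<in> eff X \<Longrightarrow> d \<noteq> 0 \<Longrightarrow> 0 < lam d"
  using kahler_eff[OF kahler] by (simp add: lam_def pos_real_def)
lemma lam_nonneg: "d \<in> eff X \<Longrightarrow> 0 \<le> lam d"
  using lam_pos[of d] by (cases "d = 0") auto
lemma h2pair_lam: "d \<in> eff X \<Longrightarrow> h2pair X \<omega> d = of_real (lam d)"
proof (cases "d = 0")
  case True
  have "h2pair X \<omega> 0 = 0" using h2pair_add[of \<omega> 0 0] by simp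
  then show ?thesis using True by simp
next
  case False
  assume "d \<in> eff X"
  then have "h2pair X \<omega> d \<in> \<real>" using kahler_eff[OF kahler] False by (simp add: pos_real_def)
  then show ?thesis by (simp add: lam_def)
qed

lemma finite_lam: "finite {d \<in> eff X. lam d \<le> C}"
  using kahler_bounded[OF kahler, of C] by (simp add: lam_def)

definition pairs :: "'d \<Rightarrow> ('d \<times> 'd) set" where
  "pairs d = {(d1, d2). d1 \<in> eff X \<and> d2 \<in> eff X \<and> d1 + d2 = d}"

lemma pairs_lam: "(d1, d2) \<in> pairs d \<Longrightarrow> lam d = lam d1 + lam d2"
  by (auto simp: pairs_def lam_add)

lemma finite_pairs [simp]: "finite (pairs d)"
proof (rule finite_subset)
  show "pairs d \<subseteq> (\<lambda>d1. (d1, d - d1)) ` {d1 \<in> eff X. lam d1 \<le> lam d}"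
    using lam_nonneg by (auto simp: pairs_def lam_add image_iff)
qed (intro finite_imageI finite_lam)

lemma pairs_0: "pairs 0 = {(0, 0)}"
proof -
  have "d1 = 0 \<and> d2 = 0" if "(d1, d2) \<in> pairs 0" for d1 d2
  proof -
    have e: "d1 \<in> eff X" "d2 \<in> eff X" "lam d1 + lam d2 = 0"
      using that pairs_lam[OF that] by (auto simp: pairs_def)
    have "d1 = 0"
      using lam_pos[OF e(1)] lam_nonneg[OF e(2)] e(3) by (cases "d1 = 0") simp_all
    moreover have "d2 = 0"
      using lam_pos[OF e(2)] lam_nonneg[OF e(1)] e(3) by (cases "d2 = 0") simp_all
    ultimately show ?thesis by simp
  qed
  then have "pairs 0 \<subseteq> {(0, 0)}" by (intro subsetI) (metis prod.collapse singletonI)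
  moreover have "(0, 0) \<in> pairs 0" using eff_zero by (simp add: pairs_def)
  ultimately show ?thesis by blast
qed

lemma gw_linear1: "Vector_Spaces.linear (*s) (*) (\<lambda>\<alpha>. gw X [(\<alpha>, k), (\<beta>, l)] d)"
  by (rule gw_linear)
lemma gw_swap: "gw X [(\<alpha>, k), (\<beta>, l)] d = gw X [(\<beta>, l), (\<alpha>, k)] d"
  by (rule gw_sym) simp
lemma gw_linear2: "Vector_Spaces.linear (*s) (*) (\<lambda>\<beta>. gw X [(\<alpha>, k), (\<beta>, l)] d)"
  unfolding gw_swap[of \<alpha> k _ l d] by (rule gw_linear)

text \<open>The coefficient of z^(-k-1) in the degree-\<open>d\<close> part of the fundamental
  solution. The next operator, \<open>Q d\<close>, is the degree-\<open>d\<close> part of quantum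
  multiplication by \<omega>, without its exponential factor.\<close>

definition S :: "'d \<Rightarrow> nat \<Rightarrow> (complex^'n) endo" where
  "S d k = bil (\<lambda>\<alpha> \<beta>. gw X [(\<alpha>, 0), (\<beta>, k)] d)"

definition Q :: "'d \<Rightarrow> (complex^'n) endo" where
  "Q d = bil (\<lambda>\<alpha> \<beta>. gw X [(\<alpha>, 0), (\<omega>, 0), (\<beta>, 0)] d)"

lemma pair_S: "orb_pair X (S d k \<rhd> \<alpha>) \<beta> = gw X [(\<alpha>, 0), (\<beta>, k)] d"
  unfolding S_def by (rule orb_pair_bil[OF gw_linear1 gw_linear2])

lemma clin_S: "clin (S d k)" unfolding S_def by (rule clin_bil[OF gw_linear1])

lemma gw_rev3: "gw X [(\<alpha>, 0), (\<omega>, 0), (\<beta>, 0)] d = gw X [(\<beta>, 0), (\<omega>, 0), (\<alpha>, 0)] d"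
  by (rule gw_sym) (simp add: add_mset_commute)

lemma pair_Q: "orb_pair X (Q d \<rhd> \<alpha>) \<beta> = gw X [(\<alpha>, 0), (\<omega>, 0), (\<beta>, 0)] d"
  unfolding Q_def
proof (rule orb_pair_bil)
  show 1: "Vector_Spaces.linear (*s) (*) (\<lambda>\<alpha>. gw X [(\<alpha>, 0), (\<omega>, 0), (\<beta>, 0)] d)" for \<beta>
    by (rule gw_linear)
  show "Vector_Spaces.linear (*s) (*) (\<lambda>\<beta>. gw X [(\<alpha>, 0), (\<omega>, 0), (\<beta>, 0)] d)" for \<alpha>
    unfolding gw_rev3[of \<alpha>] by (rule gw_linear)
qed

lemma clin_Q: "clin (Q d)" unfolding Q_def by (rule clin_bil[OF gw_linear])

lemma Q_selfadjoint: "orb_pair X (Q d \<rhd> \<alpha>) \<beta> = orb_pair X \<alpha> (Q d \<rhd> \<beta>)"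
  unfolding orb_pair_sym[of \<alpha>] pair_Q by (rule gw_rev3)

lemma endo_eq_pair: "(\<And>\<alpha> \<beta>. orb_pair X (A \<rhd> \<alpha>) \<beta> = orb_pair X (B \<rhd> \<alpha>) \<beta>) \<Longrightarrow> A = B"
  by (rule endo_eqI, rule orb_pair_eqI)

lemma S_0: "S 0 k = 0"
  by (rule endo_eq_pair) (simp add: pair_S gw_unstable stable_def)

lemma Q_0: "Q 0 = N"
proof (rule endo_eq_pair)
  fix \<alpha> \<beta>
  have "gw X [(\<alpha>, 0), (\<omega>, 0), (\<beta>, 0)] 0 = gw X [(\<omega>, 0), (\<alpha>, 0), (\<beta>, 0)] 0"
    by (rule gw_sym) (simp add: add_mset_commute)
  then show "orb_pair X (Q 0 \<rhd> \<alpha>) \<beta> = orb_pair X (N \<rhd> \<alpha>) \<beta>"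
    by (simp add: pair_Q gw_degree_zero[OF omega_Hsec] N_def)
qed

lemma Q_S: assumes "d \<in> eff X" "d \<noteq> 0" shows "Q d = lam d *\<^sub>R S d 0"
proof (rule endo_eq_pair)
  fix \<alpha> \<beta>
  have "gw X [(\<alpha>, 0), (\<omega>, 0), (\<beta>, 0)] d = gw X [(\<omega>, 0), (\<alpha>, 0), (\<beta>, 0)] d"
    by (rule gw_sym) (simp add: add_mset_commute)
  also have "\<dots> = h2pair X \<omega> d * gw X [(\<alpha>, 0), (\<beta>, 0)] d + lower X (act X \<omega>) [(\<alpha>, 0), (\<beta>, 0)] d"
    by (rule gw_divisor[OF _ omega_Hgr]) (use assms in \<open>simp add: stable_def\<close>)
  also have "lower X (act X \<omega>) [(\<alpha>, 0), (\<beta>, 0)] d = 0"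
  proof -
    have "{j. j < length [(\<alpha>, 0::nat), (\<beta>, 0)] \<and> 0 < snd ([(\<alpha>, 0::nat), (\<beta>, 0)] ! j)} = {}"
      by (auto simp: less_Suc_eq nth_Cons')
    then show ?thesis unfolding lower_def by (simp only: sum.empty)
  qed
  finally show "orb_pair X (Q d \<rhd> \<alpha>) \<beta> = orb_pair X ((lam d *\<^sub>R S d 0) \<rhd> \<alpha>) \<beta>"
    by (simp add: pair_Q pair_S scaleR_eq_scale orb_pair_scale_left h2pair_lam[OF assms(1)])
qed

text \<open>The divisor equation expresses the left-hand side as a three-point descendant, which topological
  recursion splits.\<close>

lemma S_recursion:
  assumes "d \<in> eff X" "d \<noteq> 0"
  shows "lam d *\<^sub>R S d (Suc k) + N * S d k = (\<Sum>(d1, d2)\<in>pairs d. S d1 k * Q d2)"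
proof (rule endo_eq_pair)
  fix \<alpha> \<beta>
  have "gw X [(\<omega>, 0), (\<alpha>, 0), (\<beta>, Suc k)] d =
      h2pair X \<omega> d * gw X [(\<alpha>, 0), (\<beta>, Suc k)] d + lower X (act X \<omega>) [(\<alpha>, 0), (\<beta>, Suc k)] d"
    by (rule gw_divisor[OF _ omega_Hgr]) (use assms in \<open>simp add: stable_def\<close>)
  also have "lower X (act X \<omega>) [(\<alpha>, 0), (\<beta>, Suc k)] d = gw X [(\<alpha>, 0), (act X \<omega> \<beta>, k)] d"
  proof -
    have "{j. j < length [(\<alpha>, 0::nat), (\<beta>, Suc k)] \<and> 0 < snd ([(\<alpha>, 0::nat), (\<beta>, Suc k)] ! j)} = {1}"
      by (auto simp: less_Suc_eq nth_Cons')
    then show ?thesis unfolding lower_def by simp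
  qed
  finally have 1: "gw X [(\<omega>, 0), (\<alpha>, 0), (\<beta>, Suc k)] d =
      orb_pair X ((lam d *\<^sub>R S d (Suc k) + N * S d k) \<rhd> \<alpha>) \<beta>"
    by (simp only: ap_add ap_scaleR ap_times scaleR_eq_scale orb_pair_add_left orb_pair_scale_left
        N_ap Act_selfadjoint[OF omega_Hsec] pair_S h2pair_lam[OF assms(1)])
  have "gw X [(\<omega>, 0), (\<alpha>, 0), (\<beta>, Suc k)] d = gw X [(\<beta>, Suc k), (\<omega>, 0), (\<alpha>, 0)] d"
    by (rule gw_sym) (simp add: add_mset_commute)
  also have "\<dots> = (\<Sum>(d1, d2)\<in>pairs d. \<Sum>i\<in>UNIV.
      gw X [(\<beta>, k), (\<phi> i, 0)] d1 * gw X [(dual_basis X i, 0), (\<omega>, 0), (\<alpha>, 0)] d2)"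
    unfolding gw_recursion pairs_def by simp
  also have "\<dots> = (\<Sum>(d1, d2)\<in>pairs d. orb_pair X (S d1 k \<rhd> Q d2 \<rhd> \<alpha>) \<beta>)"
  proof (intro sum.cong refl, clarify)
    fix d1 d2
    interpret g: Vector_Spaces.linear "(*s)" "(*)" "\<lambda>\<alpha>. gw X [(\<alpha>, 0), (\<beta>, k)] d1" by (rule gw_linear)
    have "(Q d2 \<rhd> \<alpha>) $ i = gw X [(dual_basis X i, 0), (\<omega>, 0), (\<alpha>, 0)] d2" for i
      by (subst orb_pair_dual_basis[symmetric]) (simp add: pair_Q gw_rev3[of \<alpha>])
    then have "Q d2 \<rhd> \<alpha> = (\<Sum>i\<in>UNIV. gw X [(dual_basis X i, 0), (\<omega>, 0), (\<alpha>, 0)] d2 *s \<phi> i)"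
      by (subst vec_expand[of "Q d2 \<rhd> \<alpha>"]) (simp add: \<phi>_def)
    then show "(\<Sum>i\<in>UNIV. gw X [(\<beta>, k), (\<phi> i, 0)] d1 * gw X [(dual_basis X i, 0), (\<omega>, 0), (\<alpha>, 0)] d2)
        = orb_pair X (S d1 k \<rhd> Q d2 \<rhd> \<alpha>) \<beta>"
      by (simp add: pair_S g.sum g.scale gw_swap[of \<beta>] mult.commute)
  qed
  finally show "orb_pair X ((lam d *\<^sub>R S d (Suc k) + N * S d k) \<rhd> \<alpha>) \<beta> =
      orb_pair X ((\<Sum>(d1, d2)\<in>pairs d. S d1 k * Q d2) \<rhd> \<alpha>) \<beta>"
    unfolding 1[symmetric] by (simp add: ap_sum orb_pair_sum_left case_prod_beta)
qed

text \<open>The degree axiom determines \<open>k\<close> from the degrees and ages of the two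
  insertions and the Chern number of \<open>d\<close>. Ages are nonnegative, so \<open>k\<close> is
  bounded, and each degree part is a polynomial in 1 / z.\<close>

lemma S_finite: "\<exists>K. \<forall>k\<ge>K. S d k = 0"
proof (intro exI allI impI)
  define K where "K = Suc (nat \<lceil>real (cdim X) + Re (h2pair X (c1 X) d)\<rceil>)"
  fix k assume k: "k \<ge> K"
  have z: "gw X [(\<phi> j, 0), (\<phi> i, k)] d = 0" for i j
  proof (rule ccontr)
    assume "gw X [(\<phi> j, 0), (\<phi> i, k)] d \<noteq> 0"
    then have "gw X (basis_ins [(j, 0), (i, k)]) d \<noteq> 0" by (simp add: basis_ins_def)
    from gw_degree[OF this]
    have "complex_of_real (real (hdeg X j) + age X (sector X j) + (real (hdeg X i) + age X (sector X i) + real k))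
        = of_nat (cdim X) - 1 + h2pair X (c1 X) d" by simp
    then have "Re (complex_of_real (real (hdeg X j) + age X (sector X j) + (real (hdeg X i) + age X (sector X i) + real k)))
        = Re (of_nat (cdim X) - 1 + h2pair X (c1 X) d)" by (rule arg_cong)
    then have "real (hdeg X j) + age X (sector X j) + (real (hdeg X i) + age X (sector X i) + real k)
        = real (cdim X) - 1 + Re (h2pair X (c1 X) d)" by simp
    moreover have "real (cdim X) + Re (h2pair X (c1 X) d) \<le> real K" unfolding K_def by linarith
    moreover have "0 \<le> age X (sector X j)" "0 \<le> age X (sector X i)" by (rule age_nonneg)+
    ultimately show False using k by linarith
  qed
  show "S d k = 0"
  proof (rule clin_eqI[OF clin_S])
    fix j
    have "S d k \<rhd> \<phi> j = (\<Sum>i\<in>UNIV. orb_pair X (S d k \<rhd> \<phi> j) (\<phi> i) *s dual_basis X i)"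
      by (rule expand_dual_basis)
    then show "S d k \<rhd> axis j 1 = 0 \<rhd> axis j 1" by (simp add: pair_S z flip: \<phi>_def)
  qed simp
qed

definition KK :: "'d \<Rightarrow> nat" where "KK d = (SOME K. \<forall>k\<ge>K. S d k = 0)"

lemma KK: "k \<ge> KK d \<Longrightarrow> S d k = 0"
  unfolding KK_def using someI_ex[OF S_finite[of d]] by blast

text \<open>The part of the fundamental solution of degree \<open>d\<close>; \<open>S 0 k = 0\<close> because of instability.\<close>

definition T :: "'d \<Rightarrow> complex \<Rightarrow> (complex^'n) endo" where
  "T d z = (if d = 0 then 1 else 0) + (\<Sum>k<KK d. cop (1 / z ^ Suc k) * S d k)"

lemma T_eq: "KK d \<le> M \<Longrightarrow> T d z = (if d = 0 then 1 else 0) + (\<Sum>k<M. cop (1 / z ^ Suc k) * S d k)"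
  unfolding T_def by (intro arg_cong2[of _ _ _ _ "(+)"] refl sum.mono_neutral_left) (auto simp: KK)

lemma T_0: "T 0 z = 1"
  unfolding T_def S_0 mult_zero_right sum.neutral_const by (simp only: if_True add_0_right simp_thms)

lemma clin_T: "clin (T d z)"
proof -
  have "clin (if d = 0 then 1 else 0 :: (complex^'n) endo)" by (cases "d = 0") simp_all
  moreover have "clin (\<Sum>k<KK d. cop (1 / z ^ Suc k) * S d k)"
    by (rule clin_sum, rule clin_mult, rule clin_intros, rule clin_S)
  ultimately show ?thesis unfolding T_def by (rule clin_add)
qed

text \<open>The degree-\<open>d\<close> coefficient of the quantum differential equation in the
  direction \<omega>: multiply \<open>S_recursion\<close> by z^(-k-1) and sum over k. The
  multiplication of \<open>T d\<close> by z leaves over the term lam d S d 0, which is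
  \<open>Q d\<close> and supplies the pair (0, d), since \<open>T 0\<close> is 1.\<close>

lemma T_equation:
  assumes d: "d \<in> eff X" and z: "z \<noteq> 0"
  shows "cop (z * of_real (lam d)) * T d z + N * T d z = (\<Sum>(d1, d2)\<in>pairs d. T d1 z * Q d2)"
proof (cases "d = 0")
  case True
  have "(\<Sum>(d1, d2)\<in>pairs 0. T d1 z * Q d2) = N"
    unfolding pairs_0 by (simp only: sum.insert finite.emptyI empty_iff not_False_eq_True sum.empty
        prod.case T_0 Q_0 mult_1_left add_0_right)
  then show ?thesis
    unfolding True by (simp only: T_0 lam_0 of_real_0 mult_zero_right cop_0 mult_zero_left add_0_left mult_1_right)
next
  case False
  have d0: "(0, d) \<in> pairs d" using d eff_zero by (simp add: pairs_def)
  define M where "M = Max (insert (KK d) (KK ` fst ` pairs d))"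
  have M: "KK d \<le> M" "KK d1 \<le> M" if "(d1, d2) \<in> pairs d" for d1 d2
  proof -
    have "KK d1 \<in> KK ` fst ` pairs d" using imageI[OF imageI[OF that, of fst], of KK] by simp
    then show "KK d \<le> M" "KK d1 \<le> M" unfolding M_def by (intro Max_ge; simp)+
  qed
  define c where "c k = (cop (1 / z ^ k) :: (complex^'n) endo)" for k
  have cS: "c k * (N * S d j) = N * (c k * S d j)" for k j
    unfolding c_def by (simp only: mult.assoc[symmetric] clinD[OF clin_N])
  have zc: "cop (z * of_real r) * (c (Suc k) * A) = r *\<^sub>R (c k * A)" for k r A
  proof -
    have "cop (z * of_real r) * c (Suc k) = (cop (of_real r * (1 / z ^ k)) :: (complex^'n) endo)"
      unfolding c_def cop_mult[symmetric] using z by simp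
    also have "\<dots> = r *\<^sub>R c k" unfolding c_def by (rule cop_scaleR)
    finally show ?thesis by (simp flip: mult.assoc)
  qed
  have "cop (z * of_real (lam d)) * T d z = (\<Sum>k<Suc M. cop (z * of_real (lam d)) * (c (Suc k) * S d k))"
    using T_eq[of d "Suc M" z] M(1)[OF d0] False by (simp add: sum_distrib_left c_def del: sum.lessThan_Suc power_Suc)
  also have "\<dots> = (\<Sum>k<Suc M. lam d *\<^sub>R (c k * S d k))" by (simp only: zc)
  also have "\<dots> = lam d *\<^sub>R S d 0 + (\<Sum>k<M. c (Suc k) * (lam d *\<^sub>R S d (Suc k)))"
    unfolding sum.lessThan_Suc_shift by (simp add: c_def)
  also have "(\<Sum>k<M. c (Suc k) * (lam d *\<^sub>R S d (Suc k)))
      = (\<Sum>k<M. c (Suc k) * (\<Sum>(d1, d2)\<in>pairs d. S d1 k * Q d2)) - N * (\<Sum>k<M. c (Suc k) * S d k)"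
  proof -
    have "lam d *\<^sub>R S d (Suc k) = (\<Sum>(d1, d2)\<in>pairs d. S d1 k * Q d2) - N * S d k" for k
      using S_recursion[OF d False, of k] by (simp add: algebra_simps)
    then show ?thesis by (simp add: right_diff_distrib sum_subtractf cS sum_distrib_left)
  qed
  also have "N * (\<Sum>k<M. c (Suc k) * S d k) = N * T d z"
    using T_eq[OF M(1)[OF d0], of z] False by (simp add: c_def)
  also have "lam d *\<^sub>R S d 0 = Q d" using Q_S[OF d False] by simp
  finally have "cop (z * of_real (lam d)) * T d z + N * T d z
      = Q d + (\<Sum>k<M. c (Suc k) * (\<Sum>(d1, d2)\<in>pairs d. S d1 k * Q d2))" by (simp add: algebra_simps)
  also have "(\<Sum>k<M. c (Suc k) * (\<Sum>(d1, d2)\<in>pairs d. S d1 k * Q d2))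
      = (\<Sum>(d1, d2)\<in>pairs d. (\<Sum>k<M. c (Suc k) * S d1 k) * Q d2)"
    unfolding sum_distrib_left
    by (subst sum.swap) (simp add: case_prod_beta sum_distrib_right mult.assoc)
  also have "\<dots> = (\<Sum>(d1, d2)\<in>pairs d. T d1 z * Q d2 - (if d1 = 0 then Q d2 else 0))"
  proof (intro sum.cong refl, clarify)
    fix d1 d2 assume "(d1, d2) \<in> pairs d"
    from T_eq[OF M(2)[OF this], of z] show "(\<Sum>k<M. c (Suc k) * S d1 k) * Q d2 = T d1 z * Q d2 - (if d1 = 0 then Q d2 else 0)"
      by (simp add: c_def algebra_simps)
  qed
  also have "\<dots> = (\<Sum>(d1, d2)\<in>pairs d. T d1 z * Q d2) - (\<Sum>x\<in>pairs d. if x = (0, d) then Q d else 0)"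
  proof -
    have "(case x of (d1, d2) \<Rightarrow> if d1 = 0 then Q d2 else 0) = (if x = (0, d) then Q d else 0)"
      if "x \<in> pairs d" for x
      using that by (cases x) (auto simp: pairs_def)
    then have "(\<Sum>(d1, d2)\<in>pairs d. if d1 = 0 then Q d2 else 0) = (\<Sum>x\<in>pairs d. if x = (0, d) then Q d else 0)"
      by (intro sum.cong refl)
    then show ?thesis by (simp add: case_prod_beta sum_subtractf)
  qed
  also have "(\<Sum>x\<in>pairs d. if x = (0, d) then Q d else 0) = Q d"
    using d0 by simp
  finally show ?thesis by simp
qed

end

section \<open>A summable majorant for the fundamental solution\<close>

context kahler_GW
begin

abbreviation D :: "'d set" where "D \<equiv> eff X - {0}"

text \<open>A majorant of \<open>T d z\<close> for all \<open>z\<close> of norm at least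
  \<open>r\<close> and \<open>d\<close> nonzero.\<close>

definition sig :: "real \<Rightarrow> 'd \<Rightarrow> real" where
  "sig r d = (\<Sum>k<KK d. norm (S d k) / r ^ Suc k)"

definition pairs' :: "'d \<Rightarrow> ('d \<times> 'd) set" where
  "pairs' d = pairs d \<inter> D \<times> D"

lemma finite_pairs' [simp]: "finite (pairs' d)" by (simp add: pairs'_def)

lemma sig_eq: "KK d \<le> M \<Longrightarrow> sig r d = (\<Sum>k<M. norm (S d k) / r ^ Suc k)"
  unfolding sig_def by (intro sum.mono_neutral_left) (simp_all add: KK)

lemma sig_nonneg: "0 < r \<Longrightarrow> 0 \<le> sig r d"
  unfolding sig_def by (intro sum_nonneg) simp

lemma norm_T: assumes "d \<noteq> 0" "0 < r" "r \<le> norm z" shows "norm (T d z) \<le> sig r d"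
proof -
  have "T d z = (\<Sum>k<KK d. cop (1 / z ^ Suc k) * S d k)" using assms(1) by (simp add: T_def)
  also have "norm \<dots> \<le> (\<Sum>k<KK d. norm (cop (1 / z ^ Suc k) * S d k))" by (rule norm_sum)
  also have "\<dots> \<le> sig r d" unfolding sig_def
  proof (rule sum_mono)
    fix k
    have "norm (cop (1 / z ^ Suc k) * S d k) \<le> norm (cop (1 / z ^ Suc k) :: (complex^'n) endo) * norm (S d k)"
      by (rule norm_mult_ineq)
    also have "\<dots> = norm (S d k) / norm z ^ Suc k"
      unfolding norm_cop norm_divide norm_power norm_one by simp
    also have "\<dots> \<le> norm (S d k) / r ^ Suc k"
      using assms by (intro divide_left_mono power_mono mult_pos_pos zero_less_power) auto
    finally show "norm (cop (1 / z ^ Suc k) * S d k) \<le> norm (S d k) / r ^ Suc k" .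
  qed
  finally show ?thesis .
qed

text \<open>The pair (d, 0) contains the unknown itself and is separated, using that
  \<open>Q 0\<close> is \<open>N\<close>; the pair (0, d) contributes nothing by \<open>S_0\<close>.
  The remaining pairs have both classes nonzero.\<close>

lemma S_recursion':
  assumes "d \<in> D"
  shows "lam d *\<^sub>R S d (Suc k) = S d k * N - N * S d k + (\<Sum>(d1, d2)\<in>pairs' d. S d1 k * Q d2)"
proof -
  have d: "d \<in> eff X" "d \<noteq> 0" using assms by auto
  have mem: "(d, 0) \<in> pairs d" using d eff_zero by (simp add: pairs_def)
  have sub: "insert (d, 0) (pairs' d) \<subseteq> pairs d" using mem by (auto simp: pairs'_def)
  have "(\<Sum>(d1, d2)\<in>pairs d. S d1 k * Q d2) = (\<Sum>(d1, d2)\<in>insert (d, 0) (pairs' d). S d1 k * Q d2)"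
  proof (rule sum.mono_neutral_right[OF finite_pairs sub], rule ballI)
    fix x assume x: "x \<in> pairs d - insert (d, 0) (pairs' d)"
    obtain d1 d2 where xd: "x = (d1, d2)" by (cases x)
    have "d1 = 0"
    proof (rule ccontr)
      assume "d1 \<noteq> 0"
      then have "d2 = 0" using x xd by (auto simp: pairs'_def pairs_def)
      then show False using x xd by (auto simp: pairs_def)
    qed
    then show "(case x of (d1, d2) \<Rightarrow> S d1 k * Q d2) = 0" by (simp only: xd prod.case S_0 mult_zero_left)
  qed
  also have "\<dots> = S d k * N + (\<Sum>(d1, d2)\<in>pairs' d. S d1 k * Q d2)"
    by (subst sum.insert) (simp_all add: pairs'_def Q_0)
  finally show ?thesis using S_recursion[OF d, of k] by (simp add: algebra_simps)
qed

text \<open>The recursion raises \<open>k\<close> by one, so weighting it by r^(-k-2) expresses the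
  left-hand side by the majorants themselves at the price of one factor 1 / r; the missing lowest
  term is \<open>Q d\<close>.\<close>

lemma sig_recursion:
  assumes d: "d \<in> D" and r: "0 < r"
  shows "lam d * sig r d \<le>
    (norm (Q d) + 2 * norm N * sig r d + (\<Sum>(d1, d2)\<in>pairs' d. sig r d1 * norm (Q d2))) / r"
proof -
  define M where "M = Max (insert (KK d) (KK ` fst ` pairs d))"
  have M1: "KK d \<le> M" unfolding M_def by (intro Max_ge) simp_all
  have M2: "KK d1 \<le> M" if "(d1, d2) \<in> pairs' d" for d1 d2
  proof -
    have "(d1, d2) \<in> pairs d" using that by (simp add: pairs'_def)
    then have "KK d1 \<in> KK ` fst ` pairs d" using imageI[OF imageI[of "(d1, d2)" "pairs d" fst], of KK] by simp
    then show ?thesis unfolding M_def by (intro Max_ge) simp_all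
  qed
  have lam: "0 \<le> lam d" using d lam_nonneg by simp
  define s where "s e k = norm (S e k) / r ^ Suc k" for e k
  have step: "lam d * norm (S d (Suc k)) \<le>
      2 * norm N * norm (S d k) + (\<Sum>(d1, d2)\<in>pairs' d. norm (S d1 k) * norm (Q d2))" for k
  proof -
    have "lam d * norm (S d (Suc k)) = norm (lam d *\<^sub>R S d (Suc k))" using lam by simp
    also have "\<dots> \<le> norm (S d k * N) + norm (N * S d k) + norm (\<Sum>(d1, d2)\<in>pairs' d. S d1 k * Q d2)"
      unfolding S_recursion'[OF d]
      by (rule order_trans[OF norm_triangle_ineq add_right_mono[OF norm_triangle_ineq4]])
    also have "\<dots> \<le> norm (S d k) * norm N + norm N * norm (S d k)
        + (\<Sum>(d1, d2)\<in>pairs' d. norm (S d1 k) * norm (Q d2))"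
    proof (intro add_mono norm_mult_ineq)
      have "norm (\<Sum>(d1, d2)\<in>pairs' d. S d1 k * Q d2) \<le> (\<Sum>x\<in>pairs' d. norm (case x of (d1, d2) \<Rightarrow> S d1 k * Q d2))"
        by (rule norm_sum)
      also have "\<dots> \<le> (\<Sum>(d1, d2)\<in>pairs' d. norm (S d1 k) * norm (Q d2))"
        by (intro sum_mono) (simp add: norm_mult_ineq split: prod.split)
      finally show "norm (\<Sum>(d1, d2)\<in>pairs' d. S d1 k * Q d2)
          \<le> (\<Sum>(d1, d2)\<in>pairs' d. norm (S d1 k) * norm (Q d2))" .
    qed
    finally show ?thesis by simp
  qed
  have "lam d * s d (Suc k) \<le> (2 * norm N * s d k + (\<Sum>(d1, d2)\<in>pairs' d. s d1 k * norm (Q d2))) / r" for k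
  proof -
    have "lam d * norm (S d (Suc k)) / r ^ Suc (Suc k) \<le>
        (2 * norm N * norm (S d k) + (\<Sum>(d1, d2)\<in>pairs' d. norm (S d1 k) * norm (Q d2))) / r ^ Suc (Suc k)"
      using r by (intro divide_right_mono step) simp
    also have "\<dots> = (2 * norm N * s d k + (\<Sum>(d1, d2)\<in>pairs' d. s d1 k * norm (Q d2))) / r"
      by (simp add: s_def add_divide_distrib sum_divide_distrib case_prod_beta mult_ac)
    finally show ?thesis by (simp add: s_def)
  qed
  then have "(\<Sum>k<M. lam d * s d (Suc k)) \<le>
      (\<Sum>k<M. (2 * norm N * s d k + (\<Sum>(d1, d2)\<in>pairs' d. s d1 k * norm (Q d2))) / r)"
    by (rule sum_mono)
  also have "\<dots> = (2 * norm N * sig r d + (\<Sum>(d1, d2)\<in>pairs' d. sig r d1 * norm (Q d2))) / r"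
  proof -
    have "(\<Sum>k<M. \<Sum>(d1, d2)\<in>pairs' d. s d1 k * norm (Q d2)) = (\<Sum>(d1, d2)\<in>pairs' d. sig r d1 * norm (Q d2))"
    proof (subst sum.swap, intro sum.cong refl)
      fix x assume x: "x \<in> pairs' d"
      show "(\<Sum>k<M. case x of (d1, d2) \<Rightarrow> s d1 k * norm (Q d2)) = (case x of (d1, d2) \<Rightarrow> sig r d1 * norm (Q d2))"
        using x sig_eq[OF M2, of "fst x" "snd x" r] by (simp add: case_prod_beta s_def sum_distrib_right)
    qed
    moreover have "(\<Sum>k<M. 2 * norm N * s d k) = 2 * norm N * sig r d"
      unfolding sig_eq[OF M1] s_def by (simp only: sum_distrib_left)
    ultimately show ?thesis
      by (simp only: sum_divide_distrib[symmetric] sum.distrib)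
  qed
  finally have "(\<Sum>k<M. lam d * s d (Suc k)) \<le>
      (2 * norm N * sig r d + (\<Sum>(d1, d2)\<in>pairs' d. sig r d1 * norm (Q d2))) / r" .
  moreover have "lam d * sig r d = norm (Q d) / r + (\<Sum>k<M. lam d * s d (Suc k))"
  proof -
    have "sig r d = (\<Sum>k<Suc M. s d k)" unfolding s_def by (rule sig_eq) (use M1 in simp)
    also have "\<dots> = s d 0 + (\<Sum>k<M. s d (Suc k))" by (rule sum.lessThan_Suc_shift)
    finally have "lam d * sig r d = lam d * s d 0 + (\<Sum>k<M. lam d * s d (Suc k))"
      by (simp only: distrib_left sum_distrib_left)
    moreover have "lam d * s d 0 = norm (Q d) / r"
    proof -
      have "norm (Q d) = lam d * norm (S d 0)" using Q_S[of d] d lam by simp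
      then show ?thesis by (simp add: s_def)
    qed
    ultimately show ?thesis by simp
  qed
  ultimately show ?thesis by (simp add: add_divide_distrib)
qed

end

locale convergent_GW = kahler_GW X \<omega>
  for X :: "('n::finite, 't::finite, 'd::ab_group_add, 'x::ab_group_add) orbifold" and \<omega> :: "complex^'n" +
  fixes t0 :: real
  assumes Q_summable: "(\<lambda>d. norm (Q d) * exp (- t0 * lam d)) summable_on D"
begin

definition q :: "'d \<Rightarrow> real" where "q d = exp (- t0 * lam d)"

lemma q_add: "q (d + d') = q d * q d'" by (simp add: q_def lam_add algebra_simps flip: exp_add)
lemma q_pos: "0 < q d" by (simp add: q_def)

text \<open>When lam d is large, the term with \<open>norm N\<close> in \<open>sig_recursion\<close>
  is absorbed by the left-hand side, and the majorants are bounded by a small multiple of their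
  convolution with the summable \<open>w\<close>. Areas are additive and nonnegative, so the
  convolution summed up to area \<open>n\<close> is at most the partial sum s times W. This gives s
  at most A + (1 + s) / 2, a bound that does not depend on \<open>n\<close>.\<close>

lemma sig_summable:
  assumes r: "0 < r"
  shows "(\<lambda>d. sig r d * q d) summable_on D"
proof (rule nonneg_bdd_above_summable_on)
  show "0 \<le> sig r d * q d" for d using sig_nonneg[OF r] q_pos[of d] by simp
  define w where "w d = norm (Q d) * q d" for d
  define W where "W = infsum w D"
  define f where "f d = sig r d * q d" for d
  have w0: "0 \<le> w d" for d using q_pos[of d] by (simp add: w_def)
  have f0: "0 \<le> f d" for d using sig_nonneg[OF r] q_pos[of d] by (simp add: f_def)
  have wsum: "w summable_on D" using Q_summable unfolding w_def q_def .
  have W: "sum w F \<le> W" if "finite F" "F \<subseteq> D" for F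
    unfolding W_def by (rule finite_sum_le_infsum[OF wsum that]) (rule w0)
  have W0: "0 \<le> W" using W[of "{}"] by simp
  \<comment> \<open>Chosen so that W / B is below 1/2. The threshold \<open>C\<close> is then the
    area beyond which lam d - 2 norm N / r is at least B / r.\<close>
  define B where "B = 2 * W + 1"
  define C where "C = (2 * norm N + B) / r"
  have B: "0 < B" using W0 by (simp add: B_def)
  define F where "F n = {d \<in> D. lam d \<le> n}" for n
  have finF: "finite (F n)" for n
    by (rule finite_subset[OF _ finite_lam[of n]]) (auto simp: F_def)
  have FD: "F n \<subseteq> D" for n by (auto simp: F_def)
  define A where "A = sum f (F C)"
  have large: "f d \<le> (w d + (\<Sum>(d1, d2)\<in>pairs' d. f d1 * w d2)) / B" if d: "d \<in> D" "C < lam d" for d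
  proof -
    have "B / r * sig r d \<le> (lam d - 2 * norm N / r) * sig r d"
    proof (rule mult_right_mono)
      show "B / r \<le> lam d - 2 * norm N / r" using d(2) by (simp add: C_def add_divide_distrib)
    qed (rule sig_nonneg[OF r])
    also have "\<dots> \<le> (norm (Q d) + (\<Sum>(d1, d2)\<in>pairs' d. sig r d1 * norm (Q d2))) / r"
      using sig_recursion[OF d(1) r] by (simp add: add_divide_distrib left_diff_distrib)
    finally have "B * sig r d \<le> norm (Q d) + (\<Sum>(d1, d2)\<in>pairs' d. sig r d1 * norm (Q d2))"
      using r by (simp add: divide_le_cancel)
    then have "B * sig r d * q d \<le> (norm (Q d) + (\<Sum>(d1, d2)\<in>pairs' d. sig r d1 * norm (Q d2))) * q d"
      using q_pos[of d] by (intro mult_right_mono) simp_all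
    also have "\<dots> = w d + (\<Sum>(d1, d2)\<in>pairs' d. f d1 * w d2)"
      unfolding distrib_right sum_distrib_right w_def
    proof (intro arg_cong2[of _ _ _ _ "(+)"] refl sum.cong)
      fix x assume "x \<in> pairs' d"
      then have "d = fst x + snd x" by (auto simp: pairs'_def pairs_def)
      then have "q d = q (fst x) * q (snd x)" by (simp only: q_add)
      then show "(case x of (d1, d2) \<Rightarrow> sig r d1 * norm (Q d2)) * q d
          = (case x of (d1, d2) \<Rightarrow> f d1 * (norm (Q d2) * q d2))"
        by (simp add: f_def case_prod_beta)
    qed
    finally show ?thesis using B by (simp add: f_def field_simps)
  qed
  have double: "(\<Sum>d\<in>F n. \<Sum>(d1, d2)\<in>pairs' d. f d1 * w d2) \<le> sum f (F n) * W" for n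
  proof -
    have "(\<Sum>d\<in>F n. \<Sum>(d1, d2)\<in>pairs' d. f d1 * w d2)
        = (\<Sum>(d, x)\<in>Sigma (F n) pairs'. case x of (d1, d2) \<Rightarrow> f d1 * w d2)"
      by (rule sum.Sigma) (simp_all add: finF)
    also have "\<dots> = (\<Sum>(d1, d2)\<in>snd ` Sigma (F n) pairs'. f d1 * w d2)"
    proof (subst sum.reindex)
      show "inj_on snd (Sigma (F n) pairs')"
        by (rule inj_onI) (auto simp: pairs'_def pairs_def)
    qed (simp add: case_prod_beta)
    also have "\<dots> \<le> (\<Sum>(d1, d2)\<in>F n \<times> F n. f d1 * w d2)"
    proof (rule sum_mono2)
      show "finite (F n \<times> F n)" by (simp add: finF)
      show "snd ` Sigma (F n) pairs' \<subseteq> F n \<times> F n"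
      proof
        fix x assume "x \<in> snd ` Sigma (F n) pairs'"
        then obtain d where d: "d \<in> F n" "x \<in> pairs' d" by auto
        obtain d1 d2 where x: "x = (d1, d2)" by (cases x)
        have "d1 \<in> D" "d2 \<in> D" "lam d = lam d1 + lam d2"
          using d(2) x pairs_lam[of d1 d2 d] by (simp_all add: pairs'_def)
        moreover from this have "0 \<le> lam d1" "0 \<le> lam d2" using lam_nonneg by simp_all
        ultimately show "x \<in> F n \<times> F n" using d(1) by (simp add: F_def x)
      qed
      show "0 \<le> (case x of (d1, d2) \<Rightarrow> f d1 * w d2)" for x using f0 w0 by (simp split: prod.split)
    qed
    also have "\<dots> = sum f (F n) * sum w (F n)"
      by (simp add: sum_product sum.cartesian_product)
    also have "\<dots> \<le> sum f (F n) * W"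
      by (rule mult_left_mono[OF W[OF finF FD]]) (simp add: sum_nonneg f0)
    finally show ?thesis .
  qed
  have bound: "sum f (F n) \<le> 2 * A + 2" for n
  proof -
    have "sum f (F n) \<le> sum f (F n \<inter> F C) + sum f (F n - F C)"
      using sum.Int_Diff[OF finF[of n], of f "F C"] by simp
    also have "sum f (F n \<inter> F C) \<le> A"
      unfolding A_def by (rule sum_mono2[OF finF]) (simp_all add: f0)
    also have "sum f (F n - F C) \<le> (\<Sum>d\<in>F n - F C. (w d + (\<Sum>(d1, d2)\<in>pairs' d. f d1 * w d2)) / B)"
      by (rule sum_mono, rule large) (auto simp: F_def)
    also have "\<dots> \<le> (\<Sum>d\<in>F n. (w d + (\<Sum>(d1, d2)\<in>pairs' d. f d1 * w d2)) / B)"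
    proof (rule sum_mono2[OF finF])
      fix d
      have "0 \<le> (\<Sum>(d1, d2)\<in>pairs' d. f d1 * w d2)"
        by (rule sum_nonneg) (simp add: f0 w0 split: prod.split)
      then show "0 \<le> (w d + (\<Sum>(d1, d2)\<in>pairs' d. f d1 * w d2)) / B"
        using B w0[of d] by simp
    qed blast
    also have "\<dots> = (sum w (F n) + (\<Sum>d\<in>F n. \<Sum>(d1, d2)\<in>pairs' d. f d1 * w d2)) / B"
      by (simp only: sum_divide_distrib[symmetric] sum.distrib)
    also have "\<dots> \<le> (W + sum f (F n) * W) / B"
      by (rule divide_right_mono[OF add_mono[OF W[OF finF FD] double]]) (use B in simp)
    finally have "sum f (F n) \<le> A + (W + sum f (F n) * W) / B" by simp
    moreover have "(W + sum f (F n) * W) / B \<le> (1 + sum f (F n)) / 2"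
    proof -
      have "0 \<le> sum f (F n)" by (simp add: sum_nonneg f0)
      then have "(W / B) * (1 + sum f (F n)) \<le> (1 / 2) * (1 + sum f (F n))"
        using B W0 by (intro mult_right_mono) (simp_all add: B_def field_simps)
      then show ?thesis by (simp add: distrib_left distrib_right add_divide_distrib mult.commute)
    qed
    ultimately show ?thesis by argo
  qed
  show "bdd_above (sum (\<lambda>d. sig r d * q d) ` {F. F \<subseteq> D \<and> finite F})"
  proof (rule bdd_aboveI2)
    fix G assume "G \<in> {F. F \<subseteq> D \<and> finite F}"
    then have G: "G \<subseteq> D" "finite G" by auto
    define n where "n = Max (insert 0 (lam ` G))"
    have "G \<subseteq> F n"
    proof
      fix d assume d: "d \<in> G"
      have "lam d \<le> n" unfolding n_def by (rule Max_ge) (use G d in auto)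
      then show "d \<in> F n" using G d by (auto simp: F_def)
    qed
    then have "sum f G \<le> sum f (F n)" by (rule sum_mono2[OF finF]) (simp add: f0)
    also have "\<dots> \<le> 2 * A + 2" by (rule bound)
    finally show "(\<Sum>d\<in>G. sig r d * q d) \<le> 2 * A + 2" by (simp add: f_def)
  qed
qed

end

lemma endo_left_inverse_right:
  fixes A B :: "'a::euclidean_space endo"
  assumes "A * B = 1" shows "B * A = 1"
proof (rule endo_eqI)
  fix v
  have lin: "linear ((\<rhd>) B)" by (rule bounded_linear.linear[OF ap.bounded_linear_right])
  have AB: "A \<rhd> B \<rhd> u = u" for u using assms by (simp flip: ap_times)
  have "inj ((\<rhd>) B)" by (rule inj_on_inverseI[of _ "(\<rhd>) A"]) (simp add: AB)
  then have "surj ((\<rhd>) B)" by (rule linear_injective_imp_surjective[OF lin _ refl])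
  then obtain u where "v = B \<rhd> u" by blast
  then show "(B * A) \<rhd> v = 1 \<rhd> v" by (simp add: AB)
qed

section \<open>Unitarity and convergence of the fundamental solution\<close>

context orbifold_cohomology
begin

definition adj :: "(complex^'n) endo \<Rightarrow> (complex^'n) endo" where
  "adj A = bil (\<lambda>\<alpha> \<beta>. orb_pair X \<alpha> (A \<rhd> \<beta>))"

lemma orb_pair_linear: "Vector_Spaces.linear (*s) (*) (\<lambda>\<alpha>. orb_pair X \<alpha> \<beta>)"
  by unfold_locales (simp_all add: orb_pair_add_left orb_pair_scale_left vec_eq_iff algebra_simps)

lemma orb_pair_adj: assumes "clin A" shows "orb_pair X (adj A \<rhd> \<alpha>) \<beta> = orb_pair X \<alpha> (A \<rhd> \<beta>)"
  unfolding adj_def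
proof (rule orb_pair_bil[OF orb_pair_linear])
  show "Vector_Spaces.linear (*s) (*) (\<lambda>\<beta>. orb_pair X \<alpha> (A \<rhd> \<beta>))" for \<alpha>
    by unfold_locales
      (simp_all add: ap.add_right clin_ap[OF assms] orb_pair_add_right orb_pair_scale_right vec_eq_iff algebra_simps)
qed

lemma clin_adj: "clin (adj A)"
  unfolding adj_def by (rule clin_bil[OF orb_pair_linear])

lemma holomorphic_orb_pair:
  assumes "hvec A v" shows "(\<lambda>z. orb_pair X \<beta> (v z)) holomorphic_on A"
proof -
  have "orb_pair X \<beta> (v z) = (\<Sum>j\<in>UNIV. v z $ j * orb_pair X \<beta> (axis j 1))" for z
    by (subst vec_expand[of "v z"]) (simp add: orb_pair_sum_right orb_pair_scale_right)
  then show ?thesis using assms by (simp add: hvec_def holomorphic_intros)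
qed

lemma holop_adj:
  assumes "holop A G" shows "holop A (\<lambda>z. adj (G z))"
proof (rule holopI[OF clin_adj])
  fix v
  have "(adj (G z) \<rhd> v) $ j = orb_pair X v (G z \<rhd> dual_basis X j)" for z j
    by (simp add: orb_pair_adj[OF holop_clin[OF assms]] flip: orb_pair_dual_basis)
  then show "hvec A (\<lambda>z. adj (G z) \<rhd> v)"
    unfolding hvec_def using holomorphic_orb_pair[OF hvec_ap[OF assms hvec_const]] by simp
qed

end

context kahler_GW
begin

text \<open>The degree-\<open>d\<close> part of unitarity: the equation for \<open>T\<close> turns \<open>z \<langle>\<omega>, d\<rangle> P\<^sub>d(\<alpha>, \<beta>)\<close> into
  \<open>P\<^sub>d(\<alpha>, N \<beta>) - P\<^sub>d(N \<alpha>, \<beta>)\<close>, and \<open>N\<close> is nilpotent.\<close>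

definition P :: "complex \<Rightarrow> 'd \<Rightarrow> complex^'n \<Rightarrow> complex^'n \<Rightarrow> complex" where
  "P z d \<alpha> \<beta> = (\<Sum>(d1, d2)\<in>pairs d. orb_pair X (T d1 (- z) \<rhd> \<alpha>) (T d2 z \<rhd> \<beta>))"

lemma P_0: "P z 0 \<alpha> \<beta> = orb_pair X \<alpha> \<beta>"
  by (simp add: P_def pairs_0 T_0)

lemma pairs_swap: "(\<Sum>x\<in>pairs d. F (fst x) (snd x)) = (\<Sum>x\<in>pairs d. F (snd x) (fst x))"
  by (rule sum.reindex_bij_witness[where i = prod.swap and j = prod.swap])
    (simp_all add: pairs_def case_prod_beta add.commute)

lemma pairs_assoc:
  "(\<Sum>x\<in>pairs d. \<Sum>y\<in>pairs (snd x). F (fst x) (fst y) (snd y)) =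
   (\<Sum>x\<in>pairs d. \<Sum>y\<in>pairs (fst x). F (fst y) (snd y) (snd x))"
proof -
  have "(\<Sum>(x, y)\<in>(SIGMA x:pairs d. pairs (snd x)). F (fst x) (fst y) (snd y)) =
      (\<Sum>(x, y)\<in>(SIGMA x:pairs d. pairs (fst x)). F (fst y) (snd y) (snd x))"
    by (rule sum.reindex_bij_witness[where
          i = "\<lambda>(p, r). ((fst r, snd r + snd p), (snd r, snd p))" and
          j = "\<lambda>(p, r). ((fst p + fst r, snd r), (fst p, fst r))"])
      (clarsimp simp: pairs_def eff_add add.assoc)+
  then show ?thesis by (subst (1 2) sum.Sigma) simp_all
qed

lemma pairs_rotate:
  "(\<Sum>x\<in>pairs d. \<Sum>y\<in>pairs (fst x). F (fst y) (snd y) (snd x)) =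
   (\<Sum>x\<in>pairs d. \<Sum>y\<in>pairs (fst x). F (fst y) (snd x) (snd y))"
proof -
  have "(\<Sum>x\<in>pairs d. \<Sum>y\<in>pairs (fst x). F (fst y) (snd y) (snd x)) =
      (\<Sum>x\<in>pairs d. \<Sum>y\<in>pairs (snd x). F (fst x) (fst y) (snd y))"
    by (rule pairs_assoc[symmetric])
  also have "\<dots> = (\<Sum>x\<in>pairs d. \<Sum>y\<in>pairs (snd x). F (fst x) (snd y) (fst y))"
    by (intro sum.cong refl pairs_swap)
  also have "\<dots> = (\<Sum>x\<in>pairs d. \<Sum>y\<in>pairs (fst x). F (fst y) (snd x) (snd y))"
    by (rule pairs_assoc)
  finally show ?thesis .
qed

lemma T_equation': assumes "d \<in> eff X" "z \<noteq> 0"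
  shows "(z * of_real (lam d)) *s (T d z \<rhd> \<alpha>) =
    (\<Sum>(d1, d2)\<in>pairs d. T d1 z \<rhd> Q d2 \<rhd> \<alpha>) - N \<rhd> T d z \<rhd> \<alpha>"
proof -
  have "(cop (z * of_real (lam d)) * T d z + N * T d z) \<rhd> \<alpha> = (\<Sum>(d1, d2)\<in>pairs d. T d1 z * Q d2) \<rhd> \<alpha>"
    by (simp only: T_equation[OF assms])
  also have "\<dots> = (\<Sum>(d1, d2)\<in>pairs d. T d1 z \<rhd> Q d2 \<rhd> \<alpha>)"
    by (simp add: ap_sum case_prod_beta)
  finally have "(z * of_real (lam d)) *s (T d z \<rhd> \<alpha>) + N \<rhd> T d z \<rhd> \<alpha> = (\<Sum>(d1, d2)\<in>pairs d. T d1 z \<rhd> Q d2 \<rhd> \<alpha>)"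
    by simp
  then show ?thesis by (simp add: eq_diff_eq)
qed

lemma P_step:
  assumes d: "d \<in> eff X" and z: "z \<noteq> 0"
  shows "z * of_real (lam d) * P z d \<alpha> \<beta> =
    (\<Sum>(g, f)\<in>pairs d. P z g \<alpha> (Q f \<rhd> \<beta>)) - (\<Sum>(g, f)\<in>pairs d. P z g (Q f \<rhd> \<alpha>) \<beta>)"
proof -
  let ?A = "\<lambda>d. T d (- z)" and ?B = "\<lambda>d. T d z"
  have "z * of_real (lam d) * P z d \<alpha> \<beta> = (\<Sum>(d1, d2)\<in>pairs d.
     (\<Sum>(e, f)\<in>pairs d2. orb_pair X (?A d1 \<rhd> \<alpha>) (?B e \<rhd> Q f \<rhd> \<beta>))
      - (\<Sum>(e, f)\<in>pairs d1. orb_pair X (?A e \<rhd> Q f \<rhd> \<alpha>) (?B d2 \<rhd> \<beta>)))"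
    unfolding P_def sum_distrib_left
  proof (intro sum.cong refl)
    fix x assume x: "x \<in> pairs d"
    obtain d1 d2 where xd: "x = (d1, d2)" by (cases x)
    have e1: "d1 \<in> eff X" and e2: "d2 \<in> eff X" and l: "lam d = lam d1 + lam d2"
      using x xd pairs_lam[of d1 d2 d] by (simp_all add: pairs_def)
    have mz: "- z \<noteq> 0" using z by simp
    have "z * of_real (lam d) * orb_pair X (?A d1 \<rhd> \<alpha>) (?B d2 \<rhd> \<beta>) =
      orb_pair X (?A d1 \<rhd> \<alpha>) ((z * of_real (lam d2)) *s (?B d2 \<rhd> \<beta>))
      - orb_pair X ((- z * of_real (lam d1)) *s (?A d1 \<rhd> \<alpha>)) (?B d2 \<rhd> \<beta>)"
    proof -
      have "z * (of_real (lam d1) + of_real (lam d2)) * u = z * of_real (lam d2) * u - - z * of_real (lam d1) * u" for u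
        by algebra
      then show ?thesis by (simp only: l of_real_add orb_pair_scale_left orb_pair_scale_right)
    qed
    also have "\<dots> = (\<Sum>(e, f)\<in>pairs d2. orb_pair X (?A d1 \<rhd> \<alpha>) (?B e \<rhd> Q f \<rhd> \<beta>))
      - (\<Sum>(e, f)\<in>pairs d1. orb_pair X (?A e \<rhd> Q f \<rhd> \<alpha>) (?B d2 \<rhd> \<beta>))"
      unfolding T_equation'[OF e2 z] T_equation'[OF e1 mz]
      unfolding orb_pair_diff_left orb_pair_diff_right orb_pair_sum_left orb_pair_sum_right
          case_prod_beta N_selfadjoint by simp
    finally show "z * of_real (lam d) * (case x of (d1, d2) \<Rightarrow> orb_pair X (?A d1 \<rhd> \<alpha>) (?B d2 \<rhd> \<beta>))
      = (case x of (d1, d2) \<Rightarrow> (\<Sum>(e, f)\<in>pairs d2. orb_pair X (?A d1 \<rhd> \<alpha>) (?B e \<rhd> Q f \<rhd> \<beta>))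
      - (\<Sum>(e, f)\<in>pairs d1. orb_pair X (?A e \<rhd> Q f \<rhd> \<alpha>) (?B d2 \<rhd> \<beta>)))"
      by (simp add: xd)
  qed
  also have "\<dots> = (\<Sum>(d1, d2)\<in>pairs d. \<Sum>(e, f)\<in>pairs d2. orb_pair X (?A d1 \<rhd> \<alpha>) (?B e \<rhd> Q f \<rhd> \<beta>))
      - (\<Sum>(d1, d2)\<in>pairs d. \<Sum>(e, f)\<in>pairs d1. orb_pair X (?A e \<rhd> Q f \<rhd> \<alpha>) (?B d2 \<rhd> \<beta>))"
    by (simp add: case_prod_beta sum_subtractf)
  also have "(\<Sum>(d1, d2)\<in>pairs d. \<Sum>(e, f)\<in>pairs d2. orb_pair X (?A d1 \<rhd> \<alpha>) (?B e \<rhd> Q f \<rhd> \<beta>))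
      = (\<Sum>(g, f)\<in>pairs d. P z g \<alpha> (Q f \<rhd> \<beta>))"
    unfolding P_def case_prod_beta
    by (rule pairs_assoc[of "\<lambda>d1 e f. orb_pair X (?A d1 \<rhd> \<alpha>) (?B e \<rhd> Q f \<rhd> \<beta>)"])
  also have "(\<Sum>(d1, d2)\<in>pairs d. \<Sum>(e, f)\<in>pairs d1. orb_pair X (?A e \<rhd> Q f \<rhd> \<alpha>) (?B d2 \<rhd> \<beta>))
      = (\<Sum>(g, f)\<in>pairs d. P z g (Q f \<rhd> \<alpha>) \<beta>)"
    unfolding P_def case_prod_beta
    by (rule pairs_rotate[of "\<lambda>e f d2. orb_pair X (?A e \<rhd> Q f \<rhd> \<alpha>) (?B d2 \<rhd> \<beta>)"])
  finally show ?thesis .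
qed

text \<open>Induction on the number of effective classes of smaller area, which is finite. Of the
  two convolutions in \<open>P_step\<close> only the pairs (0, d) and (d, 0) survive; the former
  cancel because \<open>Q d\<close> is self-adjoint, the latter put \<open>N\<close> on one of the
  arguments. After 2 m rounds some argument carries the m-th power of \<open>N\<close>, which is
  0.\<close>

lemma P_eq_0:
  assumes z: "z \<noteq> 0"
  shows "d \<in> eff X \<Longrightarrow> d \<noteq> 0 \<Longrightarrow> P z d \<alpha> \<beta> = 0"
proof (induction "card {e \<in> eff X. lam e < lam d}" arbitrary: d \<alpha> \<beta> rule: less_induct)
  case less
  note d = less.prems
  have IH: "P z g \<alpha> \<beta> = 0" if g: "g \<in> eff X" "g \<noteq> 0" "lam g < lam d" for g \<alpha> \<beta>
  proof (rule less.hyps[OF _ g(1,2)], rule psubset_card_mono)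
    show "finite {e \<in> eff X. lam e < lam d}"
      by (rule finite_subset[OF _ finite_lam[of "lam d"]]) auto
    show "{e \<in> eff X. lam e < lam g} \<subset> {e \<in> eff X. lam e < lam d}" using g by auto
  qed
  have sub: "{(0, d), (d, 0)} \<subseteq> pairs d" using d eff_zero by (simp add: pairs_def)
  have zero: "P z (fst x) \<alpha> \<beta> = 0" if x: "x \<in> pairs d - {(0, d), (d, 0)}" for x \<alpha> \<beta>
  proof -
    obtain g f where xd: "x = (g, f)" by (cases x)
    then have gf: "g \<in> eff X" "f \<in> eff X" "g + f = d" "lam d = lam g + lam f"
      using x pairs_lam[of g f d] by (simp_all add: pairs_def)
    then have "g \<noteq> 0" "f \<noteq> 0" using x xd by auto
    then show ?thesis using IH[of g] gf lam_pos[of f] xd by simp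
  qed
  have step: "z * of_real (lam d) * P z d \<alpha> \<beta> = P z d \<alpha> (N \<rhd> \<beta>) - P z d (N \<rhd> \<alpha>) \<beta>" for \<alpha> \<beta>
  proof -
    have "(\<Sum>(g, f)\<in>pairs d. P z g \<alpha> (Q f \<rhd> \<beta>)) = (\<Sum>(g, f)\<in>{(0, d), (d, 0)}. P z g \<alpha> (Q f \<rhd> \<beta>))"
      by (rule sum.mono_neutral_right[OF finite_pairs sub]) (simp add: case_prod_beta zero)
    moreover have "(\<Sum>(g, f)\<in>pairs d. P z g (Q f \<rhd> \<alpha>) \<beta>) = (\<Sum>(g, f)\<in>{(0, d), (d, 0)}. P z g (Q f \<rhd> \<alpha>) \<beta>)"
      by (rule sum.mono_neutral_right[OF finite_pairs sub]) (simp add: case_prod_beta zero)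
    ultimately show ?thesis
      using P_step[OF d(1) z, of \<alpha> \<beta>] d(2) by (simp add: P_0 Q_0 Q_selfadjoint)
  qed
  obtain m where m: "N ^ m = 0" using L.N_nilpotent by blast
  have Nm: "(N ^ a) \<rhd> \<alpha> = 0" if "a \<ge> m" for a \<alpha>
  proof -
    have "N ^ a = N ^ (a - m) * N ^ m" using that by (simp flip: power_add)
    then show ?thesis by (simp add: m)
  qed
  have P0: "P z d 0 \<beta> = 0" "P z d \<alpha> 0 = 0" for \<alpha> \<beta>
    by (simp_all add: P_def ap.zero_right case_prod_beta)
  have c: "z * of_real (lam d) \<noteq> 0" using z lam_pos[OF d] by simp
  have "P z d ((N ^ a) \<rhd> \<alpha>) ((N ^ b) \<rhd> \<beta>) = 0" if "2 * m \<le> k + a + b" for k a b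
    using that
  proof (induction k arbitrary: a b)
    case 0
    then have "a \<ge> m \<or> b \<ge> m" by linarith
    then show ?case using Nm P0 by auto
  next
    case (Suc k)
    have "z * of_real (lam d) * P z d ((N ^ a) \<rhd> \<alpha>) ((N ^ b) \<rhd> \<beta>)
       = P z d ((N ^ a) \<rhd> \<alpha>) ((N ^ Suc b) \<rhd> \<beta>) - P z d ((N ^ Suc a) \<rhd> \<alpha>) ((N ^ b) \<rhd> \<beta>)"
      by (simp add: step)
    also have "\<dots> = 0" using Suc.IH[of a "Suc b"] Suc.IH[of "Suc a" b] Suc.prems by simp
    finally show ?case using c by simp
  qed
  from this[of "2 * m" 0 0] show ?case by simp
qed

end

lemma summable_on_product_real:
  fixes u :: "'a \<Rightarrow> real" and v :: "'b \<Rightarrow> real"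
  assumes "u summable_on A" "v summable_on B" "\<And>a. 0 \<le> u a" "\<And>b. 0 \<le> v b"
  shows "(\<lambda>(a, b). u a * v b) summable_on A \<times> B"
proof -
  have "(\<lambda>(a, b). u a * v b) abs_summable_on A \<times> B"
    unfolding Infinite_Sum.abs_summable_on_Sigma_iff
  proof (intro conjI ballI)
    show "(\<lambda>b. case (a, b) of (a, b) \<Rightarrow> u a * v b) abs_summable_on B" for a
      unfolding summable_on_iff_abs_summable_on_real[symmetric] prod.case
      by (rule summable_on_cmult_right[OF assms(2)])
    have "infsum (\<lambda>b. norm (case (a, b) of (a, b) \<Rightarrow> u a * v b)) B = u a * infsum v B" for a
      using assms(3,4) by (simp add: abs_mult infsum_cmult_right')
    then show "(\<lambda>a. infsum (\<lambda>b. norm (case (a, b) of (a, b) \<Rightarrow> u a * v b)) B) abs_summable_on A"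
      unfolding summable_on_iff_abs_summable_on_real[symmetric]
      by (simp add: summable_on_cmult_left assms(1))
  qed
  then show ?thesis by (rule Infinite_Sum.abs_summable_summable)
qed

context orbifold_cohomology
begin

lemma bounded_bilinear_orb_pair: "bounded_bilinear (orb_pair X)"
proof -
  have "bilinear (orb_pair X)"
    unfolding bilinear_def
    by (auto intro!: linearI simp: orb_pair_add_left orb_pair_add_right scaleR_eq_scale
        orb_pair_scale_left orb_pair_scale_right scaleR_conv_of_real)
  then show ?thesis by (simp add: bilinear_conv_bounded_bilinear)
qed

end

context kahler_GW
begin

text \<open>A positive lower bound for the area of nonzero effective classes. Only finitely many
  have area at most 1, and inserting 1 covers the case that there are none.\<close>

definition gap :: real where "gap = Min (insert 1 (lam ` {d \<in> D. lam d \<le> 1}))"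

lemma gap: "0 < gap" "d \<in> D \<Longrightarrow> gap \<le> lam d"
proof -
  have fin: "finite (insert 1 (lam ` {d \<in> D. lam d \<le> 1}))"
    by (intro finite.insertI finite_imageI finite_subset[OF _ finite_lam[of 1]]) auto
  show "0 < gap" unfolding gap_def using fin lam_pos by (subst Min_gr_iff) auto
  show "gap \<le> lam d" if d: "d \<in> D"
  proof (cases "lam d \<le> 1")
    case True
    then show ?thesis unfolding gap_def using d by (intro Min_le fin) simp
  next
    case False
    have "gap \<le> 1" unfolding gap_def by (rule Min_le[OF fin]) simp
    then show ?thesis using False by simp
  qed
qed

definition E :: "complex \<Rightarrow> 'd \<Rightarrow> complex \<Rightarrow> (complex^'n) endo" where
  "E x d z = cop (exp (- x * of_real (lam d))) * T d z"

definition Phi :: "complex \<Rightarrow> complex \<Rightarrow> (complex^'n) endo" where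
  "Phi x z = 1 + infsum (\<lambda>d. E x d z) D"

lemma clin_E: "clin (E x d z)" unfolding E_def by (intro clin_mult clin_intros clin_T)

lemma E_0: "E x 0 z = 1" by (simp add: E_def T_0)

lemma eff_D: "eff X = insert 0 D" using eff_zero by auto

lemma holop_T: "holop (- {0}) (T d)"
proof (rule holopI[OF clin_T])
  fix v
  show "hvec (- {0}) (\<lambda>z. T d z \<rhd> v)"
    unfolding T_def ap_add ap_sum ap_times ap_cop
    by (intro hvec_add hvec_const hvec_sum hvec_scale holomorphic_intros) auto
qed

end

context convergent_GW
begin

definition fsum :: "real \<Rightarrow> real" where "fsum r = infsum (\<lambda>d. sig r d * q d) D"

lemma fsum_nonneg: "0 < r \<Longrightarrow> 0 \<le> fsum r"
  unfolding fsum_def by (intro infsum_nonneg mult_nonneg_nonneg sig_nonneg less_imp_le[OF q_pos])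

text \<open>Write Re x as t0 + (Re x - t0): the first part pays for summability over
  \<open>d\<close>, the second gives a decay that is uniform in \<open>d\<close> because of the
  gap.\<close>

lemma norm_E:
  assumes d: "d \<in> D" and r: "0 < r" "r \<le> norm z" and x: "t0 \<le> Re x"
  shows "norm (E x d z) \<le> exp (- (Re x - t0) * gap) * (sig r d * q d)"
proof -
  have "norm (E x d z) \<le> norm (cop (exp (- x * of_real (lam d))) :: (complex^'n) endo) * norm (T d z)"
    unfolding E_def by (rule norm_mult_ineq)
  also have "\<dots> \<le> exp (- Re x * lam d) * sig r d"
    unfolding norm_cop using norm_T[of d r z] d r by (intro mult_mono) simp_all
  also have "exp (- Re x * lam d) = exp (- (Re x - t0) * lam d) * q d"
    by (simp add: q_def algebra_simps flip: exp_add)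
  also have "exp (- (Re x - t0) * lam d) * q d * sig r d \<le> exp (- (Re x - t0) * gap) * q d * sig r d"
  proof (intro mult_right_mono sig_nonneg[OF r(1)] less_imp_le[OF q_pos])
    have "(Re x - t0) * gap \<le> (Re x - t0) * lam d" using gap(2)[OF d] x by (intro mult_left_mono) simp_all
    then show "exp (- (Re x - t0) * lam d) \<le> exp (- (Re x - t0) * gap)"
      by (simp only: exp_le_cancel_iff mult_minus_left neg_le_iff_le)
  qed
  finally show ?thesis by (simp only: mult_ac)
qed

lemma E_abs_summable:
  assumes "z \<noteq> 0" "t0 \<le> Re x"
  shows "(\<lambda>d. E x d z) abs_summable_on D"
proof (rule Infinite_Sum.abs_summable_on_comparison_test)
  show "(\<lambda>d. exp (- (Re x - t0) * gap) * (sig (norm z) d * q d)) abs_summable_on D"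
    unfolding summable_on_iff_abs_summable_on_real[symmetric]
    using assms by (intro summable_on_cmult_right sig_summable) simp
  show "norm (E x d z) \<le> norm (exp (- (Re x - t0) * gap) * (sig (norm z) d * q d))" if "d \<in> D" for d
    using norm_E[OF that, of "norm z" z x] assms by simp
qed

lemma Phi_near:
  assumes r: "0 < r" "r \<le> norm z" and x: "t0 \<le> Re x"
  shows "norm (Phi x z - 1) \<le> exp (- (Re x - t0) * gap) * fsum r"
proof -
  have z: "z \<noteq> 0" using r by auto
  have "((\<lambda>d. E x d z) has_sum infsum (\<lambda>d. E x d z) D) D"
    by (rule has_sum_infsum[OF Infinite_Sum.abs_summable_summable[OF E_abs_summable[OF z x]]])
  moreover have "((\<lambda>d. exp (- (Re x - t0) * gap) * (sig r d * q d)) has_sum exp (- (Re x - t0) * gap) * fsum r) D"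
    unfolding fsum_def by (rule has_sum_cmult_right[OF has_sum_infsum[OF sig_summable[OF r(1)]]])
  ultimately have "norm (infsum (\<lambda>d. E x d z) D) \<le> exp (- (Re x - t0) * gap) * fsum r"
    by (rule norm_infsum_le) (rule norm_E[OF _ r x])
  then show ?thesis by (simp add: Phi_def)
qed

lemma Phi_has_sum:
  assumes "z \<noteq> 0" "t0 \<le> Re x"
  shows "((\<lambda>d. E x d z \<rhd> v) has_sum (Phi x z \<rhd> v)) (eff X)"
proof -
  have "((\<lambda>d. E x d z) has_sum infsum (\<lambda>d. E x d z) D) D"
    by (rule has_sum_infsum[OF Infinite_Sum.abs_summable_summable[OF E_abs_summable[OF assms]]])
  then have "((\<lambda>d. E x d z) has_sum (E x 0 z + infsum (\<lambda>d. E x d z) D)) (insert 0 D)"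
    by (intro has_sum_insert) simp_all
  then have "((\<lambda>d. E x d z) has_sum Phi x z) (eff X)"
    by (simp only: eff_D[symmetric] Phi_def E_0)
  then show ?thesis by (rule has_sum_bounded_linear[OF ap.bounded_linear_left])
qed

lemma E_ap_abs_summable:
  assumes "z \<noteq> 0" "t0 \<le> Re x"
  shows "(\<lambda>d. E x d z) abs_summable_on eff X"
  by (subst eff_D, subst summable_on_insert_iff) (rule E_abs_summable[OF assms])

lemma clin_Phi: assumes "z \<noteq> 0" "t0 \<le> Re x" shows "clin (Phi x z)"
  unfolding clin_def
proof (intro allI endo_eqI)
  fix c v
  have "((\<lambda>d. E x d z \<rhd> (c *s v)) has_sum Phi x z \<rhd> (c *s v)) (eff X)" by (rule Phi_has_sum[OF assms])
  moreover have "((\<lambda>d. cop c \<rhd> E x d z \<rhd> v) has_sum cop c \<rhd> Phi x z \<rhd> v) (eff X)"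
    by (rule has_sum_bounded_linear[OF ap.bounded_linear_right Phi_has_sum[OF assms]])
  moreover have "cop c \<rhd> E x d z \<rhd> v = E x d z \<rhd> (c *s v)" for d
    by (simp add: clin_ap[OF clin_E])
  ultimately show "(Phi x z * cop c) \<rhd> v = (cop c * Phi x z) \<rhd> v"
    by (simp only: ap_times ap_cop has_sum_unique)
qed

lemma hvec_Phi:
  assumes x: "t0 \<le> Re x" shows "hvec (- {0}) (\<lambda>z. Phi x z \<rhd> v)"
  unfolding hvec_def
proof
  fix i
  define g where "g d z = (E x d z \<rhd> v) $ i" for d z
  have hg: "g d holomorphic_on - {0}" for d
  proof -
    have "holop (- {0}) (E x d)"
      unfolding E_def by (intro holop_mult holop_T holop_const clin_intros)
    from hvec_ap[OF this hvec_const[of _ v]] show ?thesis unfolding hvec_def g_def by (rule spec)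
  qed
  have comp: "norm (v $ i) \<le> norm v" for v :: "complex^'n" by (rule Finite_Cartesian_Product.norm_nth_le)
  have sum: "((\<lambda>d. g d z) has_sum (Phi x z \<rhd> v) $ i) (eff X)" if "z \<noteq> 0" for z
    unfolding g_def
    by (rule has_sum_bounded_linear[OF _ Phi_has_sum[OF that x], of "\<lambda>v. v $ i"])
      (rule bounded_linear_vec_nth)
  have diff: "(\<lambda>z. (Phi x z \<rhd> v) $ i) field_differentiable (at z0)" if z0: "z0 \<noteq> 0" for z0
  proof -
    define r where "r = norm z0 / 2"
    have r: "0 < r" using z0 by (simp add: r_def)
    have far: "r \<le> norm z" if "z \<in> cball z0 r" for z
    proof -
      have "norm z0 \<le> norm (z0 - z) + norm z" by (metis diff_add_cancel norm_triangle_ineq)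
      then show ?thesis using that by (simp add: r_def dist_norm)
    qed
    define M where "M d = (if d = 0 then norm v else exp (- (Re x - t0) * gap) * (sig r d * q d) * norm v)" for d
    have "M summable_on D \<longleftrightarrow> (\<lambda>d. exp (- (Re x - t0) * gap) * (sig r d * q d) * norm v) summable_on D"
      by (rule summable_on_cong) (simp add: M_def)
    then have "M summable_on D"
      by (simp only:) (rule summable_on_cmult_left[OF summable_on_cmult_right[OF sig_summable[OF r]]])
    then have M: "M summable_on eff X" by (subst eff_D, subst summable_on_insert_iff)
    have bound: "norm (g d z) \<le> M d" if "d \<in> eff X" "z \<in> cball z0 r" for d z
    proof -
      have "norm (g d z) \<le> norm (E x d z) * norm v"
        unfolding g_def by (rule order_trans[OF comp norm_ap])
      also have "\<dots> \<le> M d"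
      proof (cases "d = 0")
        case True
        then show ?thesis by (simp add: E_0 M_def)
      next
        case False
        then have "norm (E x d z) \<le> exp (- (Re x - t0) * gap) * (sig r d * q d)"
          by (intro norm_E[OF _ r far[OF that(2)] x]) (simp add: that(1))
        then have "norm (E x d z) * norm v \<le> exp (- (Re x - t0) * gap) * (sig r d * q d) * norm v"
          by (rule mult_right_mono) simp
        then show ?thesis by (simp only: M_def False if_False)
      qed
      finally show ?thesis .
    qed
    have "uniform_limit (cball z0 r) (\<lambda>F z. \<Sum>d\<in>F. g d z) (\<lambda>z. (Phi x z \<rhd> v) $ i) (finite_subsets_at_top (eff X))"
    proof (rule Weierstrass_m_test_general'[OF bound _ M])
      show "((\<lambda>d. g d z) has_sum (Phi x z \<rhd> v) $ i) (eff X)" if "z \<in> cball z0 r" for z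
        by (rule sum) (use far[OF that] r in auto)
    qed
    moreover have "\<forall>\<^sub>F F in finite_subsets_at_top (eff X).
        continuous_on (cball z0 r) (\<lambda>z. \<Sum>d\<in>F. g d z) \<and> (\<lambda>z. \<Sum>d\<in>F. g d z) holomorphic_on ball z0 r"
    proof (rule always_eventually, rule allI)
      fix F
      have "(\<lambda>z. \<Sum>d\<in>F. g d z) holomorphic_on - {0}" by (intro holomorphic_on_sum hg)
      moreover have "cball z0 r \<subseteq> - {0}"
      proof
        fix z assume "z \<in> cball z0 r"
        from far[OF this] r show "z \<in> - {0}" by auto
      qed
      ultimately have "(\<lambda>z. \<Sum>d\<in>F. g d z) holomorphic_on cball z0 r" by (rule holomorphic_on_subset)
      then show "continuous_on (cball z0 r) (\<lambda>z. \<Sum>d\<in>F. g d z) \<and> (\<lambda>z. \<Sum>d\<in>F. g d z) holomorphic_on ball z0 r"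
        by (intro conjI holomorphic_on_imp_continuous_on)
          (assumption, erule holomorphic_on_subset, rule ball_subset_cball)
    qed
    ultimately have "(\<lambda>z. (Phi x z \<rhd> v) $ i) holomorphic_on ball z0 r"
      by - (rule holomorphic_uniform_limit[of z0 r "\<lambda>F z. \<Sum>d\<in>F. g d z" "finite_subsets_at_top (eff X)"],
        assumption+, rule finite_subsets_at_top_neq_bot)
    then show ?thesis by (rule holomorphic_on_imp_differentiable_at) (simp_all add: r)
  qed
  show "(\<lambda>z. (Phi x z \<rhd> v) $ i) holomorphic_on - {0}"
    unfolding holomorphic_on_def by (rule ballI, rule field_differentiable_at_within, rule diff, blast)
qed

text \<open>By the convention 1 / 0 = 0 all coefficients of positive degree vanish at 0. The value
  serves only to make \<open>Phi x\<close> linear at every point, as \<open>holop\<close>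
  demands.\<close>

lemma Phi_at_0: "Phi x 0 = 1"
proof -
  have "infsum (\<lambda>d. E x d 0) D = 0"
    by (rule infsum_0) (simp add: E_def T_def)
  then show ?thesis by (simp add: Phi_def)
qed

lemma holop_Phi: assumes "t0 \<le> Re x" shows "holop (- {0}) (Phi x)"
proof (rule holopI[OF _ hvec_Phi[OF assms]])
  show "clin (Phi x z)" for z
    by (cases "z = 0") (simp_all add: Phi_at_0 clin_Phi assms)
qed

text \<open>The double sum over degrees converges absolutely and can be collected by the total
  class. By \<open>P_eq_0\<close> only the total class 0 contributes.\<close>

lemma Phi_unitary:
  assumes z: "z \<noteq> 0" and x: "t0 \<le> Re x"
  shows "orb_pair X (Phi x (- z) \<rhd> \<alpha>) (Phi x z \<rhd> \<beta>) = orb_pair X \<alpha> \<beta>"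
proof -
  have mz: "- z \<noteq> 0" using z by simp
  define F where "F = (\<lambda>(d1, d2). orb_pair X (E x d1 (- z) \<rhd> \<alpha>) (E x d2 z \<rhd> \<beta>))"
  have bl: "bounded_bilinear (\<lambda>a b. orb_pair X a b)" by (rule bounded_bilinear_orb_pair)
  then interpret op: bounded_bilinear "orb_pair X" .
  have inner: "((\<lambda>d2. F (d1, d2)) has_sum orb_pair X (E x d1 (- z) \<rhd> \<alpha>) (Phi x z \<rhd> \<beta>)) (eff X)" for d1
    unfolding F_def prod.case by (rule has_sum_bounded_linear[OF op.bounded_linear_right Phi_has_sum[OF z x]])
  have outer: "((\<lambda>d1. orb_pair X (E x d1 (- z) \<rhd> \<alpha>) (Phi x z \<rhd> \<beta>)) has_sum
      orb_pair X (Phi x (- z) \<rhd> \<alpha>) (Phi x z \<rhd> \<beta>)) (eff X)"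
    by (rule has_sum_bounded_linear[OF op.bounded_linear_left Phi_has_sum[OF mz x]])
  obtain K where K: "0 \<le> K" "\<And>a b. norm (orb_pair X a b) \<le> norm a * norm b * K"
    using op.nonneg_bounded by blast
  define u where "u d = norm (E x d (- z))" for d
  define v where "v d = norm (E x d z)" for d
  have us: "u summable_on eff X" and vs: "v summable_on eff X"
    unfolding u_def v_def by (rule E_ap_abs_summable[OF mz x], rule E_ap_abs_summable[OF z x])
  have "F abs_summable_on eff X \<times> eff X"
  proof (rule Infinite_Sum.abs_summable_on_comparison_test)
    have "(\<lambda>(d1, d2). u d1 * v d2) summable_on eff X \<times> eff X"
      by (rule summable_on_product_real[OF us vs]) (simp_all add: u_def v_def)
    then have "(\<lambda>y. (case y of (d1, d2) \<Rightarrow> u d1 * v d2) * (norm \<alpha> * norm \<beta> * K)) summable_on eff X \<times> eff X"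
      by (rule summable_on_cmult_left)
    then show "(\<lambda>y. (case y of (d1, d2) \<Rightarrow> u d1 * v d2) * (norm \<alpha> * norm \<beta> * K)) abs_summable_on eff X \<times> eff X"
      unfolding summable_on_iff_abs_summable_on_real[symmetric] .
    fix y :: "'d \<times> 'd"
    obtain d1 d2 where y: "y = (d1, d2)" by (cases y)
    have "norm (F y) \<le> norm (E x d1 (- z) \<rhd> \<alpha>) * norm (E x d2 z \<rhd> \<beta>) * K"
      unfolding F_def y prod.case by (rule K(2))
    also have "\<dots> \<le> (u d1 * norm \<alpha>) * (v d2 * norm \<beta>) * K"
      unfolding u_def v_def by (intro mult_right_mono mult_mono norm_ap K(1)) simp_all
    finally show "norm (F y) \<le> norm ((case y of (d1, d2) \<Rightarrow> u d1 * v d2) * (norm \<alpha> * norm \<beta> * K))"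
      using K(1) by (simp add: y u_def v_def mult_ac)
  qed
  then have Fs: "F summable_on eff X \<times> eff X" by (rule Infinite_Sum.abs_summable_summable)
  have "orb_pair X (Phi x (- z) \<rhd> \<alpha>) (Phi x z \<rhd> \<beta>) = infsum (\<lambda>d1. infsum (\<lambda>d2. F (d1, d2)) (eff X)) (eff X)"
    unfolding infsumI[OF inner] by (rule infsumI[OF outer, symmetric])
  also have "\<dots> = infsum F (eff X \<times> eff X)" by (rule infsum_Sigma_banach[OF Fs])
  also have bij: "bij_betw snd (SIGMA d:eff X. pairs d) (eff X \<times> eff X)"
  proof (rule bij_betw_byWitness[where f' = "\<lambda>p. (fst p + snd p, p)"])
    show "\<forall>a\<in>SIGMA d:eff X. pairs d. (fst (snd a) + snd (snd a), snd a) = a"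
      by (auto simp: pairs_def)
    show "\<forall>a'\<in>eff X \<times> eff X. snd (fst a' + snd a', a') = a'" by simp
    show "snd ` (SIGMA d:eff X. pairs d) \<subseteq> eff X \<times> eff X" by (auto simp: pairs_def)
    show "(\<lambda>p. (fst p + snd p, p)) ` (eff X \<times> eff X) \<subseteq> (SIGMA d:eff X. pairs d)"
      by (auto simp: pairs_def eff_add)
  qed
  then have "infsum F (eff X \<times> eff X) = infsum (\<lambda>y. F (snd y)) (SIGMA d:eff X. pairs d)"
    by (rule infsum_reindex_bij_betw[symmetric])
  also have "\<dots> = infsum (\<lambda>d. infsum (\<lambda>p. F p) (pairs d)) (eff X)"
    by (subst infsum_Sigma_banach[symmetric]) (use Fs summable_on_reindex_bij_betw[OF bij, of F] in simp_all)
  also have "\<dots> = infsum (\<lambda>d. exp (- x * of_real (lam d)) * P z d \<alpha> \<beta>) (eff X)"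
  proof (rule infsum_cong)
    fix d assume "d \<in> eff X"
    have "F p = exp (- x * of_real (lam d)) * (case p of (d1, d2) \<Rightarrow> orb_pair X (T d1 (- z) \<rhd> \<alpha>) (T d2 z \<rhd> \<beta>))"
      if p: "p \<in> pairs d" for p
    proof -
      obtain d1 d2 where pd: "p = (d1, d2)" by (cases p)
      have "lam d = lam d1 + lam d2" using p pd pairs_lam by simp
      then have "exp (- x * of_real (lam d)) = exp (- x * of_real (lam d1)) * exp (- x * of_real (lam d2))"
        by (simp add: distrib_left flip: exp_add)
      then show ?thesis
        unfolding F_def pd prod.case E_def ap_times ap_cop orb_pair_scale_left orb_pair_scale_right by simp
    qed
    then show "infsum F (pairs d) = exp (- x * of_real (lam d)) * P z d \<alpha> \<beta>"
      by (simp add: P_def sum_distrib_left)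
  qed
  also have "\<dots> = infsum (\<lambda>d. exp (- x * of_real (lam d)) * P z d \<alpha> \<beta>) {0}"
    by (rule infsum_cong_neutral) (use P_eq_0[OF z] eff_zero in auto)
  also have "\<dots> = orb_pair X \<alpha> \<beta>" by (simp add: P_0)
  finally show ?thesis .
qed

end

section \<open>From the convergence hypothesis to the formula for J\<close>

lemma summable_on_sum:
  fixes f :: "'i \<Rightarrow> 'a \<Rightarrow> 'b::topological_comm_monoid_add"
  assumes "\<And>i. i \<in> I \<Longrightarrow> f i summable_on A"
  shows "(\<lambda>x. \<Sum>i\<in>I. f i x) summable_on A"
  using assms
proof (induction I rule: infinite_finite_induct)
  case (insert i I)
  have "(\<lambda>x. f i x + (\<Sum>i\<in>I. f i x)) summable_on A"
    by (intro summable_on_add insert) simp_all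
  then show ?case using insert.hyps by simp
qed simp_all

context kahler_GW
begin

lemma tau_omega: "tau02 X (c *s \<omega>) = c *s \<omega>" "tau' X (c *s \<omega>) = 0"
proof -
  show 1: "tau02 X (c *s \<omega>) = c *s \<omega>"
    using omega_Hgr by (auto simp: tau02_def hcomp_def Hgr_def vec_eq_iff)
  show "tau' X (c *s \<omega>) = 0" by (simp add: tau'_def 1)
qed

lemma h2pair_scale: "d \<in> eff X \<Longrightarrow> h2pair X (c *s \<omega>) d = c * of_real (lam d)"
proof -
  interpret h: Vector_Spaces.linear "(*s)" "(*)" "\<lambda>\<tau>. h2pair X \<tau> d" by (rule h2pair_linear)
  show "d \<in> eff X \<Longrightarrow> ?thesis" by (simp add: h.scale h2pair_lam)
qed

lemma gw_zero: "gw X ((0, k) # xs) d = 0"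
proof -
  interpret g: Vector_Spaces.linear "(*s)" "(*)" "\<lambda>\<alpha>. gw X ((\<alpha>, k) # xs) d" by (rule gw_linear)
  show ?thesis by (rule g.zero)
qed

lemma gw_zero2: "gw X (x # (0, k) # xs) d = 0"
proof -
  have "gw X (x # (0, k) # xs) d = gw X ((0, k) # x # xs) d" by (rule gw_sym) simp
  then show ?thesis by (simp add: gw_zero)
qed

lemma gw_zeros: "0 < l \<Longrightarrow> gw X (x # replicate l (0, k) @ xs) d = 0"
  by (cases l) (simp_all add: gw_zero2)

lemma E_coeff:
  assumes d: "d \<in> D"
  shows "(\<Sum>i\<in>UNIV. ((\<Sum>k. gw X [(\<alpha>, 0), (\<phi> i, k)] d / z ^ Suc k) * exp (- x * of_real (lam d))) *s dual_basis X i)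
    = E x d z \<rhd> \<alpha>"
proof -
  have d0: "d \<noteq> 0" using d by blast
  have sum: "(\<Sum>k. gw X [(\<alpha>, 0), (\<phi> i, k)] d / z ^ Suc k) = orb_pair X (T d z \<rhd> \<alpha>) (\<phi> i)" for i
  proof -
    have "(\<Sum>k. gw X [(\<alpha>, 0), (\<phi> i, k)] d / z ^ Suc k) = (\<Sum>k<KK d. gw X [(\<alpha>, 0), (\<phi> i, k)] d / z ^ Suc k)"
    proof (rule suminf_finite)
      show "gw X [(\<alpha>, 0), (\<phi> i, k)] d / z ^ Suc k = 0" if "k \<notin> {..<KK d}" for k
        using KK[of d k] that unfolding pair_S[symmetric] by simp
    qed simp
    also have "\<dots> = orb_pair X (T d z \<rhd> \<alpha>) (\<phi> i)"
      by (simp add: T_def d0 ap_sum orb_pair_sum_left orb_pair_scale_left pair_S)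
    finally show ?thesis .
  qed
  have "E x d z \<rhd> \<alpha> = exp (- x * of_real (lam d)) *s (T d z \<rhd> \<alpha>)" by (simp add: E_def)
  also have "\<dots> = (\<Sum>i\<in>UNIV. (orb_pair X (T d z \<rhd> \<alpha>) (\<phi> i) * exp (- x * of_real (lam d))) *s dual_basis X i)"
  proof -
    have "c *s v = (\<Sum>i\<in>UNIV. (orb_pair X v (\<phi> i) * c) *s dual_basis X i)" for c v
    proof -
      have "c *s v = (\<Sum>i\<in>UNIV. orb_pair X (c *s v) (\<phi> i) *s dual_basis X i)"
        by (rule expand_dual_basis)
      then show ?thesis by (simp only: orb_pair_scale_left mult.commute)
    qed
    then show ?thesis .
  qed
  finally show ?thesis unfolding sum by (rule sym)
qed

lemma tau_in_domain:
  assumes "qprod_converges_on X U"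
  obtains R where "0 < R" "\<And>x. R < Re x \<Longrightarrow> - x *s \<omega> \<in> U"
proof -
  obtain M e where M: "M > 0" "e > 0" and
    sub: "{\<tau>. (\<forall>d \<in> D. Re (h2pair X (tau02 X \<tau>) d) < - M) \<and> norm (tau' X \<tau>) < e} \<subseteq> U"
    using assms unfolding qprod_converges_on_def by blast
  show thesis
  proof (rule that)
    show "0 < M / gap" using M gap by simp
    fix x assume x: "M / gap < Re x"
    have "Re (h2pair X (tau02 X (- x *s \<omega>)) d) < - M" if d: "d \<in> D" for d
    proof -
      have "M < Re x * gap" using x gap(1) by (simp add: pos_divide_less_eq)
      also have "\<dots> \<le> Re x * lam d"
      proof (rule mult_left_mono[OF gap(2)[OF d]])
        have "0 < M / gap" using M gap by simp
        then show "0 \<le> Re x" using x by linarith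
      qed
      finally have "M < Re x * lam d" .
      moreover have "d \<in> eff X" using d by blast
      ultimately show ?thesis by (simp only: tau_omega h2pair_scale) simp
    qed
    moreover have "norm (tau' X (- x *s \<omega>)) < e" unfolding tau_omega using M by simp
    ultimately show "- x *s \<omega> \<in> U" using sub by blast
  qed
qed

text \<open>At a multiple of \<omega> the insertion \<open>tau'\<close> is 0, and the part
  \<open>l = 0\<close> of the quantum product consists of three-point invariants. Summability of
  complex coordinates is absolute, so it passes to the columns of \<open>Q d\<close> and from there
  to the norms.\<close>

lemma Q_summable_of_convergence:
  assumes U: "qprod_converges_on X U" and mem: "- of_real t *s \<omega> \<in> U"
  shows "(\<lambda>d. norm (Q d) * exp (- t * lam d)) summable_on D"
proof -
  define \<tau> where "\<tau> = - complex_of_real t *s \<omega>"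
  have \<tau>: "tau02 X \<tau> = \<tau>" "tau' X \<tau> = 0" unfolding \<tau>_def by (rule tau_omega)+
  define c where "c d = exp (- t * lam d)" for d
  define f where "f i j d = c d *\<^sub>R (\<Sum>k\<in>UNIV. gw X [(\<phi> i, 0), (\<phi> j, 0), (\<phi> k, 0)] d *s dual_basis X k)" for i j d
  have hp: "exp (h2pair X \<tau> d) = of_real (c d)" if "d \<in> D" for d
  proof -
    have "d \<in> eff X" using that by blast
    then have "exp (h2pair X \<tau> d) = exp (of_real (- t * lam d))"
      unfolding \<tau>_def h2pair_scale[OF \<open>d \<in> eff X\<close>] by simp
    then show ?thesis unfolding c_def by (simp only: exp_of_real)
  qed
  have 1: "f i j summable_on D" for i j
  proof -
    have "qprod_term X \<tau> (\<phi> i) (\<phi> j) summable_on eff X \<times> UNIV"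
      using U mem unfolding qprod_converges_on_def \<tau>_def by blast
    then have "qprod_term X \<tau> (\<phi> i) (\<phi> j) summable_on D \<times> {0}"
      by (rule summable_on_subset_banach) blast
    also have "D \<times> {0} = (\<lambda>d. (d, 0)) ` D" by auto
    finally have "(qprod_term X \<tau> (\<phi> i) (\<phi> j) \<circ> (\<lambda>d. (d, 0))) summable_on D"
      by (subst (asm) summable_on_reindex) (simp_all add: inj_on_def)
    moreover have "(qprod_term X \<tau> (\<phi> i) (\<phi> j) \<circ> (\<lambda>d. (d, 0))) d = f i j d" if "d \<in> D" for d
    proof -
      have "(a * of_real (c d)) *s v = c d *\<^sub>R (a *s v)" for a and v :: "complex^'n"
        by (simp only: scaleR_eq_scale vector_smult_assoc mult.commute)
      then show ?thesis
        by (simp add: comp_def qprod_term_def \<tau> hp[OF that] f_def scaleR_sum_right)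
    qed
    then have "(qprod_term X \<tau> (\<phi> i) (\<phi> j) \<circ> (\<lambda>d. (d, 0))) summable_on D \<longleftrightarrow> f i j summable_on D"
      by (rule summable_on_cong)
    ultimately show ?thesis by blast
  qed
  have 2: "c d *\<^sub>R (Q d \<rhd> \<phi> i) = (\<Sum>j\<in>UNIV. \<omega> $ j *s f i j d)" for d i
  proof -
    have "gw X [(\<phi> i, 0), (\<omega>, 0), (\<phi> k, 0)] d = (\<Sum>j\<in>UNIV. \<omega> $ j * gw X [(\<phi> i, 0), (\<phi> j, 0), (\<phi> k, 0)] d)" for k
    proof -
      have sw: "gw X [(\<phi> i, 0), (\<beta>, 0), (\<phi> k, 0)] d = gw X [(\<beta>, 0), (\<phi> i, 0), (\<phi> k, 0)] d" for \<beta>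
        by (rule gw_sym) (simp add: add_mset_commute)
      interpret g: Vector_Spaces.linear "(*s)" "(*)" "\<lambda>\<beta>. gw X [(\<beta>, 0), (\<phi> i, 0), (\<phi> k, 0)] d" by (rule gw_linear)
      have "gw X [(\<omega>, 0), (\<phi> i, 0), (\<phi> k, 0)] d = (\<Sum>j\<in>UNIV. \<omega> $ j * gw X [(\<phi> j, 0), (\<phi> i, 0), (\<phi> k, 0)] d)"
        by (subst vec_expand[of \<omega>, folded \<phi>_def]) (simp only: g.sum g.scale)
      then show ?thesis unfolding sw .
    qed
    then have "Q d \<rhd> \<phi> i = (\<Sum>k\<in>UNIV. (\<Sum>j\<in>UNIV. \<omega> $ j * gw X [(\<phi> i, 0), (\<phi> j, 0), (\<phi> k, 0)] d) *s dual_basis X k)"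
      by (subst expand_dual_basis[of "Q d \<rhd> \<phi> i"]) (simp add: pair_Q)
    also have "\<dots> = (\<Sum>j\<in>UNIV. \<omega> $ j *s (\<Sum>k\<in>UNIV. gw X [(\<phi> i, 0), (\<phi> j, 0), (\<phi> k, 0)] d *s dual_basis X k))"
      by (simp only: vec_eq_iff sum_component vector_smult_component sum_distrib_left sum_distrib_right mult.assoc)
        (rule allI, rule sum.swap)
    finally have Q: "Q d \<rhd> \<phi> i = \<dots>" .
    have "c d *\<^sub>R (a *s v) = a *s (c d *\<^sub>R v)" for a and v :: "complex^'n"
      by (simp add: vec_eq_iff)
    then show ?thesis by (simp only: Q f_def scaleR_sum_right)
  qed
  have 3: "(\<lambda>d. c d *\<^sub>R (Q d \<rhd> \<phi> i)) summable_on D" for i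
    unfolding 2
  proof (rule summable_on_sum)
    fix j
    have "bounded_linear (\<lambda>v::complex^'n. \<omega> $ j *s v)"
      using linear_vec_scale by (rule linear_conv_bounded_linear[THEN iffD1])
    then show "(\<lambda>d. \<omega> $ j *s f i j d) summable_on D"
      by (rule summable_on_bounded_linear[OF _ 1])
  qed
  have 4: "(\<lambda>d. norm ((c d *\<^sub>R (Q d \<rhd> \<phi> i)) $ k)) summable_on D" for i k
    unfolding summable_on_iff_abs_summable_on_complex[symmetric]
    by (rule summable_on_bounded_linear[OF bounded_linear_vec_nth 3])
  have 5: "(\<lambda>d. \<Sum>i\<in>UNIV. \<Sum>k\<in>UNIV. norm ((c d *\<^sub>R (Q d \<rhd> \<phi> i)) $ k)) summable_on D"
    by (intro summable_on_sum 4)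
  show ?thesis
  proof (rule summable_on_comparison_test[OF 5])
    show "0 \<le> norm (Q d) * exp (- t * lam d)" for d by simp
    show "norm (Q d) * exp (- t * lam d) \<le> (\<Sum>i\<in>UNIV. \<Sum>k\<in>UNIV. norm ((c d *\<^sub>R (Q d \<rhd> \<phi> i)) $ k))" for d
    proof -
      have "norm (Q d) * c d \<le> (\<Sum>i\<in>UNIV. norm (Q d \<rhd> \<phi> i)) * c d"
        using norm_clin_le[OF clin_Q[of d]] by (intro mult_right_mono) (simp_all add: c_def \<phi>_def)
      also have "\<dots> = (\<Sum>i\<in>UNIV. norm (c d *\<^sub>R (Q d \<rhd> \<phi> i)))"
        unfolding sum_distrib_right by (intro sum.cong refl) (simp add: c_def)
      also have "\<dots> \<le> (\<Sum>i\<in>UNIV. \<Sum>k\<in>UNIV. norm ((c d *\<^sub>R (Q d \<rhd> \<phi> i)) $ k))"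
        by (intro sum_mono norm_cvec_le)
      finally show ?thesis by (simp only: c_def)
    qed
  qed
qed

lemma convergence:
  assumes "qprod_converges_on X U"
  obtains t where "0 < t" "convergent_GW X \<omega> t" "\<And>x. t \<le> Re x \<Longrightarrow> - x *s \<omega> \<in> U"
proof -
  obtain R where R: "0 < R" "\<And>x. R < Re x \<Longrightarrow> - x *s \<omega> \<in> U" using tau_in_domain[OF assms] by blast
  have "convergent_GW X \<omega> (R + 1)"
  proof
    show "(\<lambda>d. norm (Q d) * exp (- (R + 1) * lam d)) summable_on D"
      by (rule Q_summable_of_convergence[OF assms R(2)]) simp
  qed
  then show thesis by (rule that[rotated]) (use R in auto)
qed

end

context convergent_GW
begin

text \<open>Correlators with an insertion \<open>tau'\<close> = 0 vanish, so the sum over (d, l)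
  reduces to \<open>l = 0\<close>, where the exponential of the pairing with \<open>d\<close> is the
  factor in \<open>E\<close>.\<close>

lemma Jop_Phi:
  assumes z: "z \<noteq> 0" and x: "t0 \<le> Re x"
  shows "Jop X (- x *s \<omega>) z \<alpha> = exp (cop (- x / z) * N) \<rhd> Phi x z \<rhd> \<alpha>"
proof -
  define G where "G = (\<lambda>(d, l). \<Sum>i\<in>UNIV.
        ((\<Sum>k. gw X ((\<alpha>, 0) # replicate l (0, 0) @ [(\<phi> i, k)]) d / z ^ Suc k)
           / fact l * exp (h2pair X (- x *s \<omega>) d)) *s dual_basis X i)"
  have "infsum G (eff X \<times> UNIV - {(0, 0)}) = infsum G (D \<times> {0})"
  proof (rule infsum_cong_neutral)
    fix y assume y: "y \<in> eff X \<times> UNIV - {(0, 0)} - D \<times> {0::nat}"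
    obtain d l where yd: "y = (d, l)" by (cases y)
    have "0 < l" using y yd by auto
    then show "G y = 0" by (simp add: G_def yd gw_zeros)
  qed auto
  also have "\<dots> = infsum (\<lambda>d. G (d, 0)) D"
    by (rule infsum_reindex_bij_betw[symmetric]) (auto simp: bij_betw_def inj_on_def)
  also have "\<dots> = infsum (\<lambda>d. E x d z \<rhd> \<alpha>) D"
  proof (rule infsum_cong)
    fix d assume d: "d \<in> D"
    then have "h2pair X (- x *s \<omega>) d = - x * of_real (lam d)" by (intro h2pair_scale) blast
    then show "G (d, 0) = E x d z \<rhd> \<alpha>"
      using E_coeff[OF d, of \<alpha> z x] by (simp add: G_def)
  qed
  also have "\<dots> = infsum (\<lambda>d. E x d z) D \<rhd> \<alpha>"
    by (rule infsumI, rule has_sum_bounded_linear[OF ap.bounded_linear_left],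
      rule has_sum_infsum[OF Infinite_Sum.abs_summable_summable[OF E_abs_summable[OF z x]]])
  finally have s: "\<alpha> + infsum G (eff X \<times> UNIV - {(0, 0)}) = Phi x z \<rhd> \<alpha>"
    by (simp add: Phi_def)
  have a: "act X (- x *s \<omega>) = (\<rhd>) (Act (- x *s \<omega>))" by (rule ext) simp
  have "cop (1 / z) * Act (- x *s \<omega>) = cop (- x / z) * N"
    unfolding Act_scale N_def mult.assoc[symmetric] cop_mult[symmetric] by simp
  then show ?thesis
    unfolding Jop_def tau_omega s[unfolded G_def] a expop_eq_exp[OF clin_Act] by simp
qed

end

lemma ap_scaleR_component: "((r *\<^sub>R A) \<rhd> v) $ i = of_real r * (A \<rhd> v) $ i"
  for A :: "(complex^'n::finite) endo"
  by (simp only: ap_scaleR scaleR_eq_scale vector_smult_component)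

text \<open>\<open>K\<close> commutes with exp (j Y) for every natural j. Since \<open>Y\<close> is
  nilpotent, the commutator is a polynomial in j with infinitely many zeros, and its coefficient of
  j is the commutator of \<open>K\<close> and \<open>Y\<close>.\<close>

lemma commutes_of_exp_commutes:
  fixes K Y :: "(complex^'n::finite) endo"
  assumes nil: "Y ^ m = 0" and comm: "K * exp Y = exp Y * K"
  shows "K * Y = Y * K"
proof -
  have e: "exp (real j *\<^sub>R Y) = exp Y ^ j" for j :: nat
  proof (induction j)
    case (Suc j)
    have "exp (real (Suc j) *\<^sub>R Y) = exp (Y + real j *\<^sub>R Y)"
      by (simp add: scaleR_add_left add.commute)
    also have "\<dots> = exp Y * exp (real j *\<^sub>R Y)" by (rule exp_add_commuting) simp
    finally show ?case by (simp add: Suc)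
  qed simp
  have c: "K * exp (real j *\<^sub>R Y) = exp (real j *\<^sub>R Y) * K" for j :: nat
    unfolding e by (induction j) (simp_all add: mult.assoc[symmetric] comm, simp add: mult.assoc)
  have ex: "exp (real j *\<^sub>R Y) = (\<Sum>k\<le>m. (real j ^ k / fact k) *\<^sub>R Y ^ k)" for j :: nat
  proof -
    have "(real j *\<^sub>R Y) ^ Suc m = 0" using nil by (simp add: scaleR_power)
    from exp_nilpotent[OF this] show ?thesis
      by (simp add: scaleR_power lessThan_Suc_atMost divide_inverse mult.commute del: power_Suc)
  qed
  define a where "a k = K * Y ^ k - Y ^ k * K" for k
  have z: "(\<Sum>k\<le>m. (real j ^ k / fact k) *\<^sub>R a k) = 0" for j :: nat
    using c[of j] unfolding ex a_def
    by (simp add: sum_distrib_left sum_distrib_right scaleR_diff_right sum_subtractf)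
  have "a 1 = 0"
  proof (cases "m = 0")
    case True
    then have "(1 :: (complex^'n) endo) = 0" using nil by simp
    then show ?thesis by (metis mult_1_right mult_zero_right)
  next
    case False
    show ?thesis
    proof (rule endo_eqI, simp only: ap_zero vec_eq_iff zero_index, rule allI)
      fix v i
      define b where "b k = (a k \<rhd> v) $ i / fact k" for k
      have "(\<Sum>k\<le>m. b k * of_nat j ^ k) = 0" for j :: nat
      proof -
        have "((\<Sum>k\<le>m. (real j ^ k / fact k) *\<^sub>R a k) \<rhd> v) $ i = 0" unfolding z by simp
        then show ?thesis unfolding ap_sum sum_component ap_scaleR_component b_def
          by (simp add: mult.commute)
      qed
      then have "range (of_nat :: nat \<Rightarrow> complex) \<subseteq> {x. (\<Sum>k\<le>m. b k * x ^ k) = 0}" by auto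
      moreover have "infinite (range (of_nat :: nat \<Rightarrow> complex))"
        by (simp add: finite_image_iff inj_of_nat)
      ultimately have "infinite {x. (\<Sum>k\<le>m. b k * x ^ k) = 0}" using finite_subset by blast
      then have "b 1 = 0" using polyfun_finite_roots[where c = b and n = m] False by (metis One_nat_def Suc_leI neq0_conv)
      then show "(a 1 \<rhd> v) $ i = 0" by (simp add: b_def)
    qed
  qed
  then show ?thesis by (simp add: a_def)
qed

lemma exp_dg: "exp (dg f) = dg (\<lambda>i. exp (f i))" for f :: "'n::finite \<Rightarrow> complex"
proof (rule clin_eqI)
  fix j
  have pw: "dg f ^ k = dg (\<lambda>i. f i ^ k)" for k
    by (induction k) (simp_all add: dg_mult)
  show "exp (dg f) \<rhd> axis j 1 = dg (\<lambda>i. exp (f i)) \<rhd> axis j 1"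
    unfolding vec_eq_iff
  proof
    fix i
    have "bounded_linear (\<lambda>A. (A \<rhd> axis j 1) $ i)"
      by (rule bounded_linear_compose[OF bounded_linear_vec_nth ap.bounded_linear_left])
    from bounded_linear.sums[OF this exp_converges[of "dg f"]]
    have 1: "(\<lambda>k. (f i ^ k /\<^sub>R fact k) * axis j 1 $ i) sums (exp (dg f) \<rhd> axis j 1) $ i"
      unfolding pw ap_scaleR_component by (simp add: scaleR_conv_of_real mult.assoc)
    have 2: "(\<lambda>k. (f i ^ k /\<^sub>R fact k) * axis j 1 $ i) sums (exp (f i) * axis j 1 $ i)"
      by (intro sums_mult2 exp_converges)
    show "(exp (dg f) \<rhd> axis j 1) $ i = (dg (\<lambda>i. exp (f i)) \<rhd> axis j 1) $ i"
      using sums_unique2[OF 1 2] by simp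
  qed
qed auto

section \<open>Real structures\<close>

locale orbifold_real = orbifold_cohomology X
  for X :: "('n::finite, 't::finite, 'd::ab_group_add, 'x::ab_group_add) orbifold" +
  fixes VR :: "(complex^'n) set"
  assumes real: "real_structure X VR"
begin

lemma VR: "subspace VR" "\<exists>!(a, b). a \<in> VR \<and> b \<in> VR \<and> \<alpha> = a + \<i> *s b"
  "galois X \<xi> ` VR = VR" "\<alpha> \<in> VR \<Longrightarrow> \<beta> \<in> VR \<Longrightarrow> V_pair X \<alpha> \<beta> \<in> \<real>"
proof -
  note r = real[unfolded real_structure_def]
  show "subspace VR" by (rule conjunct1[OF r])
  note r = conjunct2[OF r]
  show "\<exists>!(a, b). a \<in> VR \<and> b \<in> VR \<and> \<alpha> = a + \<i> *s b" by (rule spec[OF conjunct1[OF r]])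
  note r = conjunct2[OF r]
  show "galois X \<xi> ` VR = VR" by (rule spec[OF conjunct1[OF r]])
  show "\<alpha> \<in> VR \<Longrightarrow> \<beta> \<in> VR \<Longrightarrow> V_pair X \<alpha> \<beta> \<in> \<real>" by (rule bspec[OF bspec[OF conjunct2[OF r]]])
qed

lemma VR_decomp: obtains a b where "a \<in> VR" "b \<in> VR" "\<alpha> = a + \<i> *s b"
proof -
  obtain p where p: "case p of (a, b) \<Rightarrow> a \<in> VR \<and> b \<in> VR \<and> \<alpha> = a + \<i> *s b"
    using ex1_implies_ex[OF VR(2)] by blast
  obtain a b where "p = (a, b)" by (rule prod.exhaust)
  then have "a \<in> VR" "b \<in> VR" "\<alpha> = a + \<i> *s b" using p by simp_all
  then show thesis by (rule that)
qed

lemma VR_unique: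
  assumes "a \<in> VR" "b \<in> VR" "a' \<in> VR" "b' \<in> VR" "a + \<i> *s b = a' + \<i> *s b'"
  shows "a = a'" "b = b'"
proof -
  obtain p where p: "\<And>q. (case q of (c, d) \<Rightarrow> c \<in> VR \<and> d \<in> VR \<and> a + \<i> *s b = c + \<i> *s d) \<Longrightarrow> q = p"
    using VR(2)[of "a + \<i> *s b"] by (elim ex1E) blast
  have "(a, b) = p" "(a', b') = p" by (rule p, simp add: assms)+
  then have "(a, b) = (a', b')" by simp
  then show "a = a'" "b = b'" by auto
qed

lemma kappaV_eq: assumes "a \<in> VR" "b \<in> VR" shows "kappaV VR (a + \<i> *s b) = a - \<i> *s b"
  unfolding kappaV_def
proof (rule the_equality)
  show "\<exists>a'\<in>VR. \<exists>b'\<in>VR. a + \<i> *s b = a' + \<i> *s b' \<and> a - \<i> *s b = a' - \<i> *s b'"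
    using assms by blast
  fix \<beta> assume "\<exists>a'\<in>VR. \<exists>b'\<in>VR. a + \<i> *s b = a' + \<i> *s b' \<and> \<beta> = a' - \<i> *s b'"
  then show "\<beta> = a - \<i> *s b" using VR_unique[OF assms] by blast
qed

lemma kappaV_add: "kappaV VR (\<alpha> + \<beta>) = kappaV VR \<alpha> + kappaV VR \<beta>"
proof -
  obtain a b where a: "a \<in> VR" "b \<in> VR" "\<alpha> = a + \<i> *s b" by (rule VR_decomp)
  obtain c d where c: "c \<in> VR" "d \<in> VR" "\<beta> = c + \<i> *s d" by (rule VR_decomp)
  have "\<alpha> + \<beta> = (a + c) + \<i> *s (b + d)" by (simp add: a(3) c(3) vector_add_ldistrib)
  then have "kappaV VR (\<alpha> + \<beta>) = (a + c) - \<i> *s (b + d)"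
    by (simp only: kappaV_eq[OF subspace_add[OF VR(1) a(1) c(1)] subspace_add[OF VR(1) a(2) c(2)]])
  also have "\<dots> = (a - \<i> *s b) + (c - \<i> *s d)" by (simp add: vector_add_ldistrib)
  also have "\<dots> = kappaV VR \<alpha> + kappaV VR \<beta>"
    by (simp only: a(3) c(3) kappaV_eq[OF a(1,2)] kappaV_eq[OF c(1,2)])
  finally show ?thesis .
qed

lemma kappaV_scale: "kappaV VR (c *s \<alpha>) = cnj c *s kappaV VR \<alpha>"
proof -
  obtain a b where a: "a \<in> VR" "b \<in> VR" "\<alpha> = a + \<i> *s b" by (rule VR_decomp)
  let ?p = "Re c *\<^sub>R a - Im c *\<^sub>R b" and ?q = "Im c *\<^sub>R a + Re c *\<^sub>R b"
  have mem: "?p \<in> VR" "?q \<in> VR"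
    using a VR(1) by (simp_all add: subspace_diff subspace_add subspace_scale)
  have 1: "c * (u + \<i> * v) = (Re c *\<^sub>R u - Im c *\<^sub>R v) + \<i> * (Im c *\<^sub>R u + Re c *\<^sub>R v)"
    and 2: "(Re c *\<^sub>R u - Im c *\<^sub>R v) - \<i> * (Im c *\<^sub>R u + Re c *\<^sub>R v) = cnj c * (u - \<i> * v)" for u v
  proof -
    have i: "(p + \<i> * q) * (u + \<i> * v) = (p * u - q * v) + \<i> * (q * u + p * v)"
      "(p * u - q * v) - \<i> * (q * u + p * v) = (p - \<i> * q) * (u - \<i> * v)" for p q :: complex
      using complex_i_mult_minus[of 1] i_squared by algebra+
    show "c * (u + \<i> * v) = (Re c *\<^sub>R u - Im c *\<^sub>R v) + \<i> * (Im c *\<^sub>R u + Re c *\<^sub>R v)"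
      unfolding scaleR_conv_of_real i(1)[symmetric] by (subst complex_eq[of c]) (rule refl)
    show "(Re c *\<^sub>R u - Im c *\<^sub>R v) - \<i> * (Im c *\<^sub>R u + Re c *\<^sub>R v) = cnj c * (u - \<i> * v)"
      unfolding scaleR_conv_of_real i(2) using complex_eq[of "cnj c"] by simp
  qed
  have "c *s \<alpha> = ?p + \<i> *s ?q"
    unfolding a(3) vec_eq_iff vector_smult_component vector_add_component vector_minus_component
      vector_scaleR_component 1 by simp
  then have "kappaV VR (c *s \<alpha>) = ?p - \<i> *s ?q" by (simp only: kappaV_eq[OF mem])
  also have "\<dots> = cnj c *s (a - \<i> *s b)"
    unfolding vec_eq_iff vector_smult_component vector_add_component vector_minus_component
      vector_scaleR_component 2 by simp
  also have "\<dots> = cnj c *s kappaV VR \<alpha>" by (simp only: a(3) kappaV_eq[OF a(1,2)])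
  finally show ?thesis .
qed

definition Kap :: "(complex^'n) endo" where "Kap = Op (kappaV VR)"

lemma ap_Kap [simp]: "Kap \<rhd> \<alpha> = kappaV VR \<alpha>"
proof -
  have "linear (kappaV VR)"
    by (rule linearI) (simp_all only: kappaV_add kappaV_scale scaleR_eq_scale complex_cnj_complex_of_real)
  then show ?thesis by (simp add: Kap_def)
qed

lemma alin_Kap: "alin Kap"
  unfolding alin_def by (intro allI endo_eqI) (simp add: kappaV_scale)

lemma Kap_Kap: "Kap * Kap = 1"
proof (rule endo_eqI)
  fix \<alpha>
  obtain a b where a: "a \<in> VR" "b \<in> VR" "\<alpha> = a + \<i> *s b" by (rule VR_decomp)
  have "Kap \<rhd> \<alpha> = a + \<i> *s (- b)" using kappaV_eq[of a b] a by simp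
  moreover have "Kap \<rhd> (a + \<i> *s (- b)) = a - \<i> *s (- b)"
    using kappaV_eq[of a "- b"] a subspace_neg[OF VR(1)] by simp
  ultimately show "(Kap * Kap) \<rhd> \<alpha> = 1 \<rhd> \<alpha>" by (simp only: ap_times) (simp add: a(3))
qed

lemma commutes_Kap:
  assumes "clin A" "\<And>a. a \<in> VR \<Longrightarrow> A \<rhd> a \<in> VR"
  shows "Kap * A = A * Kap"
proof (rule endo_eqI)
  fix \<alpha>
  obtain a b where a: "a \<in> VR" "b \<in> VR" "\<alpha> = a + \<i> *s b" by (rule VR_decomp)
  have "A \<rhd> \<alpha> = A \<rhd> a + \<i> *s (A \<rhd> b)" by (simp only: a(3) ap.add_right clin_ap[OF assms(1)])
  then have "Kap \<rhd> A \<rhd> \<alpha> = A \<rhd> a - \<i> *s (A \<rhd> b)"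
    by (simp only: ap_Kap kappaV_eq[OF assms(2)[OF a(1)] assms(2)[OF a(2)]])
  also have "\<dots> = A \<rhd> (a - \<i> *s b)" by (simp only: ap.diff_right clin_ap[OF assms(1)])
  also have "\<dots> = A \<rhd> Kap \<rhd> \<alpha>" by (simp only: ap_Kap a(3) kappaV_eq[OF a(1,2)])
  finally show "(Kap * A) \<rhd> \<alpha> = (A * Kap) \<rhd> \<alpha>" by simp
qed

lemma Act_dg_sector:
  assumes "\<tau> \<in> Hgr X (untw X) 1"
  shows "Act \<tau> * dg (\<lambda>i. g (sector X i)) = dg (\<lambda>i. g (sector X i)) * Act \<tau>"
proof (rule clin_eqI)
  fix j
  show "(Act \<tau> * dg (\<lambda>i. g (sector X i))) \<rhd> axis j 1 = (dg (\<lambda>i. g (sector X i)) * Act \<tau>) \<rhd> axis j 1"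
    unfolding vec_eq_iff
  proof
    fix i
    have "dg (\<lambda>i. g (sector X i)) \<rhd> axis j 1 = g (sector X j) *s axis j 1"
      by (simp add: vec_eq_iff axis_def)
    then have "((Act \<tau> * dg (\<lambda>i. g (sector X i))) \<rhd> axis j 1) $ i = g (sector X j) * (Act \<tau> \<rhd> axis j 1) $ i"
      by (simp only: ap_times clin_ap[OF clin_Act] vector_smult_component)
    moreover have "((dg (\<lambda>i. g (sector X i)) * Act \<tau>) \<rhd> axis j 1) $ i = g (sector X i) * (Act \<tau> \<rhd> axis j 1) $ i"
      by (simp only: ap_times ap_dg vec_lambda_beta)
    ultimately show "((Act \<tau> * dg (\<lambda>i. g (sector X i))) \<rhd> axis j 1) $ i = ((dg (\<lambda>i. g (sector X i)) * Act \<tau>) \<rhd> axis j 1) $ i"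
      using Act_lowers(1)[OF assms, of j i] by (cases "(Act \<tau> \<rhd> axis j 1) $ i = 0") simp_all
  qed
qed (auto intro!: clin_mult)

lemma Act_nilpotent:
  assumes "\<tau> \<in> Hgr X (untw X) 1" obtains m where "Act \<tau> ^ m = 0"
proof -
  define b where "b = Max (range (hdeg X))"
  have hb: "hdeg X i \<le> b" for i unfolding b_def by (rule Max_ge) simp_all
  have "\<forall>i. (Act \<tau> ^ k \<rhd> axis j 1) $ i \<noteq> 0 \<longrightarrow> k \<le> hdeg X i" for k j
  proof (induction k)
    case (Suc k)
    show ?case
    proof (intro allI impI)
      fix i assume "(Act \<tau> ^ Suc k \<rhd> axis j 1) $ i \<noteq> 0"
      then have "(Act \<tau> \<rhd> Act \<tau> ^ k \<rhd> axis j 1) $ i \<noteq> 0" by simp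
      then have "(\<Sum>l\<in>UNIV. (Act \<tau> ^ k \<rhd> axis j 1) $ l * (Act \<tau> \<rhd> axis l 1) $ i) \<noteq> 0"
        by (subst (asm) clin_expand[OF clin_Act]) simp
      then obtain l where "(Act \<tau> ^ k \<rhd> axis j 1) $ l * (Act \<tau> \<rhd> axis l 1) $ i \<noteq> 0"
        by (meson sum.not_neutral_contains_not_neutral)
      then show "Suc k \<le> hdeg X i" using Suc Act_lowers(2)[OF assms, of l i] by simp
    qed
  qed simp
  from this[of "Suc b"] have "Act \<tau> ^ Suc b \<rhd> axis j 1 = 0" for j
    using hb not_less_eq_eq unfolding vec_eq_iff by (metis zero_index)
  then have "Act \<tau> ^ Suc b = 0"
    by (intro clin_eqI clin_power clin_Act) (simp_all del: power_Suc)
  then show thesis by (rule that)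
qed

lemma ratcl_Hgr: "ratcl X \<xi> \<in> Hgr X (untw X) 1" "conjH X (ratcl X \<xi>) = ratcl X \<xi>"
proof -
  obtain B where B: "range (ratcl X) = {\<Sum>b\<in>B. of_int (m b) *\<^sub>R b | m. True}"
    "span B = {\<alpha> \<in> Hgr X (untw X) 1. conjH X \<alpha> = \<alpha>}"
    using ratcl_lattice by blast
  have "ratcl X \<xi> \<in> {\<Sum>b\<in>B. of_int (m b) *\<^sub>R b | m. True}" unfolding B(1)[symmetric] by (rule rangeI)
  then obtain m where "ratcl X \<xi> = (\<Sum>b\<in>B. of_int (m b) *\<^sub>R b)" by blast
  then have "ratcl X \<xi> \<in> span B" by (simp add: span_sum span_scale span_base)
  then show "ratcl X \<xi> \<in> Hgr X (untw X) 1" "conjH X (ratcl X \<xi>) = ratcl X \<xi>" using B(2) by auto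
qed

text \<open>A multiple of \<open>\<xi>\<close> acts on all sectors without phases, so its Galois action is the unipotent
  operator \<open>exp (- 2 \<pi> i m \<xi>\<^sub>0)\<close>.\<close>

lemma Kap_Act_ratcl: "Kap * Act (ratcl X \<xi>) = - Act (ratcl X \<xi>) * Kap"
proof -
  define A where "A = Act (ratcl X \<xi>)"
  define f where "f v = fage X \<xi> v" for v
  define c :: complex where "c = - 2 * pi * \<i>"
  define u :: "'t \<Rightarrow> complex" where "u v = 2 * pi * \<i> * f v" for v
  define G where "G = exp (cop c * A) * dg (\<lambda>i. exp (u (sector X i)))"
  have act: "act X (ratcl X \<xi>) = (\<rhd>) A" by (rule ext) (simp add: A_def)
  have cA: "clin A" by (simp add: A_def)
  have gal: "galois X \<xi> \<alpha> = G \<rhd> \<alpha>" for \<alpha>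
    unfolding galois_def act expop_eq_exp[OF cA] G_def f_def c_def u_def by simp
  have cG: "clin G" unfolding G_def by (intro clin_mult clin_exp clin_intros cA)
  have KG: "Kap * G = G * Kap"
    by (rule commutes_Kap[OF cG]) (use VR(3)[of \<xi>] in \<open>auto simp: gal\<close>)
  have ADg: "A * dg (\<lambda>i. g (sector X i)) = dg (\<lambda>i. g (sector X i)) * A" for g
    unfolding A_def by (rule Act_dg_sector[OF ratcl_Hgr(1)])
  \<comment> \<open>A common denominator of the rational phases: the product of one denominator for
    each sector.\<close>
  obtain m :: nat where m: "0 < m" "\<And>v. real m * f v \<in> \<int>"
  proof -
    have "\<exists>k>0. real k * f v \<in> \<int>" for v
    proof -
      obtain a b where ab: "b > 0" "f v = real_of_int a / real_of_int b"
        using fage_rat[of \<xi> v] unfolding f_def by (elim Rats_cases') auto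
      then have "real (nat b) * f v = of_int a" by simp
      then show ?thesis using ab by (intro exI[of _ "nat b"]) simp
    qed
    then obtain k where k: "\<And>v. 0 < k v" "\<And>v. real (k v) * f v \<in> \<int>" by metis
    show thesis
    proof (rule that[of "\<Prod>v\<in>UNIV. k v"])
      show "0 < (\<Prod>v\<in>UNIV. k v)" using k(1) by (simp add: prod_pos)
      fix v
      have "(\<Prod>v\<in>UNIV. k v) = k v * (\<Prod>w\<in>UNIV - {v}. k w)" by (rule prod.remove) simp_all
      then have "real (\<Prod>v\<in>UNIV. k v) * f v = (real (k v) * f v) * of_nat (\<Prod>w\<in>UNIV - {v}. k w)"
        by simp
      then show "real (\<Prod>v\<in>UNIV. k v) * f v \<in> \<int>" using k(2)[of v] by (metis Ints_mult Ints_of_nat)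
    qed
  qed
  have Gk: "G ^ k = exp (cop (of_nat k * c) * A) * dg (\<lambda>i. exp (of_nat k * (u (sector X i))))" for k
  proof (induction k)
    case 0
    show ?case by simp
  next
    case (Suc k)
    define dk where "dk = dg (\<lambda>i. exp (of_nat k * (u (sector X i))))"
    have "dk * (cop c * A) = (cop c * A) * dk"
    proof -
      have dA: "dk * A = A * dk"
        unfolding dk_def using ADg[of "\<lambda>v. exp (of_nat k * u v)"] by simp
      have dc: "dk * cop c = cop c * dk" unfolding dk_def by (rule clinD) simp
      have "dk * (cop c * A) = (dk * cop c) * A" by (rule mult.assoc[symmetric])
      also have "\<dots> = cop c * (dk * A)" unfolding dc by (rule mult.assoc)
      also have "\<dots> = (cop c * A) * dk" unfolding dA by (rule mult.assoc[symmetric])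
      finally show ?thesis .
    qed
    then have sw: "dk * exp (cop c * A) = exp (cop c * A) * dk" by (rule exp_intertwine)
    have "cop (of_nat (Suc k) * c) * A = cop (of_nat k * c) * A + cop c * A"
      by (simp add: distrib_right cop_add)
    moreover have "(cop (of_nat k * c) * A) * (cop c * A) = (cop c * A) * (cop (of_nat k * c) * A)"
    proof -
      have "(cop a * A) * (cop b * A) = cop (a * b) * (A * A)" for a b
      proof -
        have "(cop a * A) * (cop b * A) = cop a * (A * cop b) * A" by (simp only: mult.assoc)
        also have "\<dots> = cop (a * b) * (A * A)" unfolding clinD[OF cA] cop_mult by (simp only: mult.assoc)
        finally show ?thesis .
      qed
      then show ?thesis by (simp only: mult.commute)
    qed
    ultimately have ex: "exp (cop (of_nat (Suc k) * c) * A) = exp (cop (of_nat k * c) * A) * exp (cop c * A)"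
      by (simp only: exp_add_commuting)
    have "G ^ Suc k = exp (cop (of_nat k * c) * A) * (dk * exp (cop c * A)) * dg (\<lambda>i. exp (u (sector X i)))"
      unfolding power_Suc2 Suc dk_def by (simp only: G_def mult.assoc)
    also have "\<dots> = exp (cop (of_nat (Suc k) * c) * A) * (dk * dg (\<lambda>i. exp (u (sector X i))))"
      unfolding sw ex by (simp only: mult.assoc)
    also have "dk * dg (\<lambda>i. exp (u (sector X i))) = dg (\<lambda>i. exp (of_nat (Suc k) * (u (sector X i))))"
      unfolding dk_def dg_mult exp_add[symmetric] by (simp add: distrib_right add.commute)
    finally show ?case .
  qed
  define Y where "Y = cop (of_nat m * c) * A"
  have "G ^ m = exp Y"
  proof -
    have "exp (of_nat m * u v) = 1" for v
    proof -
      obtain k where "real m * f v = of_int k" using m(2)[of v] by (rule Ints_cases)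
      moreover have "of_nat m * u v = of_real (2 * pi * (real m * f v)) * \<i>" by (simp add: u_def)
      ultimately have "of_nat m * u v = of_real (2 * pi * of_int k) * \<i>" by simp
      then show ?thesis unfolding exp_eq_1 by (intro conjI exI[of _ k]) simp_all
    qed
    then show ?thesis unfolding Gk Y_def by simp
  qed
  moreover have "Kap * G ^ k = G ^ k * Kap" for k
    by (induction k) (simp_all add: mult.assoc[symmetric] KG, simp add: mult.assoc)
  ultimately have KE: "Kap * exp Y = exp Y * Kap" by metis
  obtain k where "A ^ k = 0" unfolding A_def by (rule Act_nilpotent[OF ratcl_Hgr(1)])
  then have "Y ^ k = 0" unfolding Y_def by (simp add: cop_mult_power[OF cA])
  then have KY: "Kap * Y = Y * Kap" using KE by (rule commutes_of_exp_commutes)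
  \<comment> \<open>\<open>b\<close> is purely imaginary and nonzero. An antilinear map that
    commutes with b A therefore anticommutes with \<open>A\<close>.\<close>
  define b where "b = of_nat m * c"
  have b: "cnj b = - b" "b \<noteq> 0" using m(1) by (simp_all add: b_def c_def)
  have "cop b * (Kap * A) = - (Kap * cop b * A)"
    using alinD[OF alin_Kap, of b] by (simp add: b(1) cop_minus mult.assoc)
  also have "\<dots> = cop b * (- A * Kap)"
    using KY unfolding Y_def b_def[symmetric] by (simp add: mult.assoc)
  finally have "cop (1 / b) * cop b * (Kap * A) = cop (1 / b) * cop b * (- A * Kap)"
    by (simp only: mult.assoc)
  then show ?thesis unfolding A_def[symmetric] cop_mult[symmetric] using b(2) by simp
qed

text \<open>Integral classes span the real degree-2 classes over the reals, and real scalars pass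
  through the antilinear \<open>Kap\<close>.\<close>

lemma Kap_Act_real:
  assumes "\<alpha> \<in> Hgr X (untw X) 1" "conjH X \<alpha> = \<alpha>"
  shows "Kap * Act \<alpha> = - Act \<alpha> * Kap"
proof -
  obtain B where B: "independent B" "range (ratcl X) = {\<Sum>b\<in>B. of_int (m b) *\<^sub>R b | m. True}"
    "span B = {\<alpha> \<in> Hgr X (untw X) 1. conjH X \<alpha> = \<alpha>}"
    using ratcl_lattice by blast
  have fin: "finite B" by (rule independent_imp_finite[OF B(1)])
  have "b \<in> range (ratcl X)" if "b \<in> B" for b
  proof -
    have "(\<Sum>b'\<in>B. of_int (if b' = b then 1 else 0) *\<^sub>R b') = b"
      using that fin by (simp add: if_distrib[of of_int] if_distrib[of "\<lambda>c. c *\<^sub>R _"] cong: if_cong)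
    then show ?thesis unfolding B(2) mem_Collect_eq
      by (intro exI[of _ "\<lambda>b'. if b' = b then 1 else 0"] conjI TrueI) (rule sym)
  qed
  then have 1: "Kap * Act b = - Act b * Kap" if "b \<in> B" for b
    using that Kap_Act_ratcl by (metis imageE)
  have "\<alpha> \<in> span B" using assms B(3) by simp
  then show ?thesis
  proof (induction rule: span_induct_alt)
    case base
    have "Act 0 = 0" using Act_scale[of 0 0] by simp
    then show ?case by simp
  next
    case (step c x y)
    have "Act (c *\<^sub>R x) = c *\<^sub>R Act x"
      unfolding scaleR_eq_scale Act_scale cop_of_real by simp
    then show ?case using 1[OF step(1)] step(2)
      by (simp add: Act_add distrib_left distrib_right left_diff_distrib)
  qed
qed

lemma Kap_c1: "Kap * Act (c1 X) = - Act (c1 X) * Kap"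
  using c1_integral Kap_Act_ratcl by metis

end

section \<open>A closed formula for the conjugation on loops\<close>

lemma holomorphic_eq_on_circle:
  assumes "f holomorphic_on - {0}" "g holomorphic_on - {0}" "\<And>\<theta>. f (cis \<theta>) = g (cis \<theta>)" "z \<noteq> 0"
  shows "f z = (g z :: complex)"
proof -
  have lim: "(1::complex) islimpt sphere 0 1"
  proof (rule connected_imp_perfect)
    show "connected (sphere (0::complex) 1)" by (rule connected_sphere) simp
    have "(-1::complex) \<in> sphere 0 1" "(1::complex) \<in> sphere 0 1" "(-1::complex) \<noteq> 1" by auto
    then show "sphere (0::complex) 1 \<noteq> {x}" for x by (metis singletonD)
  qed simp
  have "f z - g z = 0"
  proof (rule analytic_continuation[of "\<lambda>z. f z - g z" "- {0}" "sphere 0 1" 1 z])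
    show "(\<lambda>z. f z - g z) holomorphic_on - {0}" by (intro holomorphic_intros assms)
    show "connected (- {0::complex})" by (rule connected_punctured_universe) simp
    show "f w - g w = 0" if "w \<in> sphere 0 1" for w
    proof -
      have "w = cis (Arg w)" using that rcis_cmod_Arg[of w] by (simp add: rcis_def)
      then show ?thesis using assms(3)[of "Arg w"] by simp
    qed
  qed (use assms(4) lim in auto)
  then show ?thesis by simp
qed

lemma dg_axis: "dg f \<rhd> axis j 1 = f j *s axis j 1"
  by (simp add: vec_eq_iff axis_def)

context orbifold_cohomology
begin

lemma axis_pair:
  assumes "orb_pair X (axis i 1) (axis j 1) \<noteq> 0"
  shows "sector X j = sinv X (sector X i)" "hdeg X i + hdeg X j = sdim X (sector X i)"
  using orb_pair_Hgr[OF axis_Hgr axis_Hgr assms] by simp_all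

lemma orb_pair_dg:
  assumes "\<And>i j. orb_pair X (axis i 1) (axis j 1) \<noteq> 0 \<Longrightarrow> f i * g j = 1"
  shows "orb_pair X (dg f \<rhd> \<alpha>) (dg g \<rhd> \<beta>) = orb_pair X \<alpha> \<beta>"
proof -
  have e: "orb_pair X (A \<rhd> \<alpha>) (B \<rhd> \<beta>) = (\<Sum>i\<in>UNIV. \<Sum>j\<in>UNIV. \<alpha> $ i * \<beta> $ j * orb_pair X (A \<rhd> axis i 1) (B \<rhd> axis j 1))"
    if "clin A" "clin B" for A B
    unfolding clin_expand[OF that(1), of \<alpha>] clin_expand[OF that(2), of \<beta>]
    by (simp only: orb_pair_sum_left orb_pair_sum_right orb_pair_scale_left orb_pair_scale_right
        sum_distrib_left mult.assoc) (subst sum.swap, simp only: mult.left_commute)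
  have "orb_pair X (dg f \<rhd> axis i 1) (dg g \<rhd> axis j 1) = orb_pair X (axis i 1) (axis j 1)" for i j
    using assms[of i j] unfolding dg_axis orb_pair_scale_left orb_pair_scale_right mult.assoc[symmetric]
    by (cases "orb_pair X (axis i 1) (axis j 1) = 0") (simp_all add: mult.commute)
  then show ?thesis using e[of "dg f" "dg g"] e[of 1 1] by simp
qed

definition mm :: "'n \<Rightarrow> real" where
  "mm i = real (hdeg X i) + age X (sector X i) - real (cdim X) / 2"

text \<open>The operator z^mu at z = \<open>cis\<close> \<theta> for the branch log z = i
  \<theta>.\<close>

definition Mt :: "real \<Rightarrow> (complex^'n) endo" where
  "Mt \<theta> = dg (\<lambda>i. cis (\<theta> * mm i))"

lemma expop_mu: "expop (\<i> * \<theta>) (mu X) v = Mt \<theta> \<rhd> v" "expop (- \<i> * \<theta>) (mu X) v = Mt (- \<theta>) \<rhd> v"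
proof -
  have mu: "mu X = (\<rhd>) (dg (\<lambda>i. of_real (mm i)))"
    by (rule ext) (simp add: mu_def mm_def)
  have e: "exp (cop c * dg (\<lambda>i. of_real (mm i))) = dg (\<lambda>i. exp (c * of_real (mm i)))" for c
    by (simp add: cop_eq_dg dg_mult exp_dg)
  have M: "expop (\<i> * of_real \<theta>) (mu X) v = Mt \<theta> \<rhd> v" for \<theta>
    by (simp only: mu expop_eq_exp[OF clin_intros(2)] e Mt_def cis_conv_exp of_real_mult mult.assoc)
  show "expop (\<i> * \<theta>) (mu X) v = Mt \<theta> \<rhd> v" by (rule M)
  have "- \<i> * complex_of_real \<theta> = \<i> * of_real (- \<theta>)" by simp
  then show "expop (- \<i> * \<theta>) (mu X) v = Mt (- \<theta>) \<rhd> v" by (simp only: M)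
qed

lemma mm_sum:
  assumes "sector X j = sinv X (sector X i)"
  shows "mm i + mm j = real (hdeg X i) + real (hdeg X j) - real (sdim X (sector X i))"
  using age_sinv[of "sector X i"] assms by (simp add: mm_def)

lemma Mt_isometry: "orb_pair X (Mt \<theta> \<rhd> \<alpha>) (Mt \<theta> \<rhd> \<beta>) = orb_pair X \<alpha> \<beta>"
  unfolding Mt_def
proof (rule orb_pair_dg)
  fix i j assume a: "orb_pair X (axis i 1) (axis j 1) \<noteq> 0"
  have "mm i + mm j = 0" using mm_sum[OF axis_pair(1)[OF a]] axis_pair(2)[OF a] by simp
  then have "\<theta> * mm i + \<theta> * mm j = 0" by (simp flip: distrib_left)
  then show "cis (\<theta> * mm i) * cis (\<theta> * mm j) = 1" by (simp add: cis_mult)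
qed

lemma Mt_add: "Mt \<theta> * Mt \<eta> = Mt (\<theta> + \<eta>)"
  by (simp add: Mt_def dg_mult cis_mult distrib_right)

lemma Mt_0 [simp]: "Mt 0 = 1" by (simp add: Mt_def)

end

context orbifold_real
begin

lemma Kap_exp_c1: "Kap * exp (cop (\<i> * of_real \<theta>) * Act (c1 X)) = exp (cop (\<i> * of_real \<theta>) * Act (c1 X)) * Kap"
proof (rule exp_intertwine)
  have "Kap * (cop (\<i> * of_real \<theta>) * Act (c1 X)) = cop (- (\<i> * of_real \<theta>)) * (Kap * Act (c1 X))"
    using alinD[OF alin_Kap, of "\<i> * of_real \<theta>"] by (simp add: mult.assoc[symmetric])
  also have "\<dots> = cop (\<i> * of_real \<theta>) * Act (c1 X) * Kap"
    unfolding Kap_c1 cop_minus by (simp add: mult.assoc)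
  finally show "Kap * (cop (\<i> * of_real \<theta>) * Act (c1 X)) = cop (\<i> * of_real \<theta>) * Act (c1 X) * Kap" .
qed

lemma expop_c1: "expop c (act X (c1 X)) v = exp (cop c * Act (c1 X)) \<rhd> v"
proof -
  have "act X (c1 X) = (\<rhd>) (Act (c1 X))" by (rule ext) simp
  then show ?thesis by (simp only: expop_eq_exp[OF clin_Act])
qed

lemma kappa_circle:
  "expop (- \<i> * \<theta>) (mu X) (expop (\<i> * \<theta>) (act X (c1 X))
     (kappaV VR (expop (- \<i> * \<theta>) (act X (c1 X)) (expop (\<i> * \<theta>) (mu X) v))))
   = Mt (- \<theta>) \<rhd> Kap \<rhd> Mt \<theta> \<rhd> v"
proof -
  let ?E = "exp (cop (\<i> * of_real \<theta>) * Act (c1 X))" and ?F = "exp (cop (\<i> * of_real (- \<theta>)) * Act (c1 X))"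
  have "?E * ?F = exp (cop (\<i> * of_real \<theta>) * Act (c1 X) + cop (\<i> * of_real (- \<theta>)) * Act (c1 X))"
    by (rule exp_add_commuting[symmetric]) (simp add: cop_minus)
  then have EF: "?E * ?F = 1" by (simp add: cop_minus)
  have "?E * Kap * ?F = Kap" using EF by (simp add: Kap_exp_c1[symmetric] mult.assoc)
  then have "?E \<rhd> Kap \<rhd> ?F \<rhd> u = Kap \<rhd> u" for u by (metis ap_times)
  moreover have "- \<i> * complex_of_real \<theta> = \<i> * of_real (- \<theta>)" by simp
  ultimately show ?thesis unfolding expop_c1 expop_mu ap_Kap[symmetric] by simp
qed

text \<open>The c1-exponentials commute with \<open>\<kappa>\<^sub>\<V>\<close>, so that they drop out of the realness of the pairing.\<close>

lemma Kap_pair: "orb_pair X (Kap \<rhd> \<alpha>) (Mt pi \<rhd> Kap \<rhd> \<beta>) = cnj (orb_pair X \<alpha> (Mt pi \<rhd> \<beta>))"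
proof -
  let ?R = "exp (cop (\<i> * of_real pi) * Act (c1 X))" and ?R' = "exp (- (cop (\<i> * of_real pi) * Act (c1 X)))"
  have cR: "clin ?R" by (intro clin_exp clin_mult clin_intros clin_Act)
  have V: "V_pair X \<alpha> \<beta> = orb_pair X (?R \<rhd> \<alpha>) (Mt pi \<rhd> \<beta>)" for \<alpha> \<beta>
    unfolding V_pair_def expop_c1 using expop_mu(1)[of pi \<beta>] by (simp add: mult.commute)
  have VK: "V_pair X (Kap \<rhd> \<alpha>) (Kap \<rhd> \<beta>) = cnj (V_pair X \<alpha> \<beta>)" for \<alpha> \<beta>
  proof -
    obtain a b where a: "a \<in> VR" "b \<in> VR" "\<alpha> = a + \<i> *s b" by (rule VR_decomp)
    obtain c d where c: "c \<in> VR" "d \<in> VR" "\<beta> = c + \<i> *s d" by (rule VR_decomp)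
    have cM: "clin (Mt pi)" by (simp add: Mt_def)
    have e: "V_pair X (a + x *s b) (c + y *s d) = V_pair X a c + y * V_pair X a d + x * V_pair X b c + x * y * V_pair X b d" for x y
      unfolding V ap.add_right clin_ap[OF cR] clin_ap[OF cM] orb_pair_add_left orb_pair_add_right
        orb_pair_scale_left orb_pair_scale_right by (simp only: distrib_left mult.assoc add_ac mult.left_commute[of x y])
    have r: "cnj (V_pair X a c) = V_pair X a c" "cnj (V_pair X a d) = V_pair X a d"
      "cnj (V_pair X b c) = V_pair X b c" "cnj (V_pair X b d) = V_pair X b d"
      using VR(4) a c by (simp_all add: Reals_cnj_iff)
    have k: "Kap \<rhd> (a + \<i> *s b) = a + (- \<i>) *s b" "Kap \<rhd> (c + \<i> *s d) = c + (- \<i>) *s d"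
      unfolding ap_Kap kappaV_eq[OF a(1,2)] kappaV_eq[OF c(1,2)] by simp_all
    show ?thesis unfolding a(3) c(3) k e by (simp add: r)
  qed
  have RR: "?R * ?R' = 1" by (rule exp_minus_inverse)
  have "orb_pair X (Kap \<rhd> \<alpha>) (Mt pi \<rhd> Kap \<rhd> \<beta>) = V_pair X (Kap \<rhd> ?R' \<rhd> \<alpha>) (Kap \<rhd> \<beta>)"
  proof -
    have "?R \<rhd> Kap \<rhd> ?R' \<rhd> \<alpha> = Kap \<rhd> \<alpha>"
    proof -
      have "?R * (Kap * ?R') = Kap"
        by (simp only: mult.assoc[symmetric] Kap_exp_c1[symmetric]) (simp only: mult.assoc RR mult_1_right)
      then show ?thesis by (simp only: ap_times[symmetric])
    qed
    then show ?thesis unfolding V by simp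
  qed
  also have "\<dots> = cnj (V_pair X (?R' \<rhd> \<alpha>) \<beta>)" by (rule VK)
  also have "\<dots> = cnj (orb_pair X \<alpha> (Mt pi \<rhd> \<beta>))" unfolding V by (simp only: ap_times[symmetric] RR ap_one)
  finally show ?thesis .
qed

end

locale sector_real = orbifold_real X VR
  for X :: "('n::finite, 't::finite, 'd::ab_group_add, 'x::ab_group_add) orbifold" and VR :: "(complex^'n) set" +
  assumes sectors: "kappaV VR ` Hsec X v = Hsec X (sinv X v)"
begin

lemma Kap_sector:
  assumes "(Kap \<rhd> axis j 1) $ i \<noteq> 0" shows "sector X i = sinv X (sector X j)" "sector X j = sinv X (sector X i)"
proof -
  have "axis j 1 \<in> Hsec X (sector X j)" by (rule Hgr_Hsec[OF axis_Hgr])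
  then have "Kap \<rhd> axis j 1 \<in> Hsec X (sinv X (sector X j))" using sectors by auto
  then show "sector X i = sinv X (sector X j)" using assms by (simp add: Hsec_def)
  then show "sector X j = sinv X (sector X i)" by (simp add: sinv_sinv)
qed

text \<open>The pointwise form of \<open>\<kappa>\<^sub>\<H>\<close>, continued from \<open>|z| = 1\<close>, where \<open>z\<close> is \<open>1 / cnj z\<close>. The factors \<open>z\<^sup>\<rho>\<close>
  cancel, because \<open>\<kappa>\<^sub>\<V>\<close> anticommutes with \<open>\<rho>\<close>.\<close>

definition kz :: "complex \<Rightarrow> (complex^'n) endo" where
  "kz z = dg (\<lambda>i. z powi (int (sdim X (sector X i)) - int (hdeg X i))) * Kap * dg (\<lambda>i. (1 / cnj z) powi int (hdeg X i))"

definition kH :: "(complex \<Rightarrow> complex^'n) \<Rightarrow> complex \<Rightarrow> complex^'n" where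
  "kH s z = (if z = 0 then 0 else kz z \<rhd> s (1 / cnj z))"

lemma alin_kz: "alin (kz z)"
  unfolding kz_def by (intro alin_clin_mult clin_alin_mult clin_intros alin_Kap)

lemma kz_component:
  assumes "z \<noteq> 0"
  shows "(kz z \<rhd> v) $ i = (\<Sum>j\<in>UNIV. z powi (int (sdim X (sector X i)) - int (hdeg X i) - int (hdeg X j))
      * (Kap \<rhd> axis j 1) $ i * cnj (v $ j))"
proof -
  have "(kz z \<rhd> v) $ i = (\<Sum>j\<in>UNIV. cnj (v $ j) * (kz z \<rhd> axis j 1) $ i)"
    by (subst alin_expand[OF alin_kz]) simp
  also have "\<dots> = (\<Sum>j\<in>UNIV. z powi (int (sdim X (sector X i)) - int (hdeg X i) - int (hdeg X j))
      * (Kap \<rhd> axis j 1) $ i * cnj (v $ j))"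
  proof (rule sum.cong[OF refl])
    fix j
    have "(kz z \<rhd> axis j 1) $ i = z powi (int (sdim X (sector X i)) - int (hdeg X i)) * ((1 / z) powi int (hdeg X j) * (Kap \<rhd> axis j 1) $ i)"
      unfolding kz_def ap_times dg_axis alin_ap[OF alin_Kap]
      unfolding ap_dg vec_lambda_beta vector_smult_component by simp
    also have "\<dots> = z powi (int (sdim X (sector X i)) - int (hdeg X i) - int (hdeg X j)) * (Kap \<rhd> axis j 1) $ i"
      using assms by (simp add: power_int_diff power_one_over mult_ac)
    finally show "cnj (v $ j) * (kz z \<rhd> axis j 1) $ i = z powi (int (sdim X (sector X i)) - int (hdeg X i) - int (hdeg X j))
      * (Kap \<rhd> axis j 1) $ i * cnj (v $ j)" by (simp only: mult_ac)
  qed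
  finally show ?thesis .
qed

text \<open>\<open>Kap\<close> exchanges the sectors \<open>v\<close> and \<open>sinv X v\<close>,
  whose ages add up to n - n_v. The fractional exponents of the two powers of z therefore cancel,
  and the integral power n_v - k - k' remains, independent of the branch of the logarithm.\<close>

lemma kz_circle: "kz (cis \<theta>) = Mt (- \<theta>) * Kap * Mt \<theta>"
proof (rule endo_eqI)
  fix v
  show "kz (cis \<theta>) \<rhd> v = (Mt (- \<theta>) * Kap * Mt \<theta>) \<rhd> v"
    unfolding vec_eq_iff
  proof
    fix i
    have "((Mt (- \<theta>) * Kap * Mt \<theta>) \<rhd> v) $ i = (\<Sum>j\<in>UNIV. cis (- \<theta> * mm i) * (cnj (cis (\<theta> * mm j) * v $ j) * (Kap \<rhd> axis j 1) $ i))"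
      unfolding ap_times alin_expand[OF alin_Kap, of "Mt \<theta> \<rhd> v"] unfolding Mt_def ap_dg vec_lambda_beta sum_component
        vector_smult_component sum_distrib_left ..
    also have "\<dots> = (kz (cis \<theta>) \<rhd> v) $ i"
      unfolding kz_component[OF cis_neq_zero]
    proof (rule sum.cong[OF refl])
      fix j
      show "cis (- \<theta> * mm i) * (cnj (cis (\<theta> * mm j) * v $ j) * (Kap \<rhd> axis j 1) $ i) =
         cis \<theta> powi (int (sdim X (sector X i)) - int (hdeg X i) - int (hdeg X j)) * (Kap \<rhd> axis j 1) $ i * cnj (v $ j)"
      proof (cases "(Kap \<rhd> axis j 1) $ i = 0")
        case False
        have "mm i + mm j = real (hdeg X i) + real (hdeg X j) - real (sdim X (sector X i))"
          by (rule mm_sum[OF Kap_sector(2)[OF False]])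
        then have "- \<theta> * mm i + - (\<theta> * mm j) = of_int (int (sdim X (sector X i)) - int (hdeg X i) - int (hdeg X j)) * \<theta>"
        proof -
          assume *: "mm i + mm j = real (hdeg X i) + real (hdeg X j) - real (sdim X (sector X i))"
          have "- \<theta> * mm i + - (\<theta> * mm j) = - \<theta> * (mm i + mm j)" by (simp add: distrib_left)
          also have "\<dots> = of_int (int (sdim X (sector X i)) - int (hdeg X i) - int (hdeg X j)) * \<theta>"
            unfolding * by (simp add: left_diff_distrib right_diff_distrib distrib_left mult.commute)
          finally show ?thesis .
        qed
        then have "cis (- \<theta> * mm i) * cis (- (\<theta> * mm j)) = cis \<theta> powi (int (sdim X (sector X i)) - int (hdeg X i) - int (hdeg X j))"
          by (simp only: cis_power_int cis_mult)
        from this[symmetric] show ?thesis by (simp only: complex_cnj_mult cis_cnj) (simp only: mult_ac)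
      qed simp
    qed
    finally show "(kz (cis \<theta>) \<rhd> v) $ i = ((Mt (- \<theta>) * Kap * Mt \<theta>) \<rhd> v) $ i" by (rule sym)
  qed
qed

text \<open>The points z and - z differ by the angle pi. That leaves the operator exp (pi i mu)
  between the two conjugations, exactly the one in the pairing that is real on
  \<open>VR\<close>.\<close>

lemma kz_pair:
  assumes "norm z = 1"
  shows "orb_pair X (kz (- z) \<rhd> u) (kz z \<rhd> v) = cnj (orb_pair X u v)"
proof -
  obtain \<theta> where z: "z = cis \<theta>" using assms by (metis cis_Arg complex_norm_eq_1_exp cis_conv_exp)
  have mz: "- z = cis (\<theta> + pi)" by (simp add: z cis.ctr complex_eq_iff)
  have r: "orb_pair X (Mt (- \<eta>) \<rhd> \<alpha>) \<beta> = orb_pair X \<alpha> (Mt \<eta> \<rhd> \<beta>)" for \<eta> \<alpha> \<beta>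
  proof -
    have "Mt \<eta> * Mt (- \<eta>) = 1" by (simp add: Mt_add)
    then have "Mt \<eta> \<rhd> Mt (- \<eta>) \<rhd> \<alpha> = \<alpha>" by (metis ap_times ap_one)
    then show ?thesis using Mt_isometry[of \<eta> "Mt (- \<eta>) \<rhd> \<alpha>" \<beta>] by simp
  qed
  let ?u = "Mt (\<theta> + pi) \<rhd> u" and ?v = "Mt \<theta> \<rhd> v"
  have "orb_pair X (kz (- z) \<rhd> u) (kz z \<rhd> v) = orb_pair X (Mt (- (\<theta> + pi)) \<rhd> Kap \<rhd> ?u) (Mt (- \<theta>) \<rhd> Kap \<rhd> ?v)"
    unfolding mz unfolding z kz_circle ap_times ..
  also have "\<dots> = orb_pair X (Kap \<rhd> ?u) ((Mt (\<theta> + pi) * Mt (- \<theta>)) \<rhd> Kap \<rhd> ?v)"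
    unfolding r ap_times ..
  also have "Mt (\<theta> + pi) * Mt (- \<theta>) = Mt pi" by (simp add: Mt_add)
  also have "orb_pair X (Kap \<rhd> ?u) (Mt pi \<rhd> Kap \<rhd> ?v) = cnj (orb_pair X ?u (Mt pi \<rhd> ?v))" by (rule Kap_pair)
  also have "Mt pi \<rhd> ?v = Mt (\<theta> + pi) \<rhd> v" by (metis Mt_add ap_times add.commute)
  also have "orb_pair X ?u \<dots> = orb_pair X u v" by (rule Mt_isometry)
  finally show ?thesis .
qed

lemma kz_kz: assumes z: "z \<noteq> 0" shows "kz z * kz (1 / cnj z) = 1"
proof -
  define w where "w = 1 / cnj z"
  have w: "1 / cnj w = z" "w \<noteq> 0" using z by (simp_all add: w_def)
  have "dg (\<lambda>i. w powi int (hdeg X i)) * dg (\<lambda>i. w powi (int (sdim X (sector X i)) - int (hdeg X i)))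
      = dg (\<lambda>i. w powi int (sdim X (sector X i)))"
    using w(2) by (simp add: dg_mult power_int_diff)
  moreover have "Kap * dg (\<lambda>i. w powi int (sdim X (sector X i))) = dg (\<lambda>i. cnj w powi int (sdim X (sector X i))) * Kap"
  proof (rule endo_eqI)
    fix v
    show "(Kap * dg (\<lambda>i. w powi int (sdim X (sector X i)))) \<rhd> v = (dg (\<lambda>i. cnj w powi int (sdim X (sector X i))) * Kap) \<rhd> v"
      unfolding ap_times alin_expand[OF alin_Kap, of v] alin_expand[OF alin_Kap, of "dg _ \<rhd> v"] unfolding vec_eq_iff
    proof
      fix i
      have "cnj (w powi int (sdim X (sector X j)) * v $ j) * (Kap \<rhd> axis j 1) $ i =
        cnj w powi int (sdim X (sector X i)) * (cnj (v $ j) * (Kap \<rhd> axis j 1) $ i)" for j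
        using Kap_sector(1)[of j i] by (cases "(Kap \<rhd> axis j 1) $ i = 0") (simp_all add: sdim_sinv)
      then show "(\<Sum>j\<in>UNIV. cnj ((dg (\<lambda>i. w powi int (sdim X (sector X i))) \<rhd> v) $ j) *s (Kap \<rhd> axis j 1)) $ i =
        (dg (\<lambda>i. cnj w powi int (sdim X (sector X i))) \<rhd> (\<Sum>j\<in>UNIV. cnj (v $ j) *s (Kap \<rhd> axis j 1))) $ i"
        by (simp only: ap_dg vec_lambda_beta sum_component vector_smult_component sum_distrib_left)
    qed
  qed
  ultimately have "kz z * kz w = dg (\<lambda>i. z powi (int (sdim X (sector X i)) - int (hdeg X i)))
     * dg (\<lambda>i. cnj w powi int (sdim X (sector X i))) * (Kap * Kap) * dg (\<lambda>i. z powi int (hdeg X i))"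
    unfolding kz_def w(1) w_def[symmetric] by (metis (no_types, lifting) mult.assoc)
  also have "\<dots> = dg (\<lambda>i. z powi (int (sdim X (sector X i)) - int (hdeg X i)) * cnj w powi int (sdim X (sector X i)) * z powi int (hdeg X i))"
    by (simp add: Kap_Kap dg_mult)
  also have "\<dots> = dg (\<lambda>_. 1)"
    using z by (simp add: w_def power_int_diff power_one_over)
  finally show ?thesis by (simp add: w_def)
qed

lemma kH_HH: assumes "s \<in> HH" shows "kH s \<in> HH"
  unfolding HH_def mem_Collect_eq
proof (intro conjI allI)
  show "kH s 0 = 0" by (simp add: kH_def)
  fix i
  have s: "(\<lambda>z. s z $ j) holomorphic_on - {0}" for j using assms by (simp add: HH_def)
  have c: "(\<lambda>z. cnj (s (1 / cnj z) $ j)) holomorphic_on - {0}" for j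
  proof -
    have "(\<lambda>z. cnj (s (cnj z) $ j)) holomorphic_on - {0}"
      by (rule holomorphic_cnj_cnj[OF s]) auto
    then have "((\<lambda>z. cnj (s (cnj z) $ j)) \<circ> (\<lambda>z. 1 / z)) holomorphic_on - {0}"
      by (rule holomorphic_on_compose_gen[rotated]) (auto intro!: holomorphic_intros)
    then show ?thesis by (simp add: comp_def)
  qed
  have "(\<lambda>z. \<Sum>j\<in>UNIV. z powi (int (sdim X (sector X i)) - int (hdeg X i) - int (hdeg X j))
      * (Kap \<rhd> axis j 1) $ i * cnj (s (1 / cnj z) $ j)) holomorphic_on - {0}"
    by (intro holomorphic_intros c) auto
  then show "(\<lambda>z. kH s z $ i) holomorphic_on - {0}"
    by (rule holomorphic_transform) (simp add: kH_def kz_component)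
qed

lemma kH_kH: assumes "s 0 = 0" shows "kH (kH s) = s"
proof
  fix z
  show "kH (kH s) z = s z"
  proof (cases "z = 0")
    case True then show ?thesis using assms by (simp add: kH_def)
  next
    case False
    have "kz z \<rhd> kz (1 / cnj z) \<rhd> s z = s z" using kz_kz[OF False] by (metis ap_times ap_one)
    then show ?thesis using False by (simp add: kH_def)
  qed
qed

text \<open>An element of \<open>HH\<close> is determined by its values on the unit circle, which
  settles the uniqueness required by the definite description.\<close>

lemma kappaH_eq: assumes s: "s \<in> HH" shows "kappaH X VR s = kH s"
  unfolding kappaH_def kappa_circle
proof (rule the_equality)
  have c: "kH s (cis \<theta>) = Mt (- \<theta>) \<rhd> Kap \<rhd> Mt \<theta> \<rhd> s (cis \<theta>)" for \<theta>
  proof -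
    have "1 / cnj (cis \<theta>) = cis \<theta>" by (simp add: cis_cnj cis_inverse divide_inverse)
    then show ?thesis by (simp add: kH_def kz_circle)
  qed
  then show "kH s \<in> HH \<and> (\<forall>\<theta>. kH s (cis \<theta>) = Mt (- \<theta>) \<rhd> Kap \<rhd> Mt \<theta> \<rhd> s (cis \<theta>))"
    using kH_HH[OF s] by simp
  fix t assume t: "t \<in> HH \<and> (\<forall>\<theta>. t (cis \<theta>) = Mt (- \<theta>) \<rhd> Kap \<rhd> Mt \<theta> \<rhd> s (cis \<theta>))"
  show "t = kH s"
  proof
    fix z
    show "t z = kH s z"
    proof (cases "z = 0")
      case True then show ?thesis using t kH_HH[OF s] by (simp add: HH_def)
    next
      case False
      show ?thesis unfolding vec_eq_iff
      proof
        fix i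
        show "t z $ i = kH s z $ i"
          by (rule holomorphic_eq_on_circle[OF _ _ _ False])
            (use t kH_HH[OF s] c in \<open>simp_all add: HH_def\<close>)
      qed
    qed
  qed
qed

end

lemma clin_exp_cop [intro]: "clin A \<Longrightarrow> clin (exp (cop c * A))"
  by (intro clin_exp clin_mult clin_intros)

lemma exp_cop_inverse:
  assumes "clin A" shows "exp (cop c * A) * exp (cop (- c) * A) = 1" "exp (cop (- c) * A) * exp (cop c * A) = 1"
  by (simp_all add: cop_minus exp_minus_inverse exp_minus_inverse[of "- (cop c * A)", simplified])

lemma exp_cop_add:
  assumes "clin A" shows "exp (cop (a + b) * A) = exp (cop a * A) * exp (cop b * A)"
proof -
  have "(cop a * A) * (cop b * A) = cop (a * b) * (A * A)" for a b
  proof -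
    have "(cop a * A) * (cop b * A) = cop a * (A * cop b) * A" by (simp only: mult.assoc)
    also have "\<dots> = cop (a * b) * (A * A)" unfolding clinD[OF assms] cop_mult by (simp only: mult.assoc)
    finally show ?thesis .
  qed
  then have "(cop a * A) * (cop b * A) = (cop b * A) * (cop a * A)" by (simp only: mult.commute)
  then show ?thesis unfolding cop_add distrib_right by (rule exp_add_commuting)
qed

lemma norm_exp_cop: "norm (exp (cop c * A :: (complex^'n::finite) endo)) \<le> exp (norm c * norm A)"
proof -
  have "norm (exp (cop c * A)) \<le> exp (norm (cop c * A))" by (rule norm_exp)
  also have "\<dots> \<le> exp (norm c * norm A)"
    using norm_mult_ineq[of "cop c" A] by (simp add: norm_cop)
  finally show ?thesis .
qed

lemma norm_cj: "norm (cj :: (complex^'n::finite) endo) \<le> 1"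
proof (rule norm_endo_le)
  fix v :: "complex^'n"
  show "norm (cj \<rhd> v) \<le> 1 * norm v" by (simp add: norm_vec_def)
qed simp

lemma norm_alin_le:
  assumes "alin A" shows "norm A \<le> (\<Sum>j\<in>UNIV. norm (A \<rhd> axis j 1))"
proof -
  have cja: "cj \<rhd> axis j 1 = axis j 1" for j :: 'a by (simp add: vec_eq_iff axis_def)
  have "A = (A * cj) * cj" by (simp add: mult.assoc)
  then have "norm A \<le> norm (A * cj) * norm (cj :: (complex^'a) endo)" by (metis norm_mult_ineq)
  also have "\<dots> \<le> norm (A * cj) * 1" by (rule mult_left_mono[OF norm_cj norm_ge_zero])
  also have "norm (A * cj) \<le> (\<Sum>j\<in>UNIV. norm ((A * cj) \<rhd> axis j 1))"
    by (rule norm_clin_le[OF alin_mult[OF assms alin_cj]])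
  finally show ?thesis by (simp add: cja del: ap_cj)
qed

lemma hvec_cj_inverse:
  assumes "hvec (- {0}) s" shows "hvec (- {0}) (\<lambda>z. cj \<rhd> s (1 / cnj z))"
  unfolding hvec_def
proof
  fix j
  have s: "(\<lambda>z. s z $ j) holomorphic_on - {0}" using assms by (simp add: hvec_def)
  have "(\<lambda>z. cnj (s (cnj z) $ j)) holomorphic_on - {0}"
    by (rule holomorphic_cnj_cnj[OF s]) auto
  then have "((\<lambda>z. cnj (s (cnj z) $ j)) \<circ> (\<lambda>z. 1 / z)) holomorphic_on - {0}"
    by (rule holomorphic_on_compose_gen[rotated]) (auto intro!: holomorphic_intros)
  then show "(\<lambda>z. (cj \<rhd> s (1 / cnj z)) $ j) holomorphic_on - {0}" by (simp add: comp_def)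
qed

context sector_real
begin

lemma hvec_kz: "hvec (- {0}) (\<lambda>z. kz z \<rhd> v)"
  unfolding hvec_def
proof
  fix i
  have "(\<lambda>z. \<Sum>j\<in>UNIV. z powi (int (sdim X (sector X i)) - int (hdeg X i) - int (hdeg X j))
      * (Kap \<rhd> axis j 1) $ i * cnj (v $ j)) holomorphic_on - {0}"
    by (intro holomorphic_intros) auto
  then show "(\<lambda>z. (kz z \<rhd> v) $ i) holomorphic_on - {0}"
    by (rule holomorphic_transform) (simp add: kz_component)
qed

text \<open>For fixed \<open>v\<close> the vector \<open>kz z\<close> applied to \<open>v\<close> is
  holomorphic in z, but it is antilinear in \<open>v\<close>; the factor \<open>cj\<close> turns it
  into a linear family. The factors \<open>cj\<close> in the transition operators below have this
  origin.\<close>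

lemma holop_kz_cj: "holop (- {0}) (\<lambda>z. kz z * cj)"
  by (rule holopI) (auto simp: hvec_kz simp del: ap_cj intro!: alin_mult alin_kz)

end

section \<open>The weight-preserving part of the real structure and the rescaling\<close>

locale real_GW = convergent_GW X \<omega> t0 + sector_real X VR
  for X :: "('n::finite, 't::finite, 'd::ab_group_add, 'x::ab_group_add) orbifold" and \<omega> t0 VR
begin

lemma Kap_N: "Kap * N = - N * Kap"
  unfolding N_def by (rule Kap_Act_real[OF omega_Hgr kahler_real[OF kahler]])

lemma Kap_weight: "(Kap \<rhd> axis j 1) $ i \<noteq> 0 \<Longrightarrow> wt i \<le> wt j"
  by (rule L.antilinear_lowers_weight[OF Kap_N])

text \<open>The part of \<open>\<kappa>\<^sub>\<V>\<close> that preserves the weight; the remaining part lowers it.\<close>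

definition C :: "(complex^'n) endo" where
  "C = (\<Sum>l\<in>range wt. L.pr l * Kap * L.pr l)"

lemma alin_C: "alin C"
proof -
  have "alin (L.pr l * Kap * L.pr l)" for l
    by (intro alin_clin_mult clin_alin_mult alin_Kap L.clin_pr)
  then show ?thesis unfolding C_def alin_def sum_distrib_left sum_distrib_right by simp
qed

lemma C_component: "(C \<rhd> axis j 1) $ i = (if wt i = wt j then (Kap \<rhd> axis j 1) $ i else 0)"
proof -
  have p: "L.pr l \<rhd> axis j 1 = (if l = wt j then axis j 1 else 0)" for l
    by (rule L.pr_V[OF L.axis_V])
  have c: "(L.pr l \<rhd> v) $ i = (if wt i = l then v $ i else 0)" for l v
    by (simp add: L.pr_def)
  have "(C \<rhd> axis j 1) $ i = (\<Sum>l\<in>range wt. if l = wt j then (if wt i = l then (Kap \<rhd> axis j 1) $ i else 0) else 0)"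
    unfolding C_def ap_sum sum_component ap_times c p
    by (rule sum.cong) (simp_all del: ap_Kap add: ap.zero_right)
  also have "\<dots> = (if wt i = wt j then (Kap \<rhd> axis j 1) $ i else 0)"
    by (subst sum.delta) simp_all
  finally show ?thesis .
qed

lemma C_nonzero:
  assumes "(C \<rhd> axis j 1) $ i \<noteq> 0"
  shows "wt i = wt j" "sector X i = sinv X (sector X j)" "hdeg X i = hdeg X j" "(C \<rhd> axis j 1) $ i = (Kap \<rhd> axis j 1) $ i"
proof -
  show w: "wt i = wt j" and k: "(C \<rhd> axis j 1) $ i = (Kap \<rhd> axis j 1) $ i"
    using assms unfolding C_component by presburger+
  show s: "sector X i = sinv X (sector X j)" by (rule Kap_sector(1)) (use assms k in simp)
  show "hdeg X i = hdeg X j" using w by (simp add: wt_def s sdim_sinv)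
qed

text \<open>\<open>Kap\<close> is block triangular for the weight, so the diagonal blocks of its
  square are the squares of its diagonal blocks.\<close>

lemma C_C: "C * C = 1"
proof (rule clin_eqI)
  fix j
  show "(C * C) \<rhd> axis j 1 = 1 \<rhd> axis j 1"
    unfolding vec_eq_iff
  proof
    fix i
    have C2: "((C * C) \<rhd> axis j 1) $ i = (\<Sum>k\<in>UNIV. cnj ((C \<rhd> axis j 1) $ k) * (C \<rhd> axis k 1) $ i)"
      unfolding ap_times alin_expand[OF alin_C, of "C \<rhd> axis j 1"] by simp
    have K2: "((Kap * Kap) \<rhd> axis j 1) $ i = (\<Sum>k\<in>UNIV. cnj ((Kap \<rhd> axis j 1) $ k) * (Kap \<rhd> axis k 1) $ i)"
      unfolding ap_times alin_expand[OF alin_Kap, of "Kap \<rhd> axis j 1"] by (simp del: ap_Kap)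
    show "((C * C) \<rhd> axis j 1) $ i = (1 \<rhd> axis j 1) $ i"
    proof (cases "wt i = wt j")
      case True
      have "cnj ((C \<rhd> axis j 1) $ k) * (C \<rhd> axis k 1) $ i = cnj ((Kap \<rhd> axis j 1) $ k) * (Kap \<rhd> axis k 1) $ i" for k
      proof (cases "wt k = wt j")
        case True
        then show ?thesis using \<open>wt i = wt j\<close> unfolding C_component by (simp del: ap_Kap)
      next
        case False
        then have "(Kap \<rhd> axis j 1) $ k = 0 \<or> (Kap \<rhd> axis k 1) $ i = 0"
          using Kap_weight[of j k] Kap_weight[of k i] True by linarith
        then show ?thesis unfolding C_component using False by (auto simp del: ap_Kap)
      qed
      then show ?thesis unfolding C2 using K2 Kap_Kap by simp
    next
      case False
      then have z: "cnj ((C \<rhd> axis j 1) $ k) * (C \<rhd> axis k 1) $ i = 0" for k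
        unfolding C_component by (auto simp del: ap_Kap)
      have "axis j 1 $ i = (0::complex)" using False by (auto simp: axis_def)
      then show ?thesis unfolding C2 by (simp only: z sum.neutral_const ap_one)
    qed
  qed
qed (auto intro!: alin_mult alin_C)

text \<open>For \<open>t = exp (2 r)\<close> this is \<open>t\<close> to the power \<open>- h / 2\<close>; conjugation by it multiplies \<open>N\<close> by \<open>t\<close>.\<close>

definition Dt :: "real \<Rightarrow> (complex^'n) endo" where
  "Dt r = dg (\<lambda>i. of_real (exp (- r * wt i)))"
lemma clin_Dt [simp]: "clin (Dt r)" by (simp add: Dt_def)

lemma Dt_Dt: "Dt r * Dt (- r) = 1" "Dt (- r) * Dt r = 1"
  by (simp_all add: Dt_def dg_mult flip: of_real_mult exp_add)

lemma Dt_N: "Dt r * N = cop (of_real (exp (2 * r))) * N * Dt r"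
  unfolding Dt_def
  by (rule L.dg_intertwine[where g = "\<lambda>l. of_real (exp (- r * of_int l))"
        and f = "\<lambda>l. of_real (exp (- r * of_int l))" and s = "\<lambda>l. l - 2", OF clin_N L.N_V])
    (simp_all add: right_diff_distrib flip: of_real_mult exp_add)

lemma Dt_isometry: "orb_pair X (Dt r \<rhd> \<alpha>) (Dt r \<rhd> \<beta>) = orb_pair X \<alpha> \<beta>"
  unfolding Dt_def
proof (rule orb_pair_dg)
  fix i j assume a: "orb_pair X (axis i 1) (axis j 1) \<noteq> 0"
  have "wt i + wt j = 0" using axis_pair[OF a] by (simp add: wt_def sdim_sinv)
  then have "wt j = - wt i" by simp
  then show "complex_of_real (exp (- r * wt i)) * complex_of_real (exp (- r * wt j)) = 1"
    by (simp flip: of_real_mult exp_add)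
qed

lemma norm_Dt: assumes "0 \<le> \<bar>r\<bar>" shows "norm (Dt r) \<le> exp (\<bar>r\<bar> * real L.bnd)"
  unfolding Dt_def
proof (rule norm_dg_le)
  fix i
  have "- r * wt i \<le> \<bar>r\<bar> * \<bar>real_of_int (wt i)\<bar>" by (metis abs_ge_self abs_minus_cancel abs_mult)
  also have "\<dots> \<le> \<bar>r\<bar> * real L.bnd"
  proof (rule mult_left_mono)
    show "\<bar>real_of_int (wt i)\<bar> \<le> real L.bnd" using L.wt_bnd[of i] by linarith
  qed simp
  finally show "norm (complex_of_real (exp (- r * wt i))) \<le> exp (\<bar>r\<bar> * real L.bnd)" by simp
qed

text \<open>Conjugation multiplies the entry (i, j) by exp (r (wt i - wt j)). Entries between equal
  weights make up \<open>C\<close>; the other nonzero ones lower the weight by at least 1 and shrink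
  at least like exp (- r).\<close>

lemma Kap_limit:
  assumes r: "0 \<le> r"
  shows "norm (Dt (- r) * Kap * Dt r - C) \<le> (\<Sum>j\<in>UNIV. \<Sum>i\<in>UNIV. norm ((Kap \<rhd> axis j 1) $ i)) * exp (- r)"
proof -
  let ?A = "Dt (- r) * Kap * Dt r - C"
  have al: "alin (Dt (- r) * Kap * Dt r)" by (intro alin_clin_mult clin_alin_mult alin_Kap clin_Dt)
  have "alin ?A" using al alin_C unfolding alin_def left_diff_distrib right_diff_distrib by simp
  then have "norm ?A \<le> (\<Sum>j\<in>UNIV. norm (?A \<rhd> axis j 1))" by (rule norm_alin_le)
  also have "\<dots> \<le> (\<Sum>j\<in>UNIV. \<Sum>i\<in>UNIV. norm ((?A \<rhd> axis j 1) $ i))"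
    by (intro sum_mono norm_cvec_le)
  also have "\<dots> \<le> (\<Sum>j\<in>UNIV. \<Sum>i\<in>UNIV. norm ((Kap \<rhd> axis j 1) $ i) * exp (- r))"
  proof (intro sum_mono)
    fix i j
    let ?m = "(Kap \<rhd> axis j 1) $ i"
    have "((Dt (- r) * Kap * Dt r) \<rhd> axis j 1) $ i = of_real (exp (r * wt i)) * (of_real (exp (- r * wt j)) * ?m)"
      unfolding ap_times unfolding Dt_def dg_axis alin_ap[OF alin_Kap] unfolding ap_dg vec_lambda_beta vector_smult_component
      by simp
    also have "\<dots> = of_real (exp (r * (wt i - wt j))) * ?m"
    proof -
      have "exp (r * (wt i - wt j)) = exp (r * wt i) * exp (- r * wt j)"
        by (simp add: right_diff_distrib flip: exp_add)
      then show ?thesis by (simp only: of_real_mult mult.assoc)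
    qed
    finally have e: "(?A \<rhd> axis j 1) $ i = of_real (exp (r * (wt i - wt j))) * ?m - (C \<rhd> axis j 1) $ i"
      unfolding ap_diff vector_minus_component by (simp only:)
    show "norm ((?A \<rhd> axis j 1) $ i) \<le> norm ?m * exp (- r)"
    proof (cases "?m = 0 \<or> wt i = wt j")
      case True
      then show ?thesis unfolding e C_component by auto
    next
      case False
      then have "wt i < wt j" using Kap_weight[of j i] by linarith
      then have "r * (wt i - wt j) \<le> r * (- 1)" using r by (intro mult_left_mono) linarith+
      then have "norm ?m * exp (r * (wt i - wt j)) \<le> norm ?m * exp (- r)"
        by (intro mult_left_mono) simp_all
      then show ?thesis unfolding e C_component using False by (simp add: norm_mult mult.commute)
    qed
  qed
  finally show ?thesis by (simp only: sum_distrib_right)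
qed

text \<open>\<open>C\<close> preserves the degree k as well as the weight, so the power n_v - k - k
  of z is the weight. The limit of the conjugation is z^h followed by \<open>C\<close>, the shape to
  which \<open>birkhoff_factorization\<close> applies.\<close>

lemma C_Zh:
  assumes z: "z \<noteq> 0"
  shows "dg (\<lambda>i. z powi (int (sdim X (sector X i)) - int (hdeg X i))) * C * dg (\<lambda>i. (1 / cnj z) powi int (hdeg X i)) = L.Zh z * C"
    (is "?A = ?B")
proof -
  have al: "alin ?A" "alin ?B"
    by (rule alin_clin_mult[OF clin_alin_mult[OF clin_intros(2) alin_C] clin_intros(2)],
      rule clin_alin_mult[OF L.clin_Zh alin_C])
  have "?A \<rhd> v = ?B \<rhd> v" for v
  proof -
    have "(?A \<rhd> axis j 1) $ i = (?B \<rhd> axis j 1) $ i" for i j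
    proof -
      have "(?A \<rhd> axis j 1) $ i = z powi (int (sdim X (sector X i)) - int (hdeg X i)) * ((1 / z) powi int (hdeg X j) * (C \<rhd> axis j 1) $ i)"
        unfolding ap_times dg_axis alin_ap[OF alin_C] unfolding ap_dg vec_lambda_beta vector_smult_component by simp
      also have "\<dots> = z powi wt i * (C \<rhd> axis j 1) $ i"
      proof (cases "(C \<rhd> axis j 1) $ i = 0")
        case False
        then have "wt i = int (sdim X (sector X i)) - int (hdeg X i) - int (hdeg X j)"
          using C_nonzero(3)[OF False] by (simp add: wt_def)
        then show ?thesis using z by (simp add: power_int_diff power_one_over)
      qed simp
      also have "\<dots> = (?B \<rhd> axis j 1) $ i"
        unfolding ap_times L.Zh_def ap_dg vec_lambda_beta ..
      finally show ?thesis .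
    qed
    then have "?A \<rhd> axis j 1 = ?B \<rhd> axis j 1" for j unfolding vec_eq_iff by blast
    then show ?thesis unfolding alin_expand[OF al(1), of v] alin_expand[OF al(2), of v] by (simp only:)
  qed
  then show ?thesis by (rule endo_eqI)
qed

end

definition invp :: "'a::monoid_mult \<Rightarrow> 'a \<Rightarrow> bool" where
  "invp A A' \<longleftrightarrow> A * A' = 1 \<and> A' * A = 1"

lemma invp_sym: "invp A A' \<Longrightarrow> invp A' A" by (simp add: invp_def)

lemma invp_mult: assumes "invp A A'" "invp B B'" shows "invp (A * B) (B' * A')"
proof -
  have "A * B * (B' * A') = A * (B * B') * A'" "B' * A' * (A * B) = B' * (A' * A) * B"
    by (simp_all only: mult.assoc)
  then show ?thesis using assms by (simp add: invp_def)
qed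

lemma invp_mult3:
  assumes "invp A A'" "invp B B'" "invp C C'" shows "invp (A * B * C) (C' * B' * A')"
  using invp_mult[OF invp_mult[OF assms(1,2)] assms(3)] by (simp only: mult.assoc)

lemma invp_ap: "invp A A' \<Longrightarrow> A \<rhd> A' \<rhd> v = v" "invp A A' \<Longrightarrow> A' \<rhd> A \<rhd> v = v"
  by (simp_all add: invp_def flip: ap_times)

lemma invp_cj: "invp cj cj" by (simp add: invp_def)

lemma invp_exp_cop: "clin A \<Longrightarrow> invp (exp (cop c * A)) (exp (cop (- c) * A))"
  by (simp add: invp_def exp_cop_inverse)

lemma holop_cj_inverse:
  assumes "holop (- {0}) A" shows "holop (- {0}) (\<lambda>z. cj * A (1 / cnj z) * cj)"
proof (rule holopI)
  have "alin (cj * A (1 / cnj z))" for z by (rule alin_clin_mult[OF alin_cj holop_clin[OF assms]])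
  then show "clin (cj * A (1 / cnj z) * cj)" for z by (rule alin_mult[OF _ alin_cj])
  show "hvec (- {0}) (\<lambda>z. (cj * A (1 / cnj z) * cj) \<rhd> v)" for v
    unfolding ap_times by (rule hvec_cj_inverse[OF hvec_ap[OF assms hvec_const]])
qed

section \<open>The rescaled gluing problem\<close>

locale real_GW_point = real_GW X \<omega> t0 VR
  for X :: "('n::finite, 't::finite, 'd::ab_group_add, 'x::ab_group_add) orbifold" and \<omega> t0 VR +
  fixes x :: complex and r :: real
  assumes x: "t0 \<le> Re x" and r: "Re x = exp (2 * r)" "0 \<le> r"
begin

definition B :: "complex \<Rightarrow> (complex^'n) endo" where "B z = exp (cop (z / 2) * L.e)"
definition B' :: "complex \<Rightarrow> (complex^'n) endo" where "B' z = exp (cop (- (z / 2)) * L.e)"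
definition K :: "complex \<Rightarrow> (complex^'n) endo" where "K z = exp (cop (2 / z) * N)"
definition K' :: "complex \<Rightarrow> (complex^'n) endo" where "K' z = exp (cop (- (2 / z)) * N)"
definition Phi' :: "complex \<Rightarrow> (complex^'n) endo" where "Phi' z = adj (Phi x (- z))"
text \<open>The part of the factorisation that is holomorphic at infinity, with \<open>C\<close>
  attached and made linear by \<open>cj\<close>. Evaluated at 1 / z it is absorbed into the unknown
  \<open>c\<close>; removing it on the right of \<open>G2\<close> is what makes \<open>G2\<close>
  tend to 1.\<close>

definition Lo :: "complex \<Rightarrow> (complex^'n) endo" where "Lo u = L.w * B u * (C * cj)"
definition Lo' :: "complex \<Rightarrow> (complex^'n) endo" where "Lo' u = cj * C * B' u * L.w'"
text \<open>The reflected argument 1 / cnj z is antiholomorphic in z; conjugation by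
  \<open>cj\<close> on both sides makes the family holomorphic again.\<close>

definition A1 :: "complex \<Rightarrow> (complex^'n) endo" where
  "A1 z = cj * (Phi x (1 / cnj z) * Dt r) * cj"
definition A2 :: "complex \<Rightarrow> (complex^'n) endo" where
  "A2 z = cj * (Dt (- r) * Phi' (1 / cnj z) * (kz (1 / cnj z) * cj)) * cj"
definition G1 :: "complex \<Rightarrow> (complex^'n) endo" where
  "G1 z = B' z * (Dt (- r) * Phi x z * Dt r) * B z"
definition H1 :: "complex \<Rightarrow> (complex^'n) endo" where
  "H1 z = B' z * (Dt (- r) * Phi' z * Dt r) * B z"
definition G2 :: "complex \<Rightarrow> (complex^'n) endo" where
  "G2 z = B' z * K z * (Dt (- r) * (kz z * cj) * A1 z) * Lo' (1 / z)"
definition H2 :: "complex \<Rightarrow> (complex^'n) endo" where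
  "H2 z = Lo (1 / z) * (A2 z * Dt r) * (K' z * B z)"

lemma invp_B: "invp (B z) (B' z)" unfolding B_def B'_def by (rule invp_exp_cop[OF L.clin_e])
lemma invp_K: "invp (K z) (K' z)" unfolding K_def K'_def by (rule invp_exp_cop[OF clin_N])
lemma invp_Dt: "invp (Dt s) (Dt (- s))" by (simp add: invp_def Dt_Dt)
lemma invp_C: "invp C C" by (simp add: invp_def C_C)
lemma invp_w: "invp L.w L.w'" by (simp add: invp_def L.w_w' L.w'_w)
text \<open>Unitarity says that the adjoint of \<open>Phi x (- z)\<close> is a left inverse; in
  finite dimension it is then also a right inverse.\<close>

lemma invp_Phi: assumes z: "z \<noteq> 0" shows "invp (Phi x z) (Phi' z)"
proof -
  have cP: "clin (Phi x z)" for z using holop_Phi[OF x] by (rule holop_clin)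
  have "Phi' z * Phi x z = 1"
  proof (rule endo_eq_pair)
    fix \<alpha> \<beta>
    have "orb_pair X ((Phi' z * Phi x z) \<rhd> \<alpha>) \<beta> = orb_pair X (Phi x z \<rhd> \<alpha>) (Phi x (- z) \<rhd> \<beta>)"
      unfolding Phi'_def ap_times by (rule orb_pair_adj[OF cP])
    also have "\<dots> = orb_pair X (Phi x (- z) \<rhd> \<beta>) (Phi x z \<rhd> \<alpha>)" by (rule orb_pair_sym)
    also have "\<dots> = orb_pair X \<beta> \<alpha>" by (rule Phi_unitary[OF z x])
    also have "\<dots> = orb_pair X \<alpha> \<beta>" by (rule orb_pair_sym)
    finally show "orb_pair X ((Phi' z * Phi x z) \<rhd> \<alpha>) \<beta> = orb_pair X (1 \<rhd> \<alpha>) \<beta>" by simp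
  qed
  then show ?thesis using endo_left_inverse_right by (simp add: invp_def)
qed
lemma invp_kz: assumes z: "z \<noteq> 0" shows "invp (kz z) (kz (1 / cnj z))"
  using kz_kz[OF z] kz_kz[of "1 / cnj z"] z by (simp add: invp_def)

lemma invp_Lo: "invp (Lo u) (Lo' u)"
proof -
  have "invp (L.w * B u * (C * cj)) ((cj * C) * B' u * L.w')"
    by (rule invp_mult3[OF invp_w invp_B invp_mult[OF invp_C invp_cj]])
  then show ?thesis by (simp only: Lo_def Lo'_def)
qed

lemma clin_B: "clin (B z)" "clin (B' z)" unfolding B_def B'_def by (intro clin_exp_cop L.clin_e)+
lemma holop_B: "f holomorphic_on Z \<Longrightarrow> holop Z (\<lambda>z. B (f z))" "f holomorphic_on Z \<Longrightarrow> holop Z (\<lambda>z. B' (f z))"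
  unfolding B_def B'_def by (intro holop_exp_nilpotent[OF L.clin_e L.e_nilpotent] holomorphic_intros; simp)+

lemma holop_K: "holop (- {0}) K" "holop (- {0}) K'"
  unfolding K_def[abs_def] K'_def[abs_def]
  by (intro holop_exp_nilpotent[OF clin_N L.N_nilpotent] holomorphic_intros; simp)+

lemma holop_Lo: "f holomorphic_on Z \<Longrightarrow> holop Z (\<lambda>z. Lo (f z))" "f holomorphic_on Z \<Longrightarrow> holop Z (\<lambda>z. Lo' (f z))"
  unfolding Lo_def Lo'_def
  by (intro holop_mult holop_B holop_const clin_mult alin_mult alin_C alin_cj L.clin_w L.clin_w'; assumption)+

lemma holop_Phi': "holop (- {0}) Phi'"
proof -
  have "holop (- {0}) (\<lambda>z. Phi x (- z))"
    by (rule holop_compose[OF holop_Phi[OF x]]) (auto intro!: holomorphic_intros)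
  then show ?thesis unfolding Phi'_def[abs_def] by (rule holop_adj)
qed

lemma holop_A: "holop (- {0}) A1" "holop (- {0}) A2"
  unfolding A1_def[abs_def] A2_def[abs_def]
  by (rule holop_cj_inverse[where A = "\<lambda>z. Phi x z * Dt r"], intro holop_mult holop_Phi[OF x] holop_const clin_Dt,
      rule holop_cj_inverse[where A = "\<lambda>z. Dt (- r) * Phi' z * (kz z * cj)"],
      intro holop_mult holop_Phi' holop_const clin_Dt holop_kz_cj)

lemma holo: "holop (- {0}) G1" "holop (- {0}) G2" "holop (- {0}) H1" "holop (- {0}) H2"
proof -
  have i: "(\<lambda>z. 1 / z) holomorphic_on - {0}" by (intro holomorphic_intros) auto
  show "holop (- {0}) G1" unfolding G1_def[abs_def]
    by (intro holop_mult holop_B holop_Phi[OF x] holop_const clin_Dt holomorphic_on_ident)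
  show "holop (- {0}) H1" unfolding H1_def[abs_def]
    by (intro holop_mult holop_B holop_Phi' holop_const clin_Dt holomorphic_on_ident)
  show "holop (- {0}) G2" unfolding G2_def[abs_def]
    by (intro holop_mult holop_B holop_K holop_A holop_const clin_Dt holop_kz_cj holop_Lo i holomorphic_on_ident)
  show "holop (- {0}) H2" unfolding H2_def[abs_def]
    by (intro holop_mult holop_B holop_K holop_A holop_const clin_Dt holop_Lo i holomorphic_on_ident)
qed

lemma invp_G1: assumes "z \<noteq> 0" shows "invp (G1 z) (H1 z)"
  unfolding G1_def H1_def
  by (rule invp_mult3[OF invp_sym[OF invp_B] _ invp_B])
    (rule invp_mult3[OF _ invp_Phi[OF assms], of "Dt (- r)" "Dt r" "Dt r" "Dt (- r)"], insert invp_Dt invp_sym, blast+)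

lemma R_eq: "Dt (- r) * (kz z * cj) * A1 z = Dt (- r) * kz z * (Phi x (1 / cnj z) * Dt r) * cj"
proof -
  have "Dt (- r) * (kz z * cj) * A1 z = Dt (- r) * kz z * (cj * cj) * (Phi x (1 / cnj z) * Dt r) * cj"
    unfolding A1_def by (simp only: mult.assoc)
  then show ?thesis by simp
qed

lemma invp_G2: assumes z: "z \<noteq> 0" shows "invp (G2 z) (H2 z)"
proof -
  let ?w = "1 / cnj z"
  have w: "?w \<noteq> 0" using z by simp
  have d: "invp (Dt (- r)) (Dt r)" using invp_Dt[of "- r"] by simp
  have "A2 z * Dt r = cj * (Dt (- r) * Phi' ?w) * kz ?w * (cj * cj) * Dt r"
    unfolding A2_def by (simp only: mult.assoc)
  then have A2: "A2 z * Dt r = cj * (Dt (- r) * Phi' ?w) * (kz ?w * Dt r)" by (simp add: mult.assoc)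
  have "invp (Dt (- r) * kz z * (Phi x ?w * Dt r) * cj) (cj * (Dt (- r) * Phi' ?w) * (kz ?w * Dt r))"
    using invp_mult3[OF invp_mult[OF d invp_kz[OF z]] invp_mult[OF invp_Phi[OF w] invp_Dt[of r]] invp_cj]
    by (simp only: mult.assoc)
  then have R: "invp (Dt (- r) * (kz z * cj) * A1 z) (A2 z * Dt r)" unfolding R_eq A2 .
  show ?thesis unfolding G2_def H2_def
    by (rule invp_mult3[OF invp_mult[OF invp_sym[OF invp_B] invp_K, simplified] R invp_sym[OF invp_Lo]])
qed

text \<open>A common left factor of the frames of \<open>\<F>\<^sub>\<tau>\<close> and of its conjugate, which are \<open>W G1\<close> and \<open>W G2\<close> up to
  factors holomorphic at \<open>0\<close> and at infinity, respectively.\<close>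

definition W :: "complex \<Rightarrow> (complex^'n) endo" where
  "W z = exp (cop (- x / z) * N) * Dt r * B z"
definition W' :: "complex \<Rightarrow> (complex^'n) endo" where
  "W' z = B' z * Dt (- r) * exp (cop (x / z) * N)"

lemma invp_W: "invp (W z) (W' z)"
proof -
  have "invp (exp (cop (- x / z) * N)) (exp (cop (x / z) * N))"
    using invp_exp_cop[OF clin_N, of "- x / z"] by simp
  then show ?thesis unfolding W_def W'_def by (rule invp_mult3[OF _ invp_Dt invp_B])
qed

lemma holop_W: "holop (- {0}) W" "holop (- {0}) W'"
  unfolding W_def[abs_def] W'_def[abs_def]
  by (intro holop_mult holop_exp_nilpotent[OF clin_N L.N_nilpotent] holop_B holop_const clin_Dt holomorphic_intros; simp)+

lemma Jop_W:
  assumes z: "z \<noteq> 0"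
  shows "Jop X (- x *s \<omega>) z \<alpha> = W z \<rhd> G1 z \<rhd> B' z \<rhd> Dt (- r) \<rhd> \<alpha>"
proof -
  have "W z * G1 z * B' z * Dt (- r) =
    exp (cop (- x / z) * N) * (Dt r * (B z * B' z) * Dt (- r)) * Phi x z * (Dt r * (B z * B' z) * Dt (- r))"
    unfolding W_def G1_def by (simp only: mult.assoc)
  also have "\<dots> = exp (cop (- x / z) * N) * Phi x z"
    using invp_B[of z] invp_Dt[of r] by (simp add: invp_def)
  finally show ?thesis by (simp only: Jop_Phi[OF z x] ap_times[symmetric] mult.assoc)
qed

text \<open>The part of \<open>x\<close> along the imaginary axis cancels here, because \<open>\<kappa>\<^sub>\<H>\<close> commutes with
  \<open>exp (- i y N / z)\<close>.\<close>

lemma kz_exp_N: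
  assumes z: "z \<noteq> 0"
  shows "kz z * exp (cop (- x * cnj z) * N) = exp (cop (cnj x / z) * N) * kz z"
proof (rule exp_intertwine)
  let ?a = "dg (\<lambda>i. z powi (int (sdim X (sector X i)) - int (hdeg X i)))" and ?h = "dg (\<lambda>i. (1 / cnj z) powi int (hdeg X i))"
  have dgN: "dg f * N = cop c * N * dg f" if f: "\<And>i j. sector X i = sector X j \<Longrightarrow> hdeg X i = Suc (hdeg X j) \<Longrightarrow> f i = c * f j" for f c
  proof (rule clin_eqI)
    fix j
    show "(dg f * N) \<rhd> axis j 1 = (cop c * N * dg f) \<rhd> axis j 1"
      unfolding vec_eq_iff
    proof
      fix i
      have "((dg f * N) \<rhd> axis j 1) $ i = f i * (N \<rhd> axis j 1) $ i" by simp
      moreover have "((cop c * N * dg f) \<rhd> axis j 1) $ i = c * f j * (N \<rhd> axis j 1) $ i"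
        unfolding ap_times dg_axis clin_ap[OF clin_N] ap_cop vector_smult_component
        by (rule mult.assoc[symmetric])
      moreover have "f i * (N \<rhd> axis j 1) $ i = c * f j * (N \<rhd> axis j 1) $ i"
        using Act_lowers(1,2)[OF omega_Hgr, of j i] f[of i j] unfolding N_def
        by (cases "(Act \<omega> \<rhd> axis j 1) $ i = 0") simp_all
      ultimately show "((dg f * N) \<rhd> axis j 1) $ i = ((cop c * N * dg f) \<rhd> axis j 1) $ i" by (simp only:)
    qed
  qed (auto intro!: clin_mult clin_N)
  have h: "?h * N = cop (1 / cnj z) * N * ?h"
    by (rule dgN) (simp only: power_int_of_nat power_Suc)
  have a: "?a * N = cop (1 / z) * N * ?a"
  proof (rule dgN)
    fix i j assume ij: "sector X i = sector X j" "hdeg X i = Suc (hdeg X j)"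
    have "z powi int (Suc n) = z * z powi int n" for n
      by (simp only: power_int_of_nat power_Suc)
    then show "z powi (int (sdim X (sector X i)) - int (hdeg X i)) = 1 / z * z powi (int (sdim X (sector X j)) - int (hdeg X j))"
      by (simp only: ij power_int_diff[OF disjI1[OF z]]) simp
  qed
  have kN: "kz z * N = - (cop (1 / z\<^sup>2) * N * kz z)"
  proof -
    have "kz z * N = ?a * (Kap * cop (1 / cnj z)) * N * ?h"
      unfolding kz_def mult.assoc h by (simp only: mult.assoc)
    also have "\<dots> = (?a * cop (1 / z)) * (Kap * N) * ?h"
      unfolding alinD[OF alin_Kap] by (simp add: mult.assoc)
    also have "\<dots> = - (cop (1 / z) * (?a * N) * Kap * ?h)"
      unfolding clinD[OF clin_intros(2)] Kap_N by (simp add: mult.assoc)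
    also have "\<dots> = - (cop (1 / z * (1 / z)) * N * kz z)"
      unfolding a kz_def cop_mult by (simp only: mult.assoc)
    finally show ?thesis by (simp add: power2_eq_square)
  qed
  have "kz z * (cop (- x * cnj z) * N) = cop (cnj (- x * cnj z)) * (kz z * N)"
    using alinD[OF alin_kz] by (simp only: mult.assoc[symmetric])
  also have "\<dots> = cop (cnj (- x * cnj z)) * cop (- (1 / z\<^sup>2)) * N * kz z"
    unfolding kN by (simp add: cop_minus mult.assoc)
  also have "cop (cnj (- x * cnj z)) * cop (- (1 / z\<^sup>2)) = (cop (cnj x / z) :: (complex^'n) endo)"
    unfolding cop_mult[symmetric] using z by (simp add: power2_eq_square)
  finally show "kz z * (cop (- x * cnj z) * N) = cop (cnj x / z) * N * kz z" .
qed

text \<open>Conjugation by \<open>Dt r\<close> turns exp (2 N / z) into exp (2 Re x N / z), and - x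
  + 2 Re x = cnj x. So \<open>W z\<close> times the factor \<open>K z\<close> of \<open>G2\<close>
  reproduces the exponential that \<open>kz_exp_N\<close> yields on the conjugate side.\<close>

lemma kH_W:
  assumes z: "z \<noteq> 0"
  shows "kz z \<rhd> Jop X (- x *s \<omega>) (1 / cnj z) \<beta> = W z \<rhd> G2 z \<rhd> Lo (1 / z) \<rhd> cj \<rhd> Dt (- r) \<rhd> \<beta>"
proof -
  let ?w = "1 / cnj z"
  have w: "?w \<noteq> 0" using z by simp
  have DK: "Dt r * K z = exp (cop (2 * Re x / z) * N) * Dt r"
  proof -
    have "Dt r * (cop (2 / z) * N) = cop (2 / z) * (Dt r * N)"
      using clinD[OF clin_Dt] by (simp only: mult.assoc[symmetric])
    also have "\<dots> = cop (2 / z * of_real (exp (2 * r))) * N * Dt r"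
      unfolding Dt_N cop_mult by (simp only: mult.assoc)
    finally have "Dt r * (cop (2 / z) * N) = cop (2 * Re x / z) * N * Dt r" by (simp add: r)
    then show ?thesis unfolding K_def by (rule exp_intertwine)
  qed
  have "W z * G2 z * Lo (1 / z) * cj * Dt (- r) =
    exp (cop (- x / z) * N) * (Dt r * (B z * B' z) * K z * Dt (- r)) * kz z * Phi x ?w * (Dt r * (cj * (Lo' (1 / z) * Lo (1 / z)) * cj) * Dt (- r))"
    unfolding W_def G2_def R_eq by (simp only: mult.assoc)
  also have "\<dots> = exp (cop (- x / z) * N) * (exp (cop (2 * Re x / z) * N) * (Dt r * Dt (- r))) * kz z * Phi x ?w"
    using invp_B[of z] invp_Dt[of r] invp_Lo[of "1 / z"] by (simp add: invp_def DK mult.assoc)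
  also have "\<dots> = exp (cop (- x / z + 2 * Re x / z) * N) * kz z * Phi x ?w"
    unfolding exp_cop_add[OF clin_N] by (simp add: Dt_Dt)
  also have "- x / z + 2 * Re x / z = cnj x / z"
  proof -
    have "- x + 2 * Re x = cnj x" by (simp add: complex_eq_iff)
    then show ?thesis by (simp only: add_divide_distrib[symmetric])
  qed
  also have "exp (cop (cnj x / z) * N) * kz z * Phi x ?w = kz z * exp (cop (- x / ?w) * N) * Phi x ?w"
    using kz_exp_N[OF z] by simp
  finally show ?thesis by (simp only: Jop_Phi[OF w x] ap_times[symmetric] mult.assoc)
qed

end

section \<open>Distance of the transition operators from 1 on the annulus\<close>

lemma norm_mult_le:
  fixes A B :: "'a::real_normed_algebra"
  assumes "norm A \<le> a" "norm B \<le> b" shows "norm (A * B) \<le> a * b"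
proof -
  have "norm (A * B) \<le> norm A * norm B" by (rule norm_mult_ineq)
  also have "\<dots> \<le> a * b" by (rule mult_mono[OF assms order_trans[OF norm_ge_zero assms(1)] norm_ge_zero])
  finally show ?thesis .
qed

lemma norm_powi_le:
  fixes z :: complex
  assumes "1/4 \<le> norm z" "norm z \<le> 4" "\<bar>k\<bar> \<le> int m"
  shows "norm (z powi k) \<le> 4 ^ m"
proof -
  define n where "n = nat \<bar>k\<bar>"
  have n: "k = int n \<or> k = - int n" "n \<le> m" unfolding n_def using assms(3) by linarith+
  have "norm (z ^ n) \<le> 4 ^ n" unfolding norm_power by (rule power_mono) (use assms in auto)
  moreover have "norm (inverse z ^ n) \<le> 4 ^ n"
  proof -
    have "1 / norm z \<le> 1 / (1/4)" using assms(1) by (intro divide_left_mono) auto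
    then have "norm (inverse z) \<le> 4" by (simp add: inverse_eq_divide norm_divide)
    then show ?thesis unfolding norm_power by (intro power_mono) simp_all
  qed
  moreover have "(4::real) ^ n \<le> 4 ^ m" by (rule power_increasing[OF n(2)]) simp
  ultimately have "norm (z ^ n) \<le> 4 ^ m" "norm (inverse z ^ n) \<le> 4 ^ m" by linarith+
  then show ?thesis using n(1) by (auto simp: power_int_minus power_inverse)
qed

context real_GW
begin

text \<open>Bounds on the annulus 1/4 <= norm z <= 4: both z / 2 and 1 / (2 z) have norm at most 2,
  2 / z has norm at most 8, and \<open>cd\<close> bounds all powers of z that occur in
  \<open>kz\<close>. \<open>dec\<close> is the estimate of \<open>Phi_near\<close> at radius 1/4
  with Re x = exp (2 r), multiplied by the norms of the two rescaling operators.\<close>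

definition be :: real where "be = exp (2 * norm L.e)"
definition ne :: real where "ne = exp (8 * norm N)"
definition cd :: real where "cd = 4 ^ (\<Sum>i\<in>UNIV. sdim X (sector X i) + hdeg X i)"
definition kc :: real where "kc = (\<Sum>j\<in>UNIV. \<Sum>i\<in>UNIV. norm ((Kap \<rhd> axis j 1) $ i))"
definition dec :: "real \<Rightarrow> real" where
  "dec r = exp (2 * r * real L.bnd) * (exp (- (exp (2 * r) - t0) * gap) * fsum (1/4))"
definition cG :: real where
  "cG = be * be + be * ne * (cd * cd * (kc + kc + norm C)) * (norm C * be * norm L.w')"

lemma consts_nonneg: "0 \<le> be" "0 \<le> ne" "0 \<le> cd" "0 \<le> kc" "0 \<le> dec r"
  unfolding be_def ne_def cd_def kc_def dec_def
  using fsum_nonneg[of "1/4"] by (auto intro!: sum_nonneg mult_nonneg_nonneg)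

lemma norm_exp_e: "norm c \<le> 2 \<Longrightarrow> norm (exp (cop c * L.e)) \<le> be"
  unfolding be_def by (rule order_trans[OF norm_exp_cop]) (simp add: mult_right_mono)

lemma norm_exp_N: "norm c \<le> 8 \<Longrightarrow> norm (exp (cop c * N)) \<le> ne"
  unfolding ne_def by (rule order_trans[OF norm_exp_cop]) (simp add: mult_right_mono)

lemma norm_dg_powi:
  assumes z: "1/4 \<le> norm z" "norm z \<le> 4"
  shows "norm (dg (\<lambda>i. z powi (int (sdim X (sector X i)) - int (hdeg X i)))) \<le> cd"
    "norm (dg (\<lambda>i. z powi int (hdeg X i))) \<le> cd"
proof -
  define m where "m = (\<Sum>i\<in>UNIV. sdim X (sector X i) + hdeg X i)"
  have s: "sdim X (sector X i) + hdeg X i \<le> m" for i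
    unfolding m_def by (rule member_le_sum) simp_all
  have s1: "\<bar>int (sdim X (sector X i)) - int (hdeg X i)\<bar> \<le> int m" "\<bar>int (hdeg X i)\<bar> \<le> int m" for i
    using s[of i] by linarith+
  show "norm (dg (\<lambda>i. z powi (int (sdim X (sector X i)) - int (hdeg X i)))) \<le> cd"
    unfolding cd_def m_def[symmetric] by (rule norm_dg_le, rule norm_powi_le[OF z s1(1)])
  show "norm (dg (\<lambda>i. z powi int (hdeg X i))) \<le> cd"
    unfolding cd_def m_def[symmetric] by (rule norm_dg_le, rule norm_powi_le[OF z s1(2)])
qed

text \<open>exp (- gap exp (2 r)) decays faster than any exp (2 r b) grows; this is where
  exponential smallness of the quantum corrections beats the cost of rescaling.\<close>

lemma dec_tendsto: "((\<lambda>r. exp (- r) + dec r) \<longlongrightarrow> 0) at_top"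
proof -
  have g: "0 < gap" by (rule gap)
  have "((\<lambda>r. exp (2 * r * b) * exp (- (exp (2 * r) - t0) * gap)) \<longlongrightarrow> 0) at_top" if "0 \<le> b" for b
  proof (cases "b = 0")
    case True
    then show ?thesis using g by simp real_asymp
  next
    case False
    then have "0 < b" using that by simp
    then show ?thesis using g by real_asymp
  qed
  then have "((\<lambda>r. exp (2 * r * real L.bnd) * exp (- (exp (2 * r) - t0) * gap) * fsum (1/4)) \<longlongrightarrow> 0) at_top"
    by (intro tendsto_mult_left_zero) simp
  moreover have "((\<lambda>r::real. exp (- r)) \<longlongrightarrow> 0) at_top" by real_asymp
  ultimately have "((\<lambda>r. exp (- r) + exp (2 * r * real L.bnd) * exp (- (exp (2 * r) - t0) * gap) * fsum (1/4)) \<longlongrightarrow> 0 + 0) at_top"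
    by (rule tendsto_add[rotated])
  then show ?thesis unfolding dec_def by (simp only: mult.assoc add_0_right)
qed

end

context real_GW_point
begin

lemma norm_conj_Phi:
  assumes "1/4 \<le> norm z"
  shows "norm (Dt (- r) * (Phi x z - 1) * Dt r) \<le> dec r"
proof -
  have D: "norm (Dt s) \<le> exp (r * real L.bnd)" if "\<bar>s\<bar> = r" for s
    using norm_Dt[of s] that by simp
  have "norm (Dt (- r) * (Phi x z - 1) * Dt r) \<le>
      exp (r * real L.bnd) * (exp (- (Re x - t0) * gap) * fsum (1/4)) * exp (r * real L.bnd)"
    by (intro norm_mult_le D Phi_near x assms) (use r in simp_all)
  also have "\<dots> = dec r"
  proof -
    have "exp (2 * r * real L.bnd) = exp (r * real L.bnd) * exp (r * real L.bnd)"
      by (simp flip: exp_add)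
    then show ?thesis unfolding dec_def r(1) by (simp only: mult_ac)
  qed
  finally show ?thesis .
qed

lemma near1:
  assumes z: "1/4 \<le> norm z" "norm z \<le> 4"
  shows "norm (G1 z - 1) \<le> be * be * dec r"
proof -
  have "B' z * (Dt (- r) * 1 * Dt r) * B z = 1"
    using invp_B[of z] by (simp add: Dt_Dt invp_def)
  then have "G1 z - 1 = B' z * (Dt (- r) * (Phi x z - 1) * Dt r) * B z"
    unfolding G1_def by (simp add: right_diff_distrib left_diff_distrib)
  moreover have "norm (B' z * (Dt (- r) * (Phi x z - 1) * Dt r) * B z) \<le> be * dec r * be"
    unfolding B_def B'_def
    by (intro norm_mult_le norm_exp_e norm_conj_Phi z) (use z in \<open>simp_all add: norm_divide\<close>)
  ultimately show ?thesis by (simp add: mult_ac)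
qed

text \<open>The factorisation writes 1 as the same product as \<open>G2 z\<close>, with
  \<open>C\<close> in place of the rescaled \<open>Kap\<close> and 1 in place of the rescaled
  \<open>Phi\<close>. The difference is therefore linear in these two errors, between factors that
  are bounded on the annulus.\<close>

lemma near2:
  assumes z: "1/4 \<le> norm z" "norm z \<le> 4"
  shows "norm (G2 z - 1) \<le> be * ne * (cd * cd * (kc * exp (- r) * (1 + dec r) + norm C * dec r)) * (norm C * be * norm L.w')"
proof -
  have z0: "z \<noteq> 0" using z(1) by auto
  let ?w = "1 / cnj z"
  have w: "1/4 \<le> norm ?w" "norm ?w \<le> 4"
    using z z0 by (simp_all add: norm_divide divide_le_eq le_divide_eq)
  define a where "a = dg (\<lambda>i. z powi (int (sdim X (sector X i)) - int (hdeg X i)))"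
  define h where "h = dg (\<lambda>i. ?w powi int (hdeg X i))"
  define Kt where "Kt = Dt (- r) * Kap * Dt r"
  define Pt where "Pt = Dt (- r) * Phi x ?w * Dt r"
  define L' where "L' = C * B' (1 / z) * L.w'"
  have comm: "Dt s * dg f = dg f * Dt s" for s and f :: "'n \<Rightarrow> complex"
    unfolding Dt_def dg_mult by (simp only: mult.commute)
  have "Dt (- r) * kz z * (Phi x ?w * Dt r) = (Dt (- r) * a) * Kap * (Dt r * Dt (- r)) * h * Phi x ?w * Dt r"
    unfolding kz_def a_def h_def Dt_Dt(1) by (simp only: mult.assoc mult_1_left)
  also have "\<dots> = a * (Dt (- r) * Kap * Dt r) * (Dt (- r) * h) * Phi x ?w * Dt r"
    unfolding a_def comm by (simp only: mult.assoc)
  also have "\<dots> = a * Kt * h * Pt"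
    unfolding h_def comm Kt_def Pt_def by (simp only: mult.assoc)
  finally have 1: "Dt (- r) * kz z * (Phi x ?w * Dt r) = a * Kt * h * Pt" .
  have G2: "G2 z = B' z * K z * (a * Kt * h * Pt) * L'"
  proof -
    have "G2 z = B' z * K z * (Dt (- r) * kz z * (Phi x ?w * Dt r)) * (cj * cj) * (C * B' (1 / z) * L.w')"
      unfolding G2_def R_eq Lo'_def by (simp only: mult.assoc)
    then show ?thesis unfolding 1 L'_def by simp
  qed
  have one: "1 = B' z * K z * (a * C * h) * L'"
  proof -
    have KZ: "K z * L.Zh z = B z * L.w * B (1 / z)"
    proof -
      have "1 / z / 2 = 1 / (2 * z)" by simp
      then show ?thesis unfolding K_def B_def by (simp only: L.birkhoff_factorization[OF z0])
    qed
    have "B' z * K z * (a * C * h) * L' = B' z * (K z * L.Zh z) * (C * C) * B' (1 / z) * L.w'"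
      unfolding a_def h_def C_Zh[OF z0] L'_def by (simp only: mult.assoc)
    also have "\<dots> = (B' z * B z) * (L.w * (B (1 / z) * B' (1 / z)) * L.w')"
      unfolding KZ C_C by (simp add: mult.assoc)
    also have "\<dots> = 1" using invp_B[of z] invp_B[of "1 / z"] invp_w by (simp add: invp_def)
    finally show ?thesis by (rule sym)
  qed
  have "a * Kt * h * Pt - a * C * h = a * ((Kt - C) * h * Pt + C * h * (Pt - 1))"
    by (simp add: algebra_simps)
  then have diff: "G2 z - 1 = B' z * K z * (a * ((Kt - C) * h * Pt + C * h * (Pt - 1))) * L'"
    unfolding G2 by (subst one) (simp only: right_diff_distrib[symmetric] left_diff_distrib[symmetric])
  have P1: "norm (Pt - 1) \<le> dec r"
  proof -
    have "Pt - 1 = Dt (- r) * (Phi x ?w - 1) * Dt r"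
      unfolding Pt_def by (simp add: right_diff_distrib left_diff_distrib Dt_Dt)
    then show ?thesis using norm_conj_Phi[OF w(1)] by simp
  qed
  have Pn: "norm Pt \<le> 1 + dec r"
  proof -
    have "norm Pt \<le> norm (1 :: (complex^'n) endo) + norm (Pt - 1)" by (metis add_diff_cancel_left' diff_add_cancel norm_triangle_ineq add.commute)
    then show ?thesis using P1 by simp
  qed
  have an: "norm a \<le> cd" and hn: "norm h \<le> cd"
    unfolding a_def h_def using norm_dg_powi(1)[OF z] norm_dg_powi(2)[OF w] by auto
  have Kn: "norm (Kt - C) \<le> kc * exp (- r)"
    unfolding Kt_def kc_def by (rule Kap_limit) (rule r)
  have Bn: "norm (B' z) \<le> be" "norm (B' (1 / z)) \<le> be"
    unfolding B'_def by (rule norm_exp_e; use z z0 in \<open>simp add: norm_divide norm_mult divide_le_eq\<close>)+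
  have Kzn: "norm (K z) \<le> ne"
    unfolding K_def by (rule norm_exp_N) (use z z0 in \<open>simp add: norm_divide divide_le_eq\<close>)
  have "norm (a * ((Kt - C) * h * Pt + C * h * (Pt - 1))) \<le> cd * (kc * exp (- r) * cd * (1 + dec r) + norm C * cd * dec r)"
    by (intro norm_mult_le norm_triangle_mono an hn Kn Pn P1 order_refl)
  also have "\<dots> = cd * cd * (kc * exp (- r) * (1 + dec r) + norm C * dec r)"
    by (simp add: algebra_simps)
  finally have "norm (a * ((Kt - C) * h * Pt + C * h * (Pt - 1))) \<le> cd * cd * (kc * exp (- r) * (1 + dec r) + norm C * dec r)" .
  then show ?thesis unfolding diff L'_def
    by (rule norm_mult_le[OF norm_mult_le[OF norm_mult_le[OF Bn(1) Kzn]]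
          norm_mult_le[OF norm_mult_le[OF order_refl Bn(2)] order_refl]])
qed

lemma near:
  assumes z: "1/4 \<le> norm z" "norm z \<le> 4"
  shows "norm (G1 z - 1) \<le> cG * (exp (- r) + dec r)" "norm (G2 z - 1) \<le> cG * (exp (- r) + dec r)"
proof -
  note c = consts_nonneg
  let ?l = "norm C * be * norm L.w'" and ?m = "cd * cd * (kc + kc + norm C)"
  have l: "0 \<le> ?l" "0 \<le> ?m" "0 \<le> be * ne * ?m * ?l" "0 \<le> be * be" using c by simp_all
  have "norm (G1 z - 1) \<le> be * be * dec r" by (rule near1[OF z])
  also have "\<dots> \<le> cG * (exp (- r) + dec r)"
    unfolding cG_def by (intro mult_mono) (use c l in \<open>auto simp: add_nonneg_nonneg\<close>)
  finally show "norm (G1 z - 1) \<le> cG * (exp (- r) + dec r)" .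
  have "kc * exp (- r) * (1 + dec r) + norm C * dec r \<le> (kc + kc + norm C) * (exp (- r) + dec r)"
  proof -
    have "exp (- r) * dec r \<le> 1 * dec r" using c r by (intro mult_right_mono) simp_all
    then have "kc * (exp (- r) * dec r) \<le> kc * dec r" using c(4) by (intro mult_left_mono) simp_all
    moreover have "0 \<le> norm C * exp (- r)" "0 \<le> kc * exp (- r)" "0 \<le> kc * dec r" using c by simp_all
    ultimately show ?thesis unfolding distrib_left distrib_right mult_1_right mult.assoc by linarith
  qed
  then have "cd * cd * (kc * exp (- r) * (1 + dec r) + norm C * dec r) \<le> ?m * (exp (- r) + dec r)"
    using c(3) unfolding mult.assoc by (intro mult_left_mono) simp_all
  then have "be * ne * (cd * cd * (kc * exp (- r) * (1 + dec r) + norm C * dec r)) * ?l \<le> be * ne * (?m * (exp (- r) + dec r)) * ?l"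
    using c l by (intro mult_right_mono mult_left_mono) simp_all
  also have "\<dots> = be * ne * ?m * ?l * (exp (- r) + dec r)" by (simp only: mult_ac)
  also have "\<dots> \<le> cG * (exp (- r) + dec r)"
    unfolding cG_def using c l by (intro mult_right_mono) simp_all
  finally show "norm (G2 z - 1) \<le> cG * (exp (- r) + dec r)" using near2[OF z] by linarith
qed

lemma gluing:
  assumes "cG * (exp (- r) + dec r) \<le> \<epsilon>" "320 * real CARD('n) * \<epsilon> \<le> 1"
  shows "gluing G1 G2 H1 H2 \<epsilon>"
proof
  show "norm (G1 z - 1) \<le> \<epsilon>" "norm (G2 z - 1) \<le> \<epsilon>" if "1/4 \<le> norm z" "norm z \<le> 4" for z
    using near[OF that] assms(1) by linarith+
qed (use holo invp_G1 invp_G2 assms in \<open>simp_all add: invp_def\<close>)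

end

section \<open>Entire vector functions and unitarity of J\<close>

lemma hvec_factor:
  assumes "hvec UNIV \<alpha>"
  obtains \<beta> where "hvec UNIV \<beta>" "\<And>z. \<alpha> z = \<alpha> 0 + z *s \<beta> z"
proof -
  define \<beta> where "\<beta> z = (\<chi> i. if z = 0 then deriv (\<lambda>z. \<alpha> z $ i) 0 else (\<alpha> z $ i - \<alpha> 0 $ i) / (z - 0))" for z
  have "hvec UNIV \<beta>"
    unfolding hvec_def \<beta>_def vec_lambda_beta
  proof
    fix i
    have "(\<lambda>z. \<alpha> z $ i) holomorphic_on UNIV" using assms by (simp add: hvec_def)
    then show "(\<lambda>z. if z = 0 then deriv (\<lambda>z. \<alpha> z $ i) 0 else (\<alpha> z $ i - \<alpha> 0 $ i) / (z - 0)) holomorphic_on UNIV"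
      by (rule pole_lemma) simp
  qed
  moreover have "\<alpha> z = \<alpha> 0 + z *s \<beta> z" for z
    by (cases "z = 0") (simp_all add: \<beta>_def vec_eq_iff)
  ultimately show thesis by (rule that)
qed

lemma hvec_cj_UNIV: assumes "hvec UNIV s" shows "hvec UNIV (\<lambda>z. cj \<rhd> s (cnj z))"
  unfolding hvec_def
proof
  fix j
  have "(\<lambda>z. cnj (s (cnj z) $ j)) holomorphic_on UNIV"
    by (rule holomorphic_cnj_cnj[of _ UNIV]) (use assms in \<open>simp_all add: hvec_def\<close>)
  then show "(\<lambda>z. (cj \<rhd> s (cnj z)) $ j) holomorphic_on UNIV" by simp
qed

lemma hvec_op: assumes "clin A" "hvec S s" shows "hvec S (\<lambda>z. A \<rhd> s z)"
  by (rule hvec_ap[OF holop_const[OF assms(1)] assms(2)])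

text \<open>The relation on the circle continues to p z = cnj (p (- 1 / cnj z)), so the bound on the
  closed unit disc holds on the whole plane and Liouville's theorem applies. The constant is real
  because the relation at z = 1 equates it with its conjugate.\<close>

lemma entire_antipodal_constant:
  assumes p: "p holomorphic_on UNIV" and circ: "\<And>z. norm z = 1 \<Longrightarrow> p z = cnj (p (- z))"
  obtains k where "\<And>z. p z = k" "k \<in> \<real>"
proof -
  have refl: "p z = cnj (p (- (1 / cnj z)))" if "z \<noteq> 0" for z
  proof (rule holomorphic_eq_on_circle[OF _ _ _ that])
    show "p holomorphic_on - {0}" using p holomorphic_on_subset by blast
    have "(\<lambda>z. cnj (p (cnj z))) holomorphic_on UNIV" by (rule holomorphic_cnj_cnj[OF p]) auto
    then have "((\<lambda>z. cnj (p (cnj z))) \<circ> (\<lambda>z. - (1 / z))) holomorphic_on - {0}"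
      by (rule holomorphic_on_compose_gen[rotated]) (auto intro!: holomorphic_intros)
    then show "(\<lambda>z. cnj (p (- (1 / cnj z)))) holomorphic_on - {0}" by (simp add: comp_def)
    show "p (cis \<theta>) = cnj (p (- (1 / cnj (cis \<theta>))))" for \<theta>
      using circ[of "cis \<theta>"] by (simp add: cis_cnj cis_inverse divide_inverse)
  qed
  have "continuous_on (cball 0 1) p"
    by (rule holomorphic_on_imp_continuous_on[OF holomorphic_on_subset[OF p]]) simp
  then have "compact (p ` cball 0 1)" by (rule compact_continuous_image) simp
  then obtain M where M: "norm (p z) \<le> M" if "z \<in> cball 0 1" for z
    using compact_imp_bounded bounded_iff by (metis imageI)
  have "norm (p z) \<le> M" for z
  proof (cases "norm z \<le> 1")
    case True then show ?thesis by (intro M) simp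
  next
    case False
    then have "z \<noteq> 0" "norm (- (1 / cnj z)) \<le> 1" by (auto simp: norm_divide divide_le_eq)
    then show ?thesis using refl[of z] M[of "- (1 / cnj z)"] by simp
  qed
  then have "bounded (range p)" by (auto simp: bounded_iff)
  then obtain k where k: "\<And>z. p z = k" using Liouville_theorem[OF p] unfolding constant_on_def by auto
  moreover have "k \<in> \<real>" using circ[of 1] by (simp add: k Reals_cnj_iff)
  ultimately show thesis by (rule that)
qed

context convergent_GW
begin

lemma N_exp_selfadjoint: "orb_pair X (exp (cop c * N) \<rhd> \<alpha>) \<beta> = orb_pair X \<alpha> (exp (cop c * N) \<rhd> \<beta>)"
proof -
  let ?X = "cop c * N"
  have pow: "orb_pair X (?X ^ k \<rhd> \<alpha>) \<beta> = orb_pair X \<alpha> (?X ^ k \<rhd> \<beta>)" for k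
  proof (induction k arbitrary: \<alpha> \<beta>)
    case (Suc k)
    have X1: "orb_pair X (?X \<rhd> \<alpha>) \<beta> = orb_pair X \<alpha> (?X \<rhd> \<beta>)" for \<alpha> \<beta>
      by (simp only: ap_times ap_cop orb_pair_scale_left orb_pair_scale_right N_selfadjoint)
    have "orb_pair X (?X ^ Suc k \<rhd> \<alpha>) \<beta> = orb_pair X (?X ^ k \<rhd> \<alpha>) (?X \<rhd> \<beta>)"
      unfolding power_Suc ap_times[of ?X] by (rule X1)
    also have "\<dots> = orb_pair X \<alpha> (?X ^ k \<rhd> ?X \<rhd> \<beta>)" by (rule Suc)
    also have "\<dots> = orb_pair X \<alpha> (?X ^ Suc k \<rhd> \<beta>)" unfolding power_Suc2 ap_times[of "?X ^ k"] ..
    finally show ?case .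
  qed simp
  have "N ^ (2 * L.bnd + 1) = 0" by (rule L.N_nilpotent)
  then have "?X ^ (2 * L.bnd + 1) = 0" by (simp only: cop_mult_power[OF clin_N] mult_zero_right)
  then have e: "exp ?X = (\<Sum>k<2 * L.bnd + 1. ?X ^ k /\<^sub>R fact k)" by (rule exp_nilpotent)
  have s: "orb_pair X (t *\<^sub>R \<alpha>) \<beta> = t * orb_pair X \<alpha> \<beta>" "orb_pair X \<alpha> (t *\<^sub>R \<beta>) = t * orb_pair X \<alpha> \<beta>" for t \<alpha> \<beta>
    unfolding scaleR_eq_scale orb_pair_scale_left orb_pair_scale_right by (rule refl)+
  show ?thesis unfolding e ap_sum orb_pair_sum_left orb_pair_sum_right ap_scaleR s pow ..
qed

text \<open>\<open>N\<close> is self-adjoint and the exponents at z and - z are opposite, so the two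
  exponentials cancel and \<open>Phi_unitary\<close> remains.\<close>

lemma Jop_unitary:
  assumes z: "z \<noteq> 0" and x: "t0 \<le> Re x"
  shows "orb_pair X (Jop X (- x *s \<omega>) (- z) \<alpha>) (Jop X (- x *s \<omega>) z \<beta>) = orb_pair X \<alpha> \<beta>"
proof -
  have mz: "- z \<noteq> 0" using z by simp
  have "exp (cop (- x / - z) * N) * exp (cop (- x / z) * N) = 1"
    using exp_cop_inverse(2)[OF clin_N, of "- x / z"] by simp
  then have i: "exp (cop (- x / - z) * N) \<rhd> exp (cop (- x / z) * N) \<rhd> v = v" for v
    by (simp only: ap_times[symmetric] ap_one)
  show ?thesis
    unfolding Jop_Phi[OF z x] Jop_Phi[OF mz x] N_exp_selfadjoint i by (rule Phi_unitary[OF z x])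
qed

end

section \<open>Purity\<close>

locale real_GW_glue = real_GW_point X \<omega> t0 VR x r
  for X :: "('n::finite, 't::finite, 'd::ab_group_add, 'x::ab_group_add) orbifold" and \<omega> t0 VR x r +
  fixes \<epsilon> :: real
  assumes eps: "cG * (exp (- r) + dec r) \<le> \<epsilon>" "320 * real CARD('n) * \<epsilon> \<le> 1"
begin

sublocale G: gluing G1 G2 H1 H2 \<epsilon> by (rule gluing[OF eps])

definition J :: "complex \<Rightarrow> complex^'n \<Rightarrow> complex^'n" where "J = Jop X (- x *s \<omega>)"
abbreviation F :: "(complex \<Rightarrow> complex^'n) set" where "F \<equiv> Fspace X (- x *s \<omega>)"

definition ext :: "(complex \<Rightarrow> complex^'n) \<Rightarrow> complex \<Rightarrow> complex^'n" where
  "ext s z = (if z = 0 then 0 else s z)"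

lemma ext_nz: "z \<noteq> 0 \<Longrightarrow> ext s z = s z" and ext_0: "ext s 0 = 0"
  by (simp_all add: ext_def)

lemma ext_eqI: "t 0 = 0 \<Longrightarrow> (\<And>z. z \<noteq> 0 \<Longrightarrow> t z = s z) \<Longrightarrow> t = ext s"
  by (rule ext) (auto simp: ext_def)

lemma B_0: "B 0 = 1" "B' 0 = 1" by (simp_all add: B_def B'_def)

lemma W_cancel: "z \<noteq> 0 \<Longrightarrow> W z \<rhd> u = W z \<rhd> v \<Longrightarrow> u = v"
  using invp_ap(2)[OF invp_W] by metis

lemma J_eq: "z \<noteq> 0 \<Longrightarrow> J z \<alpha> = W z \<rhd> G1 z \<rhd> B' z \<rhd> Dt (- r) \<rhd> \<alpha>"
  unfolding J_def by (rule Jop_W)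

lemma kz_J: "z \<noteq> 0 \<Longrightarrow> kz z \<rhd> J (1 / cnj z) \<beta> = W z \<rhd> G2 z \<rhd> Lo (1 / z) \<rhd> cj \<rhd> Dt (- r) \<rhd> \<beta>"
  unfolding J_def by (rule kH_W)

lemma J_W: "z \<noteq> 0 \<Longrightarrow> J z (Dt r \<rhd> B z \<rhd> a) = W z \<rhd> G1 z \<rhd> a"
  by (simp only: J_eq invp_ap(2)[OF invp_Dt] invp_ap(2)[OF invp_B] simp_thms)

lemma hvec_B: "hvec UNIV a \<Longrightarrow> hvec UNIV (\<lambda>z. B z \<rhd> a z)" "hvec UNIV a \<Longrightarrow> hvec UNIV (\<lambda>z. B' z \<rhd> a z)"
  using hvec_ap[OF holop_B(1)[OF holomorphic_on_ident]] hvec_ap[OF holop_B(2)[OF holomorphic_on_ident]] by blast+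

lemma F_mem:
  assumes "hvec UNIV \<alpha>" shows "ext (\<lambda>z. J z (\<alpha> z)) \<in> F"
  unfolding Fspace_def mem_Collect_eq
proof (intro conjI exI[of _ \<alpha>])
  show "ext (\<lambda>z. J z (\<alpha> z)) 0 = 0" by (rule ext_0)
  show "\<forall>i. (\<lambda>z. \<alpha> z $ i) holomorphic_on UNIV" using assms unfolding hvec_def .
  show "\<forall>z. z \<noteq> 0 \<longrightarrow> ext (\<lambda>z. J z (\<alpha> z)) z = Jop X (- x *s \<omega>) z (\<alpha> z)"
    unfolding J_def[symmetric] by (simp add: ext_nz)
qed

lemma F_E:
  assumes "s \<in> F" obtains \<alpha> where "hvec UNIV \<alpha>" "s = ext (\<lambda>z. J z (\<alpha> z))"
proof -
  obtain a where a: "s 0 = 0" "\<forall>i. (\<lambda>z. a z $ i) holomorphic_on UNIV" "\<forall>z. z \<noteq> 0 \<longrightarrow> s z = J z (a z)"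
    using assms unfolding Fspace_def J_def by blast
  show thesis
  proof (rule that[of a])
    show "hvec UNIV a" using a(2) by (simp add: hvec_def)
    show "s = ext (\<lambda>z. J z (a z))" by (rule ext_eqI) (use a in simp_all)
  qed
qed

text \<open>With \<open>S2\<close> below, a pair of coordinates on the two spaces to be compared: by
  \<open>F_iff\<close> and \<open>kF_iff\<close> they are the images of all entire \<open>a\<close>
  and \<open>c\<close>, and both start with the factor \<open>W z\<close>, which can be
  cancelled.\<close>

definition S1 :: "(complex \<Rightarrow> complex^'n) \<Rightarrow> complex \<Rightarrow> complex^'n" where
  "S1 a = ext (\<lambda>z. W z \<rhd> G1 z \<rhd> a z)"
definition S2 :: "(complex \<Rightarrow> complex^'n) \<Rightarrow> complex \<Rightarrow> complex^'n" where
  "S2 c = ext (\<lambda>z. W z \<rhd> G2 z \<rhd> c (1 / z))"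

lemma S1_J: "S1 a = ext (\<lambda>z. J z (Dt r \<rhd> B z \<rhd> a z))"
  unfolding S1_def by (rule HOL.ext) (simp add: ext_def J_W)

lemma J_S1: "ext (\<lambda>z. J z (\<alpha> z)) = S1 (\<lambda>z. B' z \<rhd> Dt (- r) \<rhd> \<alpha> z)"
  unfolding S1_def by (rule HOL.ext) (simp add: ext_def J_eq)

lemma hvec_DB: "hvec UNIV a \<Longrightarrow> hvec UNIV (\<lambda>z. Dt r \<rhd> B z \<rhd> a z)"
  by (intro hvec_op clin_Dt hvec_B)

lemma hvec_BD: "hvec UNIV a \<Longrightarrow> hvec UNIV (\<lambda>z. B' z \<rhd> Dt (- r) \<rhd> a z)"
  by (intro hvec_op clin_Dt hvec_B)

lemma F_iff: "s \<in> F \<longleftrightarrow> (\<exists>a. hvec UNIV a \<and> s = S1 a)"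
proof
  assume "s \<in> F"
  then obtain \<alpha> where "hvec UNIV \<alpha>" "s = ext (\<lambda>z. J z (\<alpha> z))" by (rule F_E)
  then show "\<exists>a. hvec UNIV a \<and> s = S1 a" using hvec_BD J_S1 by blast
next
  assume "\<exists>a. hvec UNIV a \<and> s = S1 a"
  then obtain a where "hvec UNIV a" "s = S1 a" by blast
  then show "s \<in> F" using F_mem[OF hvec_DB] S1_J by simp
qed

lemma HH_ext: "hvec (- {0}) s \<Longrightarrow> ext s \<in> HH"
proof -
  assume s: "hvec (- {0}) s"
  have "hvec (- {0}) (ext s)" using s by (subst hvec_cong[of _ _ s]) (simp_all add: ext_def)
  then show ?thesis by (simp add: HH_def hvec_def ext_0)
qed

lemma S1_HH: "hvec UNIV a \<Longrightarrow> S1 a \<in> HH"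
  unfolding S1_def by (intro HH_ext hvec_ap[OF holop_W(1)] hvec_ap[OF holo(1)]) (erule hvec_subset, simp)

lemma F_HH: assumes "s \<in> F" shows "s \<in> HH"
proof -
  obtain a where "hvec UNIV a" "s = S1 a" using assms unfolding F_iff by blast
  then show ?thesis by (simp only: S1_HH)
qed

lemma S2_HH: "hvec UNIV c \<Longrightarrow> S2 c \<in> HH"
  unfolding S2_def by (intro HH_ext hvec_ap[OF holop_W(1)] hvec_ap[OF holo(2)] hvec_inverse_arg)

lemma kH_J: "kH (ext (\<lambda>z. J z (\<beta> z))) = S2 (\<lambda>u. Lo u \<rhd> cj \<rhd> Dt (- r) \<rhd> \<beta> (cnj u))"
proof (rule HOL.ext)
  fix z
  show "kH (ext (\<lambda>z. J z (\<beta> z))) z = S2 (\<lambda>u. Lo u \<rhd> cj \<rhd> Dt (- r) \<rhd> \<beta> (cnj u)) z"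
    by (cases "z = 0") (simp_all add: kH_def S2_def ext_def kz_J del: ap_cj)
qed

text \<open>The entire vector whose image under J has \<open>S2 c\<close> as its conjugate; see
  \<open>kH_conj_data\<close>.\<close>

definition conj_data :: "(complex \<Rightarrow> complex^'n) \<Rightarrow> complex \<Rightarrow> complex^'n" where
  "conj_data c z = Dt r \<rhd> cj \<rhd> Lo' (cnj z) \<rhd> c (cnj z)"

lemma hvec_conj_data: assumes "hvec UNIV c" shows "hvec UNIV (conj_data c)"
proof -
  have "hvec UNIV (\<lambda>z. Lo' z \<rhd> c z)"
    by (rule hvec_ap[OF holop_Lo(2)[OF holomorphic_on_ident] assms])
  from hvec_op[OF clin_Dt hvec_cj_UNIV[OF this]] show ?thesis by (simp add: conj_data_def[abs_def])
qed

lemma kH_conj_data: "kH (ext (\<lambda>z. J z (conj_data c z))) = S2 c"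
proof -
  have "Lo u \<rhd> cj \<rhd> Dt (- r) \<rhd> conj_data c (cnj u) = c u" for u
    unfolding conj_data_def complex_cnj_cnj invp_ap(2)[OF invp_Dt] invp_ap(1)[OF invp_cj] invp_ap(1)[OF invp_Lo] ..
  then show ?thesis unfolding kH_J by simp
qed

lemma kF_iff: "s \<in> kappaH X VR ` F \<longleftrightarrow> (\<exists>c. hvec UNIV c \<and> s = S2 c)"
proof
  assume "s \<in> kappaH X VR ` F"
  then obtain f where f: "f \<in> F" "s = kappaH X VR f" by blast
  have s: "s = kH f" unfolding f(2) by (rule kappaH_eq[OF F_HH[OF f(1)]])
  obtain \<beta> where \<beta>: "hvec UNIV \<beta>" "f = ext (\<lambda>z. J z (\<beta> z))" using f(1) by (rule F_E)
  have "hvec UNIV (\<lambda>u. Lo u \<rhd> cj \<rhd> Dt (- r) \<rhd> \<beta> (cnj u))"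
    by (rule hvec_ap[OF holop_Lo(1)[OF holomorphic_on_ident]]) (rule hvec_cj_UNIV[OF hvec_op[OF clin_Dt \<beta>(1)]])
  then show "\<exists>c. hvec UNIV c \<and> s = S2 c" unfolding s \<beta>(2) kH_J by (intro exI[of _ "\<lambda>u. Lo u \<rhd> cj \<rhd> Dt (- r) \<rhd> \<beta> (cnj u)"] conjI) (assumption, rule refl)
next
  assume "\<exists>c. hvec UNIV c \<and> s = S2 c"
  then obtain c where c: "hvec UNIV c" "s = S2 c" by blast
  let ?f = "ext (\<lambda>z. J z (conj_data c z))"
  have f: "?f \<in> F" by (rule F_mem[OF hvec_conj_data[OF c(1)]])
  have "kappaH X VR ?f = s" unfolding c(2) kappaH_eq[OF F_HH[OF f]] by (rule kH_conj_data)
  then show "s \<in> kappaH X VR ` F" using f by blast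
qed

text \<open>After cancelling \<open>W z\<close>, trivial intersection is
  \<open>gluing_unique\<close> with - c in place of \<open>c\<close>, and the spanning property is
  \<open>gluing_exists\<close> with right-hand side \<open>W' z\<close> applied to
  \<open>s z\<close>. The factor 1 / z in the gluing equation is the one in front of the conjugate
  space.\<close>

lemma pure:
  assumes U: "- x *s \<omega> \<in> U" shows "pure_at X U VR (- x *s \<omega>)"
proof -
  define K where "K = (\<lambda>s z. (1 / z) *s s z) ` (kappaH X VR ` F)"
  have zero1: "S1 (\<lambda>z. 0) = (\<lambda>z. 0)" and zero2: "S2 (\<lambda>z. 0) = (\<lambda>z. 0)"
    by (auto simp: S1_def S2_def ext_def ap.zero_right)
  have "F \<inter> K = {\<lambda>z. 0}"
  proof
    have "(\<lambda>z. 0) \<in> F" unfolding F_iff using zero1 by (intro exI[of _ "\<lambda>z. 0"]) simp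
    moreover have "(\<lambda>z. 0) \<in> kappaH X VR ` F" unfolding kF_iff using zero2 by (intro exI[of _ "\<lambda>z. 0"]) simp
    then have "(\<lambda>z. 0) \<in> K" unfolding K_def by (rule image_eqI[rotated]) simp
    ultimately show "{\<lambda>z. 0} \<subseteq> F \<inter> K" by blast
    show "F \<inter> K \<subseteq> {\<lambda>z. 0}"
    proof
      fix s assume s: "s \<in> F \<inter> K"
      then obtain a where a: "hvec UNIV a" "s = S1 a" using F_iff[of s] by blast
      obtain t where t: "t \<in> kappaH X VR ` F" "s = (\<lambda>z. (1 / z) *s t z)" using s unfolding K_def by blast
      then obtain c where c: "hvec UNIV c" "s = (\<lambda>z. (1 / z) *s S2 c z)" unfolding kF_iff by blast
      have "G1 z \<rhd> a z + (1 / z) *s (G2 z \<rhd> - c (1 / z)) = 0" if z: "z \<noteq> 0" for z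
      proof -
        have "S1 a z = (1 / z) *s S2 c z" using a(2) c(2) by metis
        then have "W z \<rhd> G1 z \<rhd> a z = W z \<rhd> ((1 / z) *s (G2 z \<rhd> c (1 / z)))"
          using z by (simp add: S1_def S2_def ext_def clin_ap[OF holop_clin[OF holop_W(1)]])
        then have "G1 z \<rhd> a z = (1 / z) *s (G2 z \<rhd> c (1 / z))" by (rule W_cancel[OF z])
        then show ?thesis by (simp add: ap.minus_right)
      qed
      then have "a z = 0" for z by (rule G.gluing_unique(1)[OF a(1) hvec_minus[OF c(1)]])
      then have "a = (\<lambda>z. 0)" by blast
      then show "s \<in> {\<lambda>z. 0}" using a(2) zero1 by simp
    qed
  qed
  moreover have "{\<lambda>z. f z + g z | f g. f \<in> F \<and> g \<in> K} = HH"
  proof (intro equalityI subsetI)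
    fix s assume "s \<in> {\<lambda>z. f z + g z | f g. f \<in> F \<and> g \<in> K}"
    then obtain f g where s: "s = (\<lambda>z. f z + g z)" "f \<in> F" "g \<in> K" by blast
    obtain t where t: "t \<in> kappaH X VR ` F" "g = (\<lambda>z. (1 / z) *s t z)" using s(3) unfolding K_def by blast
    then obtain c where c: "hvec UNIV c" "g = (\<lambda>z. (1 / z) *s S2 c z)" unfolding kF_iff by blast
    have f: "f \<in> HH" by (rule F_HH[OF s(2)])
    have "S2 c \<in> HH" by (rule S2_HH[OF c(1)])
    then have "hvec (- {0}) (\<lambda>z. (1 / z) *s S2 c z)"
      by (intro hvec_scale holomorphic_intros) (auto simp: HH_def hvec_def)
    then have "hvec (- {0}) s" unfolding s(1) c(2) using f by (intro hvec_add) (simp_all add: HH_def hvec_def)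
    then show "s \<in> HH" using f by (simp add: HH_def hvec_def s(1) c(2))
  next
    fix s :: "complex \<Rightarrow> complex^'n" assume s: "s \<in> HH"
    then have "hvec (- {0}) (\<lambda>z. W' z \<rhd> s z)" by (intro hvec_ap[OF holop_W(2)]) (simp add: HH_def hvec_def)
    then obtain a c where ac: "hvec UNIV a" "hvec UNIV c"
      and eq: "\<And>z. z \<noteq> 0 \<Longrightarrow> G1 z \<rhd> a z + (1 / z) *s (G2 z \<rhd> c (1 / z)) = W' z \<rhd> s z"
      by (rule G.gluing_exists) blast
    have sz: "s z = S1 a z + (1 / z) *s S2 c z" for z
    proof (cases "z = 0")
      case True then show ?thesis using s by (simp add: HH_def S1_def S2_def ext_def)
    next
      case False
      have "s z = W z \<rhd> (G1 z \<rhd> a z + (1 / z) *s (G2 z \<rhd> c (1 / z)))"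
        unfolding eq[OF False] by (rule invp_ap(1)[OF invp_W, symmetric])
      then show ?thesis using False
        by (simp add: S1_def S2_def ext_def ap.add_right clin_ap[OF holop_clin[OF holop_W(1)]])
    qed
    have "s = (\<lambda>z. S1 a z + (1 / z) *s S2 c z)" by (rule HOL.ext) (rule sz)
    moreover have "S1 a \<in> F" using F_iff[of "S1 a"] ac(1) by blast
    moreover have "S2 c \<in> kappaH X VR ` F" using kF_iff[of "S2 c"] ac(2) by blast
    then have "(\<lambda>z. (1 / z) *s S2 c z) \<in> K" unfolding K_def by (rule imageI)
    ultimately show "s \<in> {\<lambda>z. f z + g z | f g. f \<in> F \<and> g \<in> K}"
      unfolding mem_Collect_eq by (intro exI[of _ "S1 a"] exI[of _ "\<lambda>z. (1 / z) *s S2 c z"] conjI)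
  qed
  ultimately show ?thesis unfolding pure_at_def Let_def K_def using U by blast
qed

end

section \<open>The real sections and the Hermitian form on them\<close>

context real_GW_glue
begin

text \<open>The two coordinates of one element of the intersection of the space with its conjugate.
  No factor 1 / z occurs here, which leaves room for the free value a 0.\<close>

definition data :: "(complex \<Rightarrow> complex^'n) \<Rightarrow> (complex \<Rightarrow> complex^'n) \<Rightarrow> bool" where
  "data a c \<longleftrightarrow> hvec UNIV a \<and> hvec UNIV c \<and> (\<forall>z. z \<noteq> 0 \<longrightarrow> G1 z \<rhd> a z = G2 z \<rhd> c (1 / z))"

lemma dataD: assumes "data a c"
  shows "hvec UNIV a" "hvec UNIV c" "z \<noteq> 0 \<Longrightarrow> G1 z \<rhd> a z = G2 z \<rhd> c (1 / z)"
  using assms by (simp_all add: data_def)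

lemma data_S: assumes "data a c" shows "S1 a = S2 c"
  unfolding S1_def S2_def by (rule HOL.ext) (simp add: ext_def dataD(3)[OF assms])

lemma inter_iff: "s \<in> F \<inter> kappaH X VR ` F \<longleftrightarrow> (\<exists>a c. data a c \<and> s = S1 a)"
proof
  assume s: "s \<in> F \<inter> kappaH X VR ` F"
  then obtain a where a: "hvec UNIV a" "s = S1 a" using F_iff[of s] by blast
  obtain c where c: "hvec UNIV c" "s = S2 c" using s kF_iff[of s] by blast
  have "G1 z \<rhd> a z = G2 z \<rhd> c (1 / z)" if z: "z \<noteq> 0" for z
  proof (rule W_cancel[OF z])
    have "S1 a z = S2 c z" using a(2) c(2) by simp
    then show "W z \<rhd> G1 z \<rhd> a z = W z \<rhd> G2 z \<rhd> c (1 / z)" using z by (simp add: S1_def S2_def ext_def)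
  qed
  then have "data a c" using a(1) c(1) by (simp add: data_def)
  then show "\<exists>a c. data a c \<and> s = S1 a" using a(2) by blast
next
  assume "\<exists>a c. data a c \<and> s = S1 a"
  then obtain a c where d: "data a c" and s: "s = S1 a" by blast
  have "s \<in> F" unfolding F_iff using dataD(1)[OF d] s by blast
  moreover have "s = S2 c" using data_S[OF d] s by simp
  then have "s \<in> kappaH X VR ` F" unfolding kF_iff using dataD(2)[OF d] by blast
  ultimately show "s \<in> F \<inter> kappaH X VR ` F" by blast
qed

text \<open>Put a(z) = v + z a1(z) and divide by z: the unknowns a1 and - c solve a gluing equation
  with right-hand side - G1 z v / z.\<close>

lemma data_exists: obtains a c where "data a c" "a 0 = v"
proof -
  have "hvec (- {0}) (\<lambda>z. (- (1 / z)) *s (G1 z \<rhd> v))"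
    by (intro hvec_scale hvec_ap[OF holo(1)] hvec_const holomorphic_intros) auto
  then obtain a1 c where ac: "hvec UNIV a1" "hvec UNIV c"
    and eq: "\<And>z. z \<noteq> 0 \<Longrightarrow> G1 z \<rhd> a1 z + (1 / z) *s (G2 z \<rhd> c (1 / z)) = (- (1 / z)) *s (G1 z \<rhd> v)"
    by (rule G.gluing_exists) blast
  define a where "a z = v + z *s a1 z" for z
  have "G1 z \<rhd> a z = G2 z \<rhd> - c (1 / z)" if z: "z \<noteq> 0" for z
  proof -
    have "z *s (G1 z \<rhd> a1 z + (1 / z) *s (G2 z \<rhd> c (1 / z))) = z *s ((- (1 / z)) *s (G1 z \<rhd> v))"
      by (simp only: eq[OF z])
    then have "z *s (G1 z \<rhd> a1 z) + G2 z \<rhd> c (1 / z) = - (G1 z \<rhd> v)"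
      using z by (simp add: vector_add_ldistrib)
    moreover have "G1 z \<rhd> a z = G1 z \<rhd> v + z *s (G1 z \<rhd> a1 z)"
      unfolding a_def ap.add_right clin_ap[OF holop_clin[OF holo(1)]] ..
    ultimately show ?thesis by (simp add: ap.minus_right algebra_simps eq_neg_iff_add_eq_0)
  qed
  moreover have "hvec UNIV a" unfolding a_def[abs_def]
    by (intro hvec_add hvec_const hvec_scale holomorphic_intros ac(1))
  ultimately have "data a (\<lambda>u. - c u)" using hvec_minus[OF ac(2)] by (simp add: data_def)
  then show thesis by (rule that) (simp add: a_def)
qed

lemma data_unique:
  assumes d: "data a c" "data a' c'" and eq: "a 0 = a' 0" shows "S1 a = S1 a'"
proof -
  have "hvec UNIV (\<lambda>z. a z - a' z)" by (rule hvec_diff[OF dataD(1)[OF d(1)] dataD(1)[OF d(2)]])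
  then obtain b where b: "hvec UNIV b" "\<And>z. a z - a' z = (a 0 - a' 0) + z *s b z"
    by (rule hvec_factor) blast
  have c: "hvec UNIV (\<lambda>u. c' u - c u)" by (rule hvec_diff[OF dataD(2)[OF d(2)] dataD(2)[OF d(1)]])
  have "G1 z \<rhd> b z + (1 / z) *s (G2 z \<rhd> (c' (1 / z) - c (1 / z))) = 0" if z: "z \<noteq> 0" for z
  proof -
    have "z *s (G1 z \<rhd> b z) = G1 z \<rhd> (a z - a' z)"
      unfolding b(2) eq by (simp add: clin_ap[OF holop_clin[OF holo(1)]])
    also have "\<dots> = G2 z \<rhd> (c (1 / z) - c' (1 / z))"
      unfolding ap.diff_right dataD(3)[OF d(1) z] dataD(3)[OF d(2) z] ..
    finally have "(1 / z) *s (z *s (G1 z \<rhd> b z)) = (1 / z) *s (G2 z \<rhd> (c (1 / z) - c' (1 / z)))" by simp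
    then have "G1 z \<rhd> b z = (1 / z) *s (G2 z \<rhd> (c (1 / z) - c' (1 / z)))" using z by simp
    moreover have "c' (1 / z) - c (1 / z) = - (c (1 / z) - c' (1 / z))" by simp
    ultimately show ?thesis by (simp only: ap.minus_right) simp
  qed
  then have "b z = 0" for z by (rule G.gluing_unique(1)[OF b(1) c])
  then have "a z = a' z" for z using b(2)[of z] eq by simp
  then have "a = a'" by (rule HOL.ext)
  then show ?thesis by simp
qed

lemma J_linear: assumes z: "z \<noteq> 0" shows "J z (u + k *s v) = J z u + k *s J z v"
  unfolding J_eq[OF z] ap.add_right clin_ap[OF clin_Dt] clin_ap[OF clin_B(2)]
    clin_ap[OF holop_clin[OF holop_W(1)]] clin_ap[OF holop_clin[OF holo(1)]] ..

text \<open>Modulo z times the space only the value at 0 of the argument of J matters. This value is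
  \<open>Dt r\<close> applied to a 0, because \<open>B 0\<close> is 1, so prescribing the class of
  \<open>u\<close> means a 0 = Dt (- r) u.\<close>

lemma K_lift_eq:
  obtains a c where "data a c" "a 0 = Dt (- r) \<rhd> u" "K_lift X VR (- x *s \<omega>) u = S1 a"
proof -
  obtain a c where d: "data a c" "a 0 = Dt (- r) \<rhd> u" by (rule data_exists)
  have "K_lift X VR (- x *s \<omega>) u = S1 a"
    unfolding K_lift_def J_def[symmetric]
  proof (rule the_equality)
    have "\<exists>f\<in>F. \<forall>z. z \<noteq> 0 \<longrightarrow> S1 a z = J z u + z *s f z"
    proof -
      have "hvec UNIV (\<lambda>z. Dt r \<rhd> B z \<rhd> a z)" by (rule hvec_DB[OF dataD(1)[OF d(1)]])
      then obtain b where b: "hvec UNIV b" "\<And>z. Dt r \<rhd> B z \<rhd> a z = Dt r \<rhd> B 0 \<rhd> a 0 + z *s b z"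
        by (rule hvec_factor) blast
      have "Dt r \<rhd> B 0 \<rhd> a 0 = u" unfolding d(2) B_0 ap_one by (rule invp_ap(1)[OF invp_Dt])
      then have "S1 a z = J z u + z *s ext (\<lambda>z. J z (b z)) z" if "z \<noteq> 0" for z
        unfolding S1_J ext_nz[OF that] b(2)[of z] by (simp only: J_linear[OF that])
      then show ?thesis using F_mem[OF b(1)] by blast
    qed
    then show "S1 a \<in> F \<inter> kappaH X VR ` F \<and> (\<exists>f\<in>F. \<forall>z. z \<noteq> 0 \<longrightarrow> S1 a z = J z u + z *s f z)"
      unfolding inter_iff using d(1) by blast
    fix s assume s: "s \<in> F \<inter> kappaH X VR ` F \<and> (\<exists>f\<in>F. \<forall>z. z \<noteq> 0 \<longrightarrow> s z = J z u + z *s f z)"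
    then obtain f where f: "f \<in> F" "\<And>z. z \<noteq> 0 \<Longrightarrow> s z = J z u + z *s f z" by blast
    obtain g where g: "hvec UNIV g" "f = ext (\<lambda>z. J z (g z))" using f(1) by (rule F_E)
    obtain a1 c1 where d1: "data a1 c1" "s = S1 a1" using s unfolding inter_iff by blast
    define a' where "a' z = B' z \<rhd> Dt (- r) \<rhd> (u + z *s g z)" for z
    have a': "hvec UNIV a'" unfolding a'_def[abs_def]
      by (intro hvec_BD hvec_add hvec_const hvec_scale holomorphic_intros g(1))
    have "G1 z \<rhd> a1 z = G1 z \<rhd> a' z" if z: "z \<noteq> 0" for z
    proof (rule W_cancel[OF z])
      have "W z \<rhd> G1 z \<rhd> a1 z = s z" unfolding d1(2) S1_def ext_nz[OF z] ..
      also have "\<dots> = J z u + z *s J z (g z)" unfolding f(2)[OF z] g(2) ext_nz[OF z] ..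
      also have "\<dots> = W z \<rhd> G1 z \<rhd> a' z"
        unfolding a'_def J_linear[OF z, symmetric] by (rule J_eq[OF z])
      finally show "W z \<rhd> G1 z \<rhd> a1 z = W z \<rhd> G1 z \<rhd> a' z" .
    qed
    then have "data a' c1" "S1 a' = s" unfolding d1(2)
      using a' d1(1) by (simp_all add: data_def S1_def ext_def fun_eq_iff)
    moreover have "a' 0 = a 0" by (simp add: a'_def d(2) B_0)
    ultimately show "s = S1 a" using data_unique[OF _ d(1)] by metis
  qed
  then show thesis by (rule that[OF d])
qed

text \<open>Unitarity of J rewrites the form as the pairing \<open>p\<close> of two entire vectors
  at - z and z, so \<open>p\<close> is entire; \<open>kz_pair\<close> supplies the symmetry that
  makes it a real constant. It may then be evaluated at 0, where \<open>B\<close> is 1 and the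
  rescaling drops out because it preserves the pairing.\<close>

lemma h_form_data:
  assumes d: "data a c"
  shows "h_form X VR (S1 a) (S1 a) = orb_pair X (C \<rhd> L.w' \<rhd> c 0) (a 0)" "h_form X VR (S1 a) (S1 a) \<in> \<real>"
proof -
  define s where "s = S1 a"
  define \<alpha> where "\<alpha> z = Dt r \<rhd> B z \<rhd> a z" for z
  define \<beta> where "\<beta> = conj_data c"
  define f where "f = ext (\<lambda>z. J z (\<beta> z))"
  have \<alpha>: "hvec UNIV \<alpha>" unfolding \<alpha>_def[abs_def] by (rule hvec_DB[OF dataD(1)[OF d]])
  have \<beta>: "hvec UNIV \<beta>" unfolding \<beta>_def by (rule hvec_conj_data[OF dataD(2)[OF d]])
  have sf: "s = kH f" unfolding s_def f_def \<beta>_def data_S[OF d] by (rule kH_conj_data[symmetric])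
  have fs: "kH s = f" unfolding sf by (rule kH_kH) (simp add: f_def ext_0)
  have kap: "kappaH X VR s = f"
    using kappaH_eq[OF S1_HH[OF dataD(1)[OF d]]] fs by (simp add: s_def)
  have sJ: "s z = J z (\<alpha> z)" and fJ: "f z = J z (\<beta> z)" if "z \<noteq> 0" for z
    using that by (simp_all add: s_def S1_J f_def ext_nz \<alpha>_def)
  define p where "p z = orb_pair X (\<beta> (- z)) (\<alpha> z)" for z
  have pJ: "orb_pair X (f (- z)) (s z) = p z" if z: "z \<noteq> 0" for z
  proof -
    have mz: "- z \<noteq> 0" using z by simp
    show ?thesis unfolding sJ[OF z] fJ[OF mz] p_def J_def by (rule Jop_unitary[OF z x])
  qed
  have hol: "p holomorphic_on UNIV"
  proof -
    have comp: "(\<lambda>z. v z $ i) holomorphic_on UNIV" if "hvec UNIV v" for v :: "complex \<Rightarrow> complex^'n" and i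
      using that by (simp add: hvec_def)
    have \<beta>m: "hvec UNIV (\<lambda>z. \<beta> (- z))" by (rule hvec_compose[OF \<beta>]) (auto intro!: holomorphic_intros)
    have p: "p z = (\<Sum>j\<in>UNIV. \<alpha> z $ j * (\<Sum>k\<in>UNIV. \<beta> (- z) $ k * orb_pair X (axis k 1) (axis j 1)))" for z
      unfolding p_def
      by (subst vec_expand[of "\<alpha> z"], subst vec_expand[of "\<beta> (- z)"])
        (simp only: orb_pair_sum_right orb_pair_sum_left orb_pair_scale_left orb_pair_scale_right)
    show ?thesis unfolding p[abs_def] by (intro holomorphic_intros comp[OF \<alpha>] comp[OF \<beta>m])
  qed
  have circ: "p z = cnj (p (- z))" if n: "norm z = 1" for z
  proof -
    have z: "z \<noteq> 0" "- z \<noteq> 0" using n by auto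
    have w: "1 / cnj z = z"
    proof -
      have "z * cnj z = 1" using n by (simp add: complex_norm_square[symmetric])
      then show ?thesis using z by (simp add: field_simps)
    qed
    have s: "s z = kz z \<rhd> f z" unfolding sf kH_def using z w by simp
    have f: "f (- z) = kz (- z) \<rhd> s (- z)" unfolding fs[symmetric] kH_def using z w by simp
    have "p z = orb_pair X (kz (- z) \<rhd> s (- z)) (kz z \<rhd> f z)" using pJ[OF z(1)] s f by simp
    also have "\<dots> = cnj (orb_pair X (s (- z)) (f z))" by (rule kz_pair[OF n])
    also have "orb_pair X (s (- z)) (f z) = orb_pair X (f z) (s (- z))" by (rule orb_pair_sym)
    also have "\<dots> = p (- z)" using pJ[OF z(2)] by simp
    finally show ?thesis .
  qed
  obtain k where k: "\<And>z. p z = k" "k \<in> \<real>" using entire_antipodal_constant[OF hol circ] by blast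
  have "h_form X VR s s = k"
    unfolding h_form_def kap
  proof (rule the_equality)
    show "\<forall>z. z \<noteq> 0 \<longrightarrow> orb_pair X (f (- z)) (s z) = k" using pJ k(1) by simp
    fix c assume "\<forall>z. z \<noteq> 0 \<longrightarrow> orb_pair X (f (- z)) (s z) = c"
    then show "c = k" using pJ[of 1] k(1) by (metis one_neq_zero)
  qed
  moreover have "p 0 = orb_pair X (C \<rhd> L.w' \<rhd> c 0) (a 0)"
  proof -
    have "\<beta> 0 = Dt r \<rhd> C \<rhd> L.w' \<rhd> c 0"
      unfolding \<beta>_def conj_data_def complex_cnj_zero Lo'_def B_0 ap_times ap_one invp_ap(1)[OF invp_cj] ..
    then show ?thesis unfolding p_def by (simp add: \<alpha>_def B_0 Dt_isometry)
  qed
  ultimately show "h_form X VR (S1 a) (S1 a) = orb_pair X (C \<rhd> L.w' \<rhd> c 0) (a 0)"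
    "h_form X VR (S1 a) (S1 a) \<in> \<real>" using k by (simp_all add: s_def)
qed

lemma data_near: assumes "data a c" shows "norm (c 0 - a 0) \<le> 160 * real CARD('n) * \<epsilon> * norm (a 0)"
  using G.gluing_value_at_zero[OF dataD(1,2)[OF assms]] dataD(3)[OF assms] by blast

lemma data_nonzero: assumes "data a c" "S1 a \<noteq> (\<lambda>z. 0)" shows "a 0 \<noteq> 0"
proof
  assume "a 0 = 0"
  have "data (\<lambda>z. 0) (\<lambda>z. 0)" by (simp add: data_def ap.zero_right)
  then have "S1 a = S1 (\<lambda>z. 0)" by (rule data_unique[OF assms(1)]) (simp add: \<open>a 0 = 0\<close>)
  also have "\<dots> = (\<lambda>z. 0)" by (auto simp: S1_def ext_def ap.zero_right)
  finally show False using assms(2) by simp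
qed

end

section \<open>Hodge decomposition of Lefschetz strings\<close>

context orbifold_cohomology
begin

definition gp :: "'t \<Rightarrow> nat \<Rightarrow> (complex^'n) endo" where
  "gp v k = dg (\<lambda>i. if sector X i = v \<and> hdeg X i = k then 1 else 0)"

lemma gp_Hgr: "gp v k \<rhd> x \<in> Hgr X v k" by (auto simp: gp_def Hgr_def)
lemma gp_id: "x \<in> Hgr X v k \<Longrightarrow> gp v k \<rhd> x = x" by (auto simp: gp_def Hgr_def vec_eq_iff)

definition hconds :: "'t \<Rightarrow> nat \<Rightarrow> complex^'n \<Rightarrow> (nat \<Rightarrow> complex^'n) \<Rightarrow> bool" where
  "hconds v k x a \<longleftrightarrow> (\<forall>p\<le>2*k. a p \<in> hodge X v p (2*k - p)) \<and> (\<forall>p>2*k. a p = 0) \<and> x = (\<Sum>p\<le>2*k. a p)"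

text \<open>The projection to the Hodge type (p, q) of the sector \<open>v\<close>, defined on the
  whole cohomology: first the component in degree p + q is taken, then its Hodge component. It is
  used for p + q even only.\<close>

definition hp :: "'t \<Rightarrow> nat \<Rightarrow> nat \<Rightarrow> complex^'n \<Rightarrow> complex^'n" where
  "hp v p q x = (THE a. hconds v ((p + q) div 2) (gp v ((p + q) div 2) \<rhd> x) a) p"

lemma hconds_ex1: "x \<in> Hgr X v k \<Longrightarrow> \<exists>!a. hconds v k x a"
  unfolding hconds_def by (rule hodge_decomp)

lemma hp_eqI:
  assumes "hconds v k (gp v k \<rhd> x) a" "p + q = 2 * k" shows "hp v p q x = a p"
proof -
  have k: "(p + q) div 2 = k" using assms(2) by simp
  have "(THE a. hconds v k (gp v k \<rhd> x) a) = a"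
    by (rule the_equality[where P = "hconds v k (gp v k \<rhd> x)"], rule assms(1))
      (use hconds_ex1[OF gp_Hgr, of v k x] assms(1) in blast)
  then show ?thesis unfolding hp_def k by simp
qed

lemma hp_conds:
  assumes "p + q = 2 * k" obtains a where "hconds v k (gp v k \<rhd> x) a" "hp v p q x = a p"
proof -
  obtain a where a: "hconds v k (gp v k \<rhd> x) a" using hconds_ex1[OF gp_Hgr] by blast
  show thesis by (rule that[OF a hp_eqI[OF a assms]])
qed

lemma hodge_zero: "even (p + q) \<Longrightarrow> 0 \<in> hodge X v p q"
  using vec.subspace_0[OF hodge_subspace] by blast

lemma hp_hodge: assumes "p + q = 2 * k" shows "hp v p q x \<in> hodge X v p q"
proof -
  obtain a where a: "hconds v k (gp v k \<rhd> x) a" "hp v p q x = a p" using assms by (rule hp_conds)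
  have "p \<le> 2 * k" "2 * k - p = q" using assms by simp_all
  then show ?thesis using a unfolding hconds_def by metis
qed

lemma hp_add: assumes pq: "p + q = 2 * k" shows "hp v p q (x + y) = hp v p q x + hp v p q y"
proof -
  obtain a where a: "hconds v k (gp v k \<rhd> x) a" "hp v p q x = a p" using pq by (rule hp_conds)
  obtain b where b: "hconds v k (gp v k \<rhd> y) b" "hp v p q y = b p" using pq by (rule hp_conds)
  have "a i + b i \<in> hodge X v i (2 * k - i)" if "i \<le> 2 * k" for i
    by (rule vec.subspace_add[OF hodge_subspace]) (use that a(1) b(1) in \<open>simp_all add: hconds_def\<close>)
  then have "hconds v k (gp v k \<rhd> (x + y)) (\<lambda>i. a i + b i)"
    using a(1) b(1) by (simp add: hconds_def ap.add_right sum.distrib)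
  from hp_eqI[OF this pq] show ?thesis by (simp only: a b)
qed

lemma hp_zero: assumes pq: "p + q = 2 * k" shows "hp v p q 0 = 0"
  using hp_add[OF pq, of v 0 0] by simp

lemma hp_sum: assumes pq: "p + q = 2 * k" shows "hp v p q (\<Sum>i\<in>J. f i) = (\<Sum>i\<in>J. hp v p q (f i))"
  by (induction J rule: infinite_finite_induct) (simp_all add: hp_zero[OF pq] hp_add[OF pq])

lemma hp_id: assumes "u \<in> hodge X v p q" and pq: "p + q = 2 * k" shows "hp v p q u = u"
proof -
  have u: "gp v k \<rhd> u = u" by (rule gp_id) (use hodge_Hgr[OF pq] assms(1) in blast)
  have "hconds v k u (\<lambda>i. if i = p then u else 0)"
    unfolding hconds_def
  proof (intro conjI allI impI)
    fix i assume i: "i \<le> 2 * k"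
    show "(if i = p then u else 0) \<in> hodge X v i (2 * k - i)"
    proof (cases "i = p")
      case True
      then have "2 * k - i = q" using pq by simp
      then show ?thesis using True assms(1) by simp
    next
      case False
      then show ?thesis using hodge_zero[of i "2 * k - i" v] i by simp
    qed
  qed (use pq in auto)
  then have "hconds v k (gp v k \<rhd> u) (\<lambda>i. if i = p then u else 0)" by (simp only: u)
  from hp_eqI[OF this pq] show ?thesis by simp
qed

end

context kahler_GW
begin

lemma omega_hodge: "\<omega> \<in> hodge X (untw X) 1 1" by (rule kahler_hodge[OF kahler])

lemma N_hodge: "\<alpha> \<in> hodge X v p q \<Longrightarrow> even (p + q) \<Longrightarrow> N \<rhd> \<alpha> \<in> hodge X v (Suc p) (Suc q)"
  using hodge_act[OF _ _ omega_hodge, of p q \<alpha> v] by (simp add: N_ap)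

lemma N_Hgr: "\<alpha> \<in> Hgr X v k \<Longrightarrow> N \<rhd> \<alpha> \<in> Hgr X v (Suc k)"
  unfolding N_ap by (rule Act_Hgr[OF omega_Hgr])

lemma Npow_Hgr: "\<alpha> \<in> Hgr X v k \<Longrightarrow> N ^ j \<rhd> \<alpha> \<in> Hgr X v (k + j)"
  by (induction j) (simp_all add: N_Hgr)

lemma gp_N: "gp v (Suc k) * N = N * gp v k" "gp v 0 * N = 0"
proof -
  have c: "((gp v k * N) \<rhd> axis j 1) $ i = (if sector X i = v \<and> hdeg X i = k then (N \<rhd> axis j 1) $ i else 0)" for i j k
    by (simp add: gp_def)
  have l: "sector X i = sector X j \<and> hdeg X i = Suc (hdeg X j)" if "(N \<rhd> axis j 1) $ i \<noteq> 0" for i j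
    using Act_lowers(1,2)[OF omega_Hgr that[unfolded N_def]] by simp
  show "gp v (Suc k) * N = N * gp v k"
  proof (rule clin_eqI)
    fix j
    have "gp v k \<rhd> axis j 1 = (if sector X j = v \<and> hdeg X j = k then 1 else 0) *s axis j 1"
      unfolding gp_def dg_axis ..
    then have r: "((N * gp v k) \<rhd> axis j 1) $ i = (if sector X j = v \<and> hdeg X j = k then (N \<rhd> axis j 1) $ i else 0)" for i
      by (simp only: ap_times clin_ap[OF clin_N]) simp
    show "(gp v (Suc k) * N) \<rhd> axis j 1 = (N * gp v k) \<rhd> axis j 1"
      unfolding vec_eq_iff c r using l by (metis nat.inject)
  qed (auto simp: gp_def intro!: clin_mult clin_N)
  show "gp v 0 * N = 0"
  proof (rule clin_eqI)
    show "(gp v 0 * N) \<rhd> axis j 1 = 0 \<rhd> axis j 1" for j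
      unfolding vec_eq_iff c using l by (metis nat.distinct(1) ap_zero zero_index)
  qed (auto simp: gp_def intro!: clin_mult clin_N)
qed

text \<open>\<open>N\<close> has type (1, 1), so shifting the Hodge components of \<open>x\<close>
  by one gives those of \<open>N\<close> applied to \<open>x\<close>; at the two ends of the range
  the shifted family is 0.\<close>

lemma hp_N:
  assumes pq: "p + q = 2 * k"
  shows "hp v p q (N \<rhd> x) = (if 1 \<le> p \<and> 1 \<le> q then N \<rhd> hp v (p - 1) (q - 1) x else 0)"
proof (cases k)
  case 0
  have "gp v k \<rhd> N \<rhd> x = 0" using gp_N(2)[of v] unfolding 0 by (simp flip: ap_times)
  then have "hp v p q (N \<rhd> x) = hp v p q 0"
    unfolding hp_def using pq by (simp add: ap.zero_right)
  then show ?thesis using pq 0 hp_zero[OF pq] by simp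
next
  case (Suc k')
  obtain a where a: "hconds v k' (gp v k' \<rhd> x) a" using hconds_ex1[OF gp_Hgr] by blast
  define b where "b i = (if i = 0 then 0 else N \<rhd> a (i - 1))" for i
  have "hconds v k (gp v k \<rhd> N \<rhd> x) b"
    unfolding hconds_def
  proof (intro conjI allI impI)
    fix i assume i: "i \<le> 2 * k"
    show "b i \<in> hodge X v i (2 * k - i)"
    proof (cases "i = 0 \<or> i = 2 * k")
      case True
      moreover have "a (2 * k - 1) = 0" using a Suc by (simp add: hconds_def)
      ultimately have "b i = 0" by (auto simp: b_def ap.zero_right)
      then show ?thesis using i hodge_zero[of i "2 * k - i" v] by simp
    next
      case False
      then have i1: "i - 1 \<le> 2 * k'" "Suc (i - 1) = i" "Suc (2 * k' - (i - 1)) = 2 * k - i"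
        using i Suc by linarith+
      have "a (i - 1) \<in> hodge X v (i - 1) (2 * k' - (i - 1))" using a i1(1) unfolding hconds_def by blast
      then have "N \<rhd> a (i - 1) \<in> hodge X v (Suc (i - 1)) (Suc (2 * k' - (i - 1)))"
        by (rule N_hodge) (simp only: le_add_diff_inverse[OF i1(1)], simp)
      then have "N \<rhd> a (i - 1) \<in> hodge X v i (2 * k - i)" unfolding i1 .
      then show ?thesis using False unfolding b_def by presburger
    qed
  next
    fix i assume "2 * k < i"
    then show "b i = 0" using a Suc by (simp add: b_def hconds_def ap.zero_right)
  next
    have "gp v k \<rhd> N \<rhd> x = N \<rhd> gp v k' \<rhd> x" using gp_N(1)[of v k'] unfolding Suc by (simp flip: ap_times)
    also have "\<dots> = (\<Sum>i\<le>2 * k'. N \<rhd> a i)" using a by (simp add: hconds_def ap.sum_right)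
    also have "\<dots> = (\<Sum>i\<le>2 * k. b i)"
    proof -
      have "{..2 * k} = {..Suc (Suc (2 * k'))}" using Suc by simp
      moreover have "a (Suc (2 * k')) = 0" using a by (simp add: hconds_def)
      moreover have "(\<Sum>i\<le>Suc (Suc (2 * k')). b i) = b 0 + (\<Sum>i\<le>Suc (2 * k'). b (Suc i))"
        by (rule sum.atMost_Suc_shift)
      ultimately show ?thesis by (simp add: b_def ap.zero_right)
    qed
    finally show "gp v k \<rhd> N \<rhd> x = (\<Sum>i\<le>2 * k. b i)" .
  qed
  then have hpb: "hp v p q (N \<rhd> x) = b p" using pq by (rule hp_eqI)
  show ?thesis
  proof (cases "1 \<le> p \<and> 1 \<le> q")
    case True
    then have "(p - 1) + (q - 1) = 2 * k'" using pq Suc by linarith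
    then have "hp v (p - 1) (q - 1) x = a (p - 1)" by (rule hp_eqI[OF a])
    then show ?thesis using True hpb by (simp add: b_def)
  next
    case False
    then have "p = 0 \<or> p - 1 > 2 * k'" using pq Suc by linarith
    then have "b p = 0" using a by (auto simp: b_def hconds_def ap.zero_right)
    then show ?thesis unfolding hpb using False by presburger
  qed
qed

lemma hp_Npow:
  assumes "p + q = 2 * k"
  shows "hp v p q (N ^ j \<rhd> x) = (if j \<le> p \<and> j \<le> q then N ^ j \<rhd> hp v (p - j) (q - j) x else 0)"
  using assms
proof (induction j arbitrary: p q k)
  case (Suc j)
  have e: "N ^ Suc j \<rhd> y = N \<rhd> N ^ j \<rhd> y" for y by simp
  show ?case
  proof (cases "1 \<le> p \<and> 1 \<le> q")
    case True
    then have "(p - 1) + (q - 1) = 2 * (k - 1)" using Suc.prems by linarith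
    from Suc.IH[OF this] show ?thesis
      unfolding e hp_N[OF Suc.prems] using True by (auto simp: ap.zero_right)
  next
    case False
    then show ?thesis unfolding e hp_N[OF Suc.prems] by auto
  qed
qed simp

lemma Hgr_V: "\<alpha> \<in> Hgr X v k \<Longrightarrow> \<alpha> \<in> L.V (int (sdim X v) - 2 * int k)"
  unfolding Hgr_def L.V_def wt_def by auto

lemma hp_V:
  assumes pq: "p + q = 2 * k" and x: "x \<in> L.V l" shows "hp v p q x \<in> L.V l"
proof (cases "l = int (sdim X v) - 2 * int k")
  case True
  have "hp v p q x \<in> Hgr X v k" using hp_hodge[OF pq] hodge_Hgr[OF pq] by blast
  then show ?thesis unfolding True by (rule Hgr_V)
next
  case False
  have "gp v k \<rhd> x = 0"
    using x False by (auto simp: gp_def L.V_def wt_def vec_eq_iff)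
  then have "hp v p q x = hp v p q 0" unfolding hp_def using pq by (simp add: ap.zero_right)
  then show ?thesis by (simp add: hp_zero[OF pq])
qed

text \<open>A Lefschetz decomposition compatible with types. The last clause says that the top
  weight k is determined by the position j; strings with different indices thus differ in position,
  and the signs can be computed.\<close>

definition hodge_strings :: "'t \<Rightarrow> nat \<Rightarrow> nat \<Rightarrow> complex^'n \<Rightarrow> (nat \<times> nat \<Rightarrow> complex^'n) \<Rightarrow> bool" where
  "hodge_strings v p q u b \<longleftrightarrow> u = (\<Sum>x\<in>L.I. N ^ snd x \<rhd> b x) \<and> (\<forall>x. b x \<in> L.P (fst x)) \<and>
     (\<forall>x. b x \<noteq> 0 \<longrightarrow> snd x \<le> p \<and> snd x \<le> q \<and> b x \<in> hodge X v (p - snd x) (q - snd x) \<and>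
        fst x + 2 * ((p + q) div 2 - snd x) = sdim X v)"

text \<open>Apply the Hodge projection to the Lefschetz decomposition of \<open>u\<close>. It passes
  through powers of \<open>N\<close> with a shift of type and preserves weights, so projected
  primitive components are primitive again.\<close>

lemma hodge_lefschetz:
  assumes u: "u \<in> hodge X v p q" and pq: "p + q = 2 * m"
  shows "\<exists>b. hodge_strings v p q u b"
proof -
  obtain a where a: "L.compos a u" using L.compos_exists by blast
  define b where "b = (\<lambda>(k, j). if j \<le> p \<and> j \<le> q then hp v (p - j) (q - j) (a (k, j)) else 0)"
  have pqj: "(p - j) + (q - j) = 2 * (m - j)" if "j \<le> p" "j \<le> q" for j using that pq by linarith
  have us: "u = (\<Sum>x\<in>L.I. N ^ snd x \<rhd> a x)" using a by (simp add: L.compos_def case_prod_beta)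
  have "u = hp v p q (\<Sum>x\<in>L.I. N ^ snd x \<rhd> a x)" unfolding us[symmetric] by (rule hp_id[OF u pq, symmetric])
  also have "\<dots> = (\<Sum>x\<in>L.I. N ^ snd x \<rhd> b x)"
    unfolding hp_sum[OF pq] hp_Npow[OF pq] by (intro sum.cong refl) (auto simp: b_def ap.zero_right split: prod.split)
  finally have 1: "u = (\<Sum>x\<in>L.I. N ^ snd x \<rhd> b x)" .
  have aP: "a (k, j) \<in> L.V (int k)" "N ^ Suc k \<rhd> a (k, j) = 0" for k j
    using a by (simp_all add: L.compos_def L.P_def)
  have 2: "b (k, j) \<in> L.P k" for k j
  proof (cases "j \<le> p \<and> j \<le> q")
    case True
    let ?n = "Suc k"
    have e: "(p - j + ?n) + (q - j + ?n) = 2 * (m - j + ?n)"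
    proof -
      have "a + b = 2 * c \<Longrightarrow> a + ?n + (b + ?n) = 2 * (c + ?n)" for a b c :: nat by simp
      then show ?thesis using pqj[OF conjunct1[OF True] conjunct2[OF True]] by blast
    qed
    have "N ^ ?n \<rhd> hp v (p - j) (q - j) (a (k, j)) = hp v (p - j + ?n) (q - j + ?n) (N ^ ?n \<rhd> a (k, j))"
      unfolding hp_Npow[OF e] by (simp del: power_Suc)
    also have "\<dots> = 0" unfolding aP(2) by (rule hp_zero[OF e])
    finally show ?thesis using True hp_V[OF pqj aP(1)] by (simp add: L.P_def b_def)
  next
    case False
    then show ?thesis by (auto simp: b_def L.P_def ap.zero_right)
  qed
  have 3: "j \<le> p \<and> j \<le> q \<and> b (k, j) \<in> hodge X v (p - j) (q - j) \<and> k + 2 * (m - j) = sdim X v"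
    if nz: "b (k, j) \<noteq> 0" for k j
  proof -
    have j: "j \<le> p" "j \<le> q" using nz by (auto simp: b_def split: if_splits)
    have h: "b (k, j) \<in> hodge X v (p - j) (q - j)" unfolding b_def using hp_hodge[OF pqj[OF j]] j by simp
    then have "b (k, j) \<in> Hgr X v (m - j)" using hodge_Hgr[OF pqj[OF j]] by blast
    then have "b (k, j) \<in> L.V (int (sdim X v) - 2 * int (m - j))" by (rule Hgr_V)
    moreover have "b (k, j) \<in> L.V (int k)" using 2[of k j] by (simp add: L.P_def)
    ultimately have "int (sdim X v) - 2 * int (m - j) = int k" using nz L.V_disjoint by blast
    then show ?thesis using j h by linarith
  qed
  show ?thesis
    unfolding hodge_strings_def
  proof (intro exI[of _ b] conjI allI impI)
    fix x
    show "b x \<in> L.P (fst x)" using 2[of "fst x" "snd x"] by simp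
    assume "b x \<noteq> 0"
    then have "snd x \<le> p \<and> snd x \<le> q \<and> b x \<in> hodge X v (p - snd x) (q - snd x) \<and> fst x + 2 * (m - snd x) = sdim X v"
      using 3[of "fst x" "snd x"] by simp
    then show "snd x \<le> p" "snd x \<le> q" "b x \<in> hodge X v (p - snd x) (q - snd x)"
      "fst x + 2 * ((p + q) div 2 - snd x) = sdim X v" unfolding pq by simp_all
  qed (rule 1)
qed

lemma integ_N: "integ X (cup X (N \<rhd> \<alpha>) \<beta>) = integ X (cup X \<alpha> (N \<rhd> \<beta>))"
  unfolding N_ap act_def by (simp only: cup_assoc[symmetric] cup_commute[of "prs X \<omega>" \<alpha>])

lemma integ_Npow: "integ X (cup X (N ^ k \<rhd> \<alpha>) \<beta>) = integ X (cup X \<alpha> (N ^ k \<rhd> \<beta>))"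
proof (induction k arbitrary: \<alpha> \<beta>)
  case (Suc k)
  have "integ X (cup X (N ^ Suc k \<rhd> \<alpha>) \<beta>) = integ X (cup X (N ^ k \<rhd> \<alpha>) (N \<rhd> \<beta>))"
    unfolding power_Suc ap_times[of N] by (rule integ_N)
  also have "\<dots> = integ X (cup X \<alpha> (N ^ Suc k \<rhd> \<beta>))" unfolding Suc power_Suc2 ap_times ..
  finally show ?case .
qed simp

lemma conjH_N: "conjH X (N \<rhd> \<alpha>) = N \<rhd> conjH X \<alpha>"
  unfolding N_ap act_def by (simp add: conjH_cup conjH_prs[OF omega_Hsec] kahler_real[OF kahler])

lemma conjH_Npow: "conjH X (N ^ k \<rhd> \<alpha>) = N ^ k \<rhd> conjH X \<alpha>"
  by (induction k) (simp_all add: conjH_N)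

lemma conjH_zero: "conjH X 0 = 0"
  using conjH_add[of 0 0] by simp

lemma conjH_sum: "conjH X (\<Sum>i\<in>A. f i) = (\<Sum>i\<in>A. conjH X (f i))"
  by (induction A rule: infinite_finite_induct) (simp_all add: conjH_zero conjH_add)

lemma w'_decomposition:
  assumes b: "\<And>x. b x \<in> L.P (fst x)"
  shows "\<exists>\<rho>. (\<forall>x. (0::real) < \<rho> x) \<and> L.w' \<rhd> (\<Sum>x\<in>L.I. N ^ snd x \<rhd> b x) =
      (\<Sum>x\<in>L.I. ((-1) ^ (snd x + fst x) * \<rho> x) *\<^sub>R (N ^ (fst x - snd x) \<rhd> b x))"
proof -
  have "\<exists>r>0. snd x \<le> fst x \<longrightarrow> L.w' \<rhd> N ^ snd x \<rhd> b x = ((-1) ^ (snd x + fst x) * r) *\<^sub>R (N ^ (fst x - snd x) \<rhd> b x)" for x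
    using L.w'_string[OF b, of "snd x" x] zero_less_one by (cases "snd x \<le> fst x") blast+
  then obtain \<rho> where \<rho>: "\<And>x. 0 < \<rho> x" "\<And>x. snd x \<le> fst x \<Longrightarrow>
      L.w' \<rhd> N ^ snd x \<rhd> b x = ((-1) ^ (snd x + fst x) * \<rho> x) *\<^sub>R (N ^ (fst x - snd x) \<rhd> b x)"
    by metis
  have "L.w' \<rhd> (\<Sum>x\<in>L.I. N ^ snd x \<rhd> b x) = (\<Sum>x\<in>L.I. ((-1) ^ (snd x + fst x) * \<rho> x) *\<^sub>R (N ^ (fst x - snd x) \<rhd> b x))"
    unfolding ap.sum_right by (intro sum.cong refl \<rho>(2)) (auto simp: L.I_def)
  then show ?thesis using \<rho>(1) by (intro exI[of _ \<rho>]) simp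
qed

end

lemma pos_real_mult_of_real: "pos_real c \<Longrightarrow> 0 < r \<Longrightarrow> pos_real (of_real r * c)"
  by (simp add: pos_real_def)

lemma pos_real_sum:
  assumes "finite A" "A \<noteq> {}" "\<And>a. a \<in> A \<Longrightarrow> pos_real (f a)" shows "pos_real (\<Sum>a\<in>A. f a)"
  using assms unfolding pos_real_def by (auto intro!: sum_in_Reals sum_pos simp: Re_sum)

section \<open>Polarization\<close>

locale polar_GW = real_GW X \<omega> t0 VR
  for X :: "('n::finite, 't::finite, 'd::ab_group_add, 'x::ab_group_add) orbifold" and \<omega> t0 VR +
  assumes leading: "leading_term_condition X VR"
begin

text \<open>Classes of degree above 2k in the sector have smaller weight, so the weight-preserving
  part of the conjugation consists precisely of the prescribed leading term.\<close>

lemma C_leading: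
  assumes y: "y \<in> Hgr X v k"
  obtains \<rho> where "(0::real) < \<rho>" "C \<rhd> y = ((-1) ^ k * of_real \<rho>) *s invs X (conjH X y)"
proof -
  obtain \<rho> where \<rho>: "0 < \<rho>" and lead: "kappaV VR y - ((-1) ^ k * of_real \<rho>) *s invs X (conjH X y) \<in> Hgt X (sinv X v) k"
    using leading y unfolding leading_term_condition_def by blast
  define t where "t = ((-1) ^ k * of_real \<rho>) *s invs X (conjH X y)"
  have t: "t \<in> Hgr X (sinv X v) k"
    using invs_Hgr[OF conjH_Hgr[OF y]] by (simp add: t_def Hgr_def)
  have Ky: "(Kap \<rhd> y) $ i = 0" if "sector X i \<noteq> sinv X v" for i
  proof -
    have "Kap \<rhd> y \<in> Hsec X (sinv X v)" using sectors[of v] Hgr_Hsec[OF y] by auto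
    then show ?thesis using that by (auto simp: Hsec_def)
  qed
  have "(C \<rhd> y) $ i = t $ i" for i
  proof -
    have "(C \<rhd> y) $ i = (\<Sum>j\<in>UNIV. cnj (y $ j) * (C \<rhd> axis j 1) $ i)"
      by (subst alin_expand[OF alin_C]) simp
    also have "\<dots> = (\<Sum>j\<in>UNIV. if wt i = int (sdim X v) - 2 * int k then cnj (y $ j) * (Kap \<rhd> axis j 1) $ i else 0)"
    proof (rule sum.cong[OF refl])
      fix j
      show "cnj (y $ j) * (C \<rhd> axis j 1) $ i = (if wt i = int (sdim X v) - 2 * int k then cnj (y $ j) * (Kap \<rhd> axis j 1) $ i else 0)"
      proof (cases "y $ j = 0")
        case False
        then have "wt j = int (sdim X v) - 2 * int k" using y by (auto simp: Hgr_def wt_def)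
        then show ?thesis unfolding C_component by (simp del: ap_Kap)
      qed simp
    qed
    also have "\<dots> = (if wt i = int (sdim X v) - 2 * int k then (Kap \<rhd> y) $ i else 0)"
      unfolding alin_expand[OF alin_Kap, of y] by (simp del: ap_Kap)
    also have "\<dots> = t $ i"
    proof (cases "sector X i = sinv X v \<and> hdeg X i = k")
      case True
      then have "(kappaV VR y - t) $ i = 0" using lead unfolding t_def[symmetric] Hgt_def by blast
      then show ?thesis using True by (simp add: wt_def sdim_sinv)
    next
      case False
      then have "t $ i = 0" using t unfolding Hgr_def by blast
      moreover have "wt i = int (sdim X v) - 2 * int k \<Longrightarrow> sector X i \<noteq> sinv X v"
        using False by (auto simp: wt_def sdim_sinv)
      ultimately show ?thesis using Ky[of i] by auto
    qed
    finally show ?thesis .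
  qed
  then have "C \<rhd> y = t" by (simp add: vec_eq_iff)
  then show thesis unfolding t_def by (rule that[OF \<rho>])
qed

lemma act_power: "(act X \<omega> ^^ k) \<alpha> = N ^ k \<rhd> \<alpha>"
proof -
  have "act X \<omega> = (\<rhd>) N" by (rule ext) (simp add: N_ap)
  then show ?thesis by (simp only: ap_power)
qed

lemma Hgr_sum_scaleR:
  assumes "\<And>i. i \<in> J \<Longrightarrow> f i \<in> Hgr X v k" shows "(\<Sum>i\<in>J. c i *\<^sub>R f i) \<in> Hgr X v k"
  unfolding Hgr_def mem_Collect_eq
proof (intro allI impI)
  fix l assume "(\<Sum>i\<in>J. c i *\<^sub>R f i) $ l \<noteq> 0"
  then have "(\<Sum>i\<in>J. c i *\<^sub>R f i $ l) \<noteq> 0" by simp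
  then obtain i where "i \<in> J" "c i *\<^sub>R f i $ l \<noteq> 0" by (meson sum.not_neutral_contains_not_neutral)
  then have "i \<in> J" "f i $ l \<noteq> 0" by auto
  then show "sector X l = v \<and> hdeg X l = k" using assms[of i] by (simp add: Hgr_def)
qed

lemma cup_zero [simp]: "cup X 0 \<beta> = 0" "cup X \<beta> 0 = 0"
  using cup_scale_left[of 0 0 \<beta>] cup_commute[of 0 \<beta>] by simp_all

text \<open>The sign account: sd - m is the degree of w' u and enters through the leading term, j +
  k comes from \<open>w'_string\<close>, and dd + (m - j) is the Hodge-Riemann exponent of a
  primitive class of type (p - j, q - j). They match because sd - m + j + k = 2 k + (m - j).\<close>

lemma sign_eq:
  assumes "k + 2 * (m - j) = sd" "j \<le> m" "m \<le> sd"
  shows "(-1::complex) powi dd * ((-1) ^ (sd - m) * (-1) ^ (j + k)) = (-1) powi (dd + int (m - j))"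
proof -
  have s: "sd - m + (j + k) = 2 * k + (m - j)" using assms by linarith
  have "even (sd - m + (j + k)) \<longleftrightarrow> even (m - j)" unfolding s by simp
  then have "(-1::complex) ^ (sd - m) * (-1) ^ (j + k) = (-1) ^ (m - j)"
    unfolding power_add[symmetric] by (simp only: minus_one_power_iff)
  moreover have "(-1::complex) powi (dd + int n) = (-1) powi dd * (-1) ^ n" for n
    by (subst power_int_add) simp_all
  ultimately show ?thesis by (simp only:)
qed

text \<open>Decompose \<open>u\<close> into strings of primitive classes. \<open>w'\<close> reflects
  each string with a known sign and \<open>C\<close> conjugates; integration kills the products of
  different strings, and every diagonal term is a Hodge-Riemann form of a primitive class with the
  sign that makes it positive.\<close>

lemma leading_form_pos:
  assumes u: "u \<in> hodge X v p qq" and pq: "p + qq = 2 * m" and nz: "u \<noteq> 0"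
  shows "pos_real ((-1) powi ((int p - int qq) div 2) * orb_pair X (C \<rhd> L.w' \<rhd> u) u)"
    "L.w' \<rhd> u \<in> Hgr X v (sdim X v - m)" "m \<le> sdim X v"
proof -
  define sd where "sd = sdim X v"
  define dd where "dd = (int p - int qq) div 2"
  obtain b where b: "hodge_strings v p qq u b" using hodge_lefschetz[OF u pq] by (rule exE)
  note b = b[unfolded hodge_strings_def]
  have ub: "u = (\<Sum>x\<in>L.I. N ^ snd x \<rhd> b x)" by (rule conjunct1[OF b])
  have bP: "b x \<in> L.P (fst x)" for x by (rule spec[OF conjunct1[OF conjunct2[OF b]]])
  have bh: "snd x \<le> p \<and> snd x \<le> qq \<and> b x \<in> hodge X v (p - snd x) (qq - snd x) \<and>
      fst x + 2 * (m - snd x) = sdim X v" if "b x \<noteq> 0" for x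
    using spec[OF conjunct2[OF conjunct2[OF b]], of x] that by (simp add: pq)
  obtain \<rho> :: "nat \<times> nat \<Rightarrow> real" where \<rho>w: "(\<forall>x. 0 < \<rho> x) \<and> L.w' \<rhd> (\<Sum>x\<in>L.I. N ^ snd x \<rhd> b x) =
      (\<Sum>x\<in>L.I. ((-1) ^ (snd x + fst x) * \<rho> x) *\<^sub>R (N ^ (fst x - snd x) \<rhd> b x))"
    using w'_decomposition[of b, OF bP] by (rule exE)
  have \<rho>: "0 < \<rho> x" for x by (rule spec[OF conjunct1[OF \<rho>w]])
  note wu = conjunct2[OF \<rho>w]
  define I' where "I' = {x \<in> L.I. b x \<noteq> 0}"
  have fin: "finite I'" unfolding I'_def by simp
  have ub': "u = (\<Sum>x\<in>I'. N ^ snd x \<rhd> b x)"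
    unfolding I'_def by (subst ub, rule sum.mono_neutral_right) (auto simp: ap.zero_right)
  have wu': "L.w' \<rhd> u = (\<Sum>x\<in>I'. ((-1) ^ (snd x + fst x) * \<rho> x) *\<^sub>R (N ^ (fst x - snd x) \<rhd> b x))"
    unfolding wu[folded ub] I'_def
    by (rule sum.mono_neutral_right) (auto simp: ap.zero_right)
  have I': "snd x \<le> fst x" "snd x \<le> p" "snd x \<le> qq" "b x \<in> hodge X v (p - snd x) (qq - snd x)"
    "fst x + 2 * (m - snd x) = sd" "snd x \<le> m" "b x \<in> L.P (fst x)" "b x \<noteq> 0" if "x \<in> I'" for x
  proof -
    show "b x \<noteq> 0" using that by (simp add: I'_def)
    then show "snd x \<le> p" "snd x \<le> qq" "b x \<in> hodge X v (p - snd x) (qq - snd x)"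
      "fst x + 2 * (m - snd x) = sd" using bh[of x] by (simp_all add: sd_def)
    then show "snd x \<le> m" using pq by linarith
    show "snd x \<le> fst x" using that by (auto simp: I'_def L.I_def)
    show "b x \<in> L.P (fst x)" by (rule bP)
  qed
  have uH: "u \<in> Hgr X v m" using hodge_Hgr[OF pq] u by blast
  have msd: "m \<le> sd"
  proof -
    obtain i where "u $ i \<noteq> 0" using nz by (auto simp: vec_eq_iff)
    then have "sector X i = v" "hdeg X i = m" using uH by (auto simp: Hgr_def)
    then show ?thesis using hdeg_le[of i] by (simp add: sd_def)
  qed
  then show "m \<le> sdim X v" by (simp add: sd_def)
  have w'H: "L.w' \<rhd> u \<in> Hgr X v (sd - m)"
    unfolding wu'
  proof (rule Hgr_sum_scaleR)
    fix x assume x: "x \<in> I'"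
    have e: "(p - snd x) + (qq - snd x) = 2 * (m - snd x)" using I'(2,3)[OF x] pq by linarith
    have "b x \<in> Hgr X v (m - snd x)" using hodge_Hgr[OF e] I'(4)[OF x] by blast
    then have "N ^ (fst x - snd x) \<rhd> b x \<in> Hgr X v (m - snd x + (fst x - snd x))" by (rule Npow_Hgr)
    moreover have "m - snd x + (fst x - snd x) = sd - m" using I'(1,5,6)[OF x] by linarith
    ultimately show "N ^ (fst x - snd x) \<rhd> b x \<in> Hgr X v (sd - m)" by simp
  qed
  then show "L.w' \<rhd> u \<in> Hgr X v (sdim X v - m)" by (simp add: sd_def)
  obtain r where r: "(0::real) < r" and Cw: "C \<rhd> L.w' \<rhd> u = ((-1) ^ (sd - m) * of_real r) *s invs X (conjH X (L.w' \<rhd> u))"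
    using w'H
    by (rule C_leading)
  have orb: "orb_pair X (invs X \<alpha>) \<beta> = integ X (cup X \<alpha> \<beta>)" for \<alpha> \<beta>
    unfolding orb_pair_def invs_cup[symmetric] by (rule integ_invs)
  have cw: "conjH X (L.w' \<rhd> u) = (\<Sum>x\<in>I'. of_real ((-1) ^ (snd x + fst x) * \<rho> x) *s (N ^ (fst x - snd x) \<rhd> conjH X (b x)))"
    unfolding wu' conjH_sum scaleR_eq_scale conjH_scale conjH_Npow complex_cnj_complex_of_real ..
  have kill: "N ^ l \<rhd> b x = 0" "N ^ l \<rhd> conjH X (b x) = 0" if "x \<in> I'" "fst x < l" for x l
  proof -
    show 1: "N ^ l \<rhd> b x = 0" using L.P_kill[OF I'(7)[OF that(1)] that(2)] .
    then show "N ^ l \<rhd> conjH X (b x) = 0" unfolding conjH_Npow[symmetric] by (simp add: conjH_zero)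
  qed
  \<comment> \<open>Since k + 2 (m - j) is the same for all strings, different indices have
    different positions. Moving the powers of \<open>N\<close> to the string with the smaller j when
    its conjugate stands on the left, or to the right factor otherwise, gives an exponent beyond the
    end of that string.\<close>
  have off: "integ X (cup X (N ^ (fst x - snd x) \<rhd> conjH X (b x)) (N ^ snd y \<rhd> b y)) = 0"
    if x: "x \<in> I'" and y: "y \<in> I'" and ne: "x \<noteq> y" for x y
  proof -
    have "snd x \<noteq> snd y"
    proof
      assume "snd x = snd y"
      then have "fst x = fst y" using I'(5)[OF x] I'(5)[OF y] by simp
      then show False using ne \<open>snd x = snd y\<close> by (simp add: prod_eq_iff)
    qed
    then consider "snd x < snd y" | "snd y < snd x" by linarith
    then show ?thesis
    proof cases
      case 1
      then have "fst x < snd y + (fst x - snd x)" using I'(1)[OF x] by linarith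
      then have "N ^ snd y \<rhd> N ^ (fst x - snd x) \<rhd> conjH X (b x) = 0"
        using kill(2)[OF x] unfolding ap_times[symmetric] power_add[symmetric] by blast
      then show ?thesis unfolding integ_Npow[where k = "snd y", symmetric] by (simp add: integ.zero)
    next
      case 2
      then have "fst y < fst x - snd x + snd y" using I'(1,5,6)[OF x] I'(1,5,6)[OF y] by linarith
      then have "N ^ (fst x - snd x) \<rhd> N ^ snd y \<rhd> b y = 0"
        using kill(1)[OF y] unfolding ap_times[symmetric] power_add[symmetric] by blast
      then show ?thesis unfolding integ_Npow by (simp add: integ.zero)
    qed
  qed
  define QQ where "QQ x = integ X (cup X (N ^ fst x \<rhd> b x) (conjH X (b x)))" for x
  have diag: "integ X (cup X (N ^ (fst x - snd x) \<rhd> conjH X (b x)) (N ^ snd x \<rhd> b x)) = QQ x" if x: "x \<in> I'" for x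
  proof -
    have "integ X (cup X (N ^ (fst x - snd x) \<rhd> conjH X (b x)) (N ^ snd x \<rhd> b x)) = integ X (cup X (conjH X (b x)) (N ^ fst x \<rhd> b x))"
      unfolding integ_Npow using I'(1)[OF x] by (simp flip: ap_times power_add)
    then show ?thesis by (simp add: QQ_def cup_commute)
  qed
  have inner: "integ X (cup X (N ^ (fst x - snd x) \<rhd> conjH X (b x)) u) = QQ x" if x: "x \<in> I'" for x
  proof -
    have "integ X (cup X (N ^ (fst x - snd x) \<rhd> conjH X (b x)) u) =
        (\<Sum>y\<in>I'. integ X (cup X (N ^ (fst x - snd x) \<rhd> conjH X (b x)) (N ^ snd y \<rhd> b y)))"
      by (subst ub') (simp only: cup.sum integ.sum)
    also have "\<dots> = (\<Sum>y\<in>I'. if y = x then QQ x else 0)"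
      by (intro sum.cong refl) (use off[OF x] diag[OF x] in auto)
    also have "\<dots> = QQ x" using fin x by simp
    finally show ?thesis .
  qed
  have total: "integ X (cup X (conjH X (L.w' \<rhd> u)) u) = (\<Sum>x\<in>I'. of_real ((-1) ^ (snd x + fst x) * \<rho> x) * QQ x)"
  proof -
    have "integ X (cup X (conjH X (L.w' \<rhd> u)) u) = integ X (cup X u (conjH X (L.w' \<rhd> u)))" by (simp only: cup_commute)
    also have "\<dots> = (\<Sum>x\<in>I'. of_real ((-1) ^ (snd x + fst x) * \<rho> x) * integ X (cup X u (N ^ (fst x - snd x) \<rhd> conjH X (b x))))"
      unfolding cw by (simp only: cup.sum integ.sum cup.scale integ.scale)
    also have "\<dots> = (\<Sum>x\<in>I'. of_real ((-1) ^ (snd x + fst x) * \<rho> x) * QQ x)"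
      by (intro sum.cong refl) (use inner in \<open>simp add: cup_commute[of u]\<close>)
    finally show ?thesis .
  qed
  have "(-1) powi dd * orb_pair X (C \<rhd> L.w' \<rhd> u) u =
      (\<Sum>x\<in>I'. of_real (r * \<rho> x) * ((-1) powi (dd + int (m - snd x)) * QQ x))"
    unfolding Cw orb_pair_scale_left orb total sum_distrib_left
  proof (rule sum.cong[OF refl])
    fix x assume x: "x \<in> I'"
    have "(-1) powi dd * ((-1) ^ (sd - m) * of_real r * (of_real ((-1) ^ (snd x + fst x) * \<rho> x) * QQ x))
       = of_real (r * \<rho> x) * ((-1) powi dd * ((-1) ^ (sd - m) * (-1) ^ (snd x + fst x)) * QQ x)"
      by simp
    then show "(-1) powi dd * ((-1) ^ (sd - m) * of_real r * (of_real ((-1) ^ (snd x + fst x) * \<rho> x) * QQ x))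
       = of_real (r * \<rho> x) * ((-1) powi (dd + int (m - snd x)) * QQ x)"
      unfolding sign_eq[OF I'(5)[OF x] I'(6)[OF x] msd] .
  qed
  also have "pos_real \<dots>"
  proof (rule pos_real_sum[OF fin])
    show "I' \<noteq> {}" using nz ub' by auto
    fix x assume x: "x \<in> I'"
    have e: "(p - snd x) + (qq - snd x) = 2 * (m - snd x)" using I'(2,3)[OF x] pq by linarith
    have s: "2 * (m - snd x) \<le> sdim X v" "sdim X v - 2 * (m - snd x) = fst x" using I'(5)[OF x] by (simp_all add: sd_def)
    have "(act X \<omega> ^^ (sdim X v - 2 * (m - snd x) + 1)) (b x) = 0"
      unfolding act_power s(2) by (rule kill(1)[OF x]) simp
    from hodge_riemann[OF kahler e s(1) I'(4)[OF x] this I'(8)[OF x]]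
    have "pos_real ((-1) powi ((int (p - snd x) - int (qq - snd x)) div 2 + int (m - snd x)) * QQ x)"
      unfolding act_power s(2) QQ_def .
    moreover have "int (p - snd x) - int (qq - snd x) = int p - int qq" using I'(2,3)[OF x] by simp
    ultimately have "pos_real ((-1) powi (dd + int (m - snd x)) * QQ x)" unfolding dd_def by simp
    then show "pos_real (of_real (r * \<rho> x) * ((-1) powi (dd + int (m - snd x)) * QQ x))"
      by (rule pos_real_mult_of_real) (use r \<rho> in simp)
  qed
  finally show "pos_real ((-1) powi ((int p - int qq) div 2) * orb_pair X (C \<rhd> L.w' \<rhd> u) u)"
    unfolding dd_def .
qed

end

section \<open>Uniform positivity and the passage to large Re x\<close>

lemma quadratic_lower_bound:
  fixes f :: "'a::euclidean_space \<Rightarrow> real"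
  assumes A: "subspace A" and cont: "continuous_on UNIV f" and hom: "\<And>c u. f (c *\<^sub>R u) = c\<^sup>2 * f u"
    and pos: "\<And>u. u \<in> A \<Longrightarrow> u \<noteq> 0 \<Longrightarrow> 0 < f u"
  obtains \<delta> where "0 < \<delta>" "\<And>u. u \<in> A \<Longrightarrow> \<delta> * (norm u)\<^sup>2 \<le> f u"
proof -
  have f0: "f 0 = 0" using hom[of 0 0] by simp
  have comp: "compact (A \<inter> sphere 0 1)" by (intro closed_Int_compact closed_subspace A compact_sphere)
  have "\<exists>\<delta>>0. \<forall>u\<in>A \<inter> sphere 0 1. \<delta> \<le> f u"
  proof (cases "A \<inter> sphere 0 1 = {}")
    case True then show ?thesis using zero_less_one by blast
  next
    case False
    obtain e where e: "e \<in> A \<inter> sphere 0 1" "\<forall>u\<in>A \<inter> sphere 0 1. f e \<le> f u"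
      using continuous_attains_inf[OF comp False continuous_on_subset[OF cont]] by blast
    then have "0 < f e" by (intro pos) auto
    then show ?thesis using e(2) by blast
  qed
  then obtain \<delta> where \<delta>: "0 < \<delta>" "\<forall>u\<in>A \<inter> sphere 0 1. \<delta> \<le> f u" by blast
  show thesis
  proof (rule that[OF \<delta>(1)])
    fix u assume u: "u \<in> A"
    show "\<delta> * (norm u)\<^sup>2 \<le> f u"
    proof (cases "u = 0")
      case True then show ?thesis by (simp add: f0)
    next
      case False
      define e where "e = (1 / norm u) *\<^sub>R u"
      have "e \<in> A \<inter> sphere 0 1" using False subspace_scale[OF A u] by (simp add: e_def)
      then have "\<delta> \<le> f e" using \<delta>(2) by blast
      moreover have "f u = (norm u)\<^sup>2 * f e"
        using hom[of "norm u" e] False by (simp add: e_def)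
      ultimately show ?thesis using mult_left_mono[of \<delta> "f e" "(norm u)\<^sup>2"] by (simp add: mult.commute)
    qed
  qed
qed

context real_GW
begin

lemma real_GW_glue_eventually:
  assumes \<epsilon>: "0 < \<epsilon>" "320 * real CARD('n) * \<epsilon> \<le> 1"
  obtains R where "0 < R" "\<And>x. R < Re x \<Longrightarrow> \<exists>r. real_GW_glue X \<omega> t0 VR x r \<epsilon>"
proof -
  have "((\<lambda>r. cG * (exp (- r) + dec r)) \<longlongrightarrow> cG * 0) at_top"
    by (rule tendsto_mult_left[OF dec_tendsto])
  then have "\<forall>\<^sub>F r in at_top. cG * (exp (- r) + dec r) < \<epsilon>"
    using \<epsilon>(1) by (intro order_tendstoD(2)[where a = \<epsilon>]) simp_all
  then obtain r0 where r0: "\<And>r. r0 \<le> r \<Longrightarrow> cG * (exp (- r) + dec r) < \<epsilon>"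
    by (auto simp: eventually_at_top_linorder)
  define R where "R = max (max 1 t0) (exp (2 * r0))"
  show thesis
  proof (rule that)
    show "0 < R" by (simp add: R_def)
    fix x assume x: "R < Re x"
    define r where "r = ln (Re x) / 2"
    have x1: "1 < Re x" "t0 \<le> Re x" "exp (2 * r0) < Re x" using x by (simp_all add: R_def)
    then have r: "Re x = exp (2 * r)" "0 \<le> r" by (simp_all add: r_def)
    have "r0 \<le> r" using x1(3) unfolding r(1) by simp
    have "real_GW_glue X \<omega> t0 VR x r \<epsilon>"
      by unfold_locales (use x1 r r0[OF \<open>r0 \<le> r\<close>] \<epsilon> in auto)
    then show "\<exists>r. real_GW_glue X \<omega> t0 VR x r \<epsilon>" by blast
  qed
qed

lemma pure_eventually:
  assumes U: "\<And>x. t0 \<le> Re x \<Longrightarrow> - x *s \<omega> \<in> U"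
  shows "\<exists>R>0. \<forall>x. R < Re x \<longrightarrow> pure_at X U VR (- x *s \<omega>)"
proof -
  define \<epsilon> where "\<epsilon> = 1 / (320 * real CARD('n))"
  have "0 < \<epsilon>" "320 * real CARD('n) * \<epsilon> \<le> 1" by (simp_all add: \<epsilon>_def)
  then obtain R where R: "0 < R" "\<And>x. R < Re x \<Longrightarrow> \<exists>r. real_GW_glue X \<omega> t0 VR x r \<epsilon>"
    by (rule real_GW_glue_eventually) blast
  have "pure_at X U VR (- x *s \<omega>)" if x: "R < Re x" for x
  proof -
    obtain r where "real_GW_glue X \<omega> t0 VR x r \<epsilon>" using R(2)[OF x] by blast
    then interpret g: real_GW_glue X \<omega> t0 VR x r \<epsilon> .
    show ?thesis by (rule g.pure[OF U[OF g.x]])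
  qed
  then show ?thesis using R(1) by blast
qed

text \<open>The limit of the polarisation form in the coordinate a 0: the expression in
  \<open>h_form_data\<close> as a function of both arguments, to be used at c 0 near a 0.\<close>

definition form :: "complex^'n \<Rightarrow> complex^'n \<Rightarrow> complex" where
  "form c a = orb_pair X (C \<rhd> L.w' \<rhd> c) a"

lemma form_add: "form (c + c') a = form c a + form c' a" "form c (a + a') = form c a + form c a'"
  by (simp_all add: form_def ap.add_right orb_pair_add_left orb_pair_add_right)

lemma form_scaleR: "form (r *\<^sub>R c) a = of_real r * form c a" "form c (r *\<^sub>R a) = of_real r * form c a"
  by (simp_all only: form_def ap.scaleR_right) (simp_all only: scaleR_eq_scale orb_pair_scale_left orb_pair_scale_right)

lemma form_bound:
  obtains K where "0 \<le> K" "\<And>c a. norm (form c a) \<le> K * norm c * norm a"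
proof -
  interpret op: bounded_bilinear "orb_pair X" by (rule bounded_bilinear_orb_pair)
  obtain K where K: "0 \<le> K" "\<And>a b. norm (orb_pair X a b) \<le> norm a * norm b * K"
    using op.nonneg_bounded by blast
  show thesis
  proof (rule that[of "norm C * norm L.w' * K"])
    show "0 \<le> norm C * norm L.w' * K" using K(1) by simp
    fix c a :: "complex^'n"
    have "norm (C \<rhd> L.w' \<rhd> c) \<le> norm C * (norm L.w' * norm c)"
      by (rule order_trans[OF norm_ap mult_left_mono[OF norm_ap norm_ge_zero]])
    then have "norm (C \<rhd> L.w' \<rhd> c) * norm a * K \<le> norm C * (norm L.w' * norm c) * norm a * K"
      using K(1) by (intro mult_right_mono) simp_all
    then show "norm (form c a) \<le> norm C * norm L.w' * K * norm c * norm a"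
      using K(2)[of "C \<rhd> L.w' \<rhd> c" a] unfolding form_def by (simp add: mult_ac)
  qed
qed

lemma continuous_form: "continuous_on UNIV (\<lambda>u. Re (s * form u u))"
proof -
  interpret op: bounded_bilinear "orb_pair X" by (rule bounded_bilinear_orb_pair)
  have "continuous_on UNIV (\<lambda>u. C \<rhd> L.w' \<rhd> u)"
    by (intro ap.continuous_on continuous_intros)
  then show ?thesis unfolding form_def by (intro continuous_intros op.continuous_on)
qed

lemma form_square: "Re (s * form (c *\<^sub>R u) (c *\<^sub>R u)) = c\<^sup>2 * Re (s * form u u)"
proof -
  have "s * (of_real c * (of_real c * w)) = of_real (c\<^sup>2) * (s * w)" for w
    by (simp add: power2_eq_square)
  then have eq: "s * form (c *\<^sub>R u) (c *\<^sub>R u) = of_real (c\<^sup>2) * (s * form u u)" unfolding form_scaleR .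
  have "Re (of_real r * w) = r * Re w" for r w by simp
  then show ?thesis unfolding eq .
qed

end

context real_GW_glue
begin

text \<open>By \<open>data_near\<close> the value of the polarisation form differs little from its limit \<open>form\<close>.\<close>

lemma form_near:
  assumes d: "data a c" and K: "0 \<le> M" "\<And>c a. norm (form c a) \<le> M * norm c * norm a"
    and s: "norm s = 1" "s \<in> \<real>"
    and low: "\<delta> * (norm (a 0))\<^sup>2 \<le> Re (s * form (a 0) (a 0))" and a0: "a 0 \<noteq> 0"
    and small: "M * (160 * real CARD('n) * \<epsilon>) < \<delta>"
  shows "pos_real (s * h_form X VR (S1 a) (S1 a))"
  unfolding pos_real_def
proof
  note h = h_form_data[OF d]
  show "s * h_form X VR (S1 a) (S1 a) \<in> \<real>" by (rule Reals_mult[OF s(2) h(2)])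
  have "norm (form (c 0 - a 0) (a 0)) \<le> M * norm (c 0 - a 0) * norm (a 0)" by (rule K(2))
  also have "\<dots> \<le> M * (160 * real CARD('n) * \<epsilon> * norm (a 0)) * norm (a 0)"
    by (intro mult_right_mono mult_left_mono data_near[OF d] K(1)) simp
  also have "\<dots> = M * (160 * real CARD('n) * \<epsilon>) * (norm (a 0))\<^sup>2" by (simp add: power2_eq_square)
  also have "\<dots> < \<delta> * (norm (a 0))\<^sup>2" using small a0 by simp
  finally have 1: "norm (s * form (c 0 - a 0) (a 0)) < \<delta> * (norm (a 0))\<^sup>2" by (simp add: norm_mult s(1))
  have "form (c 0) (a 0) = form (a 0) (a 0) + form (c 0 - a 0) (a 0)"
    unfolding form_add(1)[symmetric] by simp
  then have "Re (s * form (c 0) (a 0)) = Re (s * form (a 0) (a 0)) + Re (s * form (c 0 - a 0) (a 0))"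
    by (simp add: distrib_left)
  moreover have "- norm (s * form (c 0 - a 0) (a 0)) \<le> Re (s * form (c 0 - a 0) (a 0))"
    using abs_Re_le_cmod[of "s * form (c 0 - a 0) (a 0)"] by linarith
  ultimately have "0 < Re (s * form (c 0) (a 0))" using 1 low by linarith
  then show "0 < Re (s * h_form X VR (S1 a) (S1 a))" unfolding h(1) form_def .
qed

end

lemma sign_real: "norm ((-1::complex) powi k) = 1" "(-1::complex) powi k \<in> \<real>"
  by (simp_all add: power_int_minus_left)

context polar_GW
begin

text \<open>A Hodge component lies in a single weight space, on which the rescaling is a scalar;
  thus a 0 = Dt (- r) u keeps the type of \<open>u\<close>.\<close>

lemma Dt_hodge:
  assumes u: "u \<in> hodge X v p q'" and e: "even (p + q')"
  shows "Dt s \<rhd> u \<in> hodge X v p q'"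
proof -
  obtain m where pq: "p + q' = 2 * m" using e by (rule evenE)
  have "u \<in> L.V (int (sdim X v) - 2 * int m)" using Hgr_V hodge_Hgr[OF pq] u by blast
  then have "Dt s \<rhd> u = of_real (exp (- s * (int (sdim X v) - 2 * int m))) *s u"
    unfolding Dt_def by (rule L.dg_weight[where f = "\<lambda>l. of_real (exp (- s * of_int l))"])
  then show ?thesis using vec.subspace_scale[OF hodge_subspace[OF e] u] by simp
qed

text \<open>Only finitely many triples (v, p, q) carry nonzero classes, so one constant serves for
  all of them. Inserting 1 keeps the minimum defined when there is none.\<close>

lemma hodge_bound:
  obtains \<delta> where "0 < \<delta>" "\<And>v p q' u. even (p + q') \<Longrightarrow> u \<in> hodge X v p q' \<Longrightarrow>
    \<delta> * (norm u)\<^sup>2 \<le> Re ((-1) powi ((int p - int q') div 2) * form u u)"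
proof -
  have ex: "\<exists>\<delta>>0. \<forall>u\<in>hodge X v p q'. \<delta> * (norm u)\<^sup>2 \<le> Re ((-1) powi ((int p - int q') div 2) * form u u)"
    if e: "even (p + q')" for v p q'
  proof -
    obtain m where pq: "p + q' = 2 * m" using e by (rule evenE)
    have "subspace (hodge X v p q')"
    proof (rule subspaceI)
      note s = hodge_subspace[OF e, of v]
      show "0 \<in> hodge X v p q'" by (rule vec.subspace_0[OF s])
      show "x + y \<in> hodge X v p q'" if "x \<in> hodge X v p q'" "y \<in> hodge X v p q'" for x y
        by (rule vec.subspace_add[OF s that])
      show "c *\<^sub>R x \<in> hodge X v p q'" if "x \<in> hodge X v p q'" for c x
        unfolding scaleR_eq_scale by (rule vec.subspace_scale[OF s that])
    qed
    then obtain \<delta> where "0 < \<delta>" "\<And>u. u \<in> hodge X v p q' \<Longrightarrow> \<delta> * (norm u)\<^sup>2 \<le> Re ((-1) powi ((int p - int q') div 2) * form u u)"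
    proof (rule quadratic_lower_bound[OF _ continuous_form form_square])
      show "0 < Re ((-1) powi ((int p - int q') div 2) * form u u)" if "u \<in> hodge X v p q'" "u \<noteq> 0" for u
        using leading_form_pos(1)[OF that(1) pq that(2)] unfolding form_def pos_real_def by blast
    qed blast
    then show ?thesis by blast
  qed
  define T :: "('t \<times> nat \<times> nat) set" where "T = {(v, p, q'). even (p + q') \<and> p + q' \<le> 2 * Max (range (hdeg X))}"
  have fin: "finite (UNIV \<times> {..2 * Max (range (hdeg X))} \<times> {..2 * Max (range (hdeg X))} :: ('t \<times> nat \<times> nat) set)" by simp
  have finT: "finite T" by (rule finite_subset[OF _ fin]) (auto simp: T_def)
  define d where "d v p q' = (SOME \<delta>. 0 < \<delta> \<and>
    (\<forall>u\<in>hodge X v p q'. \<delta> * (norm u)\<^sup>2 \<le> Re ((-1) powi ((int p - int q') div 2) * form u u)))" for v p q'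
  have d: "0 < d v p q' \<and> (\<forall>u\<in>hodge X v p q'. d v p q' * (norm u)\<^sup>2 \<le> Re ((-1) powi ((int p - int q') div 2) * form u u))"
    if "even (p + q')" for v p q'
    unfolding d_def by (rule someI_ex[OF ex[OF that]])
  define \<delta> where "\<delta> = Min (insert 1 ((\<lambda>(v, p, q'). d v p q') ` T))"
  show thesis
  proof (rule that)
    show "0 < \<delta>" unfolding \<delta>_def using finT d by (subst Min_gr_iff) (auto simp: T_def)
    fix v p q' u assume e: "even (p + q')" and u: "u \<in> hodge X v p q'"
    show "\<delta> * (norm u)\<^sup>2 \<le> Re ((-1) powi ((int p - int q') div 2) * form u u)"
    proof (cases "u = 0")
      case True
      then show ?thesis using form_scaleR(1)[of 0 0 0] by simp
    next
      case False
      obtain m where pq: "p + q' = 2 * m" using e by (rule evenE)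
      have "u \<in> Hgr X v m" using hodge_Hgr[OF pq] u by blast
      moreover obtain i where "u $ i \<noteq> 0" using False by (auto simp: vec_eq_iff)
      ultimately have "m = hdeg X i" by (auto simp: Hgr_def)
      then have "m \<le> Max (range (hdeg X))" by (simp add: Max_ge)
      then have "(v, p, q') \<in> T" using pq e
        by (simp only: T_def mem_Collect_eq prod.case) simp
      then have "\<delta> \<le> d v p q'" unfolding \<delta>_def using finT by (intro Min_le) (auto intro: rev_image_eqI)
      then have "\<delta> * (norm u)\<^sup>2 \<le> d v p q' * (norm u)\<^sup>2" by (rule mult_right_mono) simp
      also have "\<dots> \<le> Re ((-1) powi ((int p - int q') div 2) * form u u)" using d[OF e] u by blast
      finally show ?thesis .
    qed
  qed
qed

lemma small_eps:
  assumes "0 \<le> K" "0 < \<delta>"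
  obtains \<epsilon> where "0 < \<epsilon>" "320 * real CARD('n) * \<epsilon> \<le> 1" "K * (160 * real CARD('n) * \<epsilon>) < \<delta>"
proof -
  define n where "n = real CARD('n)"
  have n: "0 < n" by (simp add: n_def)
  define \<epsilon> where "\<epsilon> = min 1 (\<delta> / (K + 1)) / (320 * n)"
  have m: "0 < min 1 (\<delta> / (K + 1))" using assms by simp
  show thesis
  proof (rule that)
    show "0 < \<epsilon>" using m n by (simp add: \<epsilon>_def)
    have e: "320 * n * \<epsilon> = min 1 (\<delta> / (K + 1))" using n by (simp add: \<epsilon>_def)
    then show "320 * real CARD('n) * \<epsilon> \<le> 1" by (simp add: n_def)
    have half: "a \<le> b / 2" if "2 * a \<le> b" for a b :: real using that by simp
    have "2 * (160 * n * \<epsilon>) = min 1 (\<delta> / (K + 1))" using e by simp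
    also have "\<dots> \<le> \<delta> / (K + 1)" by simp
    finally have "160 * n * \<epsilon> \<le> \<delta> / (K + 1) / 2" by (rule half)
    then have "K * (160 * n * \<epsilon>) \<le> K * (\<delta> / (K + 1) / 2)" using assms(1) by (rule mult_left_mono)
    also have "\<dots> < \<delta>"
    proof -
      have "K * \<delta> < (2 * K + 2) * \<delta>" using assms by simp
      then show ?thesis using assms by (simp add: field_simps)
    qed
    finally show "K * (160 * real CARD('n) * \<epsilon>) < \<delta>" by (simp add: n_def)
  qed
qed

text \<open>The norm of a 0 = Dt (- r) u depends on x without control, but the estimates in
  \<open>form_near\<close> are homogeneous in a 0. Hence \<open>K\<close>, \<delta> and \<epsilon>
  are chosen once, and R works for all \<open>u\<close> simultaneously.\<close>

lemma h_K_eventually: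
  "\<exists>R>0. \<forall>x. R < Re x \<longrightarrow> (\<forall>v p q'. even (p + q') \<longrightarrow> (\<forall>u \<in> hodge X v p q'. u \<noteq> 0 \<longrightarrow>
     pos_real ((-1) powi ((int p - int q') div 2) * h_K X VR (- x *s \<omega>) u u)))"
proof -
  obtain K where K: "0 \<le> K" "\<And>c a. norm (form c a) \<le> K * norm c * norm a" by (rule form_bound) blast
  obtain \<delta> where \<delta>: "0 < \<delta>" "\<And>v p q' u. even (p + q') \<Longrightarrow> u \<in> hodge X v p q' \<Longrightarrow>
    \<delta> * (norm u)\<^sup>2 \<le> Re ((-1) powi ((int p - int q') div 2) * form u u)" by (rule hodge_bound) blast
  obtain \<epsilon> where \<epsilon>: "0 < \<epsilon>" "320 * real CARD('n) * \<epsilon> \<le> 1" "K * (160 * real CARD('n) * \<epsilon>) < \<delta>"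
    using small_eps[OF K(1) \<delta>(1)] by blast
  obtain R where R: "0 < R" "\<And>x. R < Re x \<Longrightarrow> \<exists>r. real_GW_glue X \<omega> t0 VR x r \<epsilon>"
    using real_GW_glue_eventually[OF \<epsilon>(1,2)] by blast
  have "pos_real ((-1) powi ((int p - int q') div 2) * h_K X VR (- x *s \<omega>) u u)"
    if x: "R < Re x" and e: "even (p + q')" and u: "u \<in> hodge X v p q'" "u \<noteq> 0" for x v p q' u
  proof -
    obtain r where "real_GW_glue X \<omega> t0 VR x r \<epsilon>" using R(2)[OF x] by blast
    then interpret g: real_GW_glue X \<omega> t0 VR x r \<epsilon> .
    obtain a c where d: "g.data a c" "a 0 = Dt (- r) \<rhd> u" "K_lift X VR (- x *s \<omega>) u = g.S1 a"
      by (rule g.K_lift_eq)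
    have a0: "a 0 \<in> hodge X v p q'" unfolding d(2) by (rule Dt_hodge[OF u(1) e])
    have "a 0 \<noteq> 0"
    proof
      assume "a 0 = 0"
      then have "Dt r \<rhd> Dt (- r) \<rhd> u = 0" unfolding d(2) by (simp only: ap.zero_right)
      then show False using u(2) by (simp flip: ap_times add: Dt_Dt)
    qed
    then show ?thesis unfolding h_K_def d(3)
      by (rule g.form_near[OF d(1) K sign_real \<delta>(2)[OF e a0] _ \<epsilon>(3)])
  qed
  then show ?thesis using R(1) by blast
qed

text \<open>For classes of type (p, p) the sign is 1. The limit form is block diagonal:
  \<open>C\<close> after \<open>w'\<close> maps degree 2k of \<open>v\<close> to the complementary
  degree of \<open>sinv X v\<close>, which pairs only with degree 2k of \<open>v\<close>. So it is
  positive definite on the whole cohomology, and every nonzero real section has a 0 different from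
  0.\<close>

lemma polarized_eventually:
  assumes U: "\<And>x. t0 \<le> Re x \<Longrightarrow> - x *s \<omega> \<in> U" and pp: "\<And>v p. Hgr X v p = hodge X v p p"
  shows "\<exists>R>0. \<forall>x. R < Re x \<longrightarrow> polarized_at X U VR (- x *s \<omega>)"
proof -
  define Z where "Z = (UNIV :: 't set) \<times> {..Max (range (hdeg X))}"
  define g where "g y u = gp (fst y) (snd y) \<rhd> u" for y u
  have finZ: "finite Z" by (simp add: Z_def)
  have gH: "g y u \<in> Hgr X (fst y) (snd y)" for y u unfolding g_def by (rule gp_Hgr)
  have dec: "(\<Sum>y\<in>Z. g y u) = u" for u
    unfolding vec_eq_iff
  proof
    fix i
    have "hdeg X i \<le> Max (range (hdeg X))" by (simp add: Max_ge)
    then have m: "(sector X i, hdeg X i) \<in> Z" by (simp add: Z_def)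
    have "(\<Sum>y\<in>Z. g y u) $ i = (\<Sum>y\<in>Z. if y = (sector X i, hdeg X i) then u $ i else 0)"
      unfolding sum_component by (intro sum.cong refl) (auto simp: g_def gp_def)
    then show "(\<Sum>y\<in>Z. g y u) $ i = u $ i" using finZ m by simp
  qed
  have ppos: "0 < Re (form w w)" "form w w' = 0 \<or> (v, k) = (v', k')"
    if w: "w \<in> Hgr X v k" "w \<noteq> 0" and w': "w' \<in> Hgr X v' k'" for w w' v k v' k'
  proof -
    have h: "w \<in> hodge X v k k" "k + k = 2 * k" using w pp by auto
    note L = leading_form_pos[OF h w(2)]
    show "0 < Re (form w w)" using L(1) by (simp add: form_def pos_real_def)
    obtain \<rho> where "C \<rhd> L.w' \<rhd> w = ((-1) ^ (sdim X v - k) * of_real \<rho>) *s invs X (conjH X (L.w' \<rhd> w))"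
      using C_leading[OF L(2)] by blast
    then have "C \<rhd> L.w' \<rhd> w \<in> Hgr X (sinv X v) (sdim X v - k)"
      using invs_Hgr[OF conjH_Hgr[OF L(2)]] by (simp add: Hgr_def)
    from orb_pair_Hgr[OF this w'] show "form w w' = 0 \<or> (v, k) = (v', k')"
      unfolding form_def using L(3) by (auto simp: sinv_sinv sdim_sinv)
  qed
  have form_sum: "form (\<Sum>y\<in>A. f y) a = (\<Sum>y\<in>A. form (f y) a)" "form a (\<Sum>y\<in>A. f y) = (\<Sum>y\<in>A. form a (f y))" for A f a
    unfolding form_def by (simp_all add: ap.sum_right orb_pair_sum_left orb_pair_sum_right)
  have pos: "0 < Re (1 * form u u)" if u: "u \<in> UNIV" "u \<noteq> 0" for u
  proof -
    have z: "form 0 a = 0" for a using form_scaleR(1)[of 0 0 a] by simp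
    have "form u u = (\<Sum>y\<in>Z. \<Sum>y'\<in>Z. form (g y u) (g y' u))"
      unfolding form_sum[symmetric] dec ..
    also have "\<dots> = (\<Sum>y\<in>Z. \<Sum>y'\<in>Z. if y' = y then form (g y u) (g y u) else 0)"
    proof (intro sum.cong refl)
      fix y y'
      show "form (g y u) (g y' u) = (if y' = y then form (g y u) (g y u) else 0)"
        using ppos(2)[OF gH[of y u] _ gH[of y' u]] z by (cases "g y u = 0") auto
    qed
    also have "\<dots> = (\<Sum>y\<in>Z. form (g y u) (g y u))" using finZ by simp
    finally have "Re (form u u) = (\<Sum>y\<in>Z. Re (form (g y u) (g y u)))" by (simp add: Re_sum)
    moreover have "0 < \<dots>"
    proof -
      obtain y where y: "y \<in> Z" "g y u \<noteq> 0"
      proof (rule ccontr)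
        assume "\<not> thesis"
        then have "\<forall>y\<in>Z. g y u = 0" using that by blast
        then have "(\<Sum>y\<in>Z. g y u) = 0" by simp
        then show False using dec u(2) by simp
      qed
      show ?thesis
      proof (rule sum_pos2[OF finZ y(1)])
        show "0 < Re (form (g y u) (g y u))" by (rule ppos(1)[OF gH y(2) gH])
        show "0 \<le> Re (form (g y' u) (g y' u))" if "y' \<in> Z" for y'
          using ppos(1)[OF gH[of y' u] _ gH[of y' u]] z[of 0] by (cases "g y' u = 0") (simp_all add: less_imp_le)
      qed
    qed
    ultimately show ?thesis by simp
  qed
  obtain \<delta> where \<delta>: "0 < \<delta>" "\<And>u. u \<in> UNIV \<Longrightarrow> \<delta> * (norm u)\<^sup>2 \<le> Re (1 * form u u)"
    using quadratic_lower_bound[OF subspace_UNIV continuous_form form_square pos] by blast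
  obtain K where K: "0 \<le> K" "\<And>c a. norm (form c a) \<le> K * norm c * norm a" by (rule form_bound) blast
  obtain \<epsilon> where \<epsilon>: "0 < \<epsilon>" "320 * real CARD('n) * \<epsilon> \<le> 1" "K * (160 * real CARD('n) * \<epsilon>) < \<delta>"
    using small_eps[OF K(1) \<delta>(1)] by blast
  obtain R where R: "0 < R" "\<And>x. R < Re x \<Longrightarrow> \<exists>r. real_GW_glue X \<omega> t0 VR x r \<epsilon>"
    using real_GW_glue_eventually[OF \<epsilon>(1,2)] by blast
  have "polarized_at X U VR (- x *s \<omega>)" if x: "R < Re x" for x
    unfolding polarized_at_def
  proof (intro conjI ballI impI)
    obtain r where "real_GW_glue X \<omega> t0 VR x r \<epsilon>" using R(2)[OF x] by blast
    then interpret g: real_GW_glue X \<omega> t0 VR x r \<epsilon> .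
    show "- x *s \<omega> \<in> U" by (rule U[OF g.x])
    fix s assume s: "s \<in> g.F \<inter> kappaH X VR ` g.F" and nz: "s \<noteq> (\<lambda>z. 0)"
    obtain a c where d: "g.data a c" and sa: "s = g.S1 a" using s unfolding g.inter_iff by blast
    have "a 0 \<noteq> 0" by (rule g.data_nonzero[OF d]) (use nz sa in simp)
    from g.form_near[OF d K _ _ \<delta>(2) this \<epsilon>(3)] show "pos_real (h_form X VR s s)"
      by (simp add: sa)
  qed
  then show ?thesis using R(1) by blast
qed

end

theorem theorem3p7:
  fixes X :: "('n::finite, 't::finite, 'd::ab_group_add, 'x::ab_group_add) orbifold"
    and U VR :: "(complex^'n) set" and \<omega> :: "complex^'n"
  assumes "orbifold_GW X"
    and "qprod_converges_on X U"
    and "real_structure X VR"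
    and "\<omega> \<in> kahler X"
  shows
    "(respects_sectors X VR \<longrightarrow>
       (\<exists>R>0. \<forall>x::complex. Re x > R \<longrightarrow> pure_at X U VR (- x *s \<omega>))) \<and>
     (respects_sectors X VR \<and> leading_term_condition X VR \<longrightarrow>
       (\<exists>R>0. \<forall>x::complex. Re x > R \<longrightarrow>
          (\<forall>v p q. even (p + q) \<longrightarrow> (\<forall>u \<in> hodge X v p q. u \<noteq> 0 \<longrightarrow>
             pos_real ((-1) powi ((int p - int q) div 2) * h_K X VR (- x *s \<omega>) u u)))) \<and>
       ((\<forall>v p. Hgr X v p = hodge X v p p) \<longrightarrow>
          (\<exists>R>0. \<forall>x::complex. Re x > R \<longrightarrow> polarized_at X U VR (- x *s \<omega>))))"
proof -
  interpret orbifold_GW X by (rule assms(1))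
  interpret kahler_GW X \<omega> by unfold_locales (rule assms(4))
  obtain t where U: "convergent_GW X \<omega> t" "\<And>x. t \<le> Re x \<Longrightarrow> - x *s \<omega> \<in> U"
    using convergence[OF assms(2)] by blast
  have R: "real_GW X \<omega> t VR" if "respects_sectors X VR"
  proof -
    interpret convergent_GW X \<omega> t by (rule U(1))
    show ?thesis
      by unfold_locales (use assms(3) that in \<open>simp_all add: respects_sectors_def\<close>)
  qed
  have P: "polar_GW X \<omega> t VR" if "respects_sectors X VR" "leading_term_condition X VR"
    using R[OF that(1)] that(2) by (simp add: polar_GW_def polar_GW_axioms_def)
  show ?thesis
  proof (intro conjI impI)
    assume "respects_sectors X VR"
    then show "\<exists>R>0. \<forall>x. R < Re x \<longrightarrow> pure_at X U VR (- x *s \<omega>)"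
      using real_GW.pure_eventually[OF R U(2)] by blast
  next
    assume a: "respects_sectors X VR \<and> leading_term_condition X VR"
    then show "\<exists>R>0. \<forall>x. R < Re x \<longrightarrow> (\<forall>v p q. even (p + q) \<longrightarrow> (\<forall>u \<in> hodge X v p q. u \<noteq> 0 \<longrightarrow>
       pos_real ((-1) powi ((int p - int q) div 2) * h_K X VR (- x *s \<omega>) u u)))"
      using polar_GW.h_K_eventually[OF P] by blast
    assume "\<forall>v p. Hgr X v p = hodge X v p p"
    then show "\<exists>R>0. \<forall>x. R < Re x \<longrightarrow> polarized_at X U VR (- x *s \<omega>)"
      using polar_GW.polarized_eventually[OF P U(2)] a by blast
  qed
qed

end
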